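(* Let $\Omega=(-1,1)^2$ and let $\Phi(x,t)=\phi(t)+a(x)\psi(t)$ be as in the context. The equality $H_0^{1,\Phi(\cdot)}(\Omega)=W_0^{1,\Phi(\cdot)}(\Omega)$ is valid in each of the following cases: (1) $\displaystyle\int_0\psi^*\Big(\frac1r\Big)\,r\,dr=+\infty$; (2) $\displaystyle\int_0\phi\Big(\frac1r\Big)\,r\,dr=+\infty$.
   Context: $\Omega=(-1,1)^2\subset\mathbb{R}^2$. The weight is $a(x)=1$ if $|x_1|<|x_2|$ and $a(x)=0$ if $|x_1|>|x_2|$. An Orlicz function is a convex, left-continuous $\phi:[0,\infty)\to[0,\infty]$ with $\phi(0)=0$, $\lim_{t\to0}\phi(t)=0$, $\lim_{t\to\infty}\phi(t)=\infty$; its conjugate is $\phi^*(s)=\sup_{t\ge0}(st-\phi(t))$. It satisfies $\Delta_2$ if $\phi(2t)\le c\,\phi(t)$ for all $t\ge0$, and $\nabla_2$ if $\phi^*$ satisfies $\Delta_2$. Standing assumptions: $\phi,\psi$ are Orlicz functions satisfying $\Delta_2$ and $\nabla_2$, with $t^{p_-}\le\phi(t)\le c_1t^{p_+}+c_2$ and $t^{p_-}\le\psi(t)\le c_1t^{p_+}+c_2$ for all $t\ge 0$, where $1<p_-<p_+<\infty$, $c_1>0$; $\phi\le c_3\psi+c_4$ for some constants $c_3,c_4$; and $\phi(t)/\psi(t)\to0$ as $t\to\infty$. Put $\Phi(x,t)=\phi(t)+a(x)\psi(t)$. The notation $\int_0 f(r)\,dr$ means $\int_0^\delta f(r)\,dr$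 for a small $\delta>0$ (only convergence or divergence at $0$ matters). The norm is $\|f\|_{L^{\Phi(\cdot)}(\Omega)}=\inf\{\gamma>0:\int_\Omega\Phi(x,|f(x)/\gamma|)\,dx\le1\}$, and $L^{\Phi(\cdot)}(\Omega)$ is the space of measurable (scalar or vector valued) $f$ with finite norm. $W_0^{1,\Phi(\cdot)}(\Omega)=\{w\in W_0^{1,1}(\Omega):\nabla w\in L^{\Phi(\cdot)}(\Omega)\}$ with norm $\|\nabla w\|_{L^{\Phi(\cdot)}(\Omega)}$; $H_0^{1,\Phi(\cdot)}(\Omega)$ is the closure of $C_0^\infty(\Omega)$ in $W_0^{1,\Phi(\cdot)}(\Omega)$. *)

theory Defs
  imports "HOL-Analysis.Analysis"
begin

section \<open>Orlicz functions\<close>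

text \<open>
  A function \<open>[0,\<infinity>) \<rightarrow> [0,\<infinity>]\<close> is represented by a function of type \<^typ>\<open>real \<Rightarrow> ennreal\<close>
  of which only the values at nonnegative arguments are used.
\<close>

definition orlicz_function :: "(real \<Rightarrow> ennreal) \<Rightarrow> bool" where
  "orlicz_function \<phi> \<longleftrightarrow>
     (\<forall>s\<ge>0. \<forall>t\<ge>0. \<forall>u\<in>{0..1}.
        \<phi> ((1 - u) * s + u * t) \<le> ennreal (1 - u) * \<phi> s + ennreal u * \<phi> t) \<and>
     (\<forall>t>0. (\<phi> \<longlongrightarrow> \<phi> t) (at_left t)) \<and>
     \<phi> 0 = 0 \<and>
     (\<phi> \<longlongrightarrow> 0) (at_right 0) \<and>
     (\<phi> \<longlongrightarrow> \<infinity>) at_top"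

text \<open>
  Subtraction on \<^typ>\<open>ennreal\<close> truncates at \<open>0\<close>. This does not affect the supremum: if
  \<open>\<phi> 0 = 0\<close>, then \<open>t = 0\<close> already contributes the value \<open>0\<close>. Only arguments \<open>s \<ge> 0\<close> matter.
\<close>

definition conjugate :: "(real \<Rightarrow> ennreal) \<Rightarrow> real \<Rightarrow> ennreal" where
  "conjugate \<phi> s = (SUP t\<in>{0..}. ennreal (s * t) - \<phi> t)"

definition Delta2 :: "(real \<Rightarrow> ennreal) \<Rightarrow> bool" where
  "Delta2 \<phi> \<longleftrightarrow> (\<exists>c>0. \<forall>t\<ge>0. \<phi> (2 * t) \<le> ennreal c * \<phi> t)"

definition Nabla2 :: "(real \<Rightarrow> ennreal) \<Rightarrow> bool" where
  "Nabla2 \<phi> \<longleftrightarrow> Delta2 (conjugate \<phi>)"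

text \<open>
  The integral over \<open>(0,\<delta>)\<close> is monotone in \<open>\<delta>\<close>, so its being infinite for all small \<open>\<delta>\<close> is the
  same as its being infinite for every \<open>\<delta> > 0\<close>.
\<close>

definition integral_diverges_at_0 :: "(real \<Rightarrow> ennreal) \<Rightarrow> bool" where
  "integral_diverges_at_0 f \<longleftrightarrow> (\<forall>\<delta>>0. (\<integral>\<^sup>+ r\<in>{0<..<\<delta>}. f r \<partial>lborel) = \<infinity>)"


section \<open>Test functions and weak gradients\<close>

primrec Ck :: "nat \<Rightarrow> ('a::euclidean_space \<Rightarrow> real) \<Rightarrow> bool" where
  "Ck 0 f \<longleftrightarrow> continuous_on UNIV f"
| "Ck (Suc k) f \<longleftrightarrow>
     (\<forall>x. f differentiable (at x)) \<and>
     (\<forall>b\<in>Basis. Ck k (\<lambda>x. frechet_derivative f (at x) b))"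

definition test_functions :: "'a::euclidean_space set \<Rightarrow> ('a \<Rightarrow> real) set" where
  "test_functions S =
     {f. (\<forall>k. Ck k f) \<and> compact (closure {x. f x \<noteq> 0}) \<and> closure {x. f x \<noteq> 0} \<subseteq> S}"

definition locally_integrable ::
    "'a::euclidean_space set \<Rightarrow> ('a \<Rightarrow> 'b::euclidean_space) \<Rightarrow> bool" where
  "locally_integrable S f \<longleftrightarrow> (\<forall>K. compact K \<and> K \<subseteq> S \<longrightarrow> integrable (lebesgue_on K) f)"

definition has_weak_gradient ::
    "'a::euclidean_space set \<Rightarrow> ('a \<Rightarrow> real) \<Rightarrow> ('a \<Rightarrow> 'a) \<Rightarrow> bool" where
  "has_weak_gradient S u G \<longleftrightarrow>
     locally_integrable S u \<and> locally_integrable S G \<and>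
     (\<forall>\<eta>\<in>test_functions S. \<forall>b\<in>Basis.
        (\<integral>x. u x * frechet_derivative \<eta> (at x) b \<partial>lebesgue_on S)
          = - (\<integral>x. (G x \<bullet> b) * \<eta> x \<partial>lebesgue_on S))"

text \<open>
  On open sets the weak gradient is unique almost everywhere, so the choice of a representative
  is immaterial below.
\<close>

definition weak_gradient ::
    "'a::euclidean_space set \<Rightarrow> ('a \<Rightarrow> real) \<Rightarrow> 'a \<Rightarrow> 'a" where
  "weak_gradient S u = (SOME G. has_weak_gradient S u G)"


section \<open>Sobolev spaces\<close>

text \<open>
  All function spaces below are sets of representatives defined on the whole ambient space. They
  are closed under changing a function on a null set and outside \<open>S\<close>, so that equalities between
  them are the same as equalities between the corresponding sets of equivalence classes.
\<close>

definition W11 :: "'a::euclidean_space set \<Rightarrow> ('a \<Rightarrow> real) set" where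
  "W11 S = {u. integrable (lebesgue_on S) u \<and>
      (\<exists>G. has_weak_gradient S u G \<and> integrable (lebesgue_on S) G)}"

definition W11_norm :: "'a::euclidean_space set \<Rightarrow> ('a \<Rightarrow> real) \<Rightarrow> ennreal" where
  "W11_norm S u = (\<integral>\<^sup>+ x. ennreal (norm (u x)) \<partial>lebesgue_on S)
     + (\<integral>\<^sup>+ x. ennreal (norm (weak_gradient S u x)) \<partial>lebesgue_on S)"

definition W11_0 :: "'a::euclidean_space set \<Rightarrow> ('a \<Rightarrow> real) set" where
  "W11_0 S = {u \<in> W11 S. \<forall>\<epsilon>>0. \<exists>\<eta>\<in>test_functions S. W11_norm S (\<lambda>x. u x - \<eta> x) < \<epsilon>}"


section \<open>Musielak--Orlicz and Musielak--Orlicz--Sobolev spaces\<close>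

definition MO_norm ::
    "('a::euclidean_space \<Rightarrow> real \<Rightarrow> ennreal) \<Rightarrow> 'a set \<Rightarrow> ('a \<Rightarrow> 'b::euclidean_space) \<Rightarrow> ennreal" where
  "MO_norm \<Phi> S f =
     Inf {ennreal \<gamma> | \<gamma>. \<gamma> > 0 \<and> (\<integral>\<^sup>+ x. \<Phi> x (norm (f x /\<^sub>R \<gamma>)) \<partial>lebesgue_on S) \<le> 1}"

definition MO_space ::
    "('a::euclidean_space \<Rightarrow> real \<Rightarrow> ennreal) \<Rightarrow> 'a set \<Rightarrow> ('a \<Rightarrow> 'b::euclidean_space) set" where
  "MO_space \<Phi> S = {f \<in> borel_measurable (lebesgue_on S). MO_norm \<Phi> S f < \<infinity>}"

definition W_0 ::
    "('a::euclidean_space \<Rightarrow> real \<Rightarrow> ennreal) \<Rightarrow> 'a set \<Rightarrow> ('a \<Rightarrow> real) set" where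
  "W_0 \<Phi> S = {w \<in> W11_0 S. weak_gradient S w \<in> MO_space \<Phi> S}"

definition W_0_norm ::
    "('a::euclidean_space \<Rightarrow> real \<Rightarrow> ennreal) \<Rightarrow> 'a set \<Rightarrow> ('a \<Rightarrow> real) \<Rightarrow> ennreal" where
  "W_0_norm \<Phi> S w = MO_norm \<Phi> S (weak_gradient S w)"

definition H_0 ::
    "('a::euclidean_space \<Rightarrow> real \<Rightarrow> ennreal) \<Rightarrow> 'a set \<Rightarrow> ('a \<Rightarrow> real) set" where
  "H_0 \<Phi> S = {w \<in> W_0 \<Phi> S. \<forall>\<epsilon>>0. \<exists>\<eta>\<in>test_functions S. W_0_norm \<Phi> S (\<lambda>x. w x - \<eta> x) < \<epsilon>}"


section \<open>The checkerboard double phase model\<close>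

definition \<Omega> :: "(real^2) set" where
  "\<Omega> = {x. \<forall>i. -1 < x $ i \<and> x $ i < 1}"

text \<open>The value on the null set \<open>\<bar>x $ 1\<bar> = \<bar>x $ 2\<bar>\<close> is irrelevant.\<close>

definition weight :: "real^2 \<Rightarrow> real" where
  "weight x = (if \<bar>x $ 1\<bar> < \<bar>x $ 2\<bar> then 1 else 0)"

definition double_phase ::
    "(real \<Rightarrow> ennreal) \<Rightarrow> (real \<Rightarrow> ennreal) \<Rightarrow> real^2 \<Rightarrow> real \<Rightarrow> ennreal" where
  "double_phase \<phi> \<psi> x t = \<phi> t + ennreal (weight x) * \<psi> t"

end

theory Submission
  imports Defs
begin

text \<open>
  Truncation reduces the claim to approximating, in the sense of the modular, the gradient of a
  bounded \<open>u\<close>. The only obstruction is the origin: if \<open>\<nabla>u\<close> vanishes near \<open>0\<close>, then mollification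
  after a dilation works, because a dilation that is stronger in the second variable moves
  \<open>{\<bar>x\<^sub>1\<bar> < \<bar>x\<^sub>2\<bar>}\<close> away from its boundary into its interior, and so the weight never increases.

  In case (1), divergence of the integral of \<open>\<psi>\<^sup>*(1/r) r\<close> and \<open>\<nabla>\<^sub>2\<close> say that a point has zero
  \<open>\<psi>\<close>-capacity: there are cutoffs \<open>\<eta>\<close>, equal to \<open>1\<close> near \<open>0\<close> and supported in small balls, for which
  the integral of \<open>\<psi>(M \<bar>\<nabla>\<eta>\<bar>)\<close> is small. Since \<open>\<phi>\<close> is dominated by \<open>\<psi>\<close> and \<open>u\<close> is bounded, the
  functions \<open>(1 - \<eta>) u\<close> approximate \<open>u\<close>.

  In case (2), if the oscillation of \<open>u\<close> on the boundaries of all small squares of side \<open>2 r\<close> were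
  bounded below, Jensen's inequality on these boundaries would bound the integral of
  \<open>\<phi>(\<bar>\<nabla>u\<bar>)\<close> from below by that of \<open>\<phi>(const/r) r\<close>, which diverges. So \<open>u\<close> is close to a constant \<open>c\<close>
  on the boundaries of arbitrarily small squares. Composing \<open>u\<close> with a function that flattens a
  neighbourhood of \<open>c\<close> makes it constant on such a boundary, hence it can be filled in by that
  constant. The change in the gradient tends to zero since \<open>\<nabla>u = 0\<close> almost everywhere on \<open>{u = c}\<close>.
\<close>

section \<open>Continuously differentiable functions and their gradients\<close>

text \<open>The room for mollifying shrinks with the distance to the origin: dilating by
  \<open>1 + \<sigma>\<close> and \<open>1 + 2 * \<sigma>\<close> moves a point of the weighted
  region at distance \<open>r\<close> away from the diagonals by about \<open>\<sigma> * r\<close>,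
  and the kernel must be smaller than that. Where this works, Jensen's inequality bounds the modular
  of the mollified gradient by the mollified energy density, which converges in L1 and takes the
  place of a fixed dominating function. In case (1), near maximisers \<open>t j\<close> of
  \<open>2 ^ j * t - \<psi> t\<close> prescribe the gradient of the cutoff on dyadic annuli, so that
  its energy is measured by a dyadic form of the divergent integral. Convexity alone only keeps this
  energy bounded; \<open>Nabla2\<close> supplies the missing small factor. In case (2),
  \<open>u\<close> has no values on a given boundary, so oscillation is controlled for
  \<open>C^1\<close> approximants. By truncation their boundary values lie in a compact interval,
  which yields a constant for each square and then one \<open>c\<close> for all: the gradient may be
  lost on one level set only. Flattening an interval around \<open>c\<close>, and not just the
  point, makes the filled approximants \<open>C^1\<close>.\<close>

definition gradient :: "('a::euclidean_space \<Rightarrow> real) \<Rightarrow> 'a \<Rightarrow> 'a" where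
  "gradient f x = (\<Sum>b\<in>Basis. frechet_derivative f (at x) b *\<^sub>R b)"

text \<open>Only one continuous derivative is asked for, because flattening and the filling of a
  square do not preserve more. With the gradient as an argument, a formula for it can be read off
  from each construction.\<close>

definition C1c :: "'a::euclidean_space set \<Rightarrow> ('a \<Rightarrow> real) \<Rightarrow> ('a \<Rightarrow> 'a) \<Rightarrow> bool" where
  "C1c S f g \<longleftrightarrow> (\<forall>x. (f has_derivative (\<lambda>h. g x \<bullet> h)) (at x)) \<and> continuous_on UNIV g \<and>
     (\<exists>K. compact K \<and> K \<subseteq> S \<and> (\<forall>x. x \<notin> K \<longrightarrow> f x = 0 \<and> g x = 0))"

lemma frechet_derivative_inner:
  assumes "(f has_derivative (\<lambda>h. g \<bullet> h)) (at x)"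
  shows "frechet_derivative f (at x) b = g \<bullet> b"
  using frechet_derivative_at[OF assms] by metis

lemma gradient_eqI:
  assumes "(f has_derivative (\<lambda>h. g \<bullet> h)) (at x)"
  shows "gradient f x = g"
  using frechet_derivative_inner[OF assms] by (simp add: gradient_def euclidean_representation)

lemma gradient_inner_Basis:
  "b \<in> Basis \<Longrightarrow> gradient f x \<bullet> b = frechet_derivative f (at x) b"
  by (simp add: gradient_def inner_sum_left inner_Basis if_distrib cong: if_cong)

lemma has_derivative_gradient:
  assumes "f differentiable (at x)"
  shows "(f has_derivative (\<lambda>h. gradient f x \<bullet> h)) (at x)"
proof -
  have D: "(f has_derivative frechet_derivative f (at x)) (at x)"
    using assms by (simp add: frechet_derivative_works)
  then have lin: "linear (frechet_derivative f (at x))"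
    by (rule has_derivative_linear)
  have "frechet_derivative f (at x) h = gradient f x \<bullet> h" for h
  proof -
    have "frechet_derivative f (at x) h = frechet_derivative f (at x) (\<Sum>b\<in>Basis. (h \<bullet> b) *\<^sub>R b)"
      by (simp add: euclidean_representation)
    also have "\<dots> = (\<Sum>b\<in>Basis. (h \<bullet> b) *\<^sub>R frechet_derivative f (at x) b)"
      using lin by (simp add: linear_sum linear_scale)
    also have "\<dots> = gradient f x \<bullet> h"
      by (simp add: gradient_def inner_sum_left inner_commute[of h] mult.commute)
    finally show ?thesis .
  qed
  then show ?thesis using D by (metis (no_types, lifting) ext)
qed

lemma Ck_gradient:
  assumes "\<And>k. Ck k f"
  shows "(f has_derivative (\<lambda>h. gradient f x \<bullet> h)) (at x)" "continuous_on UNIV (gradient f)"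
    "continuous_on UNIV f"
proof -
  have "Ck (Suc 0) f" using assms by blast
  then show "(f has_derivative (\<lambda>h. gradient f x \<bullet> h)) (at x)"
    by (intro has_derivative_gradient) simp
  show "continuous_on UNIV (gradient f)" unfolding gradient_def
    using \<open>Ck (Suc 0) f\<close> by (intro continuous_intros) simp
  show "continuous_on UNIV f" using assms[of 0] by simp
qed

lemma test_functions_C1c:
  assumes "\<eta> \<in> test_functions S"
  shows "C1c S \<eta> (gradient \<eta>)"
proof -
  obtain K where K: "compact K" "K \<subseteq> S" "closure {x. \<eta> x \<noteq> 0} = K" and k: "\<And>k. Ck k \<eta>"
    using assms unfolding test_functions_def by blast
  have z: "\<eta> x = 0" if "x \<notin> K" for x
    using that closure_subset[of "{x. \<eta> x \<noteq> 0}"] K(3) by blast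
  have o: "open (- K)" using K(1) by (intro open_Compl compact_imp_closed)
  have "gradient \<eta> x = 0" if "x \<notin> K" for x
  proof (rule gradient_eqI)
    have "((\<lambda>x. 0) has_derivative (\<lambda>h. 0)) (at x)" by simp
    then have "(\<eta> has_derivative (\<lambda>h. 0)) (at x)"
      by (rule has_derivative_transform_within_open[OF _ o]) (simp_all add: that z)
    then show "(\<eta> has_derivative (\<lambda>h. 0 \<bullet> h)) (at x)" by simp
  qed
  then show ?thesis unfolding C1c_def
    by (intro conjI allI exI[of _ K] Ck_gradient[OF k] impI K z) simp_all
qed

lemma C1cD:
  assumes "C1c S f g"
  shows "(f has_derivative (\<lambda>h. g x \<bullet> h)) (at x)" "continuous_on UNIV g" "continuous_on UNIV f"
    "x \<notin> S \<Longrightarrow> f x = 0" "x \<notin> S \<Longrightarrow> g x = 0"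
    "f \<in> borel_measurable borel" "g \<in> borel_measurable borel"
proof -
  show D: "(f has_derivative (\<lambda>h. g x \<bullet> h)) (at x)" for x
    using assms by (auto simp: C1c_def)
  show g: "continuous_on UNIV g"
    using assms by (auto simp: C1c_def)
  show f: "continuous_on UNIV f"
    by (rule has_derivative_continuous_on[OF has_derivative_at_withinI[OF D]])
  show "x \<notin> S \<Longrightarrow> f x = 0" "x \<notin> S \<Longrightarrow> g x = 0"
    using assms by (auto simp: C1c_def)
  show "f \<in> borel_measurable borel" "g \<in> borel_measurable borel"
    using f g by (auto intro: borel_measurable_continuous_onI)
qed

lemma compact_support_bounded:
  fixes g :: "'a::euclidean_space \<Rightarrow> 'b::euclidean_space"
  assumes "continuous_on UNIV g" "compact K" "\<And>x. x \<notin> K \<Longrightarrow> g x = 0"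
  obtains B where "B > 0" "\<And>x. norm (g x) \<le> B"
proof -
  have "compact (g ` K)"
    using compact_continuous_image continuous_on_subset[OF assms(1) subset_UNIV] assms(2) by blast
  from compact_imp_bounded[OF this] obtain B where B: "B > 0" "\<And>y. y \<in> g ` K \<Longrightarrow> norm y \<le> B"
    unfolding bounded_pos by blast
  then have "norm (g x) \<le> B" for x
    using assms(3)[of x] B by (cases "x \<in> K") auto
  with \<open>B > 0\<close> show ?thesis using that by blast
qed

lemma compact_support_integrable:
  fixes g :: "'a::euclidean_space \<Rightarrow> 'b::euclidean_space"
  assumes "continuous_on UNIV g" "compact K" "\<And>x. x \<notin> K \<Longrightarrow> g x = 0"
  shows "integrable lborel g"
proof -
  have "integrable lborel (\<lambda>x. indicator K x *\<^sub>R g x)"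
    using borel_integrable_compact[OF assms(2), of g] assms(1)
    by (simp add: set_integrable_def continuous_on_subset)
  also have "(\<lambda>x. indicator K x *\<^sub>R g x) = g"
    using assms(3) by (auto simp: indicator_def)
  finally show ?thesis .
qed

lemma C1c_integrable:
  assumes "C1c S f g"
  shows "integrable lborel f" "integrable lborel g"
  using assms compact_support_integrable[of f] compact_support_integrable[of g] C1cD[OF assms]
  by (auto simp: C1c_def)

lemma C1c_bounded:
  assumes "C1c S f g"
  obtains B where "B > 0" "\<And>x. \<bar>f x\<bar> \<le> B" "\<And>x. norm (g x) \<le> B"
proof -
  obtain K where K: "compact K" "\<And>x. x \<notin> K \<Longrightarrow> f x = 0" "\<And>x. x \<notin> K \<Longrightarrow> g x = 0"
    using assms by (auto simp: C1c_def)
  obtain B1 where "B1 > 0" "\<And>x. norm (f x) \<le> B1"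
    using compact_support_bounded[OF C1cD(3)[OF assms] K(1,2)] by blast
  moreover obtain B2 where "B2 > 0" "\<And>x. norm (g x) \<le> B2"
    using compact_support_bounded[OF C1cD(2)[OF assms] K(1,3)] by blast
  ultimately show ?thesis using that[of "max B1 B2"]
    by (auto simp: le_max_iff_disj less_max_iff_disj)
qed

lemma gradient_bound_lipschitz:
  fixes f :: "'a::euclidean_space \<Rightarrow> real"
  assumes "\<And>x. (f has_derivative (\<lambda>h. g x \<bullet> h)) (at x)" "\<And>x. norm (g x) \<le> B"
  shows "\<bar>f x - f y\<bar> \<le> B * norm (x - y)"
proof -
  have "onorm (\<lambda>h. g x \<bullet> h) \<le> B" for x
    by (intro onorm_le order_trans[OF Cauchy_Schwarz_ineq2[folded real_norm_def] mult_right_mono[OF assms(2)]]) simp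
  then show ?thesis
    using differentiable_bound[of UNIV f "\<lambda>x h. g x \<bullet> h" B x y] assms(1)
    by (auto simp: has_derivative_at_withinI)
qed

section \<open>Integrals of derivatives and integration by parts\<close>

lemma integrable_lborel_translate:
  fixes f :: "'a::euclidean_space \<Rightarrow> 'b::{banach, second_countable_topology}"
  assumes "integrable lborel f"
  shows "integrable lborel (\<lambda>x. f (c + x))" "(\<integral>x. f (c + x) \<partial>lborel) = (\<integral>x. f x \<partial>lborel)"
proof -
  have f: "f \<in> borel_measurable borel" using assms by (simp add: integrable_iff_bounded)
  have "integrable (distr lborel borel ((+) c)) f" using assms by (simp add: lborel_distr_plus)
  then show "integrable lborel (\<lambda>x. f (c + x))"
    by (subst (asm) integrable_distr_eq) (use f in auto)
  have "(\<integral>x. f x \<partial>distr lborel borel ((+) c)) = (\<integral>x. f (c + x) \<partial>lborel)"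
    by (rule integral_distr) (use f in auto)
  then show "(\<integral>x. f (c + x) \<partial>lborel) = (\<integral>x. f x \<partial>lborel)" by (simp add: lborel_distr_plus)
qed

text \<open>Translation invariance of Lebesgue measure makes every difference quotient of
  \<open>f\<close> in direction \<open>b\<close> integrate to zero. The quotients are bounded by
  \<open>B * norm b\<close> and supported in one fixed ball, so dominated convergence passes this on
  to the derivative.\<close>

lemma C1c_integral_derivative_eq_0:
  assumes "C1c S f g"
  shows "(\<integral>x. g x \<bullet> b \<partial>lborel) = 0"
proof -
  obtain B where B: "B > 0" "\<And>x. \<bar>f x\<bar> \<le> B" "\<And>x. norm (g x) \<le> B" using C1c_bounded[OF assms] by blast
  obtain K where K: "compact K" "\<And>x. x \<notin> K \<Longrightarrow> f x = 0"
    using assms by (auto simp: C1c_def)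
  obtain R where R: "R > 0" "K \<subseteq> cball 0 R"
  proof -
    obtain r where "0 < r" "K \<subseteq> ball 0 r"
      using bounded_subset_ballD[OF compact_imp_bounded[OF K(1)], of 0] by blast
    then show thesis using that[of r] ball_subset_cball[of 0 r] by blast
  qed
  define q where "q n x = real (Suc n) * (f (inverse (real (Suc n)) *\<^sub>R b + x) - f x)" for n x
  have fi: "integrable lborel f" using C1c_integrable[OF assms] by simp
  have q0: "(\<integral>x. q n x \<partial>lborel) = 0" for n
    unfolding q_def using integrable_lborel_translate[OF fi] fi by simp
  have "(\<lambda>n. \<integral>x. q n x \<partial>lborel) \<longlonglongrightarrow> (\<integral>x. g x \<bullet> b \<partial>lborel)"
  proof (rule integral_dominated_convergence[where w="\<lambda>x. B * norm b * indicator (cball 0 (R + norm b)) x"])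
    show "(\<lambda>x. g x \<bullet> b) \<in> borel_measurable lborel"
      using C1cD(7)[OF assms] by simp
    show "q n \<in> borel_measurable lborel" for n
      unfolding q_def using C1cD(6)[OF assms] by simp
    show "integrable lborel (\<lambda>x. B * norm b * indicator (cball 0 (R + norm b)) x)"
      by (intro integrable_mult_right integrable_real_indicator) (simp_all add: emeasure_lborel_cball_finite[unfolded infinity_ennreal_def])
    show "AE x in lborel. (\<lambda>n. q n x) \<longlonglongrightarrow> g x \<bullet> b"
    proof (rule AE_I2)
      fix x
      have "((\<lambda>t. f (x + t *\<^sub>R b)) has_derivative (\<lambda>t. g (x + 0 *\<^sub>R b) \<bullet> (t *\<^sub>R b))) (at 0)"
      proof (rule has_derivative_compose[of "\<lambda>t. x + t *\<^sub>R b" "\<lambda>t. t *\<^sub>R b" 0 UNIV f])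
        show "((\<lambda>t. x + t *\<^sub>R b) has_derivative (\<lambda>t. t *\<^sub>R b)) (at 0)"
          by (auto intro!: derivative_eq_intros)
      qed (rule C1cD(1)[OF assms])
      then have "((\<lambda>t. f (x + t *\<^sub>R b)) has_real_derivative (g x \<bullet> b)) (at 0)"
        by (simp add: has_field_derivative_def mult_commute_abs)
      then have "((\<lambda>h. (f (x + h *\<^sub>R b) - f x) / h) \<longlongrightarrow> g x \<bullet> b) (at 0)"
        by (simp add: DERIV_def)
      then have "((\<lambda>n. (f (x + inverse (real (Suc n)) *\<^sub>R b) - f x) / inverse (real (Suc n))) \<longlongrightarrow> g x \<bullet> b) sequentially"
        by (rule filterlim_compose) (use LIMSEQ_inverse_real_of_nat in \<open>simp add: filterlim_at\<close>)
      then show "(\<lambda>n. q n x) \<longlonglongrightarrow> g x \<bullet> b"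
        unfolding q_def by (simp add: divide_inverse mult.commute add.commute)
    qed
    show "AE x in lborel. norm (q n x) \<le> B * norm b * indicator (cball 0 (R + norm b)) x" for n
    proof (rule AE_I2)
      fix x
      have le1: "inverse (real (Suc n)) \<le> 1" by (simp add: inverse_le_1_iff)
      show "norm (q n x) \<le> B * norm b * indicator (cball 0 (R + norm b)) x"
      proof (cases "x \<in> cball 0 (R + norm b)")
        case True
        have "\<bar>f (inverse (real (Suc n)) *\<^sub>R b + x) - f x\<bar> \<le> B * norm (inverse (real (Suc n)) *\<^sub>R b + x - x)"
          using gradient_bound_lipschitz[of f g B] C1cD(1)[OF assms] B(3) by blast
        also have "\<dots> = inverse (real (Suc n)) * (B * norm b)" by simp
        finally have "real (Suc n) * \<bar>f (inverse (real (Suc n)) *\<^sub>R b + x) - f x\<bar> \<le> B * norm b"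
          by (simp add: field_simps del: of_nat_Suc)
        then show ?thesis using True unfolding q_def
          by (simp only: real_norm_def abs_mult abs_of_nat indicator_simps mult_1_right)
      next
        case False
        have "norm (inverse (real (Suc n)) *\<^sub>R b) \<le> norm b"
          using mult_right_mono[OF le1, of "norm b"] by simp
        then have "norm (inverse (real (Suc n)) *\<^sub>R b + x) > R"
          using False norm_triangle_ineq4[of "inverse (real (Suc n)) *\<^sub>R b + x" "inverse (real (Suc n)) *\<^sub>R b"] by simp
        moreover have "norm x > R" using False by (simp add: not_le) (use norm_ge_zero[of b] in linarith)
        ultimately have "x \<notin> K" "inverse (real (Suc n)) *\<^sub>R b + x \<notin> K"
          using R(2) by (auto dest!: subsetD)
        then have "f x = 0" "f (inverse (real (Suc n)) *\<^sub>R b + x) = 0"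
          using K(2) by blast+
        then show ?thesis using False B(1) by (simp add: q_def)
      qed
    qed
  qed
  then show ?thesis using q0 by (simp add: LIMSEQ_const_iff)
qed

lemma C1c_mult:
  assumes "C1c S f g" "\<And>x. (\<theta> has_derivative (\<lambda>h. \<theta>' x \<bullet> h)) (at x)" "continuous_on UNIV \<theta>'"
  shows "C1c S (\<lambda>x. \<theta> x * f x) (\<lambda>x. \<theta> x *\<^sub>R g x + f x *\<^sub>R \<theta>' x)"
  unfolding C1c_def
proof (intro conjI allI)
  have \<theta>: "continuous_on UNIV \<theta>"
    by (rule has_derivative_continuous_on[OF has_derivative_at_withinI[OF assms(2)]])
  show "((\<lambda>x. \<theta> x * f x) has_derivative (\<lambda>h. (\<theta> x *\<^sub>R g x + f x *\<^sub>R \<theta>' x) \<bullet> h)) (at x)" for x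
    using has_derivative_mult[of \<theta> "\<lambda>h. \<theta>' x \<bullet> h" x UNIV f "\<lambda>h. g x \<bullet> h"] assms(2)
      C1cD(1)[OF assms(1)] by (simp add: inner_add_left algebra_simps)
  show "continuous_on UNIV (\<lambda>x. \<theta> x *\<^sub>R g x + f x *\<^sub>R \<theta>' x)"
    by (intro continuous_intros \<theta> assms(3) C1cD(2,3)[OF assms(1)])
  show "\<exists>K. compact K \<and> K \<subseteq> S \<and> (\<forall>x. x \<notin> K \<longrightarrow> \<theta> x * f x = 0 \<and> \<theta> x *\<^sub>R g x + f x *\<^sub>R \<theta>' x = 0)"
  proof -
    obtain K where "compact K" "K \<subseteq> S" "\<And>x. x \<notin> K \<Longrightarrow> f x = 0 \<and> g x = 0"
      using assms(1) unfolding C1c_def by blast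
    then show ?thesis by (intro exI[of _ K]) simp
  qed
qed

text \<open>The product of \<open>\<theta>\<close> and \<open>f\<close> inherits the compact support
  of \<open>f\<close>, so the integral of its derivative vanishes although \<open>\<theta>\<close>
  itself may be supported anywhere.\<close>

lemma C1c_integration_by_parts:
  assumes "C1c S f g" "\<And>x. (\<theta> has_derivative (\<lambda>h. \<theta>' x \<bullet> h)) (at x)" "continuous_on UNIV \<theta>'"
  shows "(\<integral>x. f x * (\<theta>' x \<bullet> b) \<partial>lborel) = - (\<integral>x. (g x \<bullet> b) * \<theta> x \<partial>lborel)"
proof -
  have \<theta>: "continuous_on UNIV \<theta>"
    by (rule has_derivative_continuous_on[OF has_derivative_at_withinI[OF assms(2)]])
  obtain K where K: "compact K" "\<And>x. x \<notin> K \<Longrightarrow> f x = 0" "\<And>x. x \<notin> K \<Longrightarrow> g x = 0"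
    using assms(1) by (auto simp: C1c_def)
  have 1: "integrable lborel (\<lambda>x. f x * (\<theta>' x \<bullet> b))"
    by (rule compact_support_integrable[OF _ K(1)])
      (intro continuous_intros \<theta> assms(3) C1cD(2,3)[OF assms(1)], simp add: K)
  have 2: "integrable lborel (\<lambda>x. (g x \<bullet> b) * \<theta> x)"
    by (rule compact_support_integrable[OF _ K(1)])
      (intro continuous_intros \<theta> assms(3) C1cD(2,3)[OF assms(1)], simp add: K)
  have "0 = (\<integral>x. (\<theta> x *\<^sub>R g x + f x *\<^sub>R \<theta>' x) \<bullet> b \<partial>lborel)"
    using C1c_integral_derivative_eq_0[OF C1c_mult[of S f g \<theta> \<theta>']] assms by simp
  also have "\<dots> = (\<integral>x. f x * (\<theta>' x \<bullet> b) + (g x \<bullet> b) * \<theta> x \<partial>lborel)"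
    by (simp add: inner_add_left algebra_simps)
  also have "\<dots> = (\<integral>x. f x * (\<theta>' x \<bullet> b) \<partial>lborel) + (\<integral>x. (g x \<bullet> b) * \<theta> x \<partial>lborel)"
    using 1 2 by simp
  finally show ?thesis by simp
qed

section \<open>Mollifiers\<close>

text \<open>The powers in the denominator make this family of classical flat functions closed, up to
  linear combinations, under differentiation.\<close>

definition flat :: "nat \<Rightarrow> real \<Rightarrow> real" where
  "flat n t = (if t \<le> 0 then 0 else exp (- 1 / t) / t ^ n)"

lemma flat_tendsto_0: "((flat n) \<longlongrightarrow> 0) (at_right 0)"
proof -
  have "((\<lambda>x::real. x ^ n / exp x) \<longlongrightarrow> 0) at_top" by (rule tendsto_power_div_exp_0)
  then have "((\<lambda>t::real. inverse t ^ n / exp (inverse t)) \<longlongrightarrow> 0) (at_right 0)"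
    by (rule filterlim_compose) (rule filterlim_inverse_at_top_right)
  then show ?thesis
  proof (rule Lim_transform_eventually)
    show "\<forall>\<^sub>F t in at_right 0. inverse t ^ n / exp (inverse t) = flat n t"
      by (auto simp: eventually_at_filter flat_def exp_minus field_simps)
  qed
qed

lemma flat_derivative:
  "(flat n has_real_derivative (flat (n + 2) t - real n * flat (n + 1) t)) (at t)"
proof (cases "t = 0")
  case False
  show ?thesis
  proof (cases "t < 0")
    case True
    have "((\<lambda>_. 0) has_real_derivative 0) (at t)" by simp
    then have "(flat n has_real_derivative 0) (at t)"
      by (rule has_field_derivative_transform_within_open[of _ _ _ "{..<0}"]) (use True in \<open>auto simp: flat_def\<close>)
    then show ?thesis using True by (simp add: flat_def)
  next
    case False
    with \<open>t \<noteq> 0\<close> have t: "t > 0" by simp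
    have d1: "((\<lambda>t. exp (- 1 / t)) has_real_derivative exp (- 1 / t) / t\<^sup>2) (at t)"
    proof -
      have "((\<lambda>t::real. - inverse t) has_real_derivative - (- (inverse t ^ Suc (Suc 0)))) (at t)"
        by (rule DERIV_minus DERIV_inverse)+ (use t in simp)
      from DERIV_fun_exp[OF this] show ?thesis
        by (simp add: power2_eq_square divide_inverse)
    qed
    have "((\<lambda>t. inverse t ^ n) has_real_derivative of_nat n * (- (inverse t ^ Suc (Suc 0)) * inverse t ^ (n - Suc 0))) (at t)"
      by (rule DERIV_power DERIV_inverse)+ (use t in simp)
    moreover have "of_nat n * (- (inverse t ^ Suc (Suc 0)) * inverse t ^ (n - Suc 0)) = - (real n / t ^ (n + 1))"
      using t by (cases n) (simp_all add: field_simps)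
    ultimately have d2: "((\<lambda>t. inverse t ^ n) has_real_derivative - (real n / t ^ (n + 1))) (at t)" by simp
    have "((\<lambda>t. exp (- 1 / t) * inverse t ^ n) has_real_derivative
        exp (- 1 / t) / t\<^sup>2 * inverse t ^ n + - (real n / t ^ (n + 1)) * exp (- 1 / t)) (at t)"
      by (rule DERIV_mult[OF d1 d2])
    moreover have "exp (- 1 / t) / t\<^sup>2 * inverse t ^ n + - (real n / t ^ (n + 1)) * exp (- 1 / t)
        = flat (n + 2) t - real n * flat (n + 1) t"
      using t by (simp add: flat_def power_add power2_eq_square power_inverse divide_inverse mult_ac)
    moreover have "(\<lambda>t::real. exp (- 1 / t) * inverse t ^ n) = (\<lambda>t. exp (- 1 / t) / t ^ n)"
      by (simp add: power_inverse divide_inverse)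
    ultimately have "((\<lambda>t. exp (- 1 / t) / t ^ n) has_real_derivative (flat (n + 2) t - real n * flat (n + 1) t)) (at t)"
      by simp
    then show ?thesis
      by (rule has_field_derivative_transform_within_open[of _ _ _ "{0<..}"]) (use t in \<open>auto simp: flat_def\<close>)
  qed
next
  case True
  have "((\<lambda>h. (flat n (0 + h) - flat n 0) / h) \<longlongrightarrow> 0) (at 0)"
    unfolding filterlim_split_at
  proof (rule filterlim_split_at)
    show "((\<lambda>h. (flat n (0 + h) - flat n 0) / h) \<longlongrightarrow> 0) (at_left 0)"
      by (rule tendsto_eventually) (auto simp: eventually_at_filter flat_def)
    \<comment> \<open>For positive \<open>h\<close> the difference quotient is the next member of
      the family, \<open>flat (Suc n) h\<close>, which also decays at 0.\<close>
    show "((\<lambda>h. (flat n (0 + h) - flat n 0) / h) \<longlongrightarrow> 0) (at_right 0)"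
      by (rule Lim_transform_eventually[OF flat_tendsto_0[of "Suc n"]])
        (auto simp: eventually_at_filter flat_def)
  qed
  then show ?thesis using True by (simp add: DERIV_def flat_def)
qed

text \<open>
  This set contains \<open>exp (- 1 / (e - x \<bullet> x))\<close>, extended by zero, and is closed under partial
  derivatives, so that its members are smooth.
\<close>

inductive_set flat_alg :: "real \<Rightarrow> ('a::euclidean_space \<Rightarrow> real) set" for e where
  "(\<lambda>x. c) \<in> flat_alg e"
| "(\<lambda>x. x \<bullet> b) \<in> flat_alg e"
| "(\<lambda>x. flat n (e - x \<bullet> x)) \<in> flat_alg e"
| "f \<in> flat_alg e \<Longrightarrow> g \<in> flat_alg e \<Longrightarrow> (\<lambda>x. f x + g x) \<in> flat_alg e"
| "f \<in> flat_alg e \<Longrightarrow> g \<in> flat_alg e \<Longrightarrow> (\<lambda>x. f x * g x) \<in> flat_alg e"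

lemma flat_alg_derivative:
  assumes "f \<in> flat_alg e"
  shows "\<exists>D. (\<forall>x. (f has_derivative D x) (at x)) \<and> (\<forall>b. (\<lambda>x. D x b) \<in> flat_alg e)"
  using assms
proof induction
  case (1 c)
  show ?case by (rule exI[of _ "\<lambda>x h. 0"]) (auto intro: flat_alg.intros)
next
  case (2 b)
  show ?case
    by (rule exI[of _ "\<lambda>x h. h \<bullet> b"]) (auto intro!: flat_alg.intros derivative_eq_intros)
next
  case (3 n)
  show ?case
  proof (intro exI conjI allI)
    fix x :: 'a
    have "((\<lambda>x. e - x \<bullet> x) has_derivative (\<lambda>h. - 2 * (x \<bullet> h))) (at x)"
      by (rule derivative_eq_intros refl)+ (auto simp: inner_commute)
    then show "((\<lambda>x. flat n (e - x \<bullet> x)) has_derivative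
        (\<lambda>h. (flat (n + 2) (e - x \<bullet> x) + (- real n) * flat (n + 1) (e - x \<bullet> x)) * (- 2 * (x \<bullet> h)))) (at x)"
      by (auto intro: has_derivative_eq_rhs[OF has_derivative_compose[OF _ flat_derivative[unfolded has_field_derivative_def]]])
  next
    fix b :: 'a
    show "(\<lambda>x. (flat (n + 2) (e - x \<bullet> x) + (- real n) * flat (n + 1) (e - x \<bullet> x)) * (- 2 * (x \<bullet> b))) \<in> flat_alg e"
      by (intro flat_alg.intros)
  qed
next
  case (4 f g)
  then obtain D E where "\<And>x. (f has_derivative D x) (at x)" "\<And>b. (\<lambda>x. D x b) \<in> flat_alg e"
    "\<And>x. (g has_derivative E x) (at x)" "\<And>b. (\<lambda>x. E x b) \<in> flat_alg e" by blast
  then show ?case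
    by (intro exI[of _ "\<lambda>x h. D x h + E x h"]) (auto intro!: flat_alg.intros derivative_intros)
next
  case (5 f g)
  then obtain D E where "\<And>x. (f has_derivative D x) (at x)" "\<And>b. (\<lambda>x. D x b) \<in> flat_alg e"
    "\<And>x. (g has_derivative E x) (at x)" "\<And>b. (\<lambda>x. E x b) \<in> flat_alg e" by blast
  then show ?case using 5
    by (intro exI[of _ "\<lambda>x h. f x * E x h + D x h * g x"]) (auto intro!: flat_alg.intros derivative_intros)
qed

lemma flat_alg_Ck: "f \<in> flat_alg e \<Longrightarrow> Ck k f"
proof (induction k arbitrary: f)
  case 0
  then show ?case
    using flat_alg_derivative[OF 0] by (auto intro: has_derivative_continuous_on has_derivative_at_withinI)
next
  case (Suc k)
  obtain D where D: "\<And>x. (f has_derivative D x) (at x)" "\<And>b. (\<lambda>x. D x b) \<in> flat_alg e"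
    using flat_alg_derivative[OF Suc.prems] by blast
  then have "frechet_derivative f (at x) = D x" for x
    by (metis frechet_derivative_at)
  then show ?case using D Suc.IH by (auto simp: differentiable_def)
qed

definition mollifier :: "real \<Rightarrow> ('a::euclidean_space \<Rightarrow> real) \<Rightarrow> bool" where
  "mollifier e K \<longleftrightarrow> (\<forall>k. Ck k K) \<and> (\<forall>x. 0 \<le> K x) \<and> (\<forall>x. e \<le> norm x \<longrightarrow> K x = 0) \<and>
     integrable lborel K \<and> (\<integral>x. K x \<partial>lborel) = 1"

lemma mollifier_exists:
  assumes "e > 0"
  shows "\<exists>K :: 'a::euclidean_space \<Rightarrow> real. mollifier e K"
proof -
  define f where "f x = flat 0 (e\<^sup>2 - x \<bullet> x)" for x :: 'a
  define I where "I = (\<integral>x. f x \<partial>lborel)"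
  have f: "f \<in> flat_alg (e\<^sup>2)" unfolding f_def by (rule flat_alg.intros)
  then have cont: "continuous_on UNIV f" using flat_alg_Ck[of f _ 0] by simp
  have nn: "f x \<ge> 0" for x by (simp add: f_def flat_def)
  have supp: "f x = 0" if "norm x \<ge> e" for x
    using that \<open>e > 0\<close> power_mono[of e "norm x" 2] by (simp add: f_def flat_def dot_square_norm)
  have int: "integrable lborel f"
    by (rule compact_support_integrable[OF cont compact_cball[of 0 e]]) (use supp in auto)
  have "I \<noteq> 0"
  proof
    assume "I = 0"
    then have "AE x in lborel. f x = 0"
      using integral_nonneg_eq_0_iff_AE[OF int] nn by (simp add: I_def)
    then have "AE x in lebesgue. f x = 0" by (rule AE_completion)
    \<comment> \<open>A continuous function that vanishes almost everywhere vanishes at every point,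
      since its zero set is closed.\<close>
    then have "f 0 = 0"
      using mem_closed_if_AE_lebesgue[of "{x. f x = 0}" 0] closed_Collect_eq[OF cont continuous_on_const]
      by simp
    then show False using \<open>e > 0\<close> by (simp add: f_def flat_def)
  qed
  then have I: "I > 0" using nn by (simp add: I_def less_le integral_nonneg_AE)
  have "(\<lambda>x. inverse I * f x) \<in> flat_alg (e\<^sup>2)"
    by (rule flat_alg.intros(5)[OF flat_alg.intros(1) f])
  then have "Ck k (\<lambda>x. inverse I * f x)" for k by (rule flat_alg_Ck)
  moreover have "0 \<le> inverse I * f x" for x using I nn[of x] by simp
  moreover have "inverse I * f x = 0" if "e \<le> norm x" for x using supp[OF that] by simp
  moreover have "integrable lborel (\<lambda>x. inverse I * f x)" by (intro integrable_mult_right int)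
  moreover have "(\<integral>x. inverse I * f x \<partial>lborel) = inverse I * I"
    by (simp only: integral_mult_right_zero I_def)
  ultimately have "mollifier e (\<lambda>x. inverse I * f x)"
    unfolding mollifier_def using I by auto
  then show ?thesis by blast
qed

section \<open>Convolution\<close>

lemma test_functionsI:
  assumes "\<And>k. Ck k f" "compact K" "K \<subseteq> S" "\<And>x. x \<notin> K \<Longrightarrow> f x = 0"
  shows "f \<in> test_functions S"
proof -
  have "closure {x. f x \<noteq> 0} \<subseteq> K"
    by (rule closure_minimal) (use assms(4) compact_imp_closed[OF assms(2)] in auto)
  moreover from this have "compact (closure {x. f x \<noteq> 0})"
    using assms(2) by (metis closed_closure compact_Int_closed inf.absorb_iff2)
  ultimately show ?thesis using assms(1,3) unfolding test_functions_def by blast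
qed

lemma test_functions_gradient:
  assumes "\<eta> \<in> test_functions S" "b \<in> Basis"
  shows "(\<lambda>x. gradient \<eta> x \<bullet> b) \<in> test_functions S"
proof -
  obtain K where K: "compact K" "K \<subseteq> S" "\<And>x. x \<notin> K \<Longrightarrow> gradient \<eta> x = 0"
    using test_functions_C1c[OF assms(1)] unfolding C1c_def by blast
  show ?thesis
  proof (rule test_functionsI[OF _ K(1,2)])
    fix k
    have "Ck (Suc k) \<eta>" using assms(1) unfolding test_functions_def by blast
    then show "Ck k (\<lambda>x. gradient \<eta> x \<bullet> b)" using assms(2) by (simp add: gradient_inner_Basis)
  qed (simp add: K)
qed

text \<open>Independent factors for the axes are essential later: a dilation with equal factors maps
  the diagonals of the plane to themselves and gains no room.\<close>

definition diag :: "('a \<Rightarrow> real) \<Rightarrow> 'a::euclidean_space \<Rightarrow> 'a" where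
  "diag c x = (\<Sum>j\<in>Basis. (c j * (x \<bullet> j)) *\<^sub>R j)"

lemma diag_inner_Basis [simp]: "j \<in> Basis \<Longrightarrow> diag c x \<bullet> j = c j * (x \<bullet> j)"
  by (simp add: diag_def inner_sum_left inner_Basis if_distrib cong: if_cong)

lemma diag_has_derivative: "((\<lambda>x. a + diag c x) has_derivative diag c) (at x)"
proof -
  have "linear (diag c :: 'a \<Rightarrow> 'a)"
    by (rule linearI)
      (simp_all add: diag_def inner_add_left distrib_left scaleR_add_left sum.distrib scaleR_sum_right mult.left_commute)
  then have "bounded_linear (diag c :: 'a \<Rightarrow> 'a)" by (simp add: linear_conv_bounded_linear)
  then have "(diag c has_derivative diag c) (at x)" by (rule bounded_linear_imp_has_derivative)
  then show ?thesis
    using has_derivative_add[of "\<lambda>_. a" "\<lambda>_. 0" "at x" "diag c" "diag c"] by simp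
qed

lemma continuous_on_diag [continuous_intros]:
  "continuous_on S f \<Longrightarrow> continuous_on S (\<lambda>x. diag c (f x))"
  unfolding diag_def by (intro continuous_intros) auto

lemma borel_measurable_diag [measurable]: "diag c \<in> borel_measurable borel"
  by (intro borel_measurable_continuous_onI continuous_intros)

lemma has_derivative_diag_compose:
  assumes "\<And>x. (f has_derivative (\<lambda>h. g x \<bullet> h)) (at x)"
  shows "((\<lambda>x. s * f (a + diag c x)) has_derivative (\<lambda>h. (s *\<^sub>R diag c (g (a + diag c x))) \<bullet> h)) (at x)"
proof -
  have "((\<lambda>x. f (a + diag c x)) has_derivative (\<lambda>h. g (a + diag c x) \<bullet> diag c h)) (at x)"
    using has_derivative_compose[of "\<lambda>x. a + diag c x" "diag c" x UNIV f "\<lambda>h. g (a + diag c x) \<bullet> h"]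
      diag_has_derivative[of a c x] assms by blast
  then have "((\<lambda>x. s * f (a + diag c x)) has_derivative (\<lambda>h. s * (g (a + diag c x) \<bullet> diag c h))) (at x)"
    by (rule has_derivative_mult_right)
  moreover have "g (a + diag c x) \<bullet> diag c h = diag c (g (a + diag c x)) \<bullet> h" for h
  proof -
    have "g (a + diag c x) \<bullet> diag c h = (\<Sum>b\<in>Basis. (g (a + diag c x) \<bullet> b) * (diag c h \<bullet> b))"
      by (rule euclidean_inner)
    also have "\<dots> = (\<Sum>b\<in>Basis. (diag c (g (a + diag c x)) \<bullet> b) * (h \<bullet> b))"
      by (rule sum.cong) (simp_all add: mult_ac)
    also have "\<dots> = diag c (g (a + diag c x)) \<bullet> h"
      by (rule euclidean_inner[symmetric])
    finally show ?thesis .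
  qed
  ultimately show ?thesis by simp
qed

text \<open>The scalar \<open>s\<close> strengthens the induction: each partial derivative
  contributes a factor \<open>c b\<close>, which has to be absorbed.\<close>

lemma Ck_diag_compose: "Ck k f \<Longrightarrow> Ck k (\<lambda>x. s * f (a + diag c x))"
proof (induction k arbitrary: f s)
  case 0
  then have "continuous_on UNIV (\<lambda>x. f (a + diag c x))"
    by (intro continuous_on_compose2[of UNIV f UNIV "\<lambda>x. a + diag c x"] continuous_on_add
        continuous_on_const continuous_on_diag continuous_on_id) simp_all
  then show ?case by (simp add: continuous_on_mult_left)
next
  case (Suc k)
  have D: "(f has_derivative (\<lambda>h. gradient f x \<bullet> h)) (at x)" for x
    using Suc.prems by (intro has_derivative_gradient) simp
  have E: "((\<lambda>x. s * f (a + diag c x)) has_derivative (\<lambda>h. (s *\<^sub>R diag c (gradient f (a + diag c x))) \<bullet> h)) (at x)" for x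
    using has_derivative_diag_compose[of f "gradient f" s a c x] D by blast
  show ?case
    unfolding Ck.simps
  proof (intro conjI allI ballI)
    show "(\<lambda>x. s * f (a + diag c x)) differentiable at x" for x
      using E by (rule differentiableI)
    fix b :: 'a assume b: "b \<in> Basis"
    have "(\<lambda>x. frechet_derivative (\<lambda>x. s * f (a + diag c x)) (at x) b) =
        (\<lambda>x. (s * c b) * frechet_derivative f (at (a + diag c x)) b)"
      using b by (simp add: frechet_derivative_inner[OF E] gradient_inner_Basis mult.assoc)
    moreover have "Ck k (\<lambda>x. (s * c b) * frechet_derivative f (at (a + diag c x)) b)"
      using Suc.prems b by (intro Suc.IH) simp
    ultimately show "Ck k (\<lambda>x. frechet_derivative (\<lambda>x. s * f (a + diag c x)) (at x) b)"
      by simp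
  qed
qed

lemma compact_support_uniformly_continuous:
  fixes g :: "'a::euclidean_space \<Rightarrow> 'b::euclidean_space"
  assumes "continuous_on UNIV g" "compact K" "\<And>x. x \<notin> K \<Longrightarrow> g x = 0" "e > 0"
  obtains d where "d > 0" "\<And>x y. dist x y < d \<Longrightarrow> dist (g x) (g y) < e"
proof -
  obtain R where R: "R > 0" "K \<subseteq> ball 0 R"
    using bounded_subset_ballD[OF compact_imp_bounded[OF assms(2)], of 0] by blast
  have "uniformly_continuous_on (cball 0 (R + 1)) g"
    by (rule compact_uniformly_continuous) (auto intro: continuous_on_subset[OF assms(1)])
  then obtain d where d: "d > 0" "\<And>x y. x \<in> cball 0 (R + 1) \<Longrightarrow> y \<in> cball 0 (R + 1) \<Longrightarrow> dist y x < d \<Longrightarrow> dist (g y) (g x) < e"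
    using \<open>e > 0\<close> uniformly_continuous_onE[of "cball 0 (R + 1)" g e] by metis
  show ?thesis
  proof (rule that[of "min d 1"])
    show "min d 1 > 0" using d by simp
    fix x y :: 'a assume xy: "dist x y < min d 1"
    show "dist (g x) (g y) < e"
    proof (cases "x \<in> cball 0 (R + 1) \<and> y \<in> cball 0 (R + 1)")
      case True
      then show ?thesis using d(2)[of y x] xy by simp
    next
      case False
      have "norm x \<le> norm y + norm (x - y)" "norm y \<le> norm x + norm (x - y)"
        using norm_triangle_sub[of x y] norm_triangle_sub[of y x] by (simp_all add: norm_minus_commute)
      moreover have "norm (x - y) < 1" using xy by (simp add: dist_norm)
      moreover have "R + 1 < norm x \<or> R + 1 < norm y" using False by auto
      ultimately have "R < norm x" "R < norm y" by linarith+
      moreover have "z \<notin> K" if "R < norm z" for z using subsetD[OF R(2), of z] that by auto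
      ultimately have "x \<notin> K" "y \<notin> K" by blast+
      then show ?thesis using assms(3,4) by simp
    qed
  qed
qed

text \<open>The rough function \<open>w\<close> is scalar while the kernel may be vector valued, so
  that one definition also covers convolution with the gradient of a kernel.\<close>

definition conv :: "('a::euclidean_space \<Rightarrow> real) \<Rightarrow> ('a \<Rightarrow> 'b::euclidean_space) \<Rightarrow> 'a \<Rightarrow> 'b" where
  "conv w \<kappa> x = (\<integral>y. w y *\<^sub>R \<kappa> (x - y) \<partial>lborel)"

lemma integrable_bounded_scaleR:
  fixes q :: "'a::euclidean_space \<Rightarrow> 'b::euclidean_space"
  assumes w: "integrable lborel w" and q: "q \<in> borel_measurable borel" and B: "\<And>x. norm (q x) \<le> B"
  shows "integrable lborel (\<lambda>y. w y *\<^sub>R q y)"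
proof (rule Bochner_Integration.integrable_bound[where f="\<lambda>y. B * w y"])
  show "integrable lborel (\<lambda>y. B * w y)" using w by simp
  have [measurable]: "w \<in> borel_measurable borel" using w borel_measurable_integrable by fastforce
  note q[measurable]
  show "(\<lambda>y. w y *\<^sub>R q y) \<in> borel_measurable lborel" by measurable
  have "B \<ge> 0" using B[of 0] norm_ge_zero[of "q 0"] by linarith
  then show "AE x in lborel. norm (w x *\<^sub>R q x) \<le> norm (B * w x)"
    using B by (intro AE_I2) (simp add: abs_mult mult.commute[of B] mult_left_mono)
qed

lemma integrable_conv:
  fixes \<kappa> :: "'a::euclidean_space \<Rightarrow> 'b::euclidean_space"
  assumes w: "integrable lborel w" and k: "continuous_on UNIV \<kappa>" "\<And>x. norm (\<kappa> x) \<le> B"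
  shows "integrable lborel (\<lambda>y. w y *\<^sub>R \<kappa> (x - y))"
proof (rule integrable_bounded_scaleR[OF w _ k(2)])
  have [measurable]: "\<kappa> \<in> borel_measurable borel" using k(1) by (rule borel_measurable_continuous_onI)
  show "(\<lambda>y. \<kappa> (x - y)) \<in> borel_measurable borel" by measurable
qed

text \<open>Uniform continuity of \<open>\<kappa>'\<close> bounds the linearisation error of the
  kernel by \<open>norm h * e'\<close>, uniformly in the base point; integrating this bound against
  the absolute value of \<open>w\<close> gives the differential of the convolution.\<close>

lemma conv_has_derivative:
  assumes w: "integrable lborel w" and C: "C1c UNIV \<kappa> \<kappa>'"
  shows "(conv w \<kappa> has_derivative (\<lambda>h. conv w \<kappa>' x \<bullet> h)) (at x)"
  unfolding has_derivative_at_alt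
proof (intro conjI allI impI)
  show "bounded_linear ((\<bullet>) (conv w \<kappa>' x))" by (rule bounded_linear_inner_right)
  fix e :: real assume "e > 0"
  define W where "W = (\<integral>y. \<bar>w y\<bar> \<partial>lborel)"
  have W: "W \<ge> 0" unfolding W_def by simp
  define e' where "e' = e / (W + 1)"
  have e': "e' > 0" using \<open>e > 0\<close> W by (simp add: e'_def)
  obtain B where B: "B > 0" "\<And>x. \<bar>\<kappa> x\<bar> \<le> B" "\<And>x. norm (\<kappa>' x) \<le> B" using C1c_bounded[OF C] by metis
  obtain K where K: "compact K" "\<And>x. x \<notin> K \<Longrightarrow> \<kappa>' x = 0" using C unfolding C1c_def by blast
  obtain d where d: "d > 0" "\<And>x y. dist x y < d \<Longrightarrow> dist (\<kappa>' x) (\<kappa>' y) < e'"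
    using compact_support_uniformly_continuous[OF C1cD(2)[OF C] K e'] by metis
  have pt: "\<bar>\<kappa> (p + h) - \<kappa> p - \<kappa>' p \<bullet> h\<bar> \<le> norm h * e'" if h: "norm h < d" for p h
  proof -
    have "norm (\<kappa> (p + h) - \<kappa> p - \<kappa>' p \<bullet> (p + h - p)) \<le> norm (p + h - p) * e'"
    proof (rule differentiable_bound_linearization[where S="ball p d" and f'="\<lambda>x h. \<kappa>' x \<bullet> h"])
      show "p + t *\<^sub>R (p + h - p) \<in> ball p d" if t: "t \<in> {0..1}" for t
      proof -
        have "t * norm h \<le> 1 * norm h" using t by (intro mult_right_mono) auto
        then show ?thesis using t h by (simp add: dist_norm)
      qed
      show "(\<kappa> has_derivative (\<lambda>h. \<kappa>' x \<bullet> h)) (at x within ball p d)" for x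
        by (rule has_derivative_at_withinI[OF C1cD(1)[OF C]])
      show "onorm ((\<lambda>h. \<kappa>' x \<bullet> h) - (\<lambda>h. \<kappa>' p \<bullet> h)) \<le> e'" if x: "x \<in> ball p d" for x
      proof (rule onorm_le)
        fix v
        have "norm (\<kappa>' x - \<kappa>' p) \<le> e'" using d(2)[of x p] x by (simp add: dist_norm norm_minus_commute)
        then have "norm ((\<kappa>' x - \<kappa>' p) \<bullet> v) \<le> e' * norm v"
          by (intro order_trans[OF Cauchy_Schwarz_ineq2[folded real_norm_def]] mult_right_mono) auto
        then show "norm (((\<lambda>h. \<kappa>' x \<bullet> h) - (\<lambda>h. \<kappa>' p \<bullet> h)) v) \<le> e' * norm v"
          by (simp add: inner_diff_left)
      qed
    qed (use d in auto)
    then show ?thesis by simp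
  qed
  show "\<exists>d>0. \<forall>y. norm (y - x) < d \<longrightarrow>
      norm (conv w \<kappa> y - conv w \<kappa> x - conv w \<kappa>' x \<bullet> (y - x)) \<le> e * norm (y - x)"
  proof (intro exI[of _ d] conjI allI impI d(1))
    fix y assume y: "norm (y - x) < d"
    have i1: "integrable lborel (\<lambda>z. w z *\<^sub>R \<kappa> (p - z))" for p
      by (rule integrable_conv[OF w C1cD(3)[OF C], of B]) (simp add: B)
    have i2: "integrable lborel (\<lambda>z. w z *\<^sub>R \<kappa>' (x - z))"
      by (rule integrable_conv[OF w C1cD(2)[OF C] B(3)])
    have i3: "integrable lborel (\<lambda>z. (w z *\<^sub>R \<kappa>' (x - z)) \<bullet> (y - x))"
      by (rule integrable_inner_left) (use i2 in simp)
    have eq: "conv w \<kappa>' x \<bullet> (y - x) = (\<integral>z. (w z *\<^sub>R \<kappa>' (x - z)) \<bullet> (y - x) \<partial>lborel)"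
      unfolding conv_def by (rule integral_inner_left[symmetric]) (rule i2)
    have "conv w \<kappa> y - conv w \<kappa> x - conv w \<kappa>' x \<bullet> (y - x) =
      (\<integral>z. w z *\<^sub>R \<kappa> (y - z) - w z *\<^sub>R \<kappa> (x - z) - (w z *\<^sub>R \<kappa>' (x - z)) \<bullet> (y - x) \<partial>lborel)"
      unfolding eq using i1 i3 by (simp only: conv_def Bochner_Integration.integral_diff Bochner_Integration.integrable_diff)
    also have "norm \<dots> \<le> (\<integral>z. norm (y - x) * e' * \<bar>w z\<bar> \<partial>lborel)"
    proof (rule order_trans[OF integral_norm_bound integral_mono[OF integrable_norm]])
      show "integrable lborel (\<lambda>z. w z *\<^sub>R \<kappa> (y - z) - w z *\<^sub>R \<kappa> (x - z) - (w z *\<^sub>R \<kappa>' (x - z)) \<bullet> (y - x))"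
        by (intro Bochner_Integration.integrable_diff i1 i3)
      show "integrable lborel (\<lambda>z. norm (y - x) * e' * \<bar>w z\<bar>)" using w by simp
      fix z
      have "\<bar>\<kappa> (x - z + (y - x)) - \<kappa> (x - z) - \<kappa>' (x - z) \<bullet> (y - x)\<bar> \<le> norm (y - x) * e'"
        by (rule pt[OF y])
      then have "\<bar>w z\<bar> * \<bar>\<kappa> (y - z) - \<kappa> (x - z) - \<kappa>' (x - z) \<bullet> (y - x)\<bar> \<le> \<bar>w z\<bar> * (norm (y - x) * e')"
        by (intro mult_left_mono) auto
      then show "norm (w z *\<^sub>R \<kappa> (y - z) - w z *\<^sub>R \<kappa> (x - z) - (w z *\<^sub>R \<kappa>' (x - z)) \<bullet> (y - x))
          \<le> norm (y - x) * e' * \<bar>w z\<bar>"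
        by (simp only: real_norm_def real_scaleR_def inner_scaleR_left abs_mult[symmetric] right_diff_distrib)
          (simp add: mult_ac)
    qed
    also have "\<dots> = norm (y - x) * (e' * W)" by (simp add: W_def)
    also have "\<dots> \<le> norm (y - x) * e"
      using W \<open>e > 0\<close> by (intro mult_left_mono) (auto simp: e'_def field_simps)
    finally show "norm (conv w \<kappa> y - conv w \<kappa> x - conv w \<kappa>' x \<bullet> (y - x)) \<le> e * norm (y - x)"
      by (simp add: mult.commute)
  qed
qed

lemma conv_inner:
  assumes w: "integrable lborel w" and C: "C1c UNIV \<kappa> \<kappa>'"
  shows "conv w \<kappa>' x \<bullet> b = conv w (\<lambda>z. \<kappa>' z \<bullet> b) x"
proof -
  obtain B where B: "\<And>x. norm (\<kappa>' x) \<le> B" using C1c_bounded[OF C] by metis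
  have i: "integrable lborel (\<lambda>z. w z *\<^sub>R \<kappa>' (x - z))"
    by (rule integrable_conv[OF w C1cD(2)[OF C] B])
  have "conv w \<kappa>' x \<bullet> b = (\<integral>z. (w z *\<^sub>R \<kappa>' (x - z)) \<bullet> b \<partial>lborel)"
    unfolding conv_def by (rule integral_inner_left[symmetric]) (rule i)
  then show ?thesis by (simp add: conv_def)
qed

text \<open>All derivatives fall on the kernel, and a partial derivative of a test function is again
  a test function. Hence the induction has to range over all kernels.\<close>

lemma conv_Ck:
  assumes w: "integrable lborel w"
  shows "\<kappa> \<in> test_functions UNIV \<Longrightarrow> Ck k (conv w \<kappa>)"
proof (induction k arbitrary: \<kappa>)
  case 0
  then show ?case
    using has_derivative_continuous_on[OF has_derivative_at_withinI[OF conv_has_derivative[OF w test_functions_C1c]]]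
    by simp
next
  case (Suc k)
  note C = test_functions_C1c[OF Suc.prems]
  note D = conv_has_derivative[OF w C]
  show ?case
    unfolding Ck.simps
  proof (intro conjI allI ballI)
    show "conv w \<kappa> differentiable at x" for x using D by (rule differentiableI)
    fix b :: 'a assume b: "b \<in> Basis"
    have "(\<lambda>x. frechet_derivative (conv w \<kappa>) (at x) b) = conv w (\<lambda>z. gradient \<kappa> z \<bullet> b)"
      by (simp add: fun_eq_iff frechet_derivative_inner[OF D] conv_inner[OF w C])
    then show "Ck k (\<lambda>x. frechet_derivative (conv w \<kappa>) (at x) b)"
      using Suc.IH[OF test_functions_gradient[OF Suc.prems b]] by simp
  qed
qed

lemma mollifierD:
  assumes "mollifier e K"
  shows "Ck k K" "0 \<le> K x" "e \<le> norm x \<Longrightarrow> K x = 0" "integrable lborel K" "(\<integral>x. K x \<partial>lborel) = 1"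
    "K \<in> test_functions UNIV" "continuous_on UNIV K" "K \<in> borel_measurable borel"
proof -
  show k: "Ck k K" for k using assms by (simp add: mollifier_def)
  show "0 \<le> K x" "e \<le> norm x \<Longrightarrow> K x = 0" "integrable lborel K" "(\<integral>x. K x \<partial>lborel) = 1"
    using assms by (simp_all add: mollifier_def)
  show "K \<in> test_functions UNIV"
    by (rule test_functionsI[OF k compact_cball[of 0 e]]) (use assms in \<open>auto simp: mollifier_def\<close>)
  show "continuous_on UNIV K" using k[of 0] by simp
  then show "K \<in> borel_measurable borel" by (rule borel_measurable_continuous_onI)
qed

section \<open>Mollification in \<open>L\<^sup>1\<close>\<close>

text \<open>The sum of the \<open>h n\<close> has finite integral, hence is finite almost
  everywhere, and the terms of a convergent series tend to zero. With geometric errors no passage to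
  a subsequence is required.\<close>

lemma AE_tendsto_0_of_nn_integral_geometric:
  assumes [measurable]: "\<And>n. h n \<in> borel_measurable M"
    and le: "\<And>n. (\<integral>\<^sup>+x. h n x \<partial>M) \<le> ennreal ((1 / 2) ^ n)"
  shows "AE x in M. (\<lambda>n. h n x) \<longlonglongrightarrow> 0"
proof -
  have "(\<integral>\<^sup>+x. (\<Sum>n. h n x) \<partial>M) = (\<Sum>n. \<integral>\<^sup>+x. h n x \<partial>M)"
    by (rule nn_integral_suminf) measurable
  also have "\<dots> \<le> (\<Sum>n. ennreal ((1 / 2) ^ n))"
    by (intro suminf_le summableI le)
  also have "\<dots> = ennreal (\<Sum>n. (1 / 2) ^ n)"
    by (rule suminf_ennreal2) (simp_all add: summable_geometric)
  also have "\<dots> < \<infinity>" by simp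
  finally have "(\<integral>\<^sup>+x. (\<Sum>n. h n x) \<partial>M) \<noteq> \<infinity>" by simp
  then have "AE x in M. (\<Sum>n. h n x) \<noteq> \<infinity>"
    by (intro nn_integral_PInf_AE) measurable
  then show ?thesis
  proof eventually_elim
    case (elim x)
    have fin: "h n x = ennreal (enn2real (h n x))" for n
    proof -
      have "h n x \<le> (\<Sum>n. h n x)" using sum_le_suminf[of "\<lambda>n. h n x" "{n}"] by (simp add: summableI)
      then have "h n x \<noteq> top" using elim by (auto simp: top_unique)
      then show ?thesis by (simp add: less_top)
    qed
    have "(\<Sum>n. ennreal (enn2real (h n x))) \<noteq> top" using elim fin by simp
    then have "summable (\<lambda>n. enn2real (h n x))"
      by (rule summable_suminf_not_top[rotated]) simp
    then have "(\<lambda>n. enn2real (h n x)) \<longlonglongrightarrow> 0" by (rule summable_LIMSEQ_zero)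
    then have "(\<lambda>n. ennreal (enn2real (h n x))) \<longlonglongrightarrow> ennreal 0" by (rule tendsto_ennrealI)
    then show ?case using fin by simp
  qed
qed

lemma nn_integral_reflect:
  fixes f :: "'a::euclidean_space \<Rightarrow> ennreal"
  assumes [measurable]: "f \<in> borel_measurable borel"
  shows "(\<integral>\<^sup>+y. f (a - y) \<partial>lborel) = (\<integral>\<^sup>+y. f y \<partial>lborel)"
proof -
  have "(\<integral>\<^sup>+y. f y \<partial>lborel) = (\<integral>\<^sup>+y. f y \<partial>density (distr lborel borel (\<lambda>x::'a. a + (-1) *\<^sub>R x)) (\<lambda>_. ennreal (\<bar>-1\<bar> ^ DIM('a))))"
    by (rule arg_cong[where f="\<lambda>M. integral\<^sup>N M f"], rule lborel_affine) simp
  also have "\<dots> = (\<integral>\<^sup>+y. f (a - y) \<partial>lborel)"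
    by (simp add: nn_integral_density nn_integral_distr)
  finally show ?thesis by simp
qed

lemma integral_reflect:
  fixes f :: "'a::euclidean_space \<Rightarrow> real"
  assumes [measurable]: "f \<in> borel_measurable borel"
  shows "(\<integral>y. f (a - y) \<partial>lborel) = (\<integral>y. f y \<partial>lborel)"
proof -
  have "distr lborel borel (\<lambda>x::'a. a - x) = lborel"
    using lborel_affine[of "-1" a] by (simp add: density_1)
  then have "(\<integral>y. f y \<partial>lborel) = (\<integral>y. f y \<partial>distr lborel borel (\<lambda>x::'a. a - x))" by simp
  also have "\<dots> = (\<integral>y. f (a - y) \<partial>lborel)" by (rule integral_distr) measurable
  finally show ?thesis by simp
qed

text \<open>The Jacobian of the dilation is the product of its factors, which is at least 1.\<close>

lemma nn_integral_diag_le: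
  fixes f :: "'a::euclidean_space \<Rightarrow> ennreal"
  assumes [measurable]: "f \<in> borel_measurable borel" and c: "\<And>j. j \<in> Basis \<Longrightarrow> 1 \<le> c j"
  shows "(\<integral>\<^sup>+x. f (a + diag c x) \<partial>lborel) \<le> (\<integral>\<^sup>+x. f x \<partial>lborel)"
proof -
  let ?P = "\<Prod>j\<in>Basis. \<bar>c j\<bar>"
  have P: "1 \<le> ?P" using c by (intro prod_ge_1) fastforce
  have "lborel = density (distr lborel borel (\<lambda>x. a + diag c x)) (\<lambda>_. ennreal ?P)"
    unfolding diag_def by (rule lborel_affine_euclidean) (use c in fastforce)
  then have "(\<integral>\<^sup>+x. f x \<partial>lborel) = (\<integral>\<^sup>+x. f x \<partial>density (distr lborel borel (\<lambda>x. a + diag c x)) (\<lambda>_. ennreal ?P))"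
    by (rule arg_cong)
  also have "\<dots> = (\<integral>\<^sup>+x. ennreal ?P * f (a + diag c x) \<partial>lborel)"
    by (simp add: nn_integral_density nn_integral_distr)
  also have "\<dots> = ennreal ?P * (\<integral>\<^sup>+x. f (a + diag c x) \<partial>lborel)"
    by (rule nn_integral_cmult) measurable
  finally have "(\<integral>\<^sup>+x. f x \<partial>lborel) = ennreal ?P * (\<integral>\<^sup>+x. f (a + diag c x) \<partial>lborel)" .
  moreover have "1 * (\<integral>\<^sup>+x. f (a + diag c x) \<partial>lborel) \<le> ennreal ?P * (\<integral>\<^sup>+x. f (a + diag c x) \<partial>lborel)"
    using P by (intro mult_right_mono) (simp_all add: ennreal_le_iff flip: ennreal_1)
  ultimately show ?thesis by simp
qed

lemma mollifier_nn_integral: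
  assumes "mollifier e K"
  shows "(\<integral>\<^sup>+x. ennreal (K x) \<partial>lborel) = 1"
  using nn_integral_eq_integral[OF mollifierD(4)[OF assms]] mollifierD(2,5)[OF assms] by simp

lemma mollifier_bound:
  assumes "mollifier e K"
  obtains B where "\<And>x. norm (K x) \<le> B"
  using compact_support_bounded[OF mollifierD(7)[OF assms] compact_cball[of 0 e]] mollifierD(3)[OF assms]
  by (metis less_eq_real_def mem_cball_0 not_le)

lemma mollifier_integrable:
  assumes "mollifier e K" "integrable lborel w"
  shows "integrable lborel (\<lambda>y. w y *\<^sub>R K (x - y))"
  using mollifier_bound[OF assms(1)] integrable_conv[OF assms(2) mollifierD(7)[OF assms(1)]] by metis

lemma conv_borel_measurable:
  assumes "mollifier e K" "integrable lborel w"
  shows "conv w K \<in> borel_measurable borel"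
  using conv_Ck[OF assms(2) mollifierD(6)[OF assms(1)], of 0] by (simp add: borel_measurable_continuous_onI)

lemma conv_diff:
  assumes "mollifier e K" "integrable lborel v" "integrable lborel w"
  shows "conv (\<lambda>y. v y - w y) K x = conv v K x - conv w K x"
  unfolding conv_def using mollifier_integrable[OF assms(1)] assms(2,3)
  by (simp add: left_diff_distrib del: integral_mult_left_zero integral_mult_right_zero)

text \<open>Young's inequality for convolution in L1: after Tonelli the inner integral is the mass
  of a dilated kernel, at most 1 because the factors are at least 1.\<close>

lemma nn_integral_conv_diag_le:
  fixes w :: "'a::euclidean_space \<Rightarrow> real"
  assumes K: "mollifier e K" and w: "integrable lborel w" and c: "\<And>j. j \<in> Basis \<Longrightarrow> 1 \<le> c j"
  shows "(\<integral>\<^sup>+x. ennreal \<bar>conv w K (diag c x)\<bar> \<partial>lborel) \<le> (\<integral>\<^sup>+x. ennreal \<bar>w x\<bar> \<partial>lborel)"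
proof -
  have wm [measurable]: "w \<in> borel_measurable borel" using w borel_measurable_integrable by fastforce
  have Km [measurable]: "K \<in> borel_measurable borel" by (rule mollifierD(8)[OF K])
  have "ennreal \<bar>conv w K x\<bar> \<le> (\<integral>\<^sup>+y. ennreal \<bar>w y\<bar> * ennreal (K (x - y)) \<partial>lborel)" for x
  proof -
    have "ennreal (norm (conv w K x)) \<le> (\<integral>\<^sup>+y. ennreal (norm (w y *\<^sub>R K (x - y))) \<partial>lborel)"
      unfolding conv_def by (rule integral_norm_bound_ennreal[OF mollifier_integrable[OF K w]])
    then show ?thesis using mollifierD(2)[OF K] by (simp add: abs_mult ennreal_mult)
  qed
  then have "(\<integral>\<^sup>+x. ennreal \<bar>conv w K (diag c x)\<bar> \<partial>lborel)
      \<le> (\<integral>\<^sup>+x. \<integral>\<^sup>+y. ennreal \<bar>w y\<bar> * ennreal (K (diag c x - y)) \<partial>lborel \<partial>lborel)"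
    by (intro nn_integral_mono)
  also have "\<dots> = (\<integral>\<^sup>+y. \<integral>\<^sup>+x. ennreal \<bar>w y\<bar> * ennreal (K (diag c x - y)) \<partial>lborel \<partial>lborel)"
    by (rule lborel_pair.Fubini'[symmetric]) measurable
  also have "\<dots> = (\<integral>\<^sup>+y. ennreal \<bar>w y\<bar> * (\<integral>\<^sup>+x. ennreal (K (diag c x - y)) \<partial>lborel) \<partial>lborel)"
    by (intro nn_integral_cong nn_integral_cmult) measurable
  also have "\<dots> \<le> (\<integral>\<^sup>+y. ennreal \<bar>w y\<bar> * 1 \<partial>lborel)"
  proof (intro nn_integral_mono mult_left_mono)
    fix y
    have "(\<integral>\<^sup>+x. ennreal (K (- y + diag c x)) \<partial>lborel) \<le> (\<integral>\<^sup>+x. ennreal (K x) \<partial>lborel)"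
      by (rule nn_integral_diag_le[OF _ c]) measurable
    then show "(\<integral>\<^sup>+x. ennreal (K (diag c x - y)) \<partial>lborel) \<le> 1"
      using mollifier_nn_integral[OF K] by simp
  qed simp
  finally show ?thesis by simp
qed

text \<open>Clamping the values and cutting off at infinity come first. Only after these truncations
  does almost everywhere convergence of continuous functions \<open>h n\<close> to \<open>g\<close>
  imply convergence in L1, since the truncated \<open>h n\<close> share a bounded dominating
  function of compact support.\<close>

lemma integrable_approx_continuous:
  fixes g :: "'a::euclidean_space \<Rightarrow> real"
  assumes g: "integrable lborel g" and "e > 0"
  obtains f R where "continuous_on UNIV f" "R > 0" "\<And>x. x \<notin> cball 0 R \<Longrightarrow> f x = 0"
    "(\<integral>\<^sup>+x. ennreal \<bar>g x - f x\<bar> \<partial>lborel) < ennreal e"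
proof -
  define cut where "cut m x = max 0 (min 1 (real m + 1 - norm x))" for m and x :: 'a
  define cl where "cl m t = max (- real m) (min (real m) t)" for m t
  have cutc: "continuous_on UNIV (cut m)" for m unfolding cut_def by (intro continuous_intros)
  have clc: "continuous_on UNIV (cl m)" for m unfolding cl_def by (intro continuous_intros)
  have cut01: "0 \<le> cut m x" "cut m x \<le> 1" for m x by (auto simp: cut_def)
  have clb: "\<bar>cl m t\<bar> \<le> real m" "\<bar>cl m t\<bar> \<le> \<bar>t\<bar>" for m t by (auto simp: cl_def)
  have cut0: "cut m x = 0" if "x \<notin> cball 0 (real m + 1)" for m x using that by (auto simp: cut_def)
  have [measurable]: "g \<in> borel_measurable borel" using g borel_measurable_integrable by fastforce
  have [measurable]: "cut m \<in> borel_measurable borel" for m using cutc by (rule borel_measurable_continuous_onI)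
  have [measurable]: "cl m \<in> borel_measurable borel" for m using clc by (rule borel_measurable_continuous_onI)
  have gfin: "(\<integral>\<^sup>+x. ennreal \<bar>g x\<bar> \<partial>lborel) < \<infinity>" using g by (simp add: integrable_iff_bounded)
  have "(\<lambda>m. \<integral>\<^sup>+x. ennreal (norm (g x - cut m x * cl m (g x))) \<partial>lborel) \<longlonglongrightarrow> 0"
  proof (rule nn_integral_dominated_convergence_norm[where w="\<lambda>x. \<bar>g x\<bar>"])
    show "AE x in lborel. norm (cut m x * cl m (g x)) \<le> \<bar>g x\<bar>" for m
      using mult_mono[OF cut01(2) clb(2)] cut01(1) by (intro AE_I2) (simp add: abs_mult)
    show "AE x in lborel. (\<lambda>m. cut m x * cl m (g x)) \<longlonglongrightarrow> g x"
    proof (rule AE_I2)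
      fix x
      obtain N :: nat where N: "norm x \<le> real N" "\<bar>g x\<bar> \<le> real N"
        using real_arch_simple[of "max (norm x) \<bar>g x\<bar>"] by auto
      have "cut m x * cl m (g x) = g x" if "m \<ge> N" for m
      proof -
        have "real m \<ge> real N" using that by simp
        then show ?thesis using N by (auto simp: cut_def cl_def)
      qed
      then show "(\<lambda>m. cut m x * cl m (g x)) \<longlonglongrightarrow> g x"
        by (intro tendsto_eventually eventually_sequentiallyI[of N])
    qed
  qed (use gfin in measurable)
  then have "\<forall>\<^sub>F m in sequentially. (\<integral>\<^sup>+x. ennreal (norm (g x - cut m x * cl m (g x))) \<partial>lborel) < ennreal (e / 2)"
    by (rule order_tendstoD) (use \<open>e > 0\<close> in simp)
  then obtain m where m: "(\<integral>\<^sup>+x. ennreal \<bar>g x - cut m x * cl m (g x)\<bar> \<partial>lborel) < ennreal (e / 2)"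
    by (auto simp: eventually_sequentially)
  have "g \<in> borel_measurable lebesgue" by (rule measurable_completion) simp
  then have "g measurable_on UNIV" by (rule lebesgue_measurable_imp_measurable_on_real) simp
  then obtain N h where N: "negligible N" and h: "\<And>n. continuous_on UNIV (h n)"
      and lim: "\<And>x. x \<notin> N \<Longrightarrow> (\<lambda>n. h n x) \<longlonglongrightarrow> g x"
    unfolding measurable_on_def by auto
  have [measurable]: "h n \<in> borel_measurable borel" for n using h by (rule borel_measurable_continuous_onI)
  have "(\<lambda>n. \<integral>\<^sup>+x. ennreal (norm (cut m x * cl m (g x) - cut m x * cl m (h n x))) \<partial>lborel) \<longlonglongrightarrow> 0"
  proof (rule nn_integral_dominated_convergence_norm[where w="\<lambda>x. real m * indicator (cball (0::'a) (real m + 1)) x"])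
    show "AE x in lborel. norm (cut m x * cl m (h n x)) \<le> real m * indicator (cball 0 (real m + 1)) x" for n
    proof (rule AE_I2)
      fix x
      have "\<bar>cut m x\<bar> * \<bar>cl m (h n x)\<bar> \<le> 1 * real m"
        using cut01 clb by (intro mult_mono) auto
      then show "norm (cut m x * cl m (h n x)) \<le> real m * indicator (cball 0 (real m + 1)) x"
        using cut0[of x m] by (cases "x \<in> cball 0 (real m + 1)") (simp_all add: abs_mult)
    qed
    have "(\<integral>\<^sup>+x. ennreal (real m * indicator (cball 0 (real m + 1)) x) \<partial>(lborel :: 'a measure)) =
        (\<integral>\<^sup>+x. ennreal (real m) * indicator (cball 0 (real m + 1)) x \<partial>(lborel :: 'a measure))"
      by (intro nn_integral_cong) (simp add: ennreal_mult' ennreal_indicator)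
    also have "\<dots> = ennreal (real m) * emeasure lborel (cball (0::'a) (real m + 1))"
      by (rule nn_integral_cmult_indicator) simp
    also have "\<dots> < \<infinity>"
      using emeasure_lborel_cball_finite[of "0::'a" "real m + 1"] by (simp add: ennreal_mult_less_top)
    finally show "(\<integral>\<^sup>+x. ennreal (real m * indicator (cball 0 (real m + 1)) x) \<partial>(lborel :: 'a measure)) < \<infinity>" .
    show "(\<lambda>x. real m * indicator (cball (0::'a) (real m + 1)) x) \<in> borel_measurable lborel"
      by (intro borel_measurable_times borel_measurable_const borel_measurable_indicator) simp
    have "N \<in> null_sets lebesgue" using N by (simp add: negligible_iff_null_sets)
    then have "AE x in lebesgue. x \<notin> N" by (rule AE_not_in)
    then have "AE x in lebesgue. (\<lambda>n. h n x) \<longlonglongrightarrow> g x" by eventually_elim (rule lim)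
    then have "AE x in lborel. (\<lambda>n. h n x) \<longlonglongrightarrow> g x"
      by (subst (asm) AE_completion_iff) measurable
    then show "AE x in lborel. (\<lambda>n. cut m x * cl m (h n x)) \<longlonglongrightarrow> cut m x * cl m (g x)"
      by eventually_elim
        (intro tendsto_intros continuous_on_tendsto_compose[OF clc], auto)
  qed (measurable, measurable)
  then have "\<forall>\<^sub>F n in sequentially. (\<integral>\<^sup>+x. ennreal (norm (cut m x * cl m (g x) - cut m x * cl m (h n x))) \<partial>lborel) < ennreal (e / 2)"
    by (rule order_tendstoD) (use \<open>e > 0\<close> in simp)
  then obtain n where n: "(\<integral>\<^sup>+x. ennreal \<bar>cut m x * cl m (g x) - cut m x * cl m (h n x)\<bar> \<partial>lborel) < ennreal (e / 2)"
    by (auto simp: eventually_sequentially)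
  show ?thesis
  proof (rule that[of "\<lambda>x. cut m x * cl m (h n x)" "real m + 1"])
    show "continuous_on UNIV (\<lambda>x. cut m x * cl m (h n x))"
      by (intro continuous_on_mult cutc continuous_on_compose2[OF clc h]) simp
    show "real m + 1 > 0" by simp
    show "cut m x * cl m (h n x) = 0" if "x \<notin> cball 0 (real m + 1)" for x using cut0[OF that] by simp
    have "(\<integral>\<^sup>+x. ennreal \<bar>g x - cut m x * cl m (h n x)\<bar> \<partial>lborel) \<le>
      (\<integral>\<^sup>+x. ennreal \<bar>g x - cut m x * cl m (g x)\<bar> + ennreal \<bar>cut m x * cl m (g x) - cut m x * cl m (h n x)\<bar> \<partial>lborel)"
      by (intro nn_integral_mono) (simp flip: ennreal_plus)
    also have "\<dots> = (\<integral>\<^sup>+x. ennreal \<bar>g x - cut m x * cl m (g x)\<bar> \<partial>lborel) +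
        (\<integral>\<^sup>+x. ennreal \<bar>cut m x * cl m (g x) - cut m x * cl m (h n x)\<bar> \<partial>lborel)"
      by (rule nn_integral_add) measurable
    also have "\<dots> < ennreal (e / 2) + ennreal (e / 2)"
      by (rule add_strict_mono[OF m n])
    also have "\<dots> = ennreal e" using \<open>e > 0\<close> by (simp flip: ennreal_plus)
    finally show "(\<integral>\<^sup>+x. ennreal \<bar>g x - cut m x * cl m (h n x)\<bar> \<partial>lborel) < ennreal e" .
  qed
qed

lemma conv_mollifier_near:
  fixes f :: "'a::euclidean_space \<Rightarrow> real"
  assumes K: "mollifier e K" and f: "integrable lborel f"
    and near: "\<And>y. norm (p - y) < e \<Longrightarrow> \<bar>f y - t\<bar> \<le> \<omega>"
  shows "\<bar>conv f K p - t\<bar> \<le> \<omega>"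
proof -
  have Km: "K \<in> borel_measurable borel" by (rule mollifierD(8)[OF K])
  have i1: "integrable lborel (\<lambda>y. K (p - y))"
  proof -
    have "integrable lborel (\<lambda>y. K (p - y)) \<longleftrightarrow> integrable (distr lborel borel (\<lambda>y. p - y)) K"
      by (rule integrable_distr_eq[symmetric]) (use Km in auto)
    moreover have "distr lborel borel (\<lambda>x::'a. p - x) = lborel"
      using lborel_affine[of "-1" p] by (simp add: density_1)
    ultimately show ?thesis using mollifierD(4)[OF K] by simp
  qed
  have one: "(\<integral>y. K (p - y) \<partial>lborel) = 1"
    using integral_reflect[OF Km] mollifierD(5)[OF K] by simp
  have i2: "integrable lborel (\<lambda>y. f y * K (p - y))"
    using mollifier_integrable[OF K f, of p] by simp
  have "conv f K p - t = (\<integral>y. f y * K (p - y) - t * K (p - y) \<partial>lborel)"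
    using i1 i2 one by (simp add: conv_def)
  also have "\<bar>\<dots>\<bar> \<le> (\<integral>y. \<bar>f y * K (p - y) - t * K (p - y)\<bar> \<partial>lborel)"
    by (rule integral_abs_bound)
  also have "\<dots> \<le> (\<integral>y. \<omega> * K (p - y) \<partial>lborel)"
  proof (rule integral_mono)
    show "integrable lborel (\<lambda>y. \<bar>f y * K (p - y) - t * K (p - y)\<bar>)"
      using i1 i2 by (intro integrable_abs Bochner_Integration.integrable_diff integrable_mult_right)
    show "integrable lborel (\<lambda>y. \<omega> * K (p - y))" using i1 by simp
    fix y
    show "\<bar>f y * K (p - y) - t * K (p - y)\<bar> \<le> \<omega> * K (p - y)"
    proof (cases "norm (p - y) < e")
      case True
      have "\<bar>f y * K (p - y) - t * K (p - y)\<bar> = \<bar>f y - t\<bar> * K (p - y)"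
        using mollifierD(2)[OF K, of "p - y"] by (simp add: abs_mult flip: left_diff_distrib)
      also have "\<dots> \<le> \<omega> * K (p - y)"
        by (rule mult_right_mono[OF near[OF True] mollifierD(2)[OF K]])
      finally show ?thesis .
    next
      case False
      then show ?thesis using mollifierD(3)[OF K, of "p - y"] by simp
    qed
  qed
  also have "\<dots> = \<omega>" using one by simp
  finally show ?thesis .
qed

text \<open>Contractivity in L1 reduces the claim to a continuous \<open>f\<close> of compact
  support, where uniform continuity applies. The threshold is uniform over all kernels and dilation
  factors, because later a single kernel has to serve several functions at once.\<close>

lemma mollify_L1:
  fixes g :: "'a::euclidean_space \<Rightarrow> real"
  assumes g: "integrable lborel g" and "\<delta> > 0"
  obtains \<tau> where "\<tau> > 0"
    "\<And>e K c. mollifier e K \<Longrightarrow> e \<le> \<tau> \<Longrightarrow> (\<And>j. j \<in> Basis \<Longrightarrow> 1 \<le> c j \<and> c j \<le> 1 + \<tau>) \<Longrightarrow>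
      (\<integral>\<^sup>+x. ennreal \<bar>conv g K (diag c x) - g x\<bar> \<partial>lborel) \<le> ennreal \<delta>"
proof -
  obtain f R where f: "continuous_on UNIV f" "R > 0" "\<And>x. x \<notin> cball 0 R \<Longrightarrow> f x = 0"
    "(\<integral>\<^sup>+x. ennreal \<bar>g x - f x\<bar> \<partial>lborel) < ennreal (\<delta> / 3)"
    using integrable_approx_continuous[OF g, of "\<delta> / 3"] \<open>\<delta> > 0\<close> by auto
  have fi: "integrable lborel f"
    by (rule compact_support_integrable[OF f(1) compact_cball f(3)])
  have [measurable]: "f \<in> borel_measurable borel" using f(1) by (rule borel_measurable_continuous_onI)
  have [measurable]: "g \<in> borel_measurable borel" using g borel_measurable_integrable by fastforce
  define V where "V = measure lborel (cball (0::'a) (R + 1))"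
  have V: "V \<ge> 0" by (simp add: V_def)
  define \<omega> where "\<omega> = \<delta> / (3 * (V + 1))"
  have \<omega>: "\<omega> > 0" "\<omega> * V \<le> \<delta> / 3" using \<open>\<delta> > 0\<close> V by (auto simp: \<omega>_def field_simps)
  obtain d where d: "d > 0" "\<And>x y. dist x y < d \<Longrightarrow> dist (f x) (f y) < \<omega>"
    using compact_support_uniformly_continuous[OF f(1) compact_cball f(3) \<omega>(1)] by metis
  \<comment> \<open>On the ball of radius \<open>R + 1\<close> the dilation moves a point by at most
    \<open>\<tau> * (R + 1)\<close>, and the kernel reaches at most \<open>\<tau>\<close> further.
    The sum \<open>\<tau> * (R + 2)\<close> has to stay below the modulus \<open>d\<close>.\<close>
  define \<tau> where "\<tau> = min 1 (d / (R + 3))"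
  have \<tau>: "\<tau> > 0" "\<tau> \<le> 1" "\<tau> * (R + 2) < d"
  proof -
    show "\<tau> > 0" "\<tau> \<le> 1" using d(1) f(2) by (auto simp: \<tau>_def)
    have "\<tau> * (R + 2) \<le> d / (R + 3) * (R + 2)" using f(2) by (intro mult_right_mono) (auto simp: \<tau>_def)
    also have "\<dots> < d" using d(1) f(2) by (simp add: field_simps)
    finally show "\<tau> * (R + 2) < d" .
  qed
  show ?thesis
  proof (rule that[OF \<tau>(1)])
    fix e :: real and K :: "'a \<Rightarrow> real" and c :: "'a \<Rightarrow> real"
    assume K: "mollifier e K" and e: "e \<le> \<tau>" and c: "\<And>j. j \<in> Basis \<Longrightarrow> 1 \<le> c j \<and> c j \<le> 1 + \<tau>"
    have [measurable]: "conv f K \<in> borel_measurable borel" "conv g K \<in> borel_measurable borel"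
      using conv_borel_measurable[OF K] fi g by auto
    have ge: "norm x \<le> norm (diag c x)" for x
    proof (rule norm_le_componentwise)
      fix b :: 'a assume b: "b \<in> Basis"
      have "1 * \<bar>x \<bullet> b\<bar> \<le> \<bar>c b\<bar> * \<bar>x \<bullet> b\<bar>" using c[OF b] by (intro mult_right_mono) auto
      then show "\<bar>x \<bullet> b\<bar> \<le> \<bar>diag c x \<bullet> b\<bar>" using b by (simp add: abs_mult)
    qed
    have cl: "norm (diag c x - x) \<le> \<tau> * norm x" for x
    proof -
      have "norm (diag c x - x) \<le> norm (\<tau> *\<^sub>R x)"
      proof (rule norm_le_componentwise)
        fix b :: 'a assume b: "b \<in> Basis"
        have "(diag c x - x) \<bullet> b = (c b - 1) * (x \<bullet> b)" using b by (simp add: inner_diff_left algebra_simps)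
        moreover have "\<bar>c b - 1\<bar> \<le> \<bar>\<tau>\<bar>" using c[OF b] by auto
        ultimately show "\<bar>(diag c x - x) \<bullet> b\<bar> \<le> \<bar>\<tau> *\<^sub>R x \<bullet> b\<bar>"
          by (simp add: abs_mult mult_right_mono)
      qed
      then show ?thesis using \<tau>(1) by simp
    qed
    have F: "\<bar>conv f K (diag c x) - f x\<bar> \<le> \<omega> * indicator (cball 0 (R + 1)) x" for x
    proof (cases "x \<in> cball 0 (R + 1)")
      case True
      have "\<bar>conv f K (diag c x) - f x\<bar> \<le> \<omega>"
      proof (rule conv_mollifier_near[OF K fi])
        fix y assume y: "norm (diag c x - y) < e"
        have "norm (x - y) \<le> norm (diag c x - x) + norm (diag c x - y)"
          using norm_triangle_ineq4[of "diag c x - y" "diag c x - x"] by simp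
        also have "\<dots> < \<tau> * (R + 1) + \<tau>"
        proof (rule add_le_less_mono)
          have "\<tau> * norm x \<le> \<tau> * (R + 1)" using True \<tau>(1) by (intro mult_left_mono) auto
          then show "norm (diag c x - x) \<le> \<tau> * (R + 1)" using cl[of x] by linarith
          show "norm (diag c x - y) < \<tau>" using y e by linarith
        qed
        also have "\<dots> < d" using \<tau>(3) by (simp add: algebra_simps)
        finally have "dist x y < d" by (simp add: dist_norm)
        from d(2)[OF this] show "\<bar>f y - f x\<bar> \<le> \<omega>" by (simp add: dist_real_def)
      qed
      then show ?thesis using True by simp
    next
      case False
      have "\<bar>conv f K (diag c x) - 0\<bar> \<le> 0"
      proof (rule conv_mollifier_near[OF K fi])
        fix y assume y: "norm (diag c x - y) < e"
        have "norm (diag c x) \<le> norm y + norm (diag c x - y)" by (rule norm_triangle_sub)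
        then have "norm y > R" using y e \<tau>(2) ge[of x] False by auto
        then show "\<bar>f y - 0\<bar> \<le> 0" using f(3)[of y] by simp
      qed
      moreover have "f x = 0" using False f(3)[of x] by auto
      ultimately show ?thesis using False by simp
    qed
    have 1: "(\<integral>\<^sup>+x. ennreal \<bar>conv g K (diag c x) - conv f K (diag c x)\<bar> \<partial>lborel) \<le> ennreal (\<delta> / 3)"
    proof -
      have "(\<integral>\<^sup>+x. ennreal \<bar>conv (\<lambda>y. g y - f y) K (diag c x)\<bar> \<partial>lborel) \<le> (\<integral>\<^sup>+x. ennreal \<bar>g x - f x\<bar> \<partial>lborel)"
        by (rule nn_integral_conv_diag_le[OF K]) (use g fi c in auto)
      then show ?thesis using f(4) by (simp add: conv_diff[OF K g fi])
    qed
    have 2: "(\<integral>\<^sup>+x. ennreal \<bar>conv f K (diag c x) - f x\<bar> \<partial>lborel) \<le> ennreal (\<delta> / 3)"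
    proof -
      have "(\<integral>\<^sup>+x. ennreal \<bar>conv f K (diag c x) - f x\<bar> \<partial>lborel)
          \<le> (\<integral>\<^sup>+x. ennreal \<omega> * indicator (cball (0::'a) (R + 1)) x \<partial>lborel)"
      proof (rule nn_integral_mono)
        fix x :: 'a
        show "ennreal \<bar>conv f K (diag c x) - f x\<bar> \<le> ennreal \<omega> * indicator (cball 0 (R + 1)) x"
          using F[of x] by (cases "x \<in> cball 0 (R + 1)") (auto intro: ennreal_leI)
      qed
      also have "\<dots> = ennreal \<omega> * emeasure lborel (cball (0::'a) (R + 1))"
        by (rule nn_integral_cmult_indicator) simp
      also have "\<dots> = ennreal (\<omega> * V)"
        using \<omega>(1) V emeasure_lborel_cball_finite[of "0::'a" "R + 1"]
        by (simp add: V_def ennreal_mult emeasure_eq_ennreal_measure)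
      also have "\<dots> \<le> ennreal (\<delta> / 3)" using \<omega>(2) by (rule ennreal_leI)
      finally show ?thesis .
    qed
    have 3: "(\<integral>\<^sup>+x. ennreal \<bar>f x - g x\<bar> \<partial>lborel) \<le> ennreal (\<delta> / 3)"
      using f(4) by (simp add: abs_minus_commute)
    have "(\<integral>\<^sup>+x. ennreal \<bar>conv g K (diag c x) - g x\<bar> \<partial>lborel) \<le>
        (\<integral>\<^sup>+x. ennreal \<bar>conv g K (diag c x) - conv f K (diag c x)\<bar> +
          (ennreal \<bar>conv f K (diag c x) - f x\<bar> + ennreal \<bar>f x - g x\<bar>) \<partial>lborel)"
      by (intro nn_integral_mono) (simp flip: ennreal_plus)
    also have "\<dots> = (\<integral>\<^sup>+x. ennreal \<bar>conv g K (diag c x) - conv f K (diag c x)\<bar> \<partial>lborel) +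
          ((\<integral>\<^sup>+x. ennreal \<bar>conv f K (diag c x) - f x\<bar> \<partial>lborel) + (\<integral>\<^sup>+x. ennreal \<bar>f x - g x\<bar> \<partial>lborel))"
      by (simp add: nn_integral_add)
    also have "\<dots> \<le> ennreal (\<delta> / 3) + (ennreal (\<delta> / 3) + ennreal (\<delta> / 3))"
      by (intro add_mono 1 2 3)
    also have "\<dots> = ennreal \<delta>" using \<open>\<delta> > 0\<close> by (simp flip: ennreal_plus)
    finally show "(\<integral>\<^sup>+x. ennreal \<bar>conv g K (diag c x) - g x\<bar> \<partial>lborel) \<le> ennreal \<delta>" .
  qed
qed

lemma mollifier_translate_test_function:
  assumes K: "mollifier e K" and U: "cball x e \<subseteq> U"
  shows "(\<lambda>y. K (x - y)) \<in> test_functions U"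
proof (rule test_functionsI[OF _ compact_cball U])
  fix k
  have "Ck k (\<lambda>y. 1 * K (x + diag (\<lambda>_. -1) y))"
    by (rule Ck_diag_compose[OF mollifierD(1)[OF K]])
  moreover have "diag (\<lambda>_. -1) y = - y" for y :: 'a
    by (rule euclidean_eqI) simp
  ultimately show "Ck k (\<lambda>y. K (x - y))" by simp
qed (use mollifierD(3)[OF K] in \<open>simp add: dist_norm\<close>)

text \<open>The fundamental lemma of the calculus of variations. Mollifying \<open>g\<close> at a
  point of \<open>U\<close> means integrating it against a translated kernel, which is a test
  function of \<open>U\<close> once its radius is small. So the mollifications eventually vanish
  there, while they converge to \<open>g\<close> almost everywhere.\<close>

lemma AE_eq_0_of_test_functions:
  fixes g :: "'a::euclidean_space \<Rightarrow> real"
  assumes g: "integrable lborel g" and U: "open U"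
    and 0: "\<And>\<theta>. \<theta> \<in> test_functions U \<Longrightarrow> (\<integral>y. g y * \<theta> y \<partial>lborel) = 0"
  shows "AE x in lborel. x \<in> U \<longrightarrow> g x = 0"
proof -
  have ex: "\<exists>K :: 'a \<Rightarrow> real. mollifier (min \<tau> (inverse (real (Suc n)))) K" if "\<tau> > 0" for \<tau> n
    by (rule mollifier_exists) (use that in auto)
  have "\<exists>e K. mollifier e K \<and> e \<le> inverse (real (Suc n)) \<and>
      (\<integral>\<^sup>+x. ennreal \<bar>conv g K x - g x\<bar> \<partial>lborel) \<le> ennreal ((1 / 2) ^ n)" for n
  proof -
    obtain \<tau> where \<tau>: "\<tau> > 0" "\<And>e K c. mollifier e K \<Longrightarrow> e \<le> \<tau> \<Longrightarrow> (\<And>j. j \<in> Basis \<Longrightarrow> 1 \<le> c j \<and> c j \<le> 1 + \<tau>) \<Longrightarrow>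
        (\<integral>\<^sup>+x. ennreal \<bar>conv g K (diag c x) - g x\<bar> \<partial>lborel) \<le> ennreal ((1 / 2) ^ n)"
      by (rule mollify_L1[OF g, of "(1 / 2) ^ n"]) auto
    obtain K :: "'a \<Rightarrow> real" where K: "mollifier (min \<tau> (inverse (real (Suc n)))) K" using ex[OF \<tau>(1)] by metis
    have "diag (\<lambda>_. 1) x = x" for x :: 'a by (rule euclidean_eqI) simp
    then show ?thesis using K \<tau>(2)[OF K, of "\<lambda>_. 1"] \<tau>(1) by (intro exI[of _ "min \<tau> (inverse (real (Suc n)))"] exI[of _ K]) simp
  qed
  then obtain e K where K: "\<And>n. mollifier (e n) (K n)" and e: "\<And>n. e n \<le> inverse (real (Suc n))"
      and le: "\<And>n. (\<integral>\<^sup>+x. ennreal \<bar>conv g (K n) x - g x\<bar> \<partial>lborel) \<le> ennreal ((1 / 2) ^ n)"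
    by metis
  have [measurable]: "g \<in> borel_measurable borel" using g borel_measurable_integrable by fastforce
  have [measurable]: "conv g (K n) \<in> borel_measurable borel" for n
    by (rule conv_borel_measurable[OF K g])
  have "AE x in lborel. (\<lambda>n. ennreal \<bar>conv g (K n) x - g x\<bar>) \<longlonglongrightarrow> 0"
    by (rule AE_tendsto_0_of_nn_integral_geometric[OF _ le]) measurable
  then show ?thesis
  proof eventually_elim
    case (elim x)
    show ?case
    proof
      assume "x \<in> U"
      then obtain r where r: "r > 0" "cball x r \<subseteq> U" using U by (auto simp: open_contains_cball)
      obtain N where N: "N \<noteq> 0" "inverse (real N) < r" using real_arch_inverse[of r] r(1) by auto
      have "conv g (K n) x = 0" if "n \<ge> N" for n
      proof -
        have "inverse (real (Suc n)) \<le> inverse (real N)" using that N(1) by (intro le_imp_inverse_le) auto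
        then have "e n \<le> r" using e[of n] N(2) by linarith
        then have "cball x (e n) \<subseteq> U" using r(2) by (meson order_trans subset_cball)
        from 0[OF mollifier_translate_test_function[OF K this]] show ?thesis by (simp add: conv_def)
      qed
      then have "\<forall>\<^sub>F n in sequentially. ennreal \<bar>conv g (K n) x - g x\<bar> = ennreal \<bar>g x\<bar>"
        by (intro eventually_sequentiallyI[of N]) simp
      then have "(\<lambda>n. ennreal \<bar>conv g (K n) x - g x\<bar>) \<longlonglongrightarrow> ennreal \<bar>g x\<bar>"
        by (rule tendsto_eventually)
      from LIMSEQ_unique[OF this elim] show "g x = 0" by simp
    qed
  qed
qed

section \<open>Strong limits of compactly supported functions\<close>

text \<open>
  The pair \<open>(u, G)\<close> is a limit of pairs \<open>(f, \<nabla>f)\<close> in \<open>L\<^sup>1\<close>, where \<open>f\<close> is \<open>C\<^sup>1\<close> with compact support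
  in \<open>S\<close> and has values in \<open>A\<close>; the set \<open>A\<close> carries pointwise bounds through the limit.
\<close>

definition sob :: "'a::euclidean_space set \<Rightarrow> real set \<Rightarrow> ('a \<Rightarrow> real) \<Rightarrow> ('a \<Rightarrow> 'a) \<Rightarrow> bool" where
  "sob S A u G \<longleftrightarrow> u \<in> borel_measurable borel \<and> G \<in> borel_measurable borel \<and>
     (\<forall>x. x \<notin> S \<longrightarrow> u x = 0 \<and> G x = 0) \<and>
     (\<forall>\<epsilon>>0. \<exists>f g. C1c S f g \<and> range f \<subseteq> A \<and>
        (\<integral>\<^sup>+x. ennreal (norm (u x - f x)) \<partial>lborel) \<le> ennreal \<epsilon> \<and>
        (\<integral>\<^sup>+x. ennreal (norm (G x - g x)) \<partial>lborel) \<le> ennreal \<epsilon>)"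

lemma sob_mono:
  assumes "sob S A u G" "A \<subseteq> B"
  shows "sob S B u G"
  using assms unfolding sob_def by (meson order_trans)

lemma sob_measurable:
  assumes "sob S A u G"
  shows "u \<in> borel_measurable borel" "G \<in> borel_measurable borel"
  using assms by (simp_all add: sob_def)

lemma sob_approx:
  assumes "sob S A u G" "\<epsilon> > 0"
  obtains f g where "C1c S f g" "range f \<subseteq> A"
    "(\<integral>\<^sup>+x. ennreal (norm (u x - f x)) \<partial>lborel) \<le> ennreal \<epsilon>"
    "(\<integral>\<^sup>+x. ennreal (norm (G x - g x)) \<partial>lborel) \<le> ennreal \<epsilon>"
proof -
  have "\<exists>f g. C1c S f g \<and> range f \<subseteq> A \<and> (\<integral>\<^sup>+x. ennreal (norm (u x - f x)) \<partial>lborel) \<le> ennreal \<epsilon> \<and>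
      (\<integral>\<^sup>+x. ennreal (norm (G x - g x)) \<partial>lborel) \<le> ennreal \<epsilon>"
    using assms unfolding sob_def by blast
  then show ?thesis by (elim exE conjE) (rule that)
qed

lemma integrable_of_L1_close:
  fixes u f :: "'a::euclidean_space \<Rightarrow> 'b::euclidean_space"
  assumes "u \<in> borel_measurable borel" "integrable lborel f"
    and le: "(\<integral>\<^sup>+x. ennreal (norm (u x - f x)) \<partial>lborel) \<le> ennreal \<epsilon>"
  shows "integrable lborel (\<lambda>x. u x - f x)" "integrable lborel u"
proof -
  have f: "f \<in> borel_measurable borel" using assms(2) borel_measurable_integrable by fastforce
  show i: "integrable lborel (\<lambda>x. u x - f x)"
  proof (rule integrableI_bounded)
    show "(\<lambda>x. u x - f x) \<in> borel_measurable lborel" using assms(1) f by simp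
    show "(\<integral>\<^sup>+x. ennreal (norm (u x - f x)) \<partial>lborel) < \<infinity>"
      using le by (rule order_le_less_trans) simp
  qed
  have "integrable lborel (\<lambda>x. (u x - f x) + f x)"
    by (rule Bochner_Integration.integrable_add[OF i assms(2)])
  then show "integrable lborel u" by simp
qed

lemma sob_integrable:
  assumes "sob S A u G"
  shows "integrable lborel u" "integrable lborel G"
proof -
  obtain f g where fg: "C1c S f g" and "range f \<subseteq> A"
      and fg': "(\<integral>\<^sup>+x. ennreal (norm (u x - f x)) \<partial>lborel) \<le> ennreal 1"
      "(\<integral>\<^sup>+x. ennreal (norm (G x - g x)) \<partial>lborel) \<le> ennreal 1"
    by (rule sob_approx[OF assms zero_less_one])
  show "integrable lborel u"
    by (rule integrable_of_L1_close(2)[OF sob_measurable(1)[OF assms] C1c_integrable(1)[OF fg] fg'(1)])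
  show "integrable lborel G"
    by (rule integrable_of_L1_close(2)[OF sob_measurable(2)[OF assms] C1c_integrable(2)[OF fg] fg'(2)])
qed

lemma integral_le_of_L1_close:
  fixes w :: "'a::euclidean_space \<Rightarrow> 'b::euclidean_space"
  assumes "integrable lborel w" "(\<integral>\<^sup>+x. ennreal (norm (w x)) \<partial>lborel) \<le> ennreal \<epsilon>" "\<epsilon> \<ge> 0"
    and q: "q \<in> borel_measurable borel" and le: "\<And>x. \<bar>q x\<bar> \<le> B * norm (w x)" and "B \<ge> 0"
  shows "integrable lborel q" "\<bar>\<integral>x. q x \<partial>lborel\<bar> \<le> B * \<epsilon>"
proof -
  have i: "integrable lborel (\<lambda>x. B * norm (w x))" using assms(1) by simp
  show iq: "integrable lborel q"
    by (rule Bochner_Integration.integrable_bound[OF i]) (use q le \<open>B \<ge> 0\<close> in \<open>auto simp: abs_mult\<close>)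
  have "ennreal (\<integral>x. norm (w x) \<partial>lborel) \<le> ennreal \<epsilon>"
    using assms(1,2) by (subst nn_integral_eq_integral[symmetric]) auto
  then have n: "(\<integral>x. norm (w x) \<partial>lborel) \<le> \<epsilon>" using \<open>\<epsilon> \<ge> 0\<close> by simp
  have "\<bar>\<integral>x. q x \<partial>lborel\<bar> \<le> (\<integral>x. \<bar>q x\<bar> \<partial>lborel)" by (rule integral_abs_bound)
  also have "\<dots> \<le> (\<integral>x. B * norm (w x) \<partial>lborel)"
    by (rule integral_mono[OF integrable_abs[OF iq] i le])
  also have "\<dots> \<le> B * \<epsilon>" using n \<open>B \<ge> 0\<close> by (simp add: mult_left_mono)
  finally show "\<bar>\<integral>x. q x \<partial>lborel\<bar> \<le> B * \<epsilon>" .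
qed

text \<open>Integration by parts for the approximants passes to the limit, since the test function
  and its gradient are bounded. The test function may live on the whole space because the
  approximants have compact support in \<open>S\<close>; this admits kernels that cross the boundary
  of \<open>S\<close>.\<close>

lemma sob_weak:
  assumes s: "sob S A u G" and \<theta>: "\<theta> \<in> test_functions UNIV" and b: "b \<in> Basis"
  shows "(\<integral>x. u x * (gradient \<theta> x \<bullet> b) \<partial>lborel) = - (\<integral>x. (G x \<bullet> b) * \<theta> x \<partial>lborel)"
proof -
  note C = test_functions_C1c[OF \<theta>]
  obtain B where B: "B > 0" "\<And>x. \<bar>\<theta> x\<bar> \<le> B" "\<And>x. norm (gradient \<theta> x) \<le> B"
    using C1c_bounded[OF C] by metis
  have gb: "\<bar>gradient \<theta> x \<bullet> b\<bar> \<le> B" for x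
    using Basis_le_norm[OF b, of "gradient \<theta> x"] B(3)[of x] by linarith
  have [measurable]: "\<theta> \<in> borel_measurable borel" "gradient \<theta> \<in> borel_measurable borel"
    "u \<in> borel_measurable borel" "G \<in> borel_measurable borel"
    using C1cD(6,7)[OF C] sob_measurable[OF s] by auto
  define D where "D = (\<integral>x. u x * (gradient \<theta> x \<bullet> b) \<partial>lborel) + (\<integral>x. (G x \<bullet> b) * \<theta> x \<partial>lborel)"
  have "\<bar>D\<bar> \<le> 0 + \<epsilon>" if "\<epsilon> > 0" for \<epsilon>
  proof -
    define \<delta> where "\<delta> = \<epsilon> / (2 * B)"
    have \<delta>: "\<delta> > 0" using that B(1) by (simp add: \<delta>_def)
    obtain f g where fg: "C1c S f g" and "range f \<subseteq> A" and 1: "(\<integral>\<^sup>+x. ennreal (norm (u x - f x)) \<partial>lborel) \<le> ennreal \<delta>"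
        and 2: "(\<integral>\<^sup>+x. ennreal (norm (G x - g x)) \<partial>lborel) \<le> ennreal \<delta>"
      by (rule sob_approx[OF s \<delta>])
    have [measurable]: "f \<in> borel_measurable borel" "g \<in> borel_measurable borel" using C1cD(6,7)[OF fg] by auto
    note I = integrable_of_L1_close[OF _ C1c_integrable(1)[OF fg] 1] integrable_of_L1_close[OF _ C1c_integrable(2)[OF fg] 2]
    have le1: "\<bar>(u x - f x) * (gradient \<theta> x \<bullet> b)\<bar> \<le> B * norm (u x - f x)" for x
      using mult_left_mono[OF gb[of x], of "\<bar>u x - f x\<bar>"] by (simp add: abs_mult mult.commute)
    have le2: "\<bar>((G x - g x) \<bullet> b) * \<theta> x\<bar> \<le> B * norm (G x - g x)" for x
      using mult_mono[OF Basis_le_norm[OF b, of "G x - g x"] B(2)[of x]] by (simp add: abs_mult mult.commute)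
    have J1: "integrable lborel (\<lambda>x. (u x - f x) * (gradient \<theta> x \<bullet> b))"
      "\<bar>\<integral>x. (u x - f x) * (gradient \<theta> x \<bullet> b) \<partial>lborel\<bar> \<le> B * \<delta>"
      by (rule integral_le_of_L1_close[OF I(1) 1 _ _ le1]; use \<delta> B(1) in simp)+
    have J2: "integrable lborel (\<lambda>x. ((G x - g x) \<bullet> b) * \<theta> x)"
      "\<bar>\<integral>x. ((G x - g x) \<bullet> b) * \<theta> x \<partial>lborel\<bar> \<le> B * \<delta>"
      by (rule integral_le_of_L1_close[OF I(3) 2 _ _ le2]; use \<delta> B(1) in simp)+
    have F1: "integrable lborel (\<lambda>x. f x * (gradient \<theta> x \<bullet> b))"
      using integrable_bounded_scaleR[OF C1c_integrable(1)[OF fg], of "\<lambda>x. gradient \<theta> x \<bullet> b" B] gb by simp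
    have F2: "integrable lborel (\<lambda>x. (g x \<bullet> b) * \<theta> x)"
      using integrable_bounded_scaleR[of "\<lambda>x. g x \<bullet> b" \<theta> B] C1c_integrable(2)[OF fg] B(2) by simp
    have "(\<integral>x. u x * (gradient \<theta> x \<bullet> b) \<partial>lborel) =
        (\<integral>x. (u x - f x) * (gradient \<theta> x \<bullet> b) \<partial>lborel) + (\<integral>x. f x * (gradient \<theta> x \<bullet> b) \<partial>lborel)"
      using J1(1) F1 by (simp flip: Bochner_Integration.integral_add add: left_diff_distrib)
    moreover have "(\<integral>x. (G x \<bullet> b) * \<theta> x \<partial>lborel) =
        (\<integral>x. ((G x - g x) \<bullet> b) * \<theta> x \<partial>lborel) + (\<integral>x. (g x \<bullet> b) * \<theta> x \<partial>lborel)"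
      using J2(1) F2 by (simp flip: Bochner_Integration.integral_add add: inner_diff_left left_diff_distrib)
    moreover have "(\<integral>x. f x * (gradient \<theta> x \<bullet> b) \<partial>lborel) = - (\<integral>x. (g x \<bullet> b) * \<theta> x \<partial>lborel)"
      by (rule C1c_integration_by_parts[OF fg C1cD(1)[OF C] C1cD(2)[OF C]])
    ultimately have "\<bar>D\<bar> \<le> B * \<delta> + B * \<delta>" using J1(2) J2(2) unfolding D_def by linarith
    also have "\<dots> = \<epsilon>" using B(1) by (simp add: \<delta>_def)
    finally show ?thesis by simp
  qed
  then have "\<bar>D\<bar> \<le> 0" by (rule field_le_epsilon)
  then show ?thesis by (simp add: D_def)
qed

text \<open>A reflected and translated kernel is a test function, so the derivative can be moved
  from the kernel to \<open>u\<close>; the sign from the reflection cancels the one from integration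
  by parts.\<close>

lemma conv_gradient_mollifier:
  assumes s: "sob S A u G" and K: "mollifier e K" and b: "b \<in> Basis"
  shows "conv u (gradient K) x \<bullet> b = conv (\<lambda>y. G y \<bullet> b) K x"
proof -
  note KC = test_functions_C1c[OF mollifierD(6)[OF K]]
  have \<theta>: "(\<lambda>y. K (x - y)) \<in> test_functions UNIV" by (rule mollifier_translate_test_function[OF K]) simp
  have g: "gradient (\<lambda>y. K (x - y)) y = - gradient K (x - y)" for y
  proof (rule gradient_eqI)
    have "((\<lambda>y. x - y) has_derivative (\<lambda>h. - h)) (at y)" by (auto intro!: derivative_eq_intros)
    then have "((\<lambda>y. K (x - y)) has_derivative (\<lambda>h. gradient K (x - y) \<bullet> - h)) (at y)"
      using has_derivative_compose[of "\<lambda>y. x - y" "\<lambda>h. - h" y UNIV K "\<lambda>h. gradient K (x - y) \<bullet> h"] C1cD(1)[OF KC] by simp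
    then show "((\<lambda>y. K (x - y)) has_derivative (\<lambda>h. - gradient K (x - y) \<bullet> h)) (at y)" by simp
  qed
  have "conv u (gradient K) x \<bullet> b = conv u (\<lambda>z. gradient K z \<bullet> b) x"
    by (rule conv_inner[OF sob_integrable(1)[OF s] KC])
  also have "\<dots> = - (\<integral>y. u y * (gradient (\<lambda>y. K (x - y)) y \<bullet> b) \<partial>lborel)"
    by (simp add: conv_def g)
  also have "\<dots> = (\<integral>y. (G y \<bullet> b) * K (x - y) \<partial>lborel)" by (simp add: sob_weak[OF s \<theta> b])
  finally show ?thesis by (simp add: conv_def)
qed

lemma sob_sequence:
  assumes s: "sob S A u G"
  shows "\<exists>f g. (\<forall>n. C1c S (f n) (g n) \<and> range (f n) \<subseteq> A \<and>
      (\<integral>\<^sup>+x. ennreal (norm (u x - f n x)) \<partial>lborel) \<le> ennreal ((1 / 2) ^ n) \<and>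
      (\<integral>\<^sup>+x. ennreal (norm (G x - g n x)) \<partial>lborel) \<le> ennreal ((1 / 2) ^ n)) \<and>
    (AE x in lborel. (\<lambda>n. f n x) \<longlonglongrightarrow> u x)"
proof -
  define Q where "Q n p \<longleftrightarrow> C1c S (fst p) (snd p) \<and> range (fst p) \<subseteq> A \<and>
      (\<integral>\<^sup>+x. ennreal (norm (u x - fst p x)) \<partial>lborel) \<le> ennreal ((1 / 2) ^ n) \<and>
      (\<integral>\<^sup>+x. ennreal (norm (G x - snd p x)) \<partial>lborel) \<le> ennreal ((1 / 2) ^ n)" for n :: nat and p
  have "\<exists>p. Q n p" for n
  proof (rule sob_approx[OF s, of "(1 / 2) ^ n"])
    fix f g assume "C1c S f g" "range f \<subseteq> A"
      "(\<integral>\<^sup>+x. ennreal (norm (u x - f x)) \<partial>lborel) \<le> ennreal ((1 / 2) ^ n)"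
      "(\<integral>\<^sup>+x. ennreal (norm (G x - g x)) \<partial>lborel) \<le> ennreal ((1 / 2) ^ n)"
    then show "\<exists>p. Q n p" by (intro exI[of _ "(f, g)"]) (simp add: Q_def)
  qed simp
  then obtain P where P: "\<And>n. Q n (P n)" using choice[of Q] by blast
  define f g where "f n = fst (P n)" and "g n = snd (P n)" for n
  have fg: "C1c S (f n) (g n)" "range (f n) \<subseteq> A"
    "(\<integral>\<^sup>+x. ennreal (norm (u x - f n x)) \<partial>lborel) \<le> ennreal ((1 / 2) ^ n)"
    "(\<integral>\<^sup>+x. ennreal (norm (G x - g n x)) \<partial>lborel) \<le> ennreal ((1 / 2) ^ n)" for n
    using P[of n] by (simp_all add: Q_def f_def g_def)
  have [measurable]: "u \<in> borel_measurable borel" "f n \<in> borel_measurable borel" for n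
    using sob_measurable(1)[OF s] C1cD(6)[OF fg(1)] by auto
  have "AE x in lborel. (\<lambda>n. ennreal (norm (u x - f n x))) \<longlonglongrightarrow> 0"
    by (rule AE_tendsto_0_of_nn_integral_geometric[OF _ fg(3)]) measurable
  then have "AE x in lborel. (\<lambda>n. f n x) \<longlonglongrightarrow> u x"
  proof eventually_elim
    case (elim x)
    then have "(\<lambda>n. norm (u x - f n x)) \<longlonglongrightarrow> 0" by (subst (asm) ennreal_tendsto_0_iff) auto
    then have "(\<lambda>n. u x - f n x) \<longlonglongrightarrow> 0" by (rule tendsto_norm_zero_cancel)
    then have "(\<lambda>n. u x - (u x - f n x)) \<longlonglongrightarrow> u x - 0" by (intro tendsto_intros)
    then show ?case by simp
  qed
  with fg show ?thesis by blast
qed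

section \<open>Chain and product rules for strong limits\<close>

lemma C1c_compose:
  assumes C: "C1c S f g" and F: "\<And>t. (F has_real_derivative F' t) (at t)" "continuous_on UNIV F'" "F 0 = 0"
  shows "C1c S (\<lambda>x. F (f x)) (\<lambda>x. F' (f x) *\<^sub>R g x)"
  unfolding C1c_def
proof (intro conjI allI)
  show "((\<lambda>x. F (f x)) has_derivative (\<lambda>h. (F' (f x) *\<^sub>R g x) \<bullet> h)) (at x)" for x
    using has_derivative_compose[of f "\<lambda>h. g x \<bullet> h" x UNIV F "\<lambda>t. F' (f x) * t"] C1cD(1)[OF C] F(1)
    by (simp add: has_field_derivative_def)
  show "continuous_on UNIV (\<lambda>x. F' (f x) *\<^sub>R g x)"
    by (intro continuous_on_scaleR continuous_on_compose2[OF F(2) C1cD(3)[OF C]] C1cD(2)[OF C]) simp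
  obtain K where "compact K" "K \<subseteq> S" "\<And>x. x \<notin> K \<Longrightarrow> f x = 0 \<and> g x = 0"
    using C unfolding C1c_def by blast
  then show "\<exists>K. compact K \<and> K \<subseteq> S \<and> (\<forall>x. x \<notin> K \<longrightarrow> F (f x) = 0 \<and> F' (f x) *\<^sub>R g x = 0)"
    using F(3) by (intro exI[of _ K]) simp
qed

lemma lipschitz_of_derivative_le_1:
  fixes F :: "real \<Rightarrow> real"
  assumes "\<And>t. (F has_real_derivative F' t) (at t)" "\<And>t. \<bar>F' t\<bar> \<le> 1"
  shows "\<bar>F s - F t\<bar> \<le> \<bar>s - t\<bar>"
  using field_differentiable_bound[of UNIV F F' 1 s t] assms by (auto intro: has_field_derivative_at_within)

text \<open>The error splits into \<open>(F' (u x) - F' (f n x)) *\<^sub>R G x\<close>, which tends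
  to zero by dominated convergence, and \<open>F' (f n x) *\<^sub>R (G x - g n x)\<close>, which is
  at most the gradient error. The statement concerns the full sequence, because the filling of
  squares selects its indices by another criterion.\<close>

lemma sob_compose_gradient_tendsto:
  assumes s: "sob S A u G"
    and fg_all: "\<forall>n. C1c S (f n) (g n) \<and> range (f n) \<subseteq> A \<and>
      (\<integral>\<^sup>+x. ennreal (norm (u x - f n x)) \<partial>lborel) \<le> ennreal ((1 / 2) ^ n) \<and>
      (\<integral>\<^sup>+x. ennreal (norm (G x - g n x)) \<partial>lborel) \<le> ennreal ((1 / 2) ^ n)"
    and ae: "AE x in lborel. (\<lambda>n. f n x) \<longlonglongrightarrow> u x"
    and F: "continuous_on UNIV F'" "\<And>t. \<bar>F' t\<bar> \<le> 1"
  shows "(\<lambda>n. \<integral>\<^sup>+x. ennreal (norm (F' (u x) *\<^sub>R G x - F' (f n x) *\<^sub>R g n x)) \<partial>lborel) \<longlonglongrightarrow> 0"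
proof -
  note sob_measurable[OF s, measurable]
  have [measurable]: "F' \<in> borel_measurable borel" by (rule borel_measurable_continuous_onI[OF F(1)])
  have fg: "C1c S (f n) (g n)" "range (f n) \<subseteq> A"
    and e2: "(\<integral>\<^sup>+x. ennreal (norm (G x - g n x)) \<partial>lborel) \<le> ennreal ((1 / 2) ^ n)" for n
    using fg_all by blast+
  have [measurable]: "f n \<in> borel_measurable borel" "g n \<in> borel_measurable borel" for n
    using C1cD(6,7)[OF fg(1)] by auto
  have "(\<lambda>n. \<integral>\<^sup>+x. ennreal (norm (F' (u x) *\<^sub>R G x - F' (f n x) *\<^sub>R G x)) \<partial>lborel) \<longlonglongrightarrow> 0"
  proof (rule nn_integral_dominated_convergence_norm[where w="\<lambda>x. norm (G x)"])
    show "AE x in lborel. norm (F' (f n x) *\<^sub>R G x) \<le> norm (G x)" for n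
      using mult_right_mono[OF F(2) norm_ge_zero] by (intro AE_I2) simp
    show "(\<integral>\<^sup>+x. ennreal (norm (G x)) \<partial>lborel) < \<infinity>"
      using sob_integrable(2)[OF s] by (simp add: integrable_iff_bounded)
    show "AE x in lborel. (\<lambda>n. F' (f n x) *\<^sub>R G x) \<longlonglongrightarrow> F' (u x) *\<^sub>R G x"
      using ae by eventually_elim (intro tendsto_scaleR tendsto_const continuous_on_tendsto_compose[OF F(1)], auto)
  qed measurable
  moreover have "(\<lambda>n. ennreal ((1 / 2) ^ n)) \<longlonglongrightarrow> ennreal 0"
    by (intro tendsto_ennrealI LIMSEQ_power_zero) simp
  ultimately have "(\<lambda>n. (\<integral>\<^sup>+x. ennreal (norm (F' (u x) *\<^sub>R G x - F' (f n x) *\<^sub>R G x)) \<partial>lborel) + ennreal ((1 / 2) ^ n)) \<longlonglongrightarrow> 0 + ennreal 0"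
    by (rule tendsto_add)
  then have lim: "(\<lambda>n. (\<integral>\<^sup>+x. ennreal (norm (F' (u x) *\<^sub>R G x - F' (f n x) *\<^sub>R G x)) \<partial>lborel) + ennreal ((1 / 2) ^ n)) \<longlonglongrightarrow> 0"
    by simp
  have "(\<integral>\<^sup>+x. ennreal (norm (F' (u x) *\<^sub>R G x - F' (f n x) *\<^sub>R g n x)) \<partial>lborel) \<le>
      (\<integral>\<^sup>+x. ennreal (norm (F' (u x) *\<^sub>R G x - F' (f n x) *\<^sub>R G x)) \<partial>lborel) + ennreal ((1 / 2) ^ n)" for n
  proof -
    have "(\<integral>\<^sup>+x. ennreal (norm (F' (u x) *\<^sub>R G x - F' (f n x) *\<^sub>R g n x)) \<partial>lborel) \<le>
       (\<integral>\<^sup>+x. ennreal (norm (F' (u x) *\<^sub>R G x - F' (f n x) *\<^sub>R G x)) + ennreal (norm (G x - g n x)) \<partial>lborel)"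
    proof (rule nn_integral_mono)
      fix x
      have "norm (F' (u x) *\<^sub>R G x - F' (f n x) *\<^sub>R g n x) \<le>
          norm (F' (u x) *\<^sub>R G x - F' (f n x) *\<^sub>R G x) + norm (F' (f n x) *\<^sub>R (G x - g n x))"
        using norm_triangle_ineq[of "F' (u x) *\<^sub>R G x - F' (f n x) *\<^sub>R G x" "F' (f n x) *\<^sub>R (G x - g n x)"]
        by (simp add: scaleR_diff_right)
      also have "norm (F' (f n x) *\<^sub>R (G x - g n x)) \<le> norm (G x - g n x)"
        using mult_right_mono[OF F(2)[of "f n x"] norm_ge_zero[of "G x - g n x"]] by simp
      finally show "ennreal (norm (F' (u x) *\<^sub>R G x - F' (f n x) *\<^sub>R g n x)) \<le>
          ennreal (norm (F' (u x) *\<^sub>R G x - F' (f n x) *\<^sub>R G x)) + ennreal (norm (G x - g n x))"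
        by (simp flip: ennreal_plus)
    qed
    also have "\<dots> = (\<integral>\<^sup>+x. ennreal (norm (F' (u x) *\<^sub>R G x - F' (f n x) *\<^sub>R G x)) \<partial>lborel) + (\<integral>\<^sup>+x. ennreal (norm (G x - g n x)) \<partial>lborel)"
      by (rule nn_integral_add) measurable
    also have "\<dots> \<le> (\<integral>\<^sup>+x. ennreal (norm (F' (u x) *\<^sub>R G x - F' (f n x) *\<^sub>R G x)) \<partial>lborel) + ennreal ((1 / 2) ^ n)"
      by (rule add_left_mono[OF e2])
    finally show ?thesis .
  qed
  then show ?thesis by (intro tendsto_sandwich[OF _ _ tendsto_const lim]) simp_all
qed

text \<open>Tracking the image of \<open>A\<close> under \<open>F\<close> turns a bounded
  \<open>F\<close> into a uniform bound on the approximants; this is how truncation reaches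
  them.\<close>

lemma sob_compose:
  assumes s: "sob S A u G" and F: "\<And>t. (F has_real_derivative F' t) (at t)" "continuous_on UNIV F'"
    "\<And>t. \<bar>F' t\<bar> \<le> 1" "F 0 = 0"
  shows "sob S (F ` A) (\<lambda>x. F (u x)) (\<lambda>x. F' (u x) *\<^sub>R G x)"
proof -
  note um = sob_measurable[OF s]
  note lip = lipschitz_of_derivative_le_1[OF F(1,3)]
  have Fc: "continuous_on UNIV F"
    using F(1) by (meson DERIV_isCont continuous_at_imp_continuous_on)
  have Fm [measurable]: "F \<in> borel_measurable borel" "F' \<in> borel_measurable borel"
    using Fc F(2) by (auto intro: borel_measurable_continuous_onI)
  note um[measurable]
  obtain f g where fg_all: "\<forall>n. C1c S (f n) (g n) \<and> range (f n) \<subseteq> A \<and>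
      (\<integral>\<^sup>+x. ennreal (norm (u x - f n x)) \<partial>lborel) \<le> ennreal ((1 / 2) ^ n) \<and>
      (\<integral>\<^sup>+x. ennreal (norm (G x - g n x)) \<partial>lborel) \<le> ennreal ((1 / 2) ^ n)"
    and ae: "AE x in lborel. (\<lambda>n. f n x) \<longlonglongrightarrow> u x"
    using sob_sequence[OF s] by blast
  have fg: "C1c S (f n) (g n)" "range (f n) \<subseteq> A"
    and e1: "(\<integral>\<^sup>+x. ennreal (norm (u x - f n x)) \<partial>lborel) \<le> ennreal ((1 / 2) ^ n)"
 for n
    using fg_all by blast+
  have [measurable]: "f n \<in> borel_measurable borel" "g n \<in> borel_measurable borel" for n
    using C1cD(6,7)[OF fg(1)] by auto
  note lim2 = sob_compose_gradient_tendsto[OF s fg_all ae F(2,3)]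
  have "(\<lambda>n. ennreal ((1 / 2) ^ n)) \<longlonglongrightarrow> ennreal 0"
    by (intro tendsto_ennrealI LIMSEQ_power_zero) simp
  then have lim1: "(\<lambda>n. ennreal ((1 / 2) ^ n)) \<longlonglongrightarrow> 0" by simp
  show ?thesis
    unfolding sob_def
  proof (intro conjI allI impI)
    show "(\<lambda>x. F (u x)) \<in> borel_measurable borel" "(\<lambda>x. F' (u x) *\<^sub>R G x) \<in> borel_measurable borel"
      by measurable
    show "F (u x) = 0" "F' (u x) *\<^sub>R G x = 0" if "x \<notin> S" for x
      using s that F(4) by (auto simp: sob_def)
    fix \<epsilon> :: real assume "\<epsilon> > 0"
    have "\<forall>\<^sub>F n in sequentially. ennreal ((1 / 2) ^ n) < ennreal \<epsilon> \<and>
        (\<integral>\<^sup>+x. ennreal (norm (F' (u x) *\<^sub>R G x - F' (f n x) *\<^sub>R g n x)) \<partial>lborel) < ennreal \<epsilon>"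
      using order_tendstoD(2)[OF lim1, of "ennreal \<epsilon>"] order_tendstoD(2)[OF lim2, of "ennreal \<epsilon>"] \<open>\<epsilon> > 0\<close>
      by (intro eventually_conj) simp_all
    from eventually_happens'[OF sequentially_bot this]
    obtain n where n: "ennreal ((1 / 2) ^ n) < ennreal \<epsilon>"
        "(\<integral>\<^sup>+x. ennreal (norm (F' (u x) *\<^sub>R G x - F' (f n x) *\<^sub>R g n x)) \<partial>lborel) < ennreal \<epsilon>"
      by (elim exE conjE)
    show "\<exists>v h. C1c S v h \<and> range v \<subseteq> F ` A \<and>
        (\<integral>\<^sup>+x. ennreal (norm (F (u x) - v x)) \<partial>lborel) \<le> ennreal \<epsilon> \<and>
        (\<integral>\<^sup>+x. ennreal (norm (F' (u x) *\<^sub>R G x - h x)) \<partial>lborel) \<le> ennreal \<epsilon>"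
    proof (intro exI conjI)
      show "C1c S (\<lambda>x. F (f n x)) (\<lambda>x. F' (f n x) *\<^sub>R g n x)"
        by (rule C1c_compose[OF fg(1) F(1,2,4)])
      show "range (\<lambda>x. F (f n x)) \<subseteq> F ` A" using fg(2)[of n] by auto
      have "(\<integral>\<^sup>+x. ennreal (norm (F (u x) - F (f n x))) \<partial>lborel) \<le> (\<integral>\<^sup>+x. ennreal (norm (u x - f n x)) \<partial>lborel)"
        using lip by (intro nn_integral_mono ennreal_leI) simp
      also have "\<dots> \<le> ennreal ((1 / 2) ^ n)" by (rule e1)
      finally show "(\<integral>\<^sup>+x. ennreal (norm (F (u x) - F (f n x))) \<partial>lborel) \<le> ennreal \<epsilon>" using n(1) by simp
      show "(\<integral>\<^sup>+x. ennreal (norm (F' (u x) *\<^sub>R G x - F' (f n x) *\<^sub>R g n x)) \<partial>lborel) \<le> ennreal \<epsilon>"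
        using n(2) by simp
    qed
  qed
qed

lemma sob_mult:
  assumes s: "sob S A u G" and \<zeta>: "\<And>x. (\<zeta> has_derivative (\<lambda>h. \<zeta>' x \<bullet> h)) (at x)" "continuous_on UNIV \<zeta>'"
    "\<And>x. \<bar>\<zeta> x\<bar> \<le> 1" "\<And>x. norm (\<zeta>' x) \<le> B"
  shows "sob S UNIV (\<lambda>x. \<zeta> x * u x) (\<lambda>x. \<zeta> x *\<^sub>R G x + u x *\<^sub>R \<zeta>' x)"
  unfolding sob_def
proof (intro conjI allI impI)
  have "continuous_on UNIV \<zeta>"
    by (rule has_derivative_continuous_on[OF has_derivative_at_withinI[OF \<zeta>(1)]])
  then have [measurable]: "\<zeta> \<in> borel_measurable borel" "\<zeta>' \<in> borel_measurable borel"
    using \<zeta>(2) by (auto intro: borel_measurable_continuous_onI)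
  note sob_measurable[OF s, measurable]
  show "(\<lambda>x. \<zeta> x * u x) \<in> borel_measurable borel" "(\<lambda>x. \<zeta> x *\<^sub>R G x + u x *\<^sub>R \<zeta>' x) \<in> borel_measurable borel"
    by measurable
  show "\<zeta> x * u x = 0" "\<zeta> x *\<^sub>R G x + u x *\<^sub>R \<zeta>' x = 0" if "x \<notin> S" for x
    using s that by (auto simp: sob_def)
  have B: "B \<ge> 0" using \<zeta>(4)[of 0] norm_ge_zero[of "\<zeta>' 0"] by linarith
  fix \<epsilon> :: real assume "\<epsilon> > 0"
  define \<delta> where "\<delta> = \<epsilon> / (B + 1)"
  have \<delta>: "\<delta> > 0" "\<delta> + B * \<delta> = \<epsilon>"
  proof -
    show "\<delta> > 0" using \<open>\<epsilon> > 0\<close> B by (simp add: \<delta>_def)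
    have "\<delta> * (B + 1) = \<epsilon>" using B by (simp add: \<delta>_def)
    then show "\<delta> + B * \<delta> = \<epsilon>" by (simp add: algebra_simps)
  qed
  then have \<delta>_le: "\<delta> \<le> \<epsilon>" using mult_nonneg_nonneg[OF B, of \<delta>] by linarith
  obtain f g where fg: "C1c S f g" and "range f \<subseteq> A" and 1: "(\<integral>\<^sup>+x. ennreal (norm (u x - f x)) \<partial>lborel) \<le> ennreal \<delta>"
      and 2: "(\<integral>\<^sup>+x. ennreal (norm (G x - g x)) \<partial>lborel) \<le> ennreal \<delta>"
    by (rule sob_approx[OF s \<delta>(1)])
  have [measurable]: "f \<in> borel_measurable borel" "g \<in> borel_measurable borel" using C1cD(6,7)[OF fg] by auto
  show "\<exists>f g. C1c S f g \<and> range f \<subseteq> UNIV \<and>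
        (\<integral>\<^sup>+x. ennreal (norm (\<zeta> x * u x - f x)) \<partial>lborel) \<le> ennreal \<epsilon> \<and>
        (\<integral>\<^sup>+x. ennreal (norm (\<zeta> x *\<^sub>R G x + u x *\<^sub>R \<zeta>' x - g x)) \<partial>lborel) \<le> ennreal \<epsilon>"
  proof (intro exI conjI)
    show "C1c S (\<lambda>x. \<zeta> x * f x) (\<lambda>x. \<zeta> x *\<^sub>R g x + f x *\<^sub>R \<zeta>' x)"
      using C1c_mult[of S f g \<zeta> \<zeta>'] fg \<zeta> by simp
    have "(\<integral>\<^sup>+x. ennreal (norm (\<zeta> x * u x - \<zeta> x * f x)) \<partial>lborel) \<le> (\<integral>\<^sup>+x. ennreal (norm (u x - f x)) \<partial>lborel)"
    proof (intro nn_integral_mono ennreal_leI)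
      fix x
      show "norm (\<zeta> x * u x - \<zeta> x * f x) \<le> norm (u x - f x)"
        using mult_right_mono[OF \<zeta>(3)[of x] abs_ge_zero[of "u x - f x"]] by (simp flip: right_diff_distrib abs_mult)
    qed
    also have "\<dots> \<le> ennreal \<delta>" by (rule 1)
    also have "\<dots> \<le> ennreal \<epsilon>" by (rule ennreal_leI[OF \<delta>_le])
    finally show "(\<integral>\<^sup>+x. ennreal (norm (\<zeta> x * u x - \<zeta> x * f x)) \<partial>lborel) \<le> ennreal \<epsilon>" .
    have "(\<integral>\<^sup>+x. ennreal (norm (\<zeta> x *\<^sub>R G x + u x *\<^sub>R \<zeta>' x - (\<zeta> x *\<^sub>R g x + f x *\<^sub>R \<zeta>' x))) \<partial>lborel)
      \<le> (\<integral>\<^sup>+x. ennreal (norm (G x - g x)) + ennreal B * ennreal (norm (u x - f x)) \<partial>lborel)"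
    proof (rule nn_integral_mono)
      fix x
      have "norm (\<zeta> x *\<^sub>R G x + u x *\<^sub>R \<zeta>' x - (\<zeta> x *\<^sub>R g x + f x *\<^sub>R \<zeta>' x)) =
          norm (\<zeta> x *\<^sub>R (G x - g x) + (u x - f x) *\<^sub>R \<zeta>' x)"
        by (simp add: algebra_simps)
      also have "\<dots> \<le> \<bar>\<zeta> x\<bar> * norm (G x - g x) + \<bar>u x - f x\<bar> * norm (\<zeta>' x)"
        using norm_triangle_ineq[of "\<zeta> x *\<^sub>R (G x - g x)" "(u x - f x) *\<^sub>R \<zeta>' x"] by simp
      also have "\<dots> \<le> 1 * norm (G x - g x) + \<bar>u x - f x\<bar> * B"
        by (intro add_mono mult_right_mono mult_left_mono \<zeta>) auto
      finally show "ennreal (norm (\<zeta> x *\<^sub>R G x + u x *\<^sub>R \<zeta>' x - (\<zeta> x *\<^sub>R g x + f x *\<^sub>R \<zeta>' x)))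
          \<le> ennreal (norm (G x - g x)) + ennreal B * ennreal (norm (u x - f x))"
        using B by (simp add: mult.commute flip: ennreal_plus ennreal_mult)
    qed
    also have "\<dots> = (\<integral>\<^sup>+x. ennreal (norm (G x - g x)) \<partial>lborel) + ennreal B * (\<integral>\<^sup>+x. ennreal (norm (u x - f x)) \<partial>lborel)"
      by (simp add: nn_integral_add nn_integral_cmult)
    also have "\<dots> \<le> ennreal \<delta> + ennreal B * ennreal \<delta>" by (intro add_mono mult_left_mono 1 2) simp
    also have "\<dots> = ennreal \<epsilon>" using B \<delta> by (simp flip: ennreal_plus ennreal_mult)
    finally show "(\<integral>\<^sup>+x. ennreal (norm (\<zeta> x *\<^sub>R G x + u x *\<^sub>R \<zeta>' x - (\<zeta> x *\<^sub>R g x + f x *\<^sub>R \<zeta>' x))) \<partial>lborel) \<le> ennreal \<epsilon>" .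
  qed simp
qed

section \<open>Flattening near a value\<close>

text \<open>A \<open>C\<^sup>1\<close> substitute for the positive part, with a derivative between \<open>0\<close> and \<open>1\<close>.\<close>

definition hinge :: "real \<Rightarrow> real \<Rightarrow> real" where
  "hinge a s = (if s \<le> 0 then 0 else s\<^sup>2 / (s + a))"

definition hinge' :: "real \<Rightarrow> real \<Rightarrow> real" where
  "hinge' a s = 1 - a\<^sup>2 / (max 0 s + a)\<^sup>2"

text \<open>An odd \<open>C^1\<close> form of soft thresholding: it vanishes on
  \<open>{-a..a}\<close> and stays within \<open>2 * a\<close> of the identity.\<close>

definition flatten :: "real \<Rightarrow> real \<Rightarrow> real" where
  "flatten a t = hinge a (t - a) - hinge a (- t - a)"

definition flatten' :: "real \<Rightarrow> real \<Rightarrow> real" where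
  "flatten' a t = hinge' a (t - a) + hinge' a (- t - a)"

lemma hinge_derivative:
  assumes a: "a > 0"
  shows "(hinge a has_real_derivative hinge' a s) (at s)"
proof -
  consider "s < 0" | "s > 0" | "s = 0" by linarith
  then show ?thesis
  proof cases
    case 1
    have "((\<lambda>_. 0) has_real_derivative 0) (at s)" by simp
    then have "(hinge a has_real_derivative 0) (at s)"
      by (rule has_field_derivative_transform_within_open[of _ _ _ "{..<0}"]) (use 1 in \<open>auto simp: hinge_def\<close>)
    then show ?thesis using 1 a by (simp add: hinge'_def)
  next
    case 2
    have "((\<lambda>s. s - a + a\<^sup>2 * inverse (s + a)) has_real_derivative 1 - 0 + a\<^sup>2 * (- (inverse (s + a) * (1 + 0) * inverse (s + a)))) (at s)"
      by (intro DERIV_add DERIV_diff DERIV_cmult DERIV_inverse' DERIV_ident DERIV_const) (use 2 a in simp)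
    moreover have "1 - 0 + a\<^sup>2 * (- (inverse (s + a) * (1 + 0) * inverse (s + a))) = hinge' a s"
      using 2 a by (simp add: hinge'_def power2_eq_square divide_inverse)
    ultimately have "((\<lambda>s. s - a + a\<^sup>2 * inverse (s + a)) has_real_derivative hinge' a s) (at s)" by simp
    then show ?thesis
      by (rule has_field_derivative_transform_within_open[of _ _ _ "{0<..}"])
        (use 2 a in \<open>auto simp: hinge_def field_simps power2_eq_square\<close>)
  next
    case 3
    have "((\<lambda>h. hinge a h / h) \<longlongrightarrow> 0) (at 0)"
    proof (rule Lim_null_comparison)
      have "norm (hinge a h / h) \<le> \<bar>h\<bar> / a" for h
      proof (cases "h \<le> 0")
        case False
        then have "hinge a h / h = h / (h + a)" using a by (simp add: hinge_def power2_eq_square)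
        moreover have "h / (h + a) \<le> h / a" using False a by (intro divide_left_mono) auto
        ultimately show ?thesis using False a by simp
      qed (use a in \<open>simp add: hinge_def divide_nonpos_pos\<close>)
      then show "\<forall>\<^sub>F h in at 0. norm (hinge a h / h) \<le> \<bar>h\<bar> / a" by simp
      show "((\<lambda>h. \<bar>h\<bar> / a) \<longlongrightarrow> 0) (at 0)"
        by (rule tendsto_eq_intros refl | use a in simp)+
    qed
    then show ?thesis using 3 a by (simp add: DERIV_def hinge_def[of a 0] hinge'_def)
  qed
qed

lemma flatten_derivative: "a > 0 \<Longrightarrow> (flatten a has_real_derivative flatten' a t) (at t)"
proof -
  assume a: "a > 0"
  have 1: "((\<lambda>t. hinge a (t - a)) has_real_derivative hinge' a (t - a) * 1) (at t)"
    by (rule DERIV_chain2[OF hinge_derivative[OF a]])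
      (use DERIV_diff[OF DERIV_ident DERIV_const[of a]] in simp)
  have 2: "((\<lambda>t. hinge a (- t - a)) has_real_derivative hinge' a (- t - a) * - 1) (at t)"
    by (rule DERIV_chain2[OF hinge_derivative[OF a]])
      (use DERIV_diff[OF DERIV_minus[OF DERIV_ident] DERIV_const[of a]] in simp)
  show ?thesis
    using DERIV_diff[OF 1 2] by (simp add: flatten_def[abs_def] flatten'_def)
qed

lemma flatten'_continuous: "a > 0 \<Longrightarrow> continuous_on UNIV (flatten' a)"
proof -
  assume a: "a > 0"
  have *: "max 0 s + a \<noteq> 0" for s using a by (auto simp: max_def)
  show ?thesis unfolding flatten'_def hinge'_def by (intro continuous_intros) (simp_all add: *)
qed

lemma hinge'_bounds: "a > 0 \<Longrightarrow> 0 \<le> hinge' a s \<and> hinge' a s \<le> 1"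
proof -
  assume a: "a > 0"
  have "a\<^sup>2 \<le> (max 0 s + a)\<^sup>2" using a by (intro power_mono) auto
  then show ?thesis using a by (auto simp: hinge'_def divide_le_eq_1)
qed

lemma hinge'_nonpos: "a > 0 \<Longrightarrow> s \<le> 0 \<Longrightarrow> hinge' a s = 0"
  by (simp add: hinge'_def)

lemma flatten'_bounds: "a > 0 \<Longrightarrow> 0 \<le> flatten' a t \<and> flatten' a t \<le> 1"
  using hinge'_bounds[of a "t - a"] hinge'_bounds[of a "- t - a"] hinge'_nonpos[of a "t - a"]
    hinge'_nonpos[of a "- t - a"] by (cases "t \<le> a") (auto simp: flatten'_def)

lemma flatten_eq_0: "\<bar>t\<bar> \<le> a \<Longrightarrow> flatten a t = 0"
  by (auto simp: flatten_def hinge_def)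

lemma flatten'_eq_0: "a > 0 \<Longrightarrow> \<bar>t\<bar> \<le> a \<Longrightarrow> flatten' a t = 0"
  by (auto simp: flatten'_def hinge'_nonpos)

lemma flatten'_eq: "a > 0 \<Longrightarrow> a < \<bar>t\<bar> \<Longrightarrow> flatten' a t = 1 - a\<^sup>2 / t\<^sup>2"
  by (cases "t > 0") (auto simp: flatten'_def hinge'_def max_def)

lemma hinge_near: "a > 0 \<Longrightarrow> s > 0 \<Longrightarrow> \<bar>hinge a s - s\<bar> \<le> a"
proof -
  assume a: "a > 0" and s: "s > 0"
  have "hinge a s - s = - (a * (s / (s + a)))" using a s by (simp add: hinge_def field_simps power2_eq_square)
  then have "\<bar>hinge a s - s\<bar> = a * (s / (s + a))" using a s by (simp only: abs_minus_cancel) simp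
  also have "\<dots> \<le> a * 1" using a s by (intro mult_left_mono) auto
  finally show ?thesis by simp
qed

lemma flatten_near: "a > 0 \<Longrightarrow> \<bar>flatten a t - t\<bar> \<le> 2 * a"
proof -
  assume a: "a > 0"
  consider "\<bar>t\<bar> \<le> a" | "t > a" | "t < - a" by linarith
  then show ?thesis
  proof cases
    case 1
    then show ?thesis using flatten_eq_0[OF 1] a by simp
  next
    case 2
    have "hinge a (- t - a) = 0" using 2 a by (simp add: hinge_def)
    then show ?thesis using hinge_near[OF a, of "t - a"] 2 by (simp add: flatten_def)
  next
    case 3
    have "hinge a (t - a) = 0" using 3 a by (simp add: hinge_def)
    then show ?thesis using hinge_near[OF a, of "- t - a"] 3 by (simp add: flatten_def)
  qed
qed

lemma flatten'_tendsto:
  "(\<lambda>n. flatten' (inverse (real (Suc n))) t) \<longlonglongrightarrow> (if t = 0 then 0 else 1)"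
proof (cases "t = 0")
  case True
  then show ?thesis by (simp add: flatten'_eq_0)
next
  case False
  have lim: "(\<lambda>n. 1 - (inverse (real (Suc n)))\<^sup>2 / t\<^sup>2) \<longlonglongrightarrow> 1 - 0\<^sup>2 / t\<^sup>2"
    by (intro tendsto_intros LIMSEQ_inverse_real_of_nat) (use False in simp)
  have "\<forall>\<^sub>F n in sequentially. inverse (real (Suc n)) < \<bar>t\<bar>"
    by (rule order_tendstoD(2)[OF LIMSEQ_inverse_real_of_nat]) (use False in simp)
  then have "\<forall>\<^sub>F n in sequentially. 1 - (inverse (real (Suc n)))\<^sup>2 / t\<^sup>2 = flatten' (inverse (real (Suc n))) t"
    by eventually_elim (simp add: flatten'_eq del: of_nat_Suc)
  with lim show ?thesis using False by (simp add: Lim_transform_eventually)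
qed

text \<open>Subtracting \<open>flatten a (- c)\<close> normalises the outer function to vanish at 0,
  without which compact support would be lost.\<close>

lemma sob_flatten:
  assumes s: "sob S A u G" and a: "a > 0"
  shows "sob S UNIV (\<lambda>x. flatten a (u x - c) - flatten a (- c)) (\<lambda>x. flatten' a (u x - c) *\<^sub>R G x)"
proof -
  let ?F = "\<lambda>t. flatten a (t - c) - flatten a (- c)"
  have "sob S (?F ` A) (\<lambda>x. ?F (u x)) (\<lambda>x. flatten' a (u x - c) *\<^sub>R G x)"
  proof (rule sob_compose[OF s])
    fix t
    have "((\<lambda>t. flatten a (t - c)) has_real_derivative flatten' a (t - c) * 1) (at t)"
      by (rule DERIV_chain2[OF flatten_derivative[OF a]])
        (use DERIV_diff[OF DERIV_ident DERIV_const[of c]] in simp)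
    from DERIV_diff[OF this DERIV_const[of "flatten a (- c)"]]
    show "(?F has_real_derivative flatten' a (t - c)) (at t)" by simp
    show "\<bar>flatten' a (t - c)\<bar> \<le> 1" using flatten'_bounds[OF a] by simp
    show "continuous_on UNIV (\<lambda>t. flatten' a (t - c))"
      by (rule continuous_on_compose2[OF flatten'_continuous[OF a]])
        (intro continuous_on_diff continuous_on_id continuous_on_const, simp)
  qed simp
  then show ?thesis by (rule sob_mono) simp
qed

text \<open>Flattening around \<open>c\<close> at width \<open>a n\<close> gives functions that
  converge to \<open>u\<close>, while their gradients converge to \<open>G\<close> off the level set
  and are zero on it. Testing both limits shows that \<open>G\<close> and its restriction to the
  complement of the level set are weak gradients of the same function, hence agree almost
  everywhere.\<close>

lemma sob_gradient_eq_0_on_level_set: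
  assumes s: "sob S A u G"
  shows "AE x in lborel. u x = c \<longrightarrow> G x = 0"
proof -
  note sob_measurable[OF s, measurable]
  note ui = sob_integrable[OF s]
  define a where "a n = inverse (real (Suc n))" for n
  have a: "a n > 0" for n by (simp add: a_def)
  define F where "F n t = flatten (a n) (t - c) - flatten (a n) (- c)" for n t
  have Fd: "(F n has_real_derivative flatten' (a n) (t - c)) (at t)" for n t
  proof -
    have "((\<lambda>t. flatten (a n) (t - c)) has_real_derivative flatten' (a n) (t - c) * 1) (at t)"
      by (rule DERIV_chain2[OF flatten_derivative[OF a]])
        (use DERIV_diff[OF DERIV_ident DERIV_const[of c]] in simp)
    from DERIV_diff[OF this DERIV_const[of "flatten (a n) (- c)"]]
    show ?thesis by (simp add: F_def[abs_def])
  qed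
  have F1: "\<bar>flatten' (a n) t\<bar> \<le> 1" for n t using flatten'_bounds[OF a] by simp
  have Fle: "\<bar>F n t\<bar> \<le> \<bar>t\<bar>" for n t
    using lipschitz_of_derivative_le_1[OF Fd F1, of n t 0] by (simp add: F_def)
  have [measurable]: "F n \<in> borel_measurable borel" "flatten' (a n) \<in> borel_measurable borel" for n
  proof -
    have "continuous_on UNIV (F n)" using DERIV_isCont[OF Fd] by (intro continuous_at_imp_continuous_on) simp
    then show "F n \<in> borel_measurable borel" by (rule borel_measurable_continuous_onI)
    show "flatten' (a n) \<in> borel_measurable borel"
      by (rule borel_measurable_continuous_onI[OF flatten'_continuous[OF a]])
  qed
  have Flim: "(\<lambda>n. F n t) \<longlonglongrightarrow> t" for t
  proof -
    have "\<bar>F n t - t\<bar> \<le> 4 * a n" for n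
      using flatten_near[OF a, of n "t - c"] flatten_near[OF a, of n "- c"] by (auto simp: F_def)
    moreover have "(\<lambda>n. 4 * a n) \<longlonglongrightarrow> 4 * 0" unfolding a_def
      by (intro tendsto_intros LIMSEQ_inverse_real_of_nat)
    ultimately have "(\<lambda>n. F n t - t) \<longlonglongrightarrow> 0"
      by (intro Lim_null_comparison[of "\<lambda>n. F n t - t" "\<lambda>n. 4 * a n"]) auto
    then show ?thesis by (simp add: LIM_zero_iff)
  qed
  have "AE x in lborel. x \<in> UNIV \<longrightarrow> (if u x = c then G x \<bullet> b else 0) = 0" if b: "b \<in> Basis" for b
  proof (rule AE_eq_0_of_test_functions)
    have Gb: "integrable lborel (\<lambda>x. G x \<bullet> b)" using ui(2) by simp
    show i0: "integrable lborel (\<lambda>x. if u x = c then G x \<bullet> b else 0)"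
      by (rule Bochner_Integration.integrable_bound[OF Gb]) auto
    fix \<theta> :: "'a \<Rightarrow> real" assume \<theta>: "\<theta> \<in> test_functions UNIV"
    note C = test_functions_C1c[OF \<theta>]
    obtain B where B: "B > 0" "\<And>x. \<bar>\<theta> x\<bar> \<le> B" "\<And>x. norm (gradient \<theta> x) \<le> B"
      using C1c_bounded[OF C] by metis
    have gb: "\<bar>gradient \<theta> x \<bullet> b\<bar> \<le> B" for x
      using Basis_le_norm[OF b, of "gradient \<theta> x"] B(3)[of x] by linarith
    have [measurable]: "\<theta> \<in> borel_measurable borel" "gradient \<theta> \<in> borel_measurable borel"
      using C1cD(6,7)[OF C] by auto
    have eq: "(\<integral>x. F n (u x) * (gradient \<theta> x \<bullet> b) \<partial>lborel) = - (\<integral>x. flatten' (a n) (u x - c) * (G x \<bullet> b) * \<theta> x \<partial>lborel)" for n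
      using sob_weak[OF sob_flatten[OF s a[of n], of c] \<theta> b] by (simp add: F_def)
    have l1: "(\<lambda>n. \<integral>x. F n (u x) * (gradient \<theta> x \<bullet> b) \<partial>lborel) \<longlonglongrightarrow> (\<integral>x. u x * (gradient \<theta> x \<bullet> b) \<partial>lborel)"
    proof (rule integral_dominated_convergence[where w="\<lambda>x. B * \<bar>u x\<bar>"])
      show "integrable lborel (\<lambda>x. B * \<bar>u x\<bar>)" using ui(1) by simp
      show "AE x in lborel. (\<lambda>n. F n (u x) * (gradient \<theta> x \<bullet> b)) \<longlonglongrightarrow> u x * (gradient \<theta> x \<bullet> b)"
        by (intro AE_I2 tendsto_mult Flim tendsto_const)
      show "AE x in lborel. norm (F n (u x) * (gradient \<theta> x \<bullet> b)) \<le> B * \<bar>u x\<bar>" for n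
        using mult_mono[OF Fle gb] by (intro AE_I2) (simp add: abs_mult mult.commute)
    qed measurable
    have l2: "(\<lambda>n. \<integral>x. flatten' (a n) (u x - c) * (G x \<bullet> b) * \<theta> x \<partial>lborel) \<longlonglongrightarrow> (\<integral>x. (if u x - c = 0 then 0 else 1) * (G x \<bullet> b) * \<theta> x \<partial>lborel)"
    proof (rule integral_dominated_convergence[where w="\<lambda>x. B * \<bar>G x \<bullet> b\<bar>"])
      show "integrable lborel (\<lambda>x. B * \<bar>G x \<bullet> b\<bar>)" using Gb by simp
      show "AE x in lborel. (\<lambda>n. flatten' (a n) (u x - c) * (G x \<bullet> b) * \<theta> x) \<longlonglongrightarrow> (if u x - c = 0 then 0 else 1) * (G x \<bullet> b) * \<theta> x"
        unfolding a_def by (intro AE_I2 tendsto_mult flatten'_tendsto tendsto_const)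
      show "AE x in lborel. norm (flatten' (a n) (u x - c) * (G x \<bullet> b) * \<theta> x) \<le> B * \<bar>G x \<bullet> b\<bar>" for n
      proof (rule AE_I2)
        fix x
        have "\<bar>flatten' (a n) (u x - c)\<bar> * \<bar>G x \<bullet> b\<bar> * \<bar>\<theta> x\<bar> \<le> 1 * \<bar>G x \<bullet> b\<bar> * B"
          by (intro mult_mono F1 B) auto
        then show "norm (flatten' (a n) (u x - c) * (G x \<bullet> b) * \<theta> x) \<le> B * \<bar>G x \<bullet> b\<bar>"
          by (simp add: abs_mult mult.commute)
      qed
    qed measurable
    have "(\<integral>x. u x * (gradient \<theta> x \<bullet> b) \<partial>lborel) = - (\<integral>x. (if u x - c = 0 then 0 else 1) * (G x \<bullet> b) * \<theta> x \<partial>lborel)"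
      by (rule LIMSEQ_unique[OF l1]) (simp only: eq, intro tendsto_minus l2)
    then have e: "(\<integral>x. (G x \<bullet> b) * \<theta> x \<partial>lborel) = (\<integral>x. (if u x - c = 0 then 0 else 1) * (G x \<bullet> b) * \<theta> x \<partial>lborel)"
      using sob_weak[OF s \<theta> b] by simp
    have i1: "integrable lborel (\<lambda>x. (G x \<bullet> b) * \<theta> x)"
      using integrable_bounded_scaleR[OF Gb, of \<theta> B] B(2) by simp
    have i2: "integrable lborel (\<lambda>x. (if u x = c then G x \<bullet> b else 0) * \<theta> x)"
      using integrable_bounded_scaleR[OF i0, of \<theta> B] B(2) by simp
    have "(\<lambda>x. (if u x - c = 0 then 0 else 1) * (G x \<bullet> b) * \<theta> x) =
        (\<lambda>x. (G x \<bullet> b) * \<theta> x - (if u x = c then G x \<bullet> b else 0) * \<theta> x)" by (auto simp: fun_eq_iff)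
    with e i1 i2 show "(\<integral>x. (if u x = c then G x \<bullet> b else 0) * \<theta> x \<partial>lborel) = 0" by simp
  qed simp
  then have "AE x in lborel. \<forall>b\<in>Basis. (if u x = c then G x \<bullet> b else 0) = 0"
    by (intro AE_finite_allI) auto
  then show ?thesis
  proof eventually_elim
    case (elim x)
    show ?case
    proof
      assume "u x = c"
      show "G x = 0"
      proof (rule euclidean_eqI)
        fix b :: 'a assume "b \<in> Basis"
        from bspec[OF elim this] \<open>u x = c\<close> show "G x \<bullet> b = 0 \<bullet> b" by (simp only: simp_thms if_True inner_zero_left)
      qed
    qed
  qed
qed

section \<open>Weak gradients\<close>

lemma integral_lebesgue_on_eq_lborel:
  fixes f :: "'a::euclidean_space \<Rightarrow> 'b::{banach, second_countable_topology}"
  assumes "f \<in> borel_measurable borel" "S \<in> sets lebesgue" "\<And>x. x \<notin> S \<Longrightarrow> f x = 0"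
  shows "(\<integral>x. f x \<partial>lebesgue_on S) = (\<integral>x. f x \<partial>lborel)"
proof -
  have "(\<lambda>x. indicator S x *\<^sub>R f x) = f" using assms(3) by (auto simp: fun_eq_iff indicator_def)
  then have "(\<integral>x. f x \<partial>lebesgue_on S) = (\<integral>x. f x \<partial>lebesgue)"
    using assms(2) by (simp add: integral_restrict_space)
  also have "\<dots> = (\<integral>x. f x \<partial>lborel)"
    by (rule integral_completion) (use assms(1) in simp)
  finally show ?thesis .
qed

lemma nn_integral_lebesgue_on_eq_lborel:
  fixes f :: "'a::euclidean_space \<Rightarrow> ennreal"
  assumes "S \<in> sets lebesgue"
  shows "(\<integral>\<^sup>+x. f x \<partial>lebesgue_on S) = (\<integral>\<^sup>+x. f x * indicator S x \<partial>lborel)"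
  using assms by (simp add: nn_integral_restrict_space nn_integral_completion)

lemma lebesgue_borel_version:
  fixes f :: "'a::euclidean_space \<Rightarrow> 'b::euclidean_space"
  assumes "f \<in> borel_measurable lebesgue"
  shows "\<exists>f'\<in>borel_measurable borel. AE x in lebesgue. f x = f' x"
proof -
  have "\<forall>b. \<exists>h. h \<in> borel_measurable borel \<and> (AE x in lebesgue. f x \<bullet> b = h x)"
  proof
    fix b
    have "(\<lambda>x. f x \<bullet> b) \<in> borel_measurable lebesgue" using assms by (intro borel_measurable_inner) auto
    then obtain h where "h \<in> borel_measurable lborel" "AE x in lborel. f x \<bullet> b = h x"
      using completion_ex_borel_measurable_real by blast
    then show "\<exists>h. h \<in> borel_measurable borel \<and> (AE x in lebesgue. f x \<bullet> b = h x)"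
      by (intro exI[of _ h] conjI AE_completion) simp_all
  qed
  from choice[OF this] obtain h where h: "\<forall>b. h b \<in> borel_measurable borel \<and> (AE x in lebesgue. f x \<bullet> b = h b x)"
    by blast
  have "AE x in lebesgue. \<forall>b\<in>Basis. f x \<bullet> b = h b x"
    by (rule AE_finite_allI) (simp_all add: h)
  then have "AE x in lebesgue. f x = (\<Sum>b\<in>Basis. h b x *\<^sub>R b)"
  proof eventually_elim
    case (elim x)
    have "f x = (\<Sum>b\<in>Basis. (f x \<bullet> b) *\<^sub>R b)" by (simp add: euclidean_representation)
    also have "\<dots> = (\<Sum>b\<in>Basis. h b x *\<^sub>R b)" by (rule sum.cong) (use elim in auto)
    finally show ?case .
  qed
  moreover have "(\<lambda>x. \<Sum>b\<in>Basis. h b x *\<^sub>R b) \<in> borel_measurable borel"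
    using h by (intro borel_measurable_sum borel_measurable_scaleR) simp_all
  ultimately show ?thesis by (rule bexI)
qed

lemma integrable_lebesgue_on_test:
  fixes v :: "'a::euclidean_space \<Rightarrow> real"
  assumes v: "integrable (lebesgue_on K) v" and K: "K \<in> sets lebesgue" "K \<subseteq> S" and S: "S \<in> sets lebesgue"
    and q: "q \<in> borel_measurable borel" "\<And>x. \<bar>q x\<bar> \<le> B" "\<And>x. x \<notin> K \<Longrightarrow> q x = 0"
  shows "integrable (lebesgue_on S) (\<lambda>x. v x * q x)"
    "(\<integral>x. v x * q x \<partial>lebesgue_on S) = (\<integral>x. indicator K x *\<^sub>R v x * q x \<partial>lebesgue)"
proof -
  have iv: "integrable lebesgue (\<lambda>x. indicator K x *\<^sub>R v x)"
    using v K(1) by (simp add: integrable_restrict_space)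
  have qm: "q \<in> borel_measurable lebesgue" using q(1) by (intro measurable_completion) simp
  have "integrable lebesgue (\<lambda>x. indicator K x *\<^sub>R v x * q x)"
  proof (rule Bochner_Integration.integrable_bound[where f="\<lambda>x. B * (indicator K x *\<^sub>R v x)"])
    show "integrable lebesgue (\<lambda>x. B * (indicator K x *\<^sub>R v x))" using iv by (rule integrable_mult_right)
    show "(\<lambda>x. indicator K x *\<^sub>R v x * q x) \<in> borel_measurable lebesgue"
      using borel_measurable_integrable[OF iv] qm by (rule borel_measurable_times)
    have "0 \<le> B" using q(2)[of 0] by linarith
    then show "AE x in lebesgue. norm (indicator K x *\<^sub>R v x * q x) \<le> norm (B * (indicator K x *\<^sub>R v x))"
      using q(2) by (intro AE_I2) (simp add: abs_mult mult.commute[of B] mult_left_mono)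
  qed
  moreover have eq: "(\<lambda>x. indicator K x *\<^sub>R v x * q x) = (\<lambda>x. indicator S x *\<^sub>R (v x * q x))"
    using K(2) q(3) by (auto simp: fun_eq_iff indicator_def)
  ultimately show "integrable (lebesgue_on S) (\<lambda>x. v x * q x)"
    using S by (simp add: integrable_restrict_space)
  show "(\<integral>x. v x * q x \<partial>lebesgue_on S) = (\<integral>x. indicator K x *\<^sub>R v x * q x \<partial>lebesgue)"
    unfolding eq using S by (simp add: integral_restrict_space)
qed

lemma test_function_data:
  assumes \<eta>: "\<eta> \<in> test_functions S"
  shows "\<exists>K B. compact K \<and> K \<subseteq> S \<and> (\<forall>x. x \<notin> K \<longrightarrow> \<eta> x = 0 \<and> gradient \<eta> x = 0) \<and>
    (\<forall>x. \<bar>\<eta> x\<bar> \<le> B \<and> norm (gradient \<eta> x) \<le> B)"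
proof -
  note C = test_functions_C1c[OF \<eta>]
  obtain K where K: "compact K" "K \<subseteq> S" "\<forall>x. x \<notin> K \<longrightarrow> \<eta> x = 0 \<and> gradient \<eta> x = 0"
    using C unfolding C1c_def by blast
  obtain B where B: "B > 0" "\<And>x. \<bar>\<eta> x\<bar> \<le> B" "\<And>x. norm (gradient \<eta> x) \<le> B"
    using C1c_bounded[OF C] by metis
  show ?thesis by (intro exI[of _ K] exI[of _ B]) (use K B in auto)
qed

lemma compact_sets_lebesgue: "compact K \<Longrightarrow> K \<in> sets lebesgue"
  by (simp add: borel_compact)

lemma open_sets_lebesgue: "open K \<Longrightarrow> K \<in> sets lebesgue"
  by (simp add: borel_open)

lemma integrable_lebesgue_on_of_lborel:
  fixes f :: "'a::euclidean_space \<Rightarrow> 'b::euclidean_space"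
  assumes "integrable lborel f" "K \<in> sets lebesgue"
  shows "integrable (lebesgue_on K) f"
proof -
  have f: "f \<in> borel_measurable borel" using assms(1) borel_measurable_integrable by fastforce
  have "integrable lebesgue f" using assms(1) f integrable_completion[of f lborel] by simp
  then have "integrable lebesgue (\<lambda>x. indicator K x *\<^sub>R f x)"
    by (rule integrable_mult_indicator[OF assms(2)])
  then show ?thesis using assms(2) by (simp add: integrable_restrict_space)
qed

lemma has_weak_gradient_test_function:
  assumes S: "open S" and \<eta>: "\<eta> \<in> test_functions S"
  shows "has_weak_gradient S \<eta> (gradient \<eta>)"
  unfolding has_weak_gradient_def locally_integrable_def
proof (intro conjI allI ballI impI)
  note C = test_functions_C1c[OF \<eta>]
  fix K assume "compact K \<and> K \<subseteq> S"
  then have K: "K \<in> sets lebesgue" by (intro compact_sets_lebesgue) simp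
  show "integrable (lebesgue_on K) \<eta>" "integrable (lebesgue_on K) (gradient \<eta>)"
    by (rule integrable_lebesgue_on_of_lborel[OF _ K], rule C1c_integrable[OF C])+
next
  note C = test_functions_C1c[OF \<eta>]
  fix \<theta> :: "'a \<Rightarrow> real" and b :: 'a assume \<theta>: "\<theta> \<in> test_functions S" and b: "b \<in> Basis"
  note T = test_functions_C1c[OF \<theta>]
  have [measurable]: "\<eta> \<in> borel_measurable borel" "gradient \<eta> \<in> borel_measurable borel"
    "\<theta> \<in> borel_measurable borel" "gradient \<theta> \<in> borel_measurable borel"
    using C1cD(6,7)[OF C] C1cD(6,7)[OF T] by auto
  have "(\<integral>x. \<eta> x * frechet_derivative \<theta> (at x) b \<partial>lebesgue_on S) = (\<integral>x. \<eta> x * (gradient \<theta> x \<bullet> b) \<partial>lebesgue_on S)"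
    using b by (simp add: gradient_inner_Basis)
  also have "\<dots> = (\<integral>x. \<eta> x * (gradient \<theta> x \<bullet> b) \<partial>lborel)"
    by (rule integral_lebesgue_on_eq_lborel) (use S C1cD(4)[OF C] in \<open>auto simp: open_sets_lebesgue\<close>)
  also have "\<dots> = - (\<integral>x. (gradient \<eta> x \<bullet> b) * \<theta> x \<partial>lborel)"
    by (rule C1c_integration_by_parts[OF C C1cD(1)[OF T] C1cD(2)[OF T]])
  also have "(\<integral>x. (gradient \<eta> x \<bullet> b) * \<theta> x \<partial>lborel) = (\<integral>x. (gradient \<eta> x \<bullet> b) * \<theta> x \<partial>lebesgue_on S)"
    by (rule integral_lebesgue_on_eq_lborel[symmetric]) (use S C1cD(4)[OF T] in \<open>auto simp: open_sets_lebesgue\<close>)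
  finally show "(\<integral>x. \<eta> x * frechet_derivative \<theta> (at x) b \<partial>lebesgue_on S) = - (\<integral>x. (gradient \<eta> x \<bullet> b) * \<theta> x \<partial>lebesgue_on S)" .
qed

lemma weak_gradient_integral:
  assumes "has_weak_gradient S u G" "\<theta> \<in> test_functions S" "b \<in> Basis"
  shows "(\<integral>x. u x * frechet_derivative \<theta> (at x) b \<partial>lebesgue_on S) = - (\<integral>x. (G x \<bullet> b) * \<theta> x \<partial>lebesgue_on S)"
  using assms unfolding has_weak_gradient_def by blast

lemma has_weak_gradient_diff:
  assumes S: "open S" and 1: "has_weak_gradient S u G" and 2: "has_weak_gradient S v H"
  shows "has_weak_gradient S (\<lambda>x. u x - v x) (\<lambda>x. G x - H x)"
  unfolding has_weak_gradient_def
proof (intro conjI ballI)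
  have li: "locally_integrable S u" "locally_integrable S v" "locally_integrable S G" "locally_integrable S H"
    using 1 2 by (simp_all add: has_weak_gradient_def)
  then show "locally_integrable S (\<lambda>x. u x - v x)" "locally_integrable S (\<lambda>x. G x - H x)"
    unfolding locally_integrable_def by (auto intro: Bochner_Integration.integrable_diff)
  fix \<theta> :: "'a \<Rightarrow> real" and b :: 'a assume \<theta>: "\<theta> \<in> test_functions S" and b: "b \<in> Basis"
  note T = test_functions_C1c[OF \<theta>]
  obtain K B where K: "compact K" "K \<subseteq> S" and Kz: "\<forall>x. x \<notin> K \<longrightarrow> \<theta> x = 0 \<and> gradient \<theta> x = 0"
    and Bb: "\<forall>x. \<bar>\<theta> x\<bar> \<le> B \<and> norm (gradient \<theta> x) \<le> B"
    using test_function_data[OF \<theta>] by blast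
  have z: "\<theta> x = 0" "gradient \<theta> x = 0" if "x \<notin> K" for x using Kz that by auto
  have B: "\<bar>\<theta> x\<bar> \<le> B" "norm (gradient \<theta> x) \<le> B" for x using Bb by auto
  have Ks: "K \<in> sets lebesgue" and Ss: "S \<in> sets lebesgue" using K(1) S by (auto simp: compact_sets_lebesgue open_sets_lebesgue)
  have gb: "\<bar>gradient \<theta> x \<bullet> b\<bar> \<le> B" for x
    using Basis_le_norm[OF b, of "gradient \<theta> x"] B(2)[of x] by linarith
  have fd: "frechet_derivative \<theta> (at x) b = gradient \<theta> x \<bullet> b" for x using b by (simp add: gradient_inner_Basis)
  have m: "(\<lambda>x. gradient \<theta> x \<bullet> b) \<in> borel_measurable borel" "\<theta> \<in> borel_measurable borel" using C1cD(6,7)[OF T] by simp_all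
  have iu: "integrable (lebesgue_on S) (\<lambda>x. u x * (gradient \<theta> x \<bullet> b))" "integrable (lebesgue_on S) (\<lambda>x. v x * (gradient \<theta> x \<bullet> b))"
    by (rule integrable_lebesgue_on_test(1)[where K=K and B=B, OF _ Ks K(2) Ss m(1) gb];
        use li K in \<open>simp add: locally_integrable_def z\<close>)+
  have iG: "integrable (lebesgue_on S) (\<lambda>x. (G x \<bullet> b) * \<theta> x)" "integrable (lebesgue_on S) (\<lambda>x. (H x \<bullet> b) * \<theta> x)"
    by (rule integrable_lebesgue_on_test(1)[where K=K and B=B, OF _ Ks K(2) Ss m(2) B(1)];
        use li K in \<open>simp add: locally_integrable_def z integrable_inner_left\<close>)+
  have e: "(\<integral>x. u x * (gradient \<theta> x \<bullet> b) \<partial>lebesgue_on S) = - (\<integral>x. (G x \<bullet> b) * \<theta> x \<partial>lebesgue_on S)"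
    "(\<integral>x. v x * (gradient \<theta> x \<bullet> b) \<partial>lebesgue_on S) = - (\<integral>x. (H x \<bullet> b) * \<theta> x \<partial>lebesgue_on S)"
    using 1 2 \<theta> b unfolding has_weak_gradient_def fd[symmetric] by auto
  show "(\<integral>x. (u x - v x) * frechet_derivative \<theta> (at x) b \<partial>lebesgue_on S) = - (\<integral>x. ((G x - H x) \<bullet> b) * \<theta> x \<partial>lebesgue_on S)"
    unfolding fd left_diff_distrib inner_diff_left
    using iu iG e by simp
qed

text \<open>The difference of two weak gradients is only locally integrable. The fundamental lemma
  is therefore applied to its restrictions to the sets of a compact exhaustion, tested on their
  interiors.\<close>

lemma has_weak_gradient_unique:
  assumes S: "open S" and 1: "has_weak_gradient S u G" and 2: "has_weak_gradient S u H"
  shows "AE x in lebesgue. x \<in> S \<longrightarrow> G x = H x"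
proof -
  have Ss: "S \<in> sets lebesgue" using S by (rule open_sets_lebesgue)
  obtain C :: "nat \<Rightarrow> 'a set" where C: "\<And>n. compact (C n)" "\<And>n. C n \<subseteq> S" "\<And>n. C n \<subseteq> interior (C (Suc n))" "\<Union>(range C) = S"
    using open_Union_compact_subsets[OF S] by metis
  have li: "locally_integrable S G" "locally_integrable S H"
    using 1 2 by (simp_all add: has_weak_gradient_def)
  have *: "AE x in lebesgue. x \<in> interior (C n) \<longrightarrow> (G x - H x) \<bullet> b = 0" if b: "b \<in> Basis" for n b
  proof -
    have Cs: "C n \<in> sets lebesgue" using C(1) by (rule compact_sets_lebesgue)
    define v where "v x = indicator (C n) x *\<^sub>R ((G x - H x) \<bullet> b)" for x
    have "integrable (lebesgue_on (C n)) (\<lambda>x. (G x - H x) \<bullet> b)"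
      using li C(1,2) unfolding locally_integrable_def by (intro integrable_inner_left Bochner_Integration.integrable_diff) auto
    then have vi: "integrable lebesgue v" unfolding v_def using Cs by (simp add: integrable_restrict_space)
    have vm: "v \<in> borel_measurable lebesgue" using vi by (rule borel_measurable_integrable)
    then obtain w where w: "w \<in> borel_measurable borel" "AE x in lebesgue. v x = w x"
      using lebesgue_borel_version[of v] by blast
    have wl: "w \<in> borel_measurable lebesgue" using w(1) by (intro measurable_completion) simp
    have "integrable lebesgue w" using vi integrable_cong_AE[OF vm wl w(2)] by simp
    then have wi: "integrable lborel w" using w(1) integrable_completion[of w lborel] by simp
    have "AE x in lborel. x \<in> interior (C n) \<longrightarrow> w x = 0"
    proof (rule AE_eq_0_of_test_functions[OF wi open_interior])
      fix \<theta> :: "'a \<Rightarrow> real" assume \<theta>': "\<theta> \<in> test_functions (interior (C n))"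
      then have \<theta>: "\<theta> \<in> test_functions S"
        using interior_subset[of "C n"] C(2)[of n] unfolding test_functions_def by blast
      note T = test_functions_C1c[OF \<theta>]
      have z: "\<theta> x = 0" if "x \<notin> C n" for x
        using C1cD(4)[OF test_functions_C1c[OF \<theta>']] interior_subset[of "C n"] that by blast
      obtain B where B: "B > 0" "\<And>x. \<bar>\<theta> x\<bar> \<le> B" "\<And>x. norm (gradient \<theta> x) \<le> B"
        using C1c_bounded[OF T] by metis
      have m: "\<theta> \<in> borel_measurable borel" using C1cD(6)[OF T] .
      have I: "integrable (lebesgue_on S) (\<lambda>x. (G x \<bullet> b) * \<theta> x)" "integrable (lebesgue_on S) (\<lambda>x. (H x \<bullet> b) * \<theta> x)"
        by (rule integrable_lebesgue_on_test(1)[where K="C n" and B=B, OF _ Cs C(2) Ss m B(2)];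
            use li C in \<open>simp add: locally_integrable_def z\<close>)+
      have "(\<integral>x. (G x \<bullet> b) * \<theta> x \<partial>lebesgue_on S) = (\<integral>x. (H x \<bullet> b) * \<theta> x \<partial>lebesgue_on S)"
      proof -
        have "- (\<integral>x. (G x \<bullet> b) * \<theta> x \<partial>lebesgue_on S) = - (\<integral>x. (H x \<bullet> b) * \<theta> x \<partial>lebesgue_on S)"
          by (rule trans[OF weak_gradient_integral[OF 1 \<theta> b, symmetric] weak_gradient_integral[OF 2 \<theta> b]])
        then show ?thesis by (simp only: neg_equal_iff_equal)
      qed
      then have "0 = (\<integral>x. ((G x - H x) \<bullet> b) * \<theta> x \<partial>lebesgue_on S)"
        using I by (simp add: inner_diff_left left_diff_distrib)
      also have "\<dots> = (\<integral>x. indicator (C n) x *\<^sub>R ((G x - H x) \<bullet> b) * \<theta> x \<partial>lebesgue)"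
        by (rule integrable_lebesgue_on_test(2)[where B=B, OF _ Cs C(2) Ss m B(2)])
          (use li C in \<open>simp_all add: locally_integrable_def z\<close>)
      also have "\<dots> = (\<integral>x. w x * \<theta> x \<partial>lebesgue)"
      proof (rule integral_cong_AE)
        have \<theta>l: "\<theta> \<in> borel_measurable lebesgue" using m by (intro measurable_completion) simp
        show "(\<lambda>x. indicator (C n) x *\<^sub>R ((G x - H x) \<bullet> b) * \<theta> x) \<in> borel_measurable lebesgue"
          using borel_measurable_times[OF vm \<theta>l] by (simp add: v_def)
        show "(\<lambda>x. w x * \<theta> x) \<in> borel_measurable lebesgue" by (rule borel_measurable_times[OF wl \<theta>l])
        show "AE x in lebesgue. indicator (C n) x *\<^sub>R ((G x - H x) \<bullet> b) * \<theta> x = w x * \<theta> x"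
          using w(2) by eventually_elim (simp add: v_def)
      qed
      also have "\<dots> = (\<integral>x. w x * \<theta> x \<partial>lborel)"
        using w(1) m by (intro integral_completion) simp
      finally show "(\<integral>x. w x * \<theta> x \<partial>lborel) = 0" by simp
    qed
    then have "AE x in lebesgue. x \<in> interior (C n) \<longrightarrow> w x = 0" by (rule AE_completion)
    with w(2) show ?thesis
    proof eventually_elim
      case (elim x)
      then show ?case using interior_subset[of "C n"] by (auto simp: v_def)
    qed
  qed
  have "AE x in lebesgue. \<forall>n. \<forall>b\<in>Basis. x \<in> interior (C n) \<longrightarrow> (G x - H x) \<bullet> b = 0"
    unfolding AE_all_countable by (intro allI AE_finite_allI *) auto
  then show ?thesis
  proof eventually_elim
    case (elim x)
    show ?case
    proof
      assume "x \<in> S"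
      then obtain n where "x \<in> C n" using C(4) by blast
      then have "x \<in> interior (C (Suc n))" using C(3) by blast
      then have "(G x - H x) \<bullet> b = 0 \<bullet> b" if "b \<in> Basis" for b
        using bspec[OF spec[OF elim, of "Suc n"] that] by simp
      then have "G x - H x = 0" by (rule euclidean_eqI)
      then show "G x = H x" by simp
    qed
  qed
qed

text \<open>\<open>weak_gradient\<close> is an arbitrary choice; uniqueness pins it down almost
  everywhere, which is all that norms and modulars see.\<close>

lemma weak_gradient_eq:
  assumes "open S" "has_weak_gradient S u G"
  shows "AE x in lebesgue. x \<in> S \<longrightarrow> weak_gradient S u x = G x"
proof -
  have "has_weak_gradient S u (weak_gradient S u)"
    unfolding weak_gradient_def by (rule someI[of "has_weak_gradient S u", OF assms(2)])
  then show ?thesis using has_weak_gradient_unique[OF assms(1) _ assms(2)] by blast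
qed

lemma weak_gradient_diff_test_function:
  assumes S: "open S" and u: "has_weak_gradient S u G" and \<eta>: "\<eta> \<in> test_functions S"
  shows "AE x in lebesgue. x \<in> S \<longrightarrow> weak_gradient S (\<lambda>x. u x - \<eta> x) x = G x - gradient \<eta> x"
  by (rule weak_gradient_eq[OF S has_weak_gradient_diff[OF S u has_weak_gradient_test_function[OF S \<eta>]]])

text \<open>Replaces Lebesgue measurable representatives on \<open>S\<close> by Borel functions that
  vanish outside \<open>S\<close>, so that all later limits can be taken over the whole space. The
  approximating test functions, together with their gradients, provide the required
  \<open>C^1\<close> pairs.\<close>

lemma W11_0_imp_sob:
  assumes S: "open S" and u: "u \<in> W11_0 S"
  obtains v G where "has_weak_gradient S u (weak_gradient S u)" "sob S UNIV v G"
    "AE x in lebesgue. x \<in> S \<longrightarrow> weak_gradient S u x = G x"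
proof -
  have Ss: "S \<in> sets lebesgue" using S by (rule open_sets_lebesgue)
  have Sb: "S \<in> sets borel" using S by (rule borel_open)
  obtain H where H: "has_weak_gradient S u H" and Hi: "integrable (lebesgue_on S) H" and ui: "integrable (lebesgue_on S) u"
    and app: "\<And>\<epsilon>. \<epsilon> > 0 \<Longrightarrow> \<exists>\<eta>\<in>test_functions S. W11_norm S (\<lambda>x. u x - \<eta> x) < \<epsilon>"
    using u by (auto simp: W11_0_def W11_def)
  have hw: "has_weak_gradient S u (weak_gradient S u)"
    unfolding weak_gradient_def by (rule someI[of "has_weak_gradient S u", OF H])
  note wH = weak_gradient_eq[OF S H]
  have "integrable lebesgue (\<lambda>x. indicator S x *\<^sub>R H x)" using Hi Ss by (simp add: integrable_restrict_space)
  then obtain G0 where G0: "G0 \<in> borel_measurable borel" "AE x in lebesgue. indicator S x *\<^sub>R H x = G0 x"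
    using lebesgue_borel_version[OF borel_measurable_integrable] by blast
  have "integrable lebesgue (\<lambda>x. indicator S x *\<^sub>R u x)" using ui Ss by (simp add: integrable_restrict_space)
  then obtain v0 where v0: "v0 \<in> borel_measurable borel" "AE x in lebesgue. indicator S x *\<^sub>R u x = v0 x"
    using lebesgue_borel_version[OF borel_measurable_integrable] by blast
  define G where "G x = indicator S x *\<^sub>R G0 x" for x
  define v where "v x = indicator S x *\<^sub>R v0 x" for x
  have m: "v \<in> borel_measurable borel" "G \<in> borel_measurable borel"
    unfolding v_def G_def using G0(1) v0(1) Sb by measurable
  have GH: "AE x in lebesgue. x \<in> S \<longrightarrow> G x = H x"
    using G0(2) by eventually_elim (auto simp: G_def indicator_def)
  have vu: "AE x in lebesgue. x \<in> S \<longrightarrow> v x = u x"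
    using v0(2) by eventually_elim (auto simp: v_def indicator_def)
  have "sob S UNIV v G"
    unfolding sob_def
  proof (intro conjI allI impI m)
    show "v x = 0" "G x = 0" if "x \<notin> S" for x using that by (simp_all add: v_def G_def)
    fix \<epsilon> :: real assume "\<epsilon> > 0"
    then obtain \<eta> where \<eta>: "\<eta> \<in> test_functions S" and le: "W11_norm S (\<lambda>x. u x - \<eta> x) < ennreal \<epsilon>"
      using app[of "ennreal \<epsilon>"] by auto
    note C = test_functions_C1c[OF \<eta>]
    have n1: "(\<integral>\<^sup>+x. ennreal (norm (v x - \<eta> x)) \<partial>lborel) = (\<integral>\<^sup>+x. ennreal (norm (u x - \<eta> x)) \<partial>lebesgue_on S)"
      unfolding nn_integral_lebesgue_on_eq_lborel[OF Ss] nn_integral_completion[symmetric, of lborel]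
      by (rule nn_integral_cong_AE) (use vu in eventually_elim, use C1cD(4)[OF C] in \<open>auto simp: indicator_def v_def\<close>)
    have n2: "(\<integral>\<^sup>+x. ennreal (norm (G x - gradient \<eta> x)) \<partial>lborel) =
        (\<integral>\<^sup>+x. ennreal (norm (weak_gradient S (\<lambda>x. u x - \<eta> x) x)) \<partial>lebesgue_on S)"
      unfolding nn_integral_lebesgue_on_eq_lborel[OF Ss] nn_integral_completion[symmetric, of lborel]
    proof (rule nn_integral_cong_AE)
      show "AE x in lebesgue. ennreal (norm (G x - gradient \<eta> x)) = ennreal (norm (weak_gradient S (\<lambda>x. u x - \<eta> x) x)) * indicator S x"
        using GH weak_gradient_diff_test_function[OF S H \<eta>]
      proof eventually_elim
        case (elim x)
        then show ?case using C1cD(5)[OF C, of x] by (cases "x \<in> S") (simp_all add: G_def)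
      qed
    qed
    have le': "(\<integral>\<^sup>+x. ennreal (norm (v x - \<eta> x)) \<partial>lborel) + (\<integral>\<^sup>+x. ennreal (norm (G x - gradient \<eta> x)) \<partial>lborel) \<le> ennreal \<epsilon>"
      using le unfolding n1 n2 W11_norm_def by simp
    show "\<exists>f g. C1c S f g \<and> range f \<subseteq> UNIV \<and>
        (\<integral>\<^sup>+x. ennreal (norm (v x - f x)) \<partial>lborel) \<le> ennreal \<epsilon> \<and>
        (\<integral>\<^sup>+x. ennreal (norm (G x - g x)) \<partial>lborel) \<le> ennreal \<epsilon>"
    proof (intro exI conjI)
      show "(\<integral>\<^sup>+x. ennreal (norm (v x - \<eta> x)) \<partial>lborel) \<le> ennreal \<epsilon>"
        by (rule order_trans[OF _ le']) simp
      show "(\<integral>\<^sup>+x. ennreal (norm (G x - gradient \<eta> x)) \<partial>lborel) \<le> ennreal \<epsilon>"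
        by (rule order_trans[OF _ le']) simp
    qed (use C in auto)
  qed
  moreover have "AE x in lebesgue. x \<in> S \<longrightarrow> weak_gradient S u x = G x"
    using wH GH by eventually_elim auto
  ultimately show ?thesis using that hw by blast
qed

section \<open>Orlicz functions and modulars\<close>

locale finite_orlicz =
  fixes \<phi> :: "real \<Rightarrow> ennreal"
  assumes orlicz: "orlicz_function \<phi>" and delta2: "Delta2 \<phi>" and finite: "\<And>t. t \<ge> 0 \<Longrightarrow> \<phi> t < \<infinity>"
begin

lemma zero: "\<phi> 0 = 0"
  using orlicz by (simp add: orlicz_function_def)

lemma convex: "s \<ge> 0 \<Longrightarrow> t \<ge> 0 \<Longrightarrow> 0 \<le> u \<Longrightarrow> u \<le> 1 \<Longrightarrow>
    \<phi> ((1 - u) * s + u * t) \<le> ennreal (1 - u) * \<phi> s + ennreal u * \<phi> t"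
  using orlicz by (simp add: orlicz_function_def)

lemma scale_le:
  assumes "t \<ge> 0" "0 \<le> u" "u \<le> 1"
  shows "\<phi> (u * t) \<le> ennreal u * \<phi> t"
  using convex[of 0 t u] assms zero by simp

lemma mono:
  assumes "0 \<le> s" "s \<le> t"
  shows "\<phi> s \<le> \<phi> t"
proof (cases "t = 0")
  case False
  then have t: "t > 0" using assms by simp
  have "\<phi> (s / t * t) \<le> ennreal (s / t) * \<phi> t" by (rule scale_le) (use assms t in auto)
  also have "\<dots> \<le> 1 * \<phi> t" using assms t by (intro mult_right_mono) (auto simp: ennreal_le_1)
  finally show ?thesis using t by simp
qed (use assms in simp)

lemma scale_bound:
  assumes "L \<ge> 0"
  shows "\<exists>C\<ge>0. \<forall>t\<ge>0. \<phi> (L * t) \<le> ennreal C * \<phi> t"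
proof -
  obtain c where c: "c > 0" "\<And>t. t \<ge> 0 \<Longrightarrow> \<phi> (2 * t) \<le> ennreal c * \<phi> t"
    using delta2 unfolding Delta2_def by blast
  have pow: "\<phi> (2 ^ n * t) \<le> ennreal (c ^ n) * \<phi> t" if "t \<ge> 0" for n t
  proof (induction n)
    case (Suc n)
    have "\<phi> (2 ^ Suc n * t) = \<phi> (2 * (2 ^ n * t))" by (simp add: mult.assoc)
    also have "\<dots> \<le> ennreal c * \<phi> (2 ^ n * t)" using that by (intro c(2)) simp
    also have "\<dots> \<le> ennreal c * (ennreal (c ^ n) * \<phi> t)" by (intro mult_left_mono Suc) simp
    also have "\<dots> = ennreal (c ^ Suc n) * \<phi> t" using c(1) by (simp add: ennreal_mult mult.assoc)
    finally show ?case .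
  qed simp
  obtain n :: nat where n: "L < 2 ^ n" using real_arch_pow[of 2 L] by auto
  have "\<phi> (L * t) \<le> ennreal (c ^ n) * \<phi> t" if "t \<ge> 0" for t
    using mono[of "L * t" "2 ^ n * t"] pow[OF that, of n] assms n that
    by (meson less_imp_le mult_nonneg_nonneg mult_right_mono order_trans)
  then show ?thesis using c(1) by (intro exI[of _ "c ^ n"]) auto
qed

lemma tendsto_0:
  assumes "\<And>n. f n \<ge> 0" "f \<longlonglongrightarrow> 0"
  shows "(\<lambda>n. \<phi> (f n)) \<longlonglongrightarrow> 0"
proof (rule order_tendstoI)
  fix e :: ennreal assume "0 < e"
  have "(\<phi> \<longlongrightarrow> 0) (at_right 0)" using orlicz by (simp add: orlicz_function_def)
  then have "\<forall>\<^sub>F t in at_right 0. \<phi> t < e" by (rule order_tendstoD) (rule \<open>0 < e\<close>)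
  then obtain d where d: "d > 0" "\<And>t. t > 0 \<Longrightarrow> t < d \<Longrightarrow> \<phi> t < e"
    unfolding eventually_at_right_field by blast
  have "\<forall>\<^sub>F n in sequentially. f n < d" using assms(2) d(1) by (rule order_tendstoD)
  then show "\<forall>\<^sub>F n in sequentially. \<phi> (f n) < e"
  proof eventually_elim
    case (elim n)
    then show ?case using d(2)[of "f n"] assms(1)[of n] zero \<open>0 < e\<close> by (cases "f n = 0") auto
  qed
qed simp

text \<open>A real-valued copy of \<open>\<phi>\<close>, made constant on the negative axis so that
  it is monotone on all reals and hence Borel measurable.\<close>

definition r :: "real \<Rightarrow> real" where "r t = enn2real (\<phi> (max 0 t))"

lemma ennreal_r: "t \<ge> 0 \<Longrightarrow> ennreal (r t) = \<phi> t"
  using finite[of t] by (simp add: r_def less_top)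

lemma r_nonneg: "r t \<ge> 0"
  by (simp add: r_def)

lemma r_zero: "r 0 = 0"
  by (simp add: r_def zero)

lemma r_mono: "s \<le> t \<Longrightarrow> r s \<le> r t"
  unfolding r_def by (intro enn2real_mono mono) (use finite[of "max 0 t"] in auto)

lemma r_measurable [measurable]: "r \<in> borel_measurable borel"
  by (rule borel_measurable_mono) (simp add: monoI r_mono)

lemma norm_measurable:
  fixes f :: "'a \<Rightarrow> 'b::euclidean_space"
  assumes [measurable]: "f \<in> borel_measurable M"
  shows "(\<lambda>x. \<phi> (norm (f x))) \<in> borel_measurable M"
proof -
  have "(\<lambda>x. \<phi> (norm (f x))) = (\<lambda>x. ennreal (r (norm (f x))))" by (simp add: ennreal_r)
  then show ?thesis by simp
qed

lemma r_convex: "convex_on {0..} r"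
proof (rule convex_onI)
  fix u x y :: real assume u: "0 < u" "u < 1" and xy: "x \<in> {0..}" "y \<in> {0..}"
  have "ennreal (r ((1 - u) * x + u * y)) \<le> ennreal (1 - u) * ennreal (r x) + ennreal u * ennreal (r y)"
    using convex[of x y u] u xy by (simp add: ennreal_r)
  also have "\<dots> = ennreal ((1 - u) * r x + u * r y)"
    using u r_nonneg by (simp add: ennreal_mult'')
  finally have "r ((1 - u) * x + u * y) \<le> (1 - u) * r x + u * r y"
    by (subst (asm) ennreal_le_iff) (use u r_nonneg in \<open>auto intro!: add_nonneg_nonneg mult_nonneg_nonneg\<close>)
  then show "r ((1 - u) *\<^sub>R x + u *\<^sub>R y) \<le> (1 - u) * r x + u * r y" by simp
qed simp

text \<open>Convexity at an interior point supplies the line. Its slope is nonnegative because at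
  the origin the line lies below \<open>r 0 = 0\<close>, while \<open>r m\<close> is
  nonnegative.\<close>

lemma support_line:
  assumes "m > 0"
  shows "\<exists>k\<ge>0. \<forall>t\<ge>0. r m + k * (t - m) \<le> r t"
proof -
  define k where "k = Inf ((\<lambda>t. (r m - r t) / (m - t)) ` ({m<..} \<inter> {0..}))"
  have int: "m \<in> interior {0..}" using assms by (simp add: interior_real_atLeast)
  have le: "r m + k * (t - m) \<le> r t" if "t \<ge> 0" for t
    using convex_le_Inf_differential[OF r_convex int, of t] that by (simp add: k_def)
  have "r m \<le> k * m" using le[of 0] r_zero by simp
  then have "0 \<le> k * m" using r_nonneg[of m] by linarith
  then have "k \<ge> 0" using assms by (simp add: zero_le_mult_iff)
  then show ?thesis using le by blast
qed

text \<open>The supporting line at the mean of \<open>g\<close> is integrated against the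
  probability density \<open>\<kappa>\<close>, where its linear part cancels.\<close>

lemma jensen:
  assumes \<kappa>: "\<And>z. 0 \<le> \<kappa> z" "integrable M \<kappa>" "(\<integral>z. \<kappa> z \<partial>M) = 1"
    and g: "\<And>z. 0 \<le> g z" "integrable M (\<lambda>z. g z * \<kappa> z)" "integrable M (\<lambda>z. r (g z) * \<kappa> z)"
  shows "r (\<integral>z. g z * \<kappa> z \<partial>M) \<le> (\<integral>z. r (g z) * \<kappa> z \<partial>M)"
proof (cases "(\<integral>z. g z * \<kappa> z \<partial>M) = 0")
  case True
  then show ?thesis using \<kappa>(1) r_nonneg by (simp add: r_zero)
next
  case False
  define m where "m = (\<integral>z. g z * \<kappa> z \<partial>M)"
  have "m \<ge> 0" unfolding m_def using \<kappa>(1) g(1) by simp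
  with False have "m > 0" by (simp add: m_def)
  then obtain k where k: "k \<ge> 0" "\<And>t. t \<ge> 0 \<Longrightarrow> r m + k * (t - m) \<le> r t" using support_line[of m] by blast
  have "r m = (\<integral>z. r m * \<kappa> z + k * (g z * \<kappa> z - m * \<kappa> z) \<partial>M)"
    using \<kappa>(2,3) g(2) by (simp add: m_def)
  also have "\<dots> \<le> (\<integral>z. r (g z) * \<kappa> z \<partial>M)"
  proof (rule integral_mono)
    show "integrable M (\<lambda>z. r m * \<kappa> z + k * (g z * \<kappa> z - m * \<kappa> z))" using \<kappa>(2) g(2) by simp
    fix z
    have "(r m + k * (g z - m)) * \<kappa> z \<le> r (g z) * \<kappa> z" by (rule mult_right_mono[OF k(2)[OF g(1)] \<kappa>(1)])
    then show "r m * \<kappa> z + k * (g z * \<kappa> z - m * \<kappa> z) \<le> r (g z) * \<kappa> z" by (simp add: algebra_simps)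
  qed (rule g(3))
  finally show ?thesis by (simp add: m_def)
qed

end

section \<open>Modulars of the double phase function\<close>

locale double_phase_functions = phi: finite_orlicz \<phi> + psi: finite_orlicz \<psi> for \<phi> \<psi>
begin

abbreviation \<Phi> :: "real^2 \<Rightarrow> real \<Rightarrow> ennreal" where "\<Phi> \<equiv> double_phase \<phi> \<psi>"

lemma weight_cases: "weight x = 0 \<or> weight x = 1"
  by (simp add: weight_def)

lemma Phi_mono: "0 \<le> s \<Longrightarrow> s \<le> t \<Longrightarrow> \<Phi> x s \<le> \<Phi> x t"
  unfolding double_phase_def by (intro add_mono mult_left_mono phi.mono psi.mono) auto

lemma Phi_scale_bound:
  assumes "L \<ge> 0"
  shows "\<exists>C\<ge>0. \<forall>x. \<forall>t\<ge>0. \<Phi> x (L * t) \<le> ennreal C * \<Phi> x t"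
proof -
  obtain C where C: "C \<ge> 0" "\<And>t. t \<ge> 0 \<Longrightarrow> \<phi> (L * t) \<le> ennreal C * \<phi> t" using phi.scale_bound[OF assms] by blast
  obtain D where D: "D \<ge> 0" "\<And>t. t \<ge> 0 \<Longrightarrow> \<psi> (L * t) \<le> ennreal D * \<psi> t" using psi.scale_bound[OF assms] by blast
  have "\<Phi> x (L * t) \<le> ennreal (max C D) * \<Phi> x t" if "t \<ge> 0" for x t
  proof -
    have "\<phi> (L * t) \<le> ennreal (max C D) * \<phi> t"
      by (rule order_trans[OF C(2)[OF that]]) (intro mult_right_mono ennreal_leI, auto)
    moreover have "\<psi> (L * t) \<le> ennreal (max C D) * \<psi> t"
      by (rule order_trans[OF D(2)[OF that]]) (intro mult_right_mono ennreal_leI, auto)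
    ultimately show ?thesis using weight_cases[of x]
      by (auto simp: double_phase_def distrib_left intro: add_mono)
  qed
  then show ?thesis using C(1) by (intro exI[of _ "max C D"]) auto
qed

text \<open>Since \<open>s + t \<le> 2 * max s t\<close>, doubling yields a triangle inequality up
  to a constant; the constant does not depend on \<open>x\<close>, as the weight is 0 or 1.\<close>

lemma Phi_quasi_add: "\<exists>C\<ge>0. \<forall>x. \<forall>s\<ge>0. \<forall>t\<ge>0. \<Phi> x (s + t) \<le> ennreal C * (\<Phi> x s + \<Phi> x t)"
proof -
  obtain C where C: "C \<ge> 0" "\<And>t x. t \<ge> 0 \<Longrightarrow> \<Phi> x (2 * t) \<le> ennreal C * \<Phi> x t" using Phi_scale_bound[of 2] by auto
  have "\<Phi> x (s + t) \<le> ennreal C * (\<Phi> x s + \<Phi> x t)" if "s \<ge> 0" "t \<ge> 0" for s t x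
  proof -
    have "\<Phi> x (s + t) \<le> \<Phi> x (2 * max s t)" by (rule Phi_mono) (use that in auto)
    also have "\<dots> \<le> ennreal C * \<Phi> x (max s t)" using C(2) that by simp
    also have "\<dots> \<le> ennreal C * (\<Phi> x s + \<Phi> x t)"
      by (intro mult_left_mono) (auto simp: max_def add_increasing add_increasing2)
    finally show ?thesis .
  qed
  then show ?thesis using C(1) by blast
qed

lemma Phi_tendsto_0:
  assumes "\<And>n. f n \<ge> 0" "f \<longlonglongrightarrow> 0"
  shows "(\<lambda>n. \<Phi> x (f n)) \<longlonglongrightarrow> 0"
proof (cases "weight x = 0")
  case True
  then show ?thesis using phi.tendsto_0[OF assms] by (simp add: double_phase_def)
next
  case False
  then have "weight x = 1" using weight_cases[of x] by simp
  then show ?thesis using tendsto_add[OF phi.tendsto_0[OF assms] psi.tendsto_0[OF assms]] by (simp add: double_phase_def)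
qed

lemma weight_measurable [measurable]: "weight \<in> borel_measurable borel"
  unfolding weight_def by measurable

lemma Phi_measurable:
  assumes [measurable]: "f \<in> borel_measurable borel"
  shows "(\<lambda>x. \<Phi> x (norm (f x :: real^2))) \<in> borel_measurable borel"
  using phi.norm_measurable[OF assms] psi.norm_measurable[OF assms] unfolding double_phase_def by measurable

lemma open_Omega: "open \<Omega>"
proof -
  have "\<Omega> = (\<Inter>i\<in>UNIV. {x. -1 < x $ i} \<inter> {x. x $ i < 1})" by (auto simp: \<Omega>_def)
  also have "open \<dots>"
  proof (intro open_INT ballI open_Int)
    show "open {x :: real^2. - 1 < x $ i}" "open {x :: real^2. x $ i < 1}" for i
      by (rule open_halfspace_component_gt_cart, rule open_halfspace_component_lt_cart)
  qed simp
  finally show ?thesis .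
qed

lemma Omega_measurable [measurable]: "\<Omega> \<in> sets borel"
  using open_Omega by (rule borel_open)

definition modular :: "(real^2 \<Rightarrow> real^2) \<Rightarrow> ennreal" where
  "modular G = (\<integral>\<^sup>+x. \<Phi> x (norm (G x)) * indicator \<Omega> x \<partial>lborel)"

lemma modular_lebesgue: "(\<integral>\<^sup>+x. \<Phi> x (norm (G x)) \<partial>lebesgue_on \<Omega>) = modular G"
  unfolding modular_def by (rule nn_integral_lebesgue_on_eq_lborel) (simp add: open_sets_lebesgue open_Omega)

lemma modular_cong:
  assumes "AE x in lebesgue. x \<in> \<Omega> \<longrightarrow> G x = H x"
  shows "modular G = modular H"
  unfolding modular_def nn_integral_completion[symmetric, of lborel]
  by (rule nn_integral_cong_AE) (use assms in \<open>eventually_elim, auto simp: indicator_def\<close>)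

lemma MO_norm_cong:
  fixes G H :: "real^2 \<Rightarrow> real^2"
  assumes "AE x in lebesgue. x \<in> \<Omega> \<longrightarrow> G x = H x"
  shows "MO_norm \<Phi> \<Omega> G = MO_norm \<Phi> \<Omega> H"
proof -
  have "modular (\<lambda>x. G x /\<^sub>R \<gamma>) = modular (\<lambda>x. H x /\<^sub>R \<gamma>)" for \<gamma>
    by (rule modular_cong) (use assms in \<open>eventually_elim, auto\<close>)
  then show ?thesis unfolding MO_norm_def modular_lebesgue by simp
qed

lemma modular_scale_bound:
  assumes "L \<ge> 0"
  shows "\<exists>C\<ge>0. \<forall>G. G \<in> borel_measurable borel \<longrightarrow> modular (\<lambda>x. L *\<^sub>R G x) \<le> ennreal C * modular G"
proof -
  obtain C where C: "C \<ge> 0" "\<And>t x. t \<ge> 0 \<Longrightarrow> \<Phi> x (L * t) \<le> ennreal C * \<Phi> x t" using Phi_scale_bound[OF assms] by blast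
  have "modular (\<lambda>x. L *\<^sub>R G x) \<le> ennreal C * modular G" if G: "G \<in> borel_measurable borel" for G
  proof -
    have m: "(\<lambda>x. \<Phi> x (norm (G x))) \<in> borel_measurable borel" by (rule Phi_measurable[OF G])
    have "modular (\<lambda>x. L *\<^sub>R G x) \<le> (\<integral>\<^sup>+x. ennreal C * (\<Phi> x (norm (G x)) * indicator \<Omega> x) \<partial>lborel)"
      unfolding modular_def using C(2) assms
      by (intro nn_integral_mono) (auto simp: indicator_def)
    also have "\<dots> = ennreal C * modular G"
      unfolding modular_def by (rule nn_integral_cmult) (use m in measurable)
    finally show ?thesis .
  qed
  then show ?thesis using C(1) by blast
qed

text \<open>A finite Luxemburg norm bounds the modular of some multiple of the function;
  \<open>Delta2\<close> undoes the scaling.\<close>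

lemma MO_space_modular_finite:
  assumes "G \<in> MO_space \<Phi> \<Omega>" and H: "H \<in> borel_measurable borel" "AE x in lebesgue. x \<in> \<Omega> \<longrightarrow> G x = H x"
  shows "modular H < \<infinity>"
proof -
  have "MO_norm \<Phi> \<Omega> H < \<infinity>" using assms(1) MO_norm_cong[OF H(2)] by (simp add: MO_space_def)
  then obtain \<gamma> where \<gamma>: "\<gamma> > 0" "modular (\<lambda>x. H x /\<^sub>R \<gamma>) \<le> 1"
    unfolding MO_norm_def modular_lebesgue by (force simp: Inf_less_iff)
  obtain C where C: "C \<ge> 0" "\<And>G. G \<in> borel_measurable borel \<Longrightarrow> modular (\<lambda>x. \<gamma> *\<^sub>R G x) \<le> ennreal C * modular G"
    using modular_scale_bound[of \<gamma>] \<gamma>(1) by auto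
  have "modular H = modular (\<lambda>x. \<gamma> *\<^sub>R (H x /\<^sub>R \<gamma>))" using \<gamma>(1) by simp
  also have "\<dots> \<le> ennreal C * modular (\<lambda>x. H x /\<^sub>R \<gamma>)" by (rule C(2)) (use H(1) in measurable)
  also have "\<dots> \<le> ennreal C * 1" by (intro mult_left_mono \<gamma>(2)) simp
  also have "\<dots> < \<infinity>" by simp
  finally show ?thesis .
qed

text \<open>Scaling by \<open>inverse \<gamma>\<close> costs only a factor \<open>C\<close>, so a
  modular below \<open>1 / (C + 1)\<close> gives a norm of at most \<open>\<gamma>\<close>. From
  here on density can be studied with modulars.\<close>

lemma modular_small_imp_norm_small:
  assumes "\<epsilon> > 0"
  shows "\<exists>\<delta>>0. \<forall>G. G \<in> borel_measurable borel \<longrightarrow> modular G \<le> ennreal \<delta> \<longrightarrow> MO_norm \<Phi> \<Omega> G < \<epsilon>"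
proof -
  obtain \<gamma>' where "0 < \<gamma>'" "\<gamma>' < \<epsilon>" using assms dense by blast
  then obtain \<gamma> where \<gamma>: "\<gamma> > 0" "ennreal \<gamma> < \<epsilon>" by (cases \<gamma>') auto
  obtain C where C: "C \<ge> 0" "\<And>G. G \<in> borel_measurable borel \<Longrightarrow> modular (\<lambda>x. inverse \<gamma> *\<^sub>R G x) \<le> ennreal C * modular G"
    using modular_scale_bound[of "inverse \<gamma>"] \<gamma>(1) by auto
  have "MO_norm \<Phi> \<Omega> G < \<epsilon>" if G: "G \<in> borel_measurable borel" "modular G \<le> ennreal (1 / (C + 1))" for G
  proof -
    have "modular (\<lambda>x. G x /\<^sub>R \<gamma>) \<le> ennreal C * modular G" by (rule C(2)[OF G(1)])
    also have "\<dots> \<le> ennreal C * ennreal (1 / (C + 1))" by (intro mult_left_mono G(2)) simp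
    also have "\<dots> = ennreal (C * (1 / (C + 1)))" by (rule ennreal_mult[symmetric]) (use C(1) in auto)
    also have "\<dots> \<le> ennreal 1" using C(1) by (intro ennreal_leI) simp
    finally have "MO_norm \<Phi> \<Omega> G \<le> ennreal \<gamma>"
      unfolding MO_norm_def modular_lebesgue using \<gamma>(1) by (intro Inf_lower) auto
    then show ?thesis using \<gamma>(2) by simp
  qed
  then show ?thesis using C(1) by (intro exI[of _ "1 / (C + 1)"]) auto
qed

text \<open>No function accompanies the field \<open>G\<close>: the norm of \<open>W_0\<close>
  involves gradients only, so approximating the gradient in modular is all that density
  requires.\<close>

definition approximable :: "(real^2 \<Rightarrow> real^2) \<Rightarrow> bool" where
  "approximable G \<longleftrightarrow> G \<in> borel_measurable borel \<and>
     (\<forall>\<epsilon>>0. \<exists>\<eta>\<in>test_functions \<Omega>. modular (\<lambda>x. G x - gradient \<eta> x) \<le> ennreal \<epsilon>)"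

lemma modular_quasi_add:
  "\<exists>C\<ge>0. \<forall>F G H. F \<in> borel_measurable borel \<longrightarrow> G \<in> borel_measurable borel \<longrightarrow> H \<in> borel_measurable borel \<longrightarrow>
     (\<forall>x. norm (F x) \<le> norm (G x) + norm (H x)) \<longrightarrow> modular F \<le> ennreal C * (modular G + modular H)"
proof -
  obtain C where C: "C \<ge> 0" "\<And>x s t. s \<ge> 0 \<Longrightarrow> t \<ge> 0 \<Longrightarrow> \<Phi> x (s + t) \<le> ennreal C * (\<Phi> x s + \<Phi> x t)"
    using Phi_quasi_add by blast
  have "modular F \<le> ennreal C * (modular G + modular H)"
    if m: "F \<in> borel_measurable borel" "G \<in> borel_measurable borel" "H \<in> borel_measurable borel"
      and le: "\<And>x. norm (F x) \<le> norm (G x) + norm (H x)" for F G H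
  proof -
    note Phi_measurable[OF m(2), measurable] Phi_measurable[OF m(3), measurable]
    have "modular F \<le> (\<integral>\<^sup>+x. ennreal C * (\<Phi> x (norm (G x)) * indicator \<Omega> x + \<Phi> x (norm (H x)) * indicator \<Omega> x) \<partial>lborel)"
      unfolding modular_def
    proof (rule nn_integral_mono)
      fix x
      have "\<Phi> x (norm (F x)) \<le> ennreal C * (\<Phi> x (norm (G x)) + \<Phi> x (norm (H x)))"
        by (rule order_trans[OF Phi_mono[OF norm_ge_zero le] C(2)]) auto
      then show "\<Phi> x (norm (F x)) * indicator \<Omega> x \<le>
          ennreal C * (\<Phi> x (norm (G x)) * indicator \<Omega> x + \<Phi> x (norm (H x)) * indicator \<Omega> x)"
        by (cases "x \<in> \<Omega>") simp_all
    qed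
    also have "\<dots> = ennreal C * (modular G + modular H)"
      unfolding modular_def by (simp add: nn_integral_cmult nn_integral_add)
    finally show ?thesis .
  qed
  then show ?thesis using C(1) by blast
qed

lemma test_gradient_measurable:
  "\<eta> \<in> test_functions S \<Longrightarrow> gradient \<eta> \<in> borel_measurable borel"
  using C1cD(7)[OF test_functions_C1c] .

lemma approximable_closed:
  assumes G: "G \<in> borel_measurable borel"
    and app: "\<And>\<epsilon>. \<epsilon> > 0 \<Longrightarrow> \<exists>H. approximable H \<and> modular (\<lambda>x. G x - H x) \<le> ennreal \<epsilon>"
  shows "approximable G"
  unfolding approximable_def
proof (intro conjI allI impI G)
  fix \<epsilon> :: real assume "\<epsilon> > 0"
  obtain C where C: "C \<ge> 0" and qa: "\<forall>F G H. F \<in> borel_measurable borel \<longrightarrow> G \<in> borel_measurable borel \<longrightarrow> H \<in> borel_measurable borel \<longrightarrow>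
     (\<forall>x. norm (F x) \<le> norm (G x) + norm (H x)) \<longrightarrow> modular F \<le> ennreal C * (modular G + modular H)"
    using modular_quasi_add by blast
  define \<delta> where "\<delta> = \<epsilon> / (2 * (C + 1))"
  have \<delta>: "\<delta> > 0" "C * (\<delta> + \<delta>) \<le> \<epsilon>"
  proof -
    show "\<delta> > 0" using \<open>\<epsilon> > 0\<close> C by (simp add: \<delta>_def)
    have "\<delta> * (2 * (C + 1)) = \<epsilon>" using C by (simp add: \<delta>_def)
    then show "C * (\<delta> + \<delta>) \<le> \<epsilon>" using \<open>\<delta> > 0\<close> by (simp add: algebra_simps)
  qed
  obtain H where H: "approximable H" and 1: "modular (\<lambda>x. G x - H x) \<le> ennreal \<delta>" using app[OF \<delta>(1)] by blast
  have Hm: "H \<in> borel_measurable borel" using H by (simp add: approximable_def)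
  obtain \<eta> where \<eta>: "\<eta> \<in> test_functions \<Omega>" and 2: "modular (\<lambda>x. H x - gradient \<eta> x) \<le> ennreal \<delta>"
    using H \<delta>(1) by (auto simp: approximable_def)
  note gm = test_gradient_measurable[OF \<eta>]
  have tri: "norm (G x - gradient \<eta> x) \<le> norm (G x - H x) + norm (H x - gradient \<eta> x)" for x
    using norm_triangle_ineq[of "G x - H x" "H x - gradient \<eta> x"] by simp
  have "modular (\<lambda>x. G x - gradient \<eta> x) \<le> ennreal C * (modular (\<lambda>x. G x - H x) + modular (\<lambda>x. H x - gradient \<eta> x))"
    using qa[rule_format, of "\<lambda>x. G x - gradient \<eta> x" "\<lambda>x. G x - H x" "\<lambda>x. H x - gradient \<eta> x"] tri G Hm gm by simp
  also have "\<dots> \<le> ennreal C * (ennreal \<delta> + ennreal \<delta>)" by (intro mult_left_mono add_mono 1 2) simp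
  also have "\<dots> = ennreal (C * (\<delta> + \<delta>))" using C \<delta>(1) by (simp add: ennreal_mult flip: ennreal_plus)
  also have "\<dots> \<le> ennreal \<epsilon>" using \<delta>(2) by (rule ennreal_leI)
  finally show "\<exists>\<eta>\<in>test_functions \<Omega>. modular (\<lambda>x. G x - gradient \<eta> x) \<le> ennreal \<epsilon>" using \<eta> by blast
qed

text \<open>The common tool for discarding part of a gradient: the multiplied field is dominated in
  modular by \<open>G\<close> itself. It serves the truncation as well as the cutoffs of both
  cases.\<close>

lemma modular_multiplier_tendsto_0:
  assumes G: "G \<in> borel_measurable borel" "modular G < \<infinity>"
    and q: "\<And>n. q n \<in> borel_measurable borel" "\<And>n x. \<bar>q n x\<bar> \<le> 1"
    and lim: "AE x in lborel. (\<lambda>n. norm (q n x *\<^sub>R G x)) \<longlonglongrightarrow> 0"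
  shows "(\<lambda>n. modular (\<lambda>x. q n x *\<^sub>R G x)) \<longlonglongrightarrow> 0"
proof -
  note G(1)[measurable] q(1)[measurable]
  have "(\<lambda>n. \<integral>\<^sup>+x. \<Phi> x (norm (q n x *\<^sub>R G x)) * indicator \<Omega> x \<partial>lborel) \<longlonglongrightarrow> (\<integral>\<^sup>+x. (0::ennreal) \<partial>(lborel :: (real^2) measure))"
  proof (rule nn_integral_dominated_convergence[where w="\<lambda>x. \<Phi> x (norm (G x)) * indicator \<Omega> x"])
    have "(\<lambda>x. q n x *\<^sub>R G x) \<in> borel_measurable borel" for n by measurable
    note Phi_measurable[OF this, measurable] Phi_measurable[OF G(1), measurable]
    show "(\<lambda>x. \<Phi> x (norm (q n x *\<^sub>R G x)) * indicator \<Omega> x) \<in> borel_measurable lborel" for n by measurable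
    show "(\<lambda>x. \<Phi> x (norm (G x)) * indicator \<Omega> x) \<in> borel_measurable lborel" by measurable
    show "(\<integral>\<^sup>+x. \<Phi> x (norm (G x)) * indicator \<Omega> x \<partial>lborel) < \<infinity>" using G(2) by (simp add: modular_def)
    show "AE x in lborel. \<Phi> x (norm (q n x *\<^sub>R G x)) * indicator \<Omega> x \<le> \<Phi> x (norm (G x)) * indicator \<Omega> x" for n
      using mult_right_mono[OF q(2) norm_ge_zero] by (intro AE_I2 mult_right_mono Phi_mono) auto
    show "AE x in lborel. (\<lambda>n. \<Phi> x (norm (q n x *\<^sub>R G x)) * indicator \<Omega> x) \<longlonglongrightarrow> 0"
      using lim
    proof eventually_elim
      case (elim x)
      have "(\<lambda>n. \<Phi> x (norm (q n x *\<^sub>R G x))) \<longlonglongrightarrow> 0" by (rule Phi_tendsto_0[OF norm_ge_zero elim])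
      then show ?case by (cases "x \<in> \<Omega>") simp_all
    qed
  qed simp
  then show ?thesis by (simp add: modular_def)
qed

lemma arctan_truncation_derivative:
  assumes "N > 0"
  shows "((\<lambda>t. N * arctan (t / N)) has_real_derivative inverse (1 + (t / N)\<^sup>2)) (at t)"
proof -
  have "((\<lambda>t. t / N) has_real_derivative 1 / N) (at t)" by (rule DERIV_cdivide[OF DERIV_ident])
  from DERIV_cmult[OF DERIV_chain2[OF DERIV_arctan this], of N]
  show ?thesis using assms by simp
qed

text \<open>\<open>N * arctan (t / N)\<close> is a truncation whose derivative lies between 0 and 1
  and tends to 1 with growing \<open>N\<close>, so the gradient changes little in modular. Both
  kinds of bound are handed on: case (1) works with the pointwise bound on \<open>v\<close>, case
  (2) with the range of the approximants.\<close>

lemma approximable_of_bounded: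
  assumes s: "sob \<Omega> UNIV u G" and fin: "modular G < \<infinity>"
    and bdd: "\<And>v H M. sob \<Omega> {-M..M} v H \<Longrightarrow> (\<And>x. \<bar>v x\<bar> \<le> M) \<Longrightarrow> modular H < \<infinity> \<Longrightarrow> approximable H"
  shows "approximable G"
proof (rule approximable_closed)
  note m = sob_measurable[OF s]
  note m[measurable]
  show "G \<in> borel_measurable borel" by measurable
  define d where "d n t = inverse (1 + (t / real (Suc n))\<^sup>2)" for n t
  have d01: "0 < d n t" "d n t \<le> 1" for n t
  proof -
    have "1 \<le> 1 + (t / real (Suc n))\<^sup>2" by simp
    then have "0 < 1 + (t / real (Suc n))\<^sup>2" by linarith
    then show "0 < d n t" unfolding d_def by (rule positive_imp_inverse_positive)
    show "d n t \<le> 1" unfolding d_def using \<open>1 \<le> 1 + (t / real (Suc n))\<^sup>2\<close> by (rule inverse_le_1_iff[THEN iffD2, OF disjI2])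
  qed
  have dc: "continuous_on UNIV (d n)" for n
  proof -
    have "1 + (t / real (Suc n))\<^sup>2 \<noteq> 0" for t
      using zero_le_power2[of "t / real (Suc n)"] by linarith
    then show ?thesis unfolding d_def by (intro continuous_intros) simp_all
  qed
  then have dm [measurable]: "d n \<in> borel_measurable borel" for n by (rule borel_measurable_continuous_onI)
  have dlim: "(\<lambda>n. d n t) \<longlonglongrightarrow> 1" for t
  proof -
    have "(\<lambda>n. t * inverse (real (Suc n))) \<longlonglongrightarrow> t * 0" by (intro tendsto_intros LIMSEQ_inverse_real_of_nat)
    then have "(\<lambda>n. inverse (1 + (t / real (Suc n))\<^sup>2)) \<longlonglongrightarrow> inverse (1 + (t * 0)\<^sup>2)"
      unfolding divide_inverse by (intro tendsto_inverse tendsto_add tendsto_const tendsto_power) simp_all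
    then show ?thesis by (simp add: d_def)
  qed
  have "(\<lambda>n. modular (\<lambda>x. (1 - d n (u x)) *\<^sub>R G x)) \<longlonglongrightarrow> 0"
  proof (rule modular_multiplier_tendsto_0[OF _ fin])
    show "(\<lambda>x. 1 - d n (u x)) \<in> borel_measurable borel" for n by measurable
    show "\<bar>1 - d n (u x)\<bar> \<le> 1" for n x using d01[of n "u x"] by simp
    have "(\<lambda>n. norm ((1 - d n (u x)) *\<^sub>R G x)) \<longlonglongrightarrow> norm ((1 - 1) *\<^sub>R G x)" for x
      by (intro tendsto_intros dlim)
    then show "AE x in lborel. (\<lambda>n. norm ((1 - d n (u x)) *\<^sub>R G x)) \<longlonglongrightarrow> 0" by simp
  qed measurable
  note lim = this
  fix \<epsilon> :: real assume "\<epsilon> > 0"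
  then have "\<forall>\<^sub>F n in sequentially. modular (\<lambda>x. (1 - d n (u x)) *\<^sub>R G x) < ennreal \<epsilon>"
    using order_tendstoD(2)[OF lim, of "ennreal \<epsilon>"] by simp
  then obtain n where n: "modular (\<lambda>x. (1 - d n (u x)) *\<^sub>R G x) < ennreal \<epsilon>"
    by (meson eventually_sequentially order_refl)
  define N where "N = real (Suc n)"
  define H where "H x = d n (u x) *\<^sub>R G x" for x
  have N: "N > 0" by (simp add: N_def)
  have "sob \<Omega> ((\<lambda>t. N * arctan (t / N)) ` UNIV) (\<lambda>x. N * arctan (u x / N)) H"
    unfolding H_def
  proof (rule sob_compose[OF s])
    show "((\<lambda>t. N * arctan (t / N)) has_real_derivative d n t) (at t)" for t
      using arctan_truncation_derivative[OF N, of t] by (simp add: d_def N_def)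
    show "\<bar>d n t\<bar> \<le> 1" for t using d01[of n t] by simp
  qed (use dc in simp_all)
  moreover have bd: "\<bar>N * arctan t\<bar> \<le> N * 2" for t
  proof -
    have "\<bar>arctan t\<bar> \<le> 2" using arctan_bounded[of t] pi_half_less_two by auto
    then show ?thesis using N by (simp add: abs_mult)
  qed
  ultimately have "sob \<Omega> {-(N * 2)..N * 2} (\<lambda>x. N * arctan (u x / N)) H"
    by (elim sob_mono) (use bd in \<open>auto simp: abs_le_iff minus_le_iff[of "N * 2"]\<close>)
  moreover have "modular H < \<infinity>"
  proof (rule order_le_less_trans[OF _ fin])
    show "modular H \<le> modular G" unfolding modular_def H_def
      using d01 by (intro nn_integral_mono mult_right_mono Phi_mono) (auto simp: mult_left_le_one_le less_imp_le)
  qed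
  ultimately have "approximable H" using bdd[of "N * 2"] bd by blast
  moreover have "(\<lambda>x. G x - H x) = (\<lambda>x. (1 - d n (u x)) *\<^sub>R G x)" by (simp add: H_def scaleR_diff_left)
  ultimately show "\<exists>H. approximable H \<and> modular (\<lambda>x. G x - H x) \<le> ennreal \<epsilon>"
    using n by (intro exI[of _ H]) (simp add: less_imp_le)
qed

text \<open>Passing to a Borel representative of the weak gradient turns density into a statement on
  modulars; almost everywhere identities carry the approximation back to the norm of
  \<open>w x - \<eta> x\<close>.\<close>

lemma H_0_eq_W_0:
  assumes app: "\<And>v G. sob \<Omega> UNIV v G \<Longrightarrow> modular G < \<infinity> \<Longrightarrow> approximable G"
  shows "H_0 \<Phi> \<Omega> = W_0 \<Phi> \<Omega>"
proof
  show "H_0 \<Phi> \<Omega> \<subseteq> W_0 \<Phi> \<Omega>" by (auto simp: H_0_def)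
  show "W_0 \<Phi> \<Omega> \<subseteq> H_0 \<Phi> \<Omega>"
  proof
    fix w assume w: "w \<in> W_0 \<Phi> \<Omega>"
    then have w1: "w \<in> W11_0 \<Omega>" and wM: "weak_gradient \<Omega> w \<in> MO_space \<Phi> \<Omega>" by (auto simp: W_0_def)
    obtain v G where hw: "has_weak_gradient \<Omega> w (weak_gradient \<Omega> w)" and s: "sob \<Omega> UNIV v G"
        and ae: "AE x in lebesgue. x \<in> \<Omega> \<longrightarrow> weak_gradient \<Omega> w x = G x"
      by (rule W11_0_imp_sob[OF open_Omega w1])
    have Gm: "G \<in> borel_measurable borel" by (rule sob_measurable[OF s])
    have A: "approximable G"
      by (rule app[OF s MO_space_modular_finite[OF wM Gm ae]])
    have "\<exists>\<eta>\<in>test_functions \<Omega>. W_0_norm \<Phi> \<Omega> (\<lambda>x. w x - \<eta> x) < \<epsilon>" if "\<epsilon> > 0" for \<epsilon>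
    proof -
      obtain \<delta> where \<delta>: "\<delta> > 0" "\<And>G. G \<in> borel_measurable borel \<Longrightarrow> modular G \<le> ennreal \<delta> \<Longrightarrow> MO_norm \<Phi> \<Omega> G < \<epsilon>"
        using modular_small_imp_norm_small[OF \<open>\<epsilon> > 0\<close>] by blast
      obtain \<eta> where \<eta>: "\<eta> \<in> test_functions \<Omega>" "modular (\<lambda>x. G x - gradient \<eta> x) \<le> ennreal \<delta>"
        using A \<delta>(1) by (auto simp: approximable_def)
      have "AE x in lebesgue. x \<in> \<Omega> \<longrightarrow> weak_gradient \<Omega> (\<lambda>x. w x - \<eta> x) x = G x - gradient \<eta> x"
        using weak_gradient_diff_test_function[OF open_Omega hw \<eta>(1)] ae by eventually_elim simp
      then have "W_0_norm \<Phi> \<Omega> (\<lambda>x. w x - \<eta> x) = MO_norm \<Phi> \<Omega> (\<lambda>x. G x - gradient \<eta> x)"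
        unfolding W_0_norm_def by (rule MO_norm_cong)
      also have "\<dots> < \<epsilon>"
        by (rule \<delta>(2)[OF _ \<eta>(2)]) (use Gm test_gradient_measurable[OF \<eta>(1)] in measurable)
      finally show ?thesis using \<eta>(1) by blast
    qed
    then show "w \<in> H_0 \<Phi> \<Omega>" using w by (simp add: H_0_def)
  qed
qed

end

section \<open>Mollification away from the origin\<close>

text \<open>The bound \<open>q + d n\<close> varies with \<open>n\<close>, but \<open>d n\<close> is
  small in L1. The minimum of \<open>h n\<close> and \<open>q\<close> is dominated by the fixed
  \<open>q\<close>, and what the minimum cuts off is at most \<open>d n\<close>.\<close>

lemma nn_integral_tendsto_0_perturbed_domination:
  fixes h d :: "nat \<Rightarrow> 'a \<Rightarrow> ennreal"
  assumes [measurable]: "\<And>n. h n \<in> borel_measurable M" "q \<in> borel_measurable M" "\<And>n. d n \<in> borel_measurable M"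
    and le: "\<And>n x. h n x \<le> q x + d n x" and q: "(\<integral>\<^sup>+x. q x \<partial>M) < \<infinity>"
    and d: "(\<lambda>n. \<integral>\<^sup>+x. d n x \<partial>M) \<longlonglongrightarrow> 0" and h: "AE x in M. (\<lambda>n. h n x) \<longlonglongrightarrow> 0"
  shows "(\<lambda>n. \<integral>\<^sup>+x. h n x \<partial>M) \<longlonglongrightarrow> 0"
proof -
  have "(\<lambda>n. \<integral>\<^sup>+x. min (h n x) (q x) \<partial>M) \<longlonglongrightarrow> (\<integral>\<^sup>+x. (0::ennreal) \<partial>M)"
  proof (rule nn_integral_dominated_convergence[where w=q])
    show "AE x in M. (\<lambda>n. min (h n x) (q x)) \<longlonglongrightarrow> 0"
      using h
    proof eventually_elim
      case (elim x)
      show ?case by (rule tendsto_sandwich[OF _ _ tendsto_const elim]) simp_all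
    qed
  qed (use q in simp_all)
  from tendsto_add[OF this d]
  have lim: "(\<lambda>n. (\<integral>\<^sup>+x. min (h n x) (q x) \<partial>M) + (\<integral>\<^sup>+x. d n x \<partial>M)) \<longlonglongrightarrow> 0" by simp
  have "(\<integral>\<^sup>+x. h n x \<partial>M) \<le> (\<integral>\<^sup>+x. min (h n x) (q x) \<partial>M) + (\<integral>\<^sup>+x. d n x \<partial>M)" for n
  proof -
    have "(\<integral>\<^sup>+x. h n x \<partial>M) \<le> (\<integral>\<^sup>+x. min (h n x) (q x) + d n x \<partial>M)"
    proof (rule nn_integral_mono)
      fix x
      show "h n x \<le> min (h n x) (q x) + d n x" using le[of n x] by (auto simp: min_def)
    qed
    also have "\<dots> = (\<integral>\<^sup>+x. min (h n x) (q x) \<partial>M) + (\<integral>\<^sup>+x. d n x \<partial>M)"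
      by (rule nn_integral_add) measurable
    finally show ?thesis .
  qed
  then show ?thesis by (intro tendsto_sandwich[OF _ _ tendsto_const lim]) simp_all
qed

text \<open>The second axis is the one inside \<open>{\<bar>x\<^sub>1\<bar> < \<bar>x\<^sub>2\<bar>}\<close>, hence the larger factor there.\<close>

definition stretch :: "real \<Rightarrow> real^2 \<Rightarrow> real" where
  "stretch \<sigma> j = (if j = axis 1 1 then 1 + \<sigma> else 1 + 2 * \<sigma>)"

lemma diag_stretch_nth:
  "diag (stretch \<sigma>) x $ 1 = (1 + \<sigma>) * x $ 1" "diag (stretch \<sigma>) x $ 2 = (1 + 2 * \<sigma>) * x $ 2"
  by (simp_all add: cart_eq_inner_axis stretch_def axis_eq_axis axis_in_Basis_iff)

text \<open>The dilation raises the difference of \<open>\<bar>x $ 2\<bar>\<close> and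
  \<open>\<bar>x $ 1\<bar>\<close> by at least \<open>\<sigma> * \<bar>x $ 2\<bar>\<close>, while
  the kernel perturbs each coordinate by less than \<open>e\<close>. As \<open>y\<close> has
  distance at least \<open>r\<close> from the origin, \<open>\<bar>x $ 2\<bar>\<close> is bounded
  below by a multiple of \<open>r\<close>, and the divisor 20 in \<open>e\<close> keeps the gain
  above \<open>2 * e\<close>.\<close>

lemma stretch_preserves_weight:
  assumes r: "0 < r" and \<sigma>: "0 < \<sigma>" "\<sigma> \<le> 1" and e: "e = \<sigma> * r / 20"
    and x: "weight x = 1" and y: "norm (diag (stretch \<sigma>) x - y) < e" "r \<le> norm y"
  shows "weight y = 1"
proof -
  have x12: "\<bar>x $ 1\<bar> < \<bar>x $ 2\<bar>" using x by (simp add: weight_def split: if_splits)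
  have e0: "e > 0" using r \<sigma> by (simp add: e)
  have c1: "\<bar>(1 + \<sigma>) * x $ 1 - y $ 1\<bar> < e"
    using component_le_norm_cart[of "diag (stretch \<sigma>) x - y" 1] y(1) by (simp add: diag_stretch_nth)
  have c2: "\<bar>(1 + 2 * \<sigma>) * x $ 2 - y $ 2\<bar> < e"
    using component_le_norm_cart[of "diag (stretch \<sigma>) x - y" 2] y(1) by (simp add: diag_stretch_nth)
  have a1: "\<bar>(1 + \<sigma>) * x $ 1\<bar> = \<bar>x $ 1\<bar> + \<sigma> * \<bar>x $ 1\<bar>"
    unfolding abs_mult using \<sigma> by (simp add: distrib_right)
  have a2: "\<bar>(1 + 2 * \<sigma>) * x $ 2\<bar> = \<bar>x $ 2\<bar> + 2 * (\<sigma> * \<bar>x $ 2\<bar>)"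
    unfolding abs_mult using \<sigma> by (simp add: distrib_right)
  have s12: "\<sigma> * \<bar>x $ 1\<bar> \<le> \<sigma> * \<bar>x $ 2\<bar>" using x12 \<sigma> by (intro mult_left_mono) auto
  have s2: "\<sigma> * \<bar>x $ 2\<bar> \<le> \<bar>x $ 2\<bar>" using \<sigma> by (simp add: mult_left_le_one_le)
  have "norm y \<le> \<bar>y $ 1\<bar> + \<bar>y $ 2\<bar>" using norm_le_l1_cart[of y] by (simp add: sum_2)
  then have "r \<le> 5 * \<bar>x $ 2\<bar> + 2 * e" using y(2) c1 c2 a1 a2 s12 s2 x12 by linarith
  then have "\<sigma> * r \<le> \<sigma> * (5 * \<bar>x $ 2\<bar> + 2 * e)" using \<sigma> by (intro mult_left_mono) auto
  then have "\<sigma> * r \<le> 5 * (\<sigma> * \<bar>x $ 2\<bar>) + 2 * (\<sigma> * e)" by (simp add: algebra_simps)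
  moreover have "\<sigma> * e \<le> e" using \<sigma> e0 by (simp add: mult_left_le_one_le)
  moreover have "\<sigma> * r = 20 * e" by (simp add: e)
  ultimately have "2 * e < \<sigma> * \<bar>x $ 2\<bar>" using e0 by linarith
  then have "\<bar>y $ 1\<bar> < \<bar>y $ 2\<bar>" using c1 c2 a1 a2 s12 x12 by linarith
  then show ?thesis by (simp add: weight_def)
qed

text \<open>Every dilation factor is at least \<open>1 + \<sigma>\<close> and the kernel radius
  \<open>e\<close> is below \<open>\<sigma>\<close>, so the result lives in the square of half side
  \<open>q < 1\<close>: the dilation that protects the weight also creates the compact
  support.\<close>

lemma stretched_conv_test_function:
  assumes w: "integrable lborel w" "\<And>x. x \<notin> \<Omega> \<Longrightarrow> w x = 0" and K: "mollifier e K"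
    and \<sigma>: "0 < \<sigma>" "e < \<sigma>" "0 < e"
  shows "(\<lambda>x. conv w K (diag (stretch \<sigma>) x)) \<in> test_functions \<Omega>"
proof -
  define q where "q = (1 + e) / (1 + \<sigma>)"
  have q: "0 < q" "q < 1" "(1 + \<sigma>) * q = 1 + e" using \<sigma> by (auto simp: q_def)
  show ?thesis
  proof (rule test_functionsI[where K="cbox (\<chi> i. - q) (\<chi> i. q)"])
    fix k
    have "Ck k (\<lambda>x. 1 * conv w K (0 + diag (stretch \<sigma>) x))"
      by (rule Ck_diag_compose[OF conv_Ck[OF w(1) mollifierD(6)[OF K]]])
    then show "Ck k (\<lambda>x. conv w K (diag (stretch \<sigma>) x))" by simp
  next
    show "cbox (\<chi> i. - q) (\<chi> i. q) \<subseteq> \<Omega>"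
    proof
      fix x :: "real^2" assume "x \<in> cbox (\<chi> i. - q) (\<chi> i. q)"
      then have "- q \<le> x $ i" "x $ i \<le> q" for i by (simp_all add: mem_box_cart)
      then have "-1 < x $ i \<and> x $ i < 1" for i using q(2) by (meson le_less_trans less_le_trans neg_less_iff_less)
      then show "x \<in> \<Omega>" by (simp add: \<Omega>_def)
    qed
  next
    fix x :: "real^2" assume "x \<notin> cbox (\<chi> i. - q) (\<chi> i. q)"
    then obtain i where "x $ i < - q \<or> q < x $ i" by (auto simp: mem_box_cart not_le)
    then have i: "q < \<bar>x $ i\<bar>" by auto
    have "1 + e < \<bar>diag (stretch \<sigma>) x $ i\<bar>"
    proof -
      have "(1 + \<sigma>) * q < (1 + \<sigma>) * \<bar>x $ i\<bar>" using i \<sigma> by (intro mult_strict_left_mono) auto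
      moreover have "(1 + \<sigma>) * \<bar>x $ i\<bar> \<le> \<bar>diag (stretch \<sigma>) x $ i\<bar>"
      proof -
        have "i = 1 \<or> i = 2" by (rule exhaust_2)
        then show ?thesis using \<sigma>(1) by (auto simp: diag_stretch_nth abs_mult intro!: mult_right_mono)
      qed
      ultimately show ?thesis using q(3) by linarith
    qed
    note far = this
    have "\<bar>conv w K (diag (stretch \<sigma>) x) - 0\<bar> \<le> 0"
    proof (rule conv_mollifier_near[OF K w(1)])
      fix y assume "norm (diag (stretch \<sigma>) x - y) < e"
      then have "\<bar>diag (stretch \<sigma>) x $ i - y $ i\<bar> < e"
        using component_le_norm_cart[of "diag (stretch \<sigma>) x - y" i] by simp
      then have "1 < \<bar>y $ i\<bar>" using far by linarith
      then have "\<not> (-1 < y $ i \<and> y $ i < 1)" by linarith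
      then have "y \<notin> \<Omega>" unfolding \<Omega>_def by blast
      then show "\<bar>w y - 0\<bar> \<le> 0" using w(2) by simp
    qed
    then show "conv w K (diag (stretch \<sigma>) x) = 0" by simp
  qed (rule compact_cbox)
qed

context double_phase_functions
begin

text \<open>Jensen's inequality with the kernel as density. The \<open>\<psi>\<close> part is
  estimated only where \<open>x\<close> has weight 1, and there the kernel sees nothing but points
  of weight 1 and points where \<open>G\<close> vanishes. The factor 3 bounds the dilation factors
  that the chain rule puts in front of the gradient.\<close>

lemma Phi_stretched_gradient_le:
  assumes s: "sob \<Omega> A w G" and r: "r > 0" "\<And>x. norm x < r \<Longrightarrow> G x = 0"
    and b: "integrable lborel (\<lambda>y. phi.r (norm (G y)) + weight y * psi.r (norm (G y)))" (is "integrable lborel ?b")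
    and \<sigma>: "0 < \<sigma>" "\<sigma> \<le> 1" and e: "e = \<sigma> * r / 20" and K: "mollifier e K"
    and C: "C \<ge> 0" "\<And>x t. t \<ge> 0 \<Longrightarrow> \<Phi> x (3 * t) \<le> ennreal C * \<Phi> x t"
  shows "\<Phi> x (norm (diag (stretch \<sigma>) (conv w (gradient K) (diag (stretch \<sigma>) x))))
    \<le> ennreal C * ennreal (conv ?b K (diag (stretch \<sigma>) x))"
proof -
  define p where "p = diag (stretch \<sigma>) x"
  define v where "v = conv w (gradient K) p"
  note m = sob_measurable(2)[OF s]
  note m[measurable]
  have Km [measurable]: "K \<in> borel_measurable borel" by (rule mollifierD(8)[OF K])
  have Gi: "integrable lborel G" by (rule sob_integrable(2)[OF s])
  have gi: "integrable lborel (\<lambda>y. norm (G y))" using Gi by simp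
  have ki: "integrable lborel (\<lambda>y. norm (G y) * K (p - y))" using mollifier_integrable[OF K gi, of p] by simp
  have k1: "integrable lborel (\<lambda>y. K (p - y))" "(\<integral>y. K (p - y) \<partial>lborel) = 1"
  proof -
    have one: "(\<integral>y. K (p - y) \<partial>lborel) = 1" using integral_reflect[OF Km] mollifierD(5)[OF K] by simp
    then show "(\<integral>y. K (p - y) \<partial>lborel) = 1" .
    show "integrable lborel (\<lambda>y. K (p - y))" using one not_integrable_integral_eq by fastforce
  qed
  define mm where "mm = (\<integral>y. norm (G y) * K (p - y) \<partial>lborel)"
  have mm: "mm \<ge> 0" unfolding mm_def using mollifierD(2)[OF K] by simp
  have vle: "norm v \<le> mm"
  proof -
    have i: "integrable lborel (\<lambda>y. K (p - y) *\<^sub>R G y)"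
      by (rule Bochner_Integration.integrable_bound[OF ki]) (use mollifierD(2)[OF K] in \<open>auto simp: mult.commute\<close>)
    have "v = (\<integral>y. K (p - y) *\<^sub>R G y \<partial>lborel)"
    proof (rule euclidean_eqI)
      fix j :: "real^2" assume j: "j \<in> Basis"
      have "v \<bullet> j = conv (\<lambda>y. G y \<bullet> j) K p" unfolding v_def by (rule conv_gradient_mollifier[OF s K j])
      also have "\<dots> = (\<integral>y. (K (p - y) *\<^sub>R G y) \<bullet> j \<partial>lborel)" by (simp add: conv_def mult.commute)
      also have "\<dots> = (\<integral>y. K (p - y) *\<^sub>R G y \<partial>lborel) \<bullet> j" by (rule integral_inner_left) (rule i)
      finally show "v \<bullet> j = (\<integral>y. K (p - y) *\<^sub>R G y \<partial>lborel) \<bullet> j" .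
    qed
    also have "norm \<dots> \<le> (\<integral>y. norm (K (p - y) *\<^sub>R G y) \<partial>lborel)" by (rule integral_norm_bound)
    also have "\<dots> = mm" unfolding mm_def using mollifierD(2)[OF K] by (simp add: mult.commute)
    finally show ?thesis .
  qed
  have dle: "norm (diag (stretch \<sigma>) v) \<le> 3 * norm v"
  proof -
    have "norm (diag (stretch \<sigma>) v) \<le> norm (3 *\<^sub>R v)"
    proof (rule norm_le_componentwise)
      fix j :: "real^2" assume "j \<in> Basis"
      moreover have "\<bar>stretch \<sigma> j\<bar> \<le> 3" using \<sigma> by (simp add: stretch_def)
      ultimately show "\<bar>diag (stretch \<sigma>) v \<bullet> j\<bar> \<le> \<bar>3 *\<^sub>R v \<bullet> j\<bar>"
        by (simp add: abs_mult mult_right_mono)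
    qed
    then show ?thesis by simp
  qed
  have bi: "integrable lborel (\<lambda>y. ?b y * K (p - y))" using mollifier_integrable[OF K b, of p] by simp
  have ri: "integrable lborel (\<lambda>y. phi.r (norm (G y)) * K (p - y))"
  proof (rule Bochner_Integration.integrable_bound[OF bi])
    show "AE y in lborel. norm (phi.r (norm (G y)) * K (p - y)) \<le> norm (?b y * K (p - y))"
      using mollifierD(2)[OF K] phi.r_nonneg psi.r_nonneg
      by (intro AE_I2) (auto simp: weight_def intro!: mult_right_mono)
  qed measurable
  have J1: "phi.r mm \<le> (\<integral>y. phi.r (norm (G y)) * K (p - y) \<partial>lborel)"
    unfolding mm_def by (rule phi.jensen[OF mollifierD(2)[OF K] k1 norm_ge_zero ki ri])
  have main: "phi.r mm + weight x * psi.r mm \<le> conv ?b K p"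
  proof (cases "weight x = 1")
    case False
    then have "weight x = 0" using weight_cases[of x] by simp
    moreover have "(\<integral>y. phi.r (norm (G y)) * K (p - y) \<partial>lborel) \<le> (\<integral>y. ?b y * K (p - y) \<partial>lborel)"
      using mollifierD(2)[OF K] psi.r_nonneg
      by (intro integral_mono ri bi mult_right_mono) (auto simp: weight_def)
    ultimately show ?thesis using J1 by (simp add: conv_def)
  next
    case True
    have sec: "?b y * K (p - y) = phi.r (norm (G y)) * K (p - y) + psi.r (norm (G y)) * K (p - y)" for y
    proof (cases "norm (p - y) < e \<and> r \<le> norm y")
      case True
      then have "weight y = 1"
        using stretch_preserves_weight[OF r(1) \<sigma> e \<open>weight x = 1\<close>, of y] by (simp add: p_def)
      then show ?thesis by (simp add: distrib_right)
    next
      case False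
      then have "K (p - y) = 0 \<or> G y = 0" using mollifierD(3)[OF K, of "p - y"] r(2)[of y] by force
      then show ?thesis by (auto simp: psi.r_zero distrib_right)
    qed
    have "integrable lborel (\<lambda>y. ?b y * K (p - y) - phi.r (norm (G y)) * K (p - y))"
      by (rule Bochner_Integration.integrable_diff[OF bi ri])
    then have pi: "integrable lborel (\<lambda>y. psi.r (norm (G y)) * K (p - y))" by (simp add: sec)
    have "psi.r mm \<le> (\<integral>y. psi.r (norm (G y)) * K (p - y) \<partial>lborel)"
      unfolding mm_def by (rule psi.jensen[OF mollifierD(2)[OF K] k1 norm_ge_zero ki pi])
    moreover have "conv ?b K p = (\<integral>y. phi.r (norm (G y)) * K (p - y) \<partial>lborel) + (\<integral>y. psi.r (norm (G y)) * K (p - y) \<partial>lborel)"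
      using ri pi by (simp add: conv_def sec)
    ultimately show ?thesis using J1 True by simp
  qed
  have "\<Phi> x (norm (diag (stretch \<sigma>) v)) \<le> \<Phi> x (3 * mm)"
    using vle dle by (intro Phi_mono) auto
  also have "\<dots> \<le> ennreal C * \<Phi> x mm" by (rule C(2)[OF mm])
  also have "\<Phi> x mm = ennreal (phi.r mm + weight x * psi.r mm)"
    using mm phi.r_nonneg psi.r_nonneg weight_cases[of x] unfolding double_phase_def
    by (auto simp: phi.ennreal_r[symmetric] psi.ennreal_r[symmetric])
  also have "ennreal C * \<dots> \<le> ennreal C * ennreal (conv ?b K p)"
    by (intro mult_left_mono ennreal_leI main) simp
  finally show ?thesis by (simp add: v_def p_def)
qed

text \<open>One \<open>\<sigma>\<close> and one kernel must serve the energy density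
  \<open>b\<close> and all components of \<open>G\<close>, hence the minimum of finitely many
  thresholds; it is halved because the larger dilation factor is
  \<open>1 + 2 * \<sigma>\<close>.\<close>

lemma stretched_mollifier_exists:
  fixes b :: "real^2 \<Rightarrow> real" and G :: "real^2 \<Rightarrow> real^2"
  assumes b: "integrable lborel b" and G: "integrable lborel G" and r: "0 < r" "r \<le> 1"
  shows "\<exists>\<sigma> K. 0 < \<sigma> \<and> \<sigma> \<le> inverse (real (Suc n)) \<and> mollifier (\<sigma> * r / 20) K \<and>
    (\<integral>\<^sup>+x. ennreal \<bar>conv b K (diag (stretch \<sigma>) x) - b x\<bar> \<partial>lborel) \<le> ennreal ((1 / 2) ^ n) \<and>
    (\<forall>j\<in>Basis. (\<integral>\<^sup>+x. ennreal \<bar>conv (\<lambda>y. G y \<bullet> j) K (diag (stretch \<sigma>) x) - G x \<bullet> j\<bar> \<partial>lborel) \<le> ennreal ((1 / 2) ^ n))"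
proof -
  define P where "P q \<tau> \<longleftrightarrow> (\<forall>e K c. mollifier e K \<longrightarrow> e \<le> \<tau> \<longrightarrow> (\<forall>j\<in>Basis. 1 \<le> c j \<and> c j \<le> 1 + \<tau>) \<longrightarrow>
      (\<integral>\<^sup>+x. ennreal \<bar>conv q K (diag c x) - q x\<bar> \<partial>lborel) \<le> ennreal ((1 / 2) ^ n))" for q :: "real^2 \<Rightarrow> real" and \<tau>
  have ex: "\<exists>\<tau>>0. P q \<tau>" if q: "integrable lborel q" for q
  proof (rule mollify_L1[OF q, of "(1 / 2) ^ n"])
    fix \<tau> :: real
    assume "\<tau> > 0" and a: "\<And>e K c. mollifier e K \<Longrightarrow> e \<le> \<tau> \<Longrightarrow> (\<And>j. j \<in> Basis \<Longrightarrow> 1 \<le> c j \<and> c j \<le> 1 + \<tau>) \<Longrightarrow>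
      (\<integral>\<^sup>+x. ennreal \<bar>conv q K (diag c x) - q x\<bar> \<partial>lborel) \<le> ennreal ((1 / 2) ^ n)"
    have "P q \<tau>" unfolding P_def by (intro allI impI a) auto
    then show ?thesis using \<open>\<tau> > 0\<close> by blast
  qed simp
  obtain \<tau>0 where \<tau>0: "\<tau>0 > 0" "P b \<tau>0" using ex[OF b] by blast
  have "\<forall>j. \<exists>\<tau>. \<tau> > 0 \<and> P (\<lambda>y. G y \<bullet> j) \<tau>" using ex G by simp
  from choice[OF this] obtain \<tau> where \<tau>: "\<forall>j. \<tau> j > 0 \<and> P (\<lambda>y. G y \<bullet> j) (\<tau> j)" by blast
  define \<tau>' where "\<tau>' = Min (insert \<tau>0 (\<tau> ` Basis))"
  have \<tau>': "\<tau>' > 0" "\<tau>' \<le> \<tau>0" using \<tau>0 \<tau> by (auto simp: \<tau>'_def)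
  have \<tau>'_le: "\<tau>' \<le> \<tau> j" if "j \<in> Basis" for j
    unfolding \<tau>'_def by (rule Min_le) (use that in auto)
  define \<sigma> where "\<sigma> = min (\<tau>' / 2) (inverse (real (Suc n)))"
  have \<sigma>: "\<sigma> > 0" "2 * \<sigma> \<le> \<tau>'" "\<sigma> \<le> inverse (real (Suc n))" using \<tau>'(1) by (auto simp: \<sigma>_def)
  have "\<sigma> * r \<le> \<sigma> * 1" using r \<sigma> by (intro mult_left_mono) auto
  then have e: "\<sigma> * r / 20 \<le> \<tau>'" using \<sigma> by linarith
  obtain K :: "real^2 \<Rightarrow> real" where K: "mollifier (\<sigma> * r / 20) K" using mollifier_exists[of "\<sigma> * r / 20"] \<sigma> r by auto
  have c: "1 \<le> stretch \<sigma> j \<and> stretch \<sigma> j \<le> 1 + \<tau>'" for j using \<sigma> by (auto simp: stretch_def)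
  have use: "(\<integral>\<^sup>+x. ennreal \<bar>conv q K (diag (stretch \<sigma>) x) - q x\<bar> \<partial>lborel) \<le> ennreal ((1 / 2) ^ n)"
    if "P q t" "\<tau>' \<le> t" for q t
  proof -
    have "\<forall>j\<in>Basis. 1 \<le> stretch \<sigma> j \<and> stretch \<sigma> j \<le> 1 + t" using c that(2) by (meson add_left_mono order_trans)
    then show ?thesis using that K e unfolding P_def by (meson order_trans)
  qed
  show ?thesis
  proof (intro exI[of _ \<sigma>] exI[of _ K] conjI ballI)
    show "(\<integral>\<^sup>+x. ennreal \<bar>conv b K (diag (stretch \<sigma>) x) - b x\<bar> \<partial>lborel) \<le> ennreal ((1 / 2) ^ n)"
      by (rule use[OF \<tau>0(2) \<tau>'(2)])
    fix j :: "real^2" assume j: "j \<in> Basis"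
    show "(\<integral>\<^sup>+x. ennreal \<bar>conv (\<lambda>y. G y \<bullet> j) K (diag (stretch \<sigma>) x) - G x \<bullet> j\<bar> \<partial>lborel) \<le> ennreal ((1 / 2) ^ n)"
      by (rule use[OF _ \<tau>'_le[OF j]]) (use \<tau> in blast)
  qed (rule \<sigma> K)+
qed

text \<open>The integrand of the error modular is at most a multiple of the energy density
  \<open>b\<close> plus a multiple of the error of mollifying \<open>b\<close>, which is the pattern
  of the perturbed dominated convergence above. The almost everywhere convergence comes from
  mollifying the components of \<open>G\<close>.\<close>

lemma approximable_of_gradient_zero_near_origin:
  assumes s: "sob \<Omega> A w G" and r0: "r > 0" "\<And>x. norm x < r \<Longrightarrow> G x = 0" and fin: "modular G < \<infinity>"
  shows "approximable G"
proof -
  \<comment> \<open>A radius of at most 1 keeps the kernel radius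
    \<open>\<sigma> n * r' / 20\<close> below \<open>\<sigma> n\<close>, as the compact support of
    the mollification demands.\<close>
  define r' where "r' = min r 1"
  have r: "r' > 0" "r' \<le> 1" "\<And>x. norm x < r' \<Longrightarrow> G x = 0" using r0 by (auto simp: r'_def)
  note m = sob_measurable[OF s]
  note m[measurable]
  have z: "w x = 0" "G x = 0" if "x \<notin> \<Omega>" for x using s that by (auto simp: sob_def)
  have wi: "integrable lborel w" and Gi: "integrable lborel G" using sob_integrable[OF s] by auto
  define b where "b y = phi.r (norm (G y)) + weight y * psi.r (norm (G y))" for y
  have bm [measurable]: "b \<in> borel_measurable borel" unfolding b_def by measurable
  have b0: "b y \<ge> 0" for y using phi.r_nonneg psi.r_nonneg weight_cases[of y] by (auto simp: b_def)
  have bPhi: "ennreal (b y) = \<Phi> y (norm (G y)) * indicator \<Omega> y" for y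
    using z(2)[of y] weight_cases[of y] phi.r_nonneg psi.r_nonneg
    by (cases "y \<in> \<Omega>") (auto simp: b_def double_phase_def phi.ennreal_r psi.ennreal_r phi.r_zero psi.r_zero)
  have bint: "(\<integral>\<^sup>+y. ennreal (b y) \<partial>lborel) = modular G" by (simp add: bPhi modular_def)
  have bi: "integrable lborel b"
    by (rule integrableI_bounded) (use b0 bint fin in simp_all)
  obtain C3 where C3: "C3 \<ge> 0" "\<And>x t. t \<ge> 0 \<Longrightarrow> \<Phi> x (3 * t) \<le> ennreal C3 * \<Phi> x t" using Phi_scale_bound[of 3] by auto
  obtain C where C: "C \<ge> 0" "\<And>x s t. s \<ge> 0 \<Longrightarrow> t \<ge> 0 \<Longrightarrow> \<Phi> x (s + t) \<le> ennreal C * (\<Phi> x s + \<Phi> x t)"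
    using Phi_quasi_add by blast
  define Q where "Q n p \<longleftrightarrow> 0 < fst p \<and> fst p \<le> inverse (real (Suc n)) \<and> mollifier (fst p * r' / 20) (snd p) \<and>
    (\<integral>\<^sup>+x. ennreal \<bar>conv b (snd p) (diag (stretch (fst p)) x) - b x\<bar> \<partial>lborel) \<le> ennreal ((1 / 2) ^ n) \<and>
    (\<forall>j\<in>Basis. (\<integral>\<^sup>+x. ennreal \<bar>conv (\<lambda>y. G y \<bullet> j) (snd p) (diag (stretch (fst p)) x) - G x \<bullet> j\<bar> \<partial>lborel) \<le> ennreal ((1 / 2) ^ n))" for n p
  have "\<forall>n. \<exists>p. Q n p"
    using stretched_mollifier_exists[OF bi Gi r(1,2)] unfolding Q_def by fastforce
  from choice[OF this] obtain P where P: "\<And>n. Q n (P n)" by blast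
  define \<sigma> K where "\<sigma> n = fst (P n)" and "K n = snd (P n)" for n
  define e where "e n = \<sigma> n * r' / 20" for n
  have \<sigma>: "0 < \<sigma> n" "\<sigma> n \<le> inverse (real (Suc n))" and K: "mollifier (e n) (K n)"
    and bl: "(\<integral>\<^sup>+x. ennreal \<bar>conv b (K n) (diag (stretch (\<sigma> n)) x) - b x\<bar> \<partial>lborel) \<le> ennreal ((1 / 2) ^ n)"
    and Gl: "\<And>j. j \<in> Basis \<Longrightarrow> (\<integral>\<^sup>+x. ennreal \<bar>conv (\<lambda>y. G y \<bullet> j) (K n) (diag (stretch (\<sigma> n)) x) - G x \<bullet> j\<bar> \<partial>lborel) \<le> ennreal ((1 / 2) ^ n)" for n
    using P[of n] unfolding Q_def \<sigma>_def K_def e_def by simp_all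
  have \<sigma>1: "\<sigma> n \<le> 1" for n
    using \<sigma>(2)[of n] by (rule order_trans) (simp add: inverse_le_1_iff)
  have e: "0 < e n" "e n < \<sigma> n" for n
  proof -
    show "0 < e n" using \<sigma>(1)[of n] r(1) by (simp add: e_def)
    have "\<sigma> n * r' \<le> \<sigma> n * 1" using \<sigma>(1)[of n] r(2) by (intro mult_left_mono) auto
    then show "e n < \<sigma> n" using \<sigma>(1)[of n] by (simp add: e_def)
  qed
  define \<eta> where "\<eta> n x = conv w (K n) (diag (stretch (\<sigma> n)) x)" for n x
  have \<eta>: "\<eta> n \<in> test_functions \<Omega>" for n
    unfolding \<eta>_def by (rule stretched_conv_test_function[OF wi z(1) K \<sigma>(1) e(2,1)])
  have grad: "gradient (\<eta> n) x = diag (stretch (\<sigma> n)) (conv w (gradient (K n)) (diag (stretch (\<sigma> n)) x))" for n x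
  proof (rule gradient_eqI)
    have D: "(conv w (K n) has_derivative (\<lambda>h. conv w (gradient (K n)) x \<bullet> h)) (at x)" for x
      by (rule conv_has_derivative[OF wi test_functions_C1c[OF mollifierD(6)[OF K]]])
    show "(\<eta> n has_derivative (\<lambda>h. diag (stretch (\<sigma> n)) (conv w (gradient (K n)) (diag (stretch (\<sigma> n)) x)) \<bullet> h)) (at x)"
      using has_derivative_diag_compose[of "conv w (K n)" "conv w (gradient (K n))" 1 0 "stretch (\<sigma> n)" x] D
      by (simp add: \<eta>_def[abs_def])
  qed
  have gm [measurable]: "gradient (\<eta> n) \<in> borel_measurable borel" for n by (rule test_gradient_measurable[OF \<eta>])
  have cm [measurable]: "conv b (K n) \<in> borel_measurable borel" "conv (\<lambda>y. G y \<bullet> j) (K n) \<in> borel_measurable borel" for n j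
    by (rule conv_borel_measurable[OF K], use bi Gi in simp)+
  define h where "h n x = \<Phi> x (norm (G x - gradient (\<eta> n) x)) * indicator \<Omega> x" for n x
  define d where "d n x = ennreal (C * C3) * ennreal \<bar>conv b (K n) (diag (stretch (\<sigma> n)) x) - b x\<bar>" for n x
  define q where "q x = ennreal (C * C3 + C) * ennreal (b x)" for x
  have "(\<lambda>n. \<integral>\<^sup>+x. h n x \<partial>lborel) \<longlonglongrightarrow> 0"
  proof (rule nn_integral_tendsto_0_perturbed_domination[where q=q and d=d])
    have "(\<lambda>x. G x - gradient (\<eta> n) x) \<in> borel_measurable borel" for n by measurable
    note Phi_measurable[OF this, measurable]
    show "h n \<in> borel_measurable lborel" for n unfolding h_def by measurable
    show "q \<in> borel_measurable lborel" unfolding q_def by measurable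
    show "d n \<in> borel_measurable lborel" for n unfolding d_def by measurable
    have "(\<integral>\<^sup>+x. q x \<partial>lborel) = ennreal (C * C3 + C) * modular G"
      unfolding q_def bint[symmetric] by (rule nn_integral_cmult) measurable
    then show "(\<integral>\<^sup>+x. q x \<partial>lborel) < \<infinity>" using fin by (simp add: ennreal_mult_less_top)
    have dle: "(\<integral>\<^sup>+x. d n x \<partial>lborel) \<le> ennreal (C * C3) * ennreal ((1 / 2) ^ n)" for n
    proof -
      have "(\<integral>\<^sup>+x. d n x \<partial>lborel) = ennreal (C * C3) * (\<integral>\<^sup>+x. ennreal \<bar>conv b (K n) (diag (stretch (\<sigma> n)) x) - b x\<bar> \<partial>lborel)"
        unfolding d_def by (rule nn_integral_cmult) measurable
      then show ?thesis using bl[of n] by (simp add: mult_left_mono)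
    qed
    have "(\<lambda>n. ennreal ((C * C3) * (1 / 2) ^ n)) \<longlonglongrightarrow> ennreal ((C * C3) * 0)"
      by (intro tendsto_ennrealI tendsto_mult tendsto_const LIMSEQ_power_zero) simp
    then have l: "(\<lambda>n. ennreal (C * C3) * ennreal ((1 / 2) ^ n)) \<longlonglongrightarrow> 0"
      using C(1) C3(1) by (simp add: ennreal_mult)
    show "(\<lambda>n. \<integral>\<^sup>+x. d n x \<partial>lborel) \<longlonglongrightarrow> 0"
      by (rule tendsto_sandwich[OF _ _ tendsto_const l]) (simp_all add: dle)
    show "h n x \<le> q x + d n x" for n x
    proof (cases "x \<in> \<Omega>")
      case True
      let ?p = "diag (stretch (\<sigma> n)) x"
      have g: "\<Phi> x (norm (gradient (\<eta> n) x)) \<le> ennreal C3 * ennreal (conv b (K n) ?p)"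
        unfolding grad
        using Phi_stretched_gradient_le[OF s r(1,3) bi[unfolded b_def] \<sigma>(1) \<sigma>1 _ K C3, where x=x] by (simp add: b_def[abs_def] e_def)
      have "norm (G x - gradient (\<eta> n) x) \<le> norm (G x) + norm (gradient (\<eta> n) x)" by (rule norm_triangle_ineq4)
      then have "\<Phi> x (norm (G x - gradient (\<eta> n) x)) \<le> ennreal C * (\<Phi> x (norm (G x)) + \<Phi> x (norm (gradient (\<eta> n) x)))"
        using Phi_mono[of "norm (G x - gradient (\<eta> n) x)" "norm (G x) + norm (gradient (\<eta> n) x)" x] C(2)[of "norm (G x)" "norm (gradient (\<eta> n) x)" x]
        by (meson norm_ge_zero order_trans)
      also have "\<dots> \<le> ennreal C * (ennreal (b x) + ennreal C3 * ennreal (conv b (K n) ?p))"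
        using True g by (intro mult_left_mono add_mono) (simp_all add: bPhi)
      also have "\<dots> \<le> ennreal C * (ennreal (b x) + ennreal C3 * (ennreal (b x) + ennreal \<bar>conv b (K n) ?p - b x\<bar>))"
        using b0[of x] by (intro mult_left_mono add_mono) (auto simp flip: ennreal_plus intro!: ennreal_leI)
      also have "\<dots> = q x + d n x"
        using C(1) C3(1) unfolding q_def d_def by (simp add: ennreal_mult distrib_left distrib_right mult.assoc add_ac)
      finally show ?thesis using True by (simp add: h_def)
    qed (simp add: h_def)
    have aeG: "AE x in lborel. (\<lambda>n. ennreal \<bar>conv (\<lambda>y. G y \<bullet> j) (K n) (diag (stretch (\<sigma> n)) x) - G x \<bullet> j\<bar>) \<longlonglongrightarrow> 0"
      if j: "j \<in> Basis" for j
      by (rule AE_tendsto_0_of_nn_integral_geometric[OF _ Gl[OF j]]) measurable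
    have "AE x in lborel. \<forall>j\<in>Basis. (\<lambda>n. ennreal \<bar>conv (\<lambda>y. G y \<bullet> j) (K n) (diag (stretch (\<sigma> n)) x) - G x \<bullet> j\<bar>) \<longlonglongrightarrow> 0"
      by (rule AE_finite_allI[OF finite_Basis aeG])
    then show "AE x in lborel. (\<lambda>n. h n x) \<longlonglongrightarrow> 0"
    proof eventually_elim
      case (elim x)
      have \<sigma>0: "\<sigma> \<longlonglongrightarrow> 0"
        by (rule tendsto_sandwich[OF _ _ tendsto_const LIMSEQ_inverse_real_of_nat])
          (use \<sigma> in \<open>auto intro!: always_eventually less_imp_le\<close>)
      have comp: "(\<lambda>n. gradient (\<eta> n) x \<bullet> j) \<longlonglongrightarrow> G x \<bullet> j" if j: "j \<in> Basis" for j
      proof -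
        have "(\<lambda>n. \<bar>conv (\<lambda>y. G y \<bullet> j) (K n) (diag (stretch (\<sigma> n)) x) - G x \<bullet> j\<bar>) \<longlonglongrightarrow> 0"
          using bspec[OF elim j] by (subst (asm) ennreal_tendsto_0_iff) auto
        then have "(\<lambda>n. conv (\<lambda>y. G y \<bullet> j) (K n) (diag (stretch (\<sigma> n)) x)) \<longlonglongrightarrow> G x \<bullet> j"
          by (simp add: tendsto_rabs_zero_iff LIM_zero_iff)
        moreover have "(\<lambda>n. stretch (\<sigma> n) j) \<longlonglongrightarrow> 1"
        proof (cases "j = axis 1 1")
          case True
          then show ?thesis using tendsto_add[OF tendsto_const[of 1] \<sigma>0] by (simp add: stretch_def)
        next
          case False
          then show ?thesis using tendsto_add[OF tendsto_const[of 1] tendsto_mult[OF tendsto_const[of 2] \<sigma>0]] by (simp add: stretch_def)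
        qed
        ultimately have "(\<lambda>n. stretch (\<sigma> n) j * conv (\<lambda>y. G y \<bullet> j) (K n) (diag (stretch (\<sigma> n)) x)) \<longlonglongrightarrow> 1 * (G x \<bullet> j)"
          by (rule tendsto_mult[rotated])
        then show ?thesis using j by (simp add: grad conv_gradient_mollifier[OF s K])
      qed
      have "(\<lambda>n. gradient (\<eta> n) x) \<longlonglongrightarrow> G x"
        by (subst tendsto_componentwise_iff) (use comp in blast)
      then have "(\<lambda>n. norm (G x - gradient (\<eta> n) x)) \<longlonglongrightarrow> norm (G x - G x)" by (intro tendsto_intros)
      then have "(\<lambda>n. \<Phi> x (norm (G x - gradient (\<eta> n) x))) \<longlonglongrightarrow> 0"
        by (intro Phi_tendsto_0) simp_all
      then show ?case by (cases "x \<in> \<Omega>") (simp_all add: h_def)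
    qed
  qed
  then have lim: "(\<lambda>n. modular (\<lambda>x. G x - gradient (\<eta> n) x)) \<longlonglongrightarrow> 0" by (simp add: h_def modular_def)
  show ?thesis
    unfolding approximable_def
  proof (intro conjI allI impI)
    show "G \<in> borel_measurable borel" by measurable
    fix \<epsilon> :: real assume "\<epsilon> > 0"
    then have "\<forall>\<^sub>F n in sequentially. modular (\<lambda>x. G x - gradient (\<eta> n) x) < ennreal \<epsilon>"
      using order_tendstoD(2)[OF lim, of "ennreal \<epsilon>"] by simp
    then obtain n where "modular (\<lambda>x. G x - gradient (\<eta> n) x) < ennreal \<epsilon>"
      by (meson eventually_sequentially order_refl)
    then show "\<exists>\<eta>\<in>test_functions \<Omega>. modular (\<lambda>x. G x - gradient \<eta> x) \<le> ennreal \<epsilon>"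
      using \<eta>[of n] by (intro bexI[of _ "\<eta> n"]) simp_all
  qed
qed

end

section \<open>The first case: points have zero capacity\<close>

context finite_orlicz
begin

text \<open>\<open>enn2real\<close> sends an infinite conjugate to 0, so this is meaningful only
  under the finiteness assumption of the context below.\<close>

definition y :: "real \<Rightarrow> real" where "y s = enn2real (conjugate \<phi> s)"

context
  assumes conj_finite: "\<And>s. s \<ge> 0 \<Longrightarrow> conjugate \<phi> s < \<infinity>"
begin

lemma ennreal_y: "s \<ge> 0 \<Longrightarrow> ennreal (y s) = conjugate \<phi> s"
  using conj_finite[of s] by (simp add: y_def)

lemma y_nonneg: "y s \<ge> 0"
  by (simp add: y_def)

lemma young:
  assumes "s \<ge> 0" "t \<ge> 0"
  shows "s * t \<le> r t + y s"
proof -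
  have "ennreal (s * t) - ennreal (r t) \<le> ennreal (y s)"
    unfolding ennreal_r[OF assms(2)] ennreal_y[OF assms(1)] conjugate_def
    by (rule SUP_upper) (use assms in simp)
  then have "ennreal (s * t - r t) \<le> ennreal (y s)" using r_nonneg by (simp add: ennreal_minus)
  then have "s * t - r t \<le> y s" using y_nonneg[of s] by (auto simp: ennreal_le_iff2)
  then show ?thesis by simp
qed

lemma y_le:
  assumes "s \<ge> 0" "B \<ge> 0" "\<And>t. t \<ge> 0 \<Longrightarrow> s * t - r t \<le> B"
  shows "y s \<le> B"
proof -
  have "conjugate \<phi> s \<le> ennreal B"
    unfolding conjugate_def
  proof (rule SUP_least)
    fix t :: real assume "t \<in> {0..}"
    then have "ennreal (s * t) - \<phi> t = ennreal (s * t - r t)"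
      using r_nonneg by (simp add: ennreal_minus flip: ennreal_r)
    also have "\<dots> \<le> ennreal B" using assms(3) \<open>t \<in> {0..}\<close> by (intro ennreal_leI) simp
    finally show "ennreal (s * t) - \<phi> t \<le> ennreal B" .
  qed
  then have "ennreal (y s) \<le> ennreal B" using ennreal_y[OF assms(1)] by simp
  then show ?thesis using assms(2) by simp
qed

lemma y_mono: "0 \<le> s \<Longrightarrow> s \<le> s' \<Longrightarrow> y s \<le> y s'"
proof (rule y_le)
  fix t :: real assume a: "0 \<le> s" "s \<le> s'" "t \<ge> 0"
  have "s * t \<le> s' * t" using a by (intro mult_right_mono) auto
  then show "s * t - r t \<le> y s'" using young[of s' t] a by linarith
qed (use y_nonneg in auto)

text \<open>Aiming at half of the supremum avoids the question whether it is attained.\<close>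

lemma y_near_maximizer:
  assumes "s \<ge> 0"
  shows "\<exists>t\<ge>0. r t + y s / 2 \<le> s * t"
proof (cases "y s = 0")
  case True
  then show ?thesis by (intro exI[of _ 0]) (simp add: r_zero)
next
  case False
  then have ys: "y s > 0" using y_nonneg[of s] by simp
  then have "ennreal (y s / 2) < conjugate \<phi> s" by (simp add: ennreal_lessI flip: ennreal_y[OF assms])
  then obtain t where t: "t \<ge> 0" "ennreal (y s / 2) < ennreal (s * t) - \<phi> t"
    unfolding conjugate_def less_SUP_iff by auto
  then have "ennreal (y s / 2) < ennreal (s * t - r t)" using r_nonneg by (simp add: ennreal_minus flip: ennreal_r)
  then have "y s / 2 < s * t - r t" using ys by (simp add: ennreal_less_iff)
  then show ?thesis using t(1) by (intro exI[of _ t]) simp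
qed

context
  assumes nabla2: "Nabla2 \<phi>"
begin

lemma y_doubling: "\<exists>c>0. \<forall>s\<ge>0. y (2 * s) \<le> c * y s"
proof -
  obtain c where c: "c > 0" "\<And>s. s \<ge> 0 \<Longrightarrow> conjugate \<phi> (2 * s) \<le> ennreal c * conjugate \<phi> s"
    using nabla2 unfolding Nabla2_def Delta2_def by blast
  have "y (2 * s) \<le> c * y s" if "s \<ge> 0" for s
  proof -
    have "ennreal (y (2 * s)) \<le> ennreal (c * y s)"
      using c(2)[OF that] that c(1) y_nonneg by (simp add: ennreal_y ennreal_mult)
    then show ?thesis using c(1) y_nonneg by (simp add: ennreal_le_iff)
  qed
  then show ?thesis using c(1) by blast
qed

text \<open>Young's inequality at the doubled slope, \<open>2 * s * t \<le> r t + y (2 * s)\<close>,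
  combined with near maximality bounds \<open>s * t\<close> by a multiple of \<open>y s\<close>, and
  \<open>r t\<close> lies below \<open>s * t\<close>. So \<open>Nabla2\<close> keeps the energy of a
  near maximiser comparable to the conjugate.\<close>

lemma y_maximizer_bounds:
  "\<exists>c>0. \<forall>s\<ge>0. \<exists>t\<ge>0. y s / 2 \<le> s * t \<and> r t \<le> c * y s"
proof -
  obtain c where c: "c > 0" "\<And>s. s \<ge> 0 \<Longrightarrow> y (2 * s) \<le> c * y s" using y_doubling by blast
  have "\<exists>t\<ge>0. y s / 2 \<le> s * t \<and> r t \<le> c * y s" if s: "s \<ge> 0" for s
  proof -
    obtain t where t: "t \<ge> 0" "r t + y s / 2 \<le> s * t" using y_near_maximizer[OF s] by blast
    have "2 * s * t \<le> r t + y (2 * s)" using young[of "2 * s" t] s t(1) by simp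
    then have "s * t \<le> c * y s" using t(2) c(2)[OF s] y_nonneg[of s] by linarith
    then show ?thesis using t r_nonneg[of t] y_nonneg[of s] by (intro exI[of _ t]) auto
  qed
  then show ?thesis using c(1) by blast
qed

text \<open>The \<open>\<nabla>\<^sub>2\<close>-condition enters here: a supporting line with slope \<open>k\<close> at \<open>\<lambda> t\<close> makes Young's
  inequality an equality for \<open>k\<close>, and it is compared with Young's inequality for \<open>2 ^ m * k\<close> at \<open>t\<close>.\<close>

lemma r_superlinear_decay:
  assumes "\<kappa> > 0"
  shows "\<exists>lam0>0. \<forall>l. 0 < l \<longrightarrow> l \<le> lam0 \<longrightarrow> (\<forall>t\<ge>0. r (l * t) \<le> \<kappa> * l * r t)"
proof -
  obtain c where c: "c > 0" "\<And>s. s \<ge> 0 \<Longrightarrow> y (2 * s) \<le> c * y s" using y_doubling by blast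
  have pow: "y (2 ^ m * s) \<le> c ^ m * y s" if "s \<ge> 0" for m s
  proof (induction m)
    case (Suc m)
    have "y (2 ^ Suc m * s) \<le> c * y (2 ^ m * s)" using c(2)[of "2 ^ m * s"] that by (simp add: mult.assoc)
    also have "\<dots> \<le> c * (c ^ m * y s)" using Suc c(1) by (intro mult_left_mono) auto
    finally show ?case by (simp add: mult.assoc)
  qed simp
  obtain m :: nat where m: "2 / \<kappa> < 2 ^ m" using real_arch_pow[of 2 "2 / \<kappa>"] by auto
  define K :: real where "K = 2 ^ m"
  have K: "K > 0" "2 / K \<le> \<kappa>" using m assms by (auto simp: K_def field_simps)
  \<comment> \<open>Chosen so that \<open>c ^ m * l \<le> K / 2\<close>: the conjugate term in
    Young's inequality is then at most half of the left side and can be absorbed.\<close>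
  define lam0 where "lam0 = K / (2 * c ^ m)"
  have "r (l * t) \<le> \<kappa> * l * r t" if l: "0 < l" "l \<le> lam0" and t: "t \<ge> 0" for l t
  proof (cases "t = 0")
    case False
    then have lt: "l * t > 0" using l t by simp
    obtain k where k: "k \<ge> 0" "\<And>\<tau>. \<tau> \<ge> 0 \<Longrightarrow> r (l * t) + k * (\<tau> - l * t) \<le> r \<tau>"
      using support_line[OF lt] by blast
    have "y k \<le> k * (l * t) - r (l * t)"
    proof (rule y_le[OF k(1)])
      show "0 \<le> k * (l * t) - r (l * t)" using k(2)[of 0] r_zero by simp
      show "k * \<tau> - r \<tau> \<le> k * (l * t) - r (l * t)" if "\<tau> \<ge> 0" for \<tau>
        using k(2)[OF that] by (simp add: algebra_simps)
    qed
    then have yk: "y k \<le> k * l * t" "r (l * t) \<le> k * l * t"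
      using r_nonneg[of "l * t"] y_nonneg[of k] by (simp_all add: mult.assoc)
    have cl: "c ^ m * l \<le> K / 2" using l(2) c(1) by (simp add: lam0_def field_simps)
    have "K * k * t \<le> r t + y (K * k)" using young[of "K * k" t] k(1) t K(1) by simp
    also have "y (K * k) \<le> c ^ m * y k" using pow[OF k(1)] by (simp add: K_def)
    also have "c ^ m * y k \<le> c ^ m * (k * l * t)" using yk(1) c(1) by (intro mult_left_mono) auto
    also have "\<dots> = c ^ m * l * (k * t)" by simp
    also have "\<dots> \<le> K / 2 * (k * t)" using k(1) t by (intro mult_right_mono cl) auto
    finally have "K * (k * t) \<le> 2 * r t" by (simp add: mult.assoc)
    then have "k * t \<le> 2 / K * r t" using K(1) by (simp add: field_simps)
    also have "\<dots> \<le> \<kappa> * r t" using K(2) r_nonneg by (intro mult_right_mono) auto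
    finally have "k * t * l \<le> \<kappa> * r t * l" using l(1) by (intro mult_right_mono) auto
    then show ?thesis using yk(2) by (simp add: mult_ac)
  qed (simp add: r_zero)
  moreover have "lam0 > 0" using K(1) c(1) by (simp add: lam0_def)
  ultimately show ?thesis by blast
qed

end

text \<open>On the interval \<open>I j\<close> the integrand is at most
  \<open>y (2 ^ (j + 1)) * (1 / 2) ^ j\<close>, and \<open>I j\<close> has length
  \<open>(1 / 2) ^ (j + 1)\<close>; the product is twice the dyadic term of index
  \<open>j + 1\<close>. Bounded partial sums would therefore make the integral finite.\<close>

lemma dyadic_sum_unbounded:
  assumes div: "integral_diverges_at_0 (\<lambda>r. conjugate \<phi> (1 / r) * ennreal r)"
  shows "\<exists>n. L < (\<Sum>j=m..m + n. y (2 ^ j) * (1 / 4) ^ j)"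
proof (rule ccontr)
  assume "\<not> ?thesis"
  then have le: "(\<Sum>j=m..m + n. y (2 ^ j) * (1 / 4) ^ j) \<le> L" for n by (simp add: not_less)
  define T where "T j = y (2 ^ (j + 1)) * (1 / 2) ^ j" for j :: nat
  have T0: "T j \<ge> 0" for j by (simp add: T_def y_nonneg)
  define I where "I j = {(1 / 2) ^ (j + 1)..(1 / 2 :: real) ^ j}" for j :: nat
  have pt: "conjugate \<phi> (1 / x) * ennreal x * indicator {0<..<(1 / 2) ^ m} x
      \<le> (\<Sum>j. ennreal (T (m + j)) * indicator (I (m + j)) x)" for x :: real
  proof (cases "x \<in> {0<..<(1 / 2) ^ m}")
    case True
    then have x: "x > 0" "x < (1 / 2) ^ m" by auto
    obtain n0 where n0: "(1 / 2 :: real) ^ n0 < x" using real_arch_pow_inv[OF x(1), of "1 / 2"] by auto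
    have "(1 / 2 :: real) ^ (m + n0) \<le> (1 / 2) ^ n0" by (rule power_decreasing) auto
    then have "\<exists>n. (1 / 2) ^ (m + n) < x" using n0 by (intro exI[of _ n0]) linarith
    define n where "n = (LEAST n. (1 / 2) ^ (m + n) < x)"
    have n: "(1 / 2) ^ (m + n) < x" unfolding n_def by (rule LeastI_ex) fact
    have "n \<noteq> 0" using n x(2) by (metis add_0_right less_asym)
    then obtain k where k: "n = Suc k" by (cases n) auto
    have "\<not> (1 / 2) ^ (m + k) < x" using not_less_Least[of k "\<lambda>n. (1 / 2) ^ (m + n) < x"] k by (simp add: n_def)
    then have xI: "x \<in> I (m + k)" using n by (simp add: I_def k)
    have "1 / x \<le> 2 ^ (m + k + 1)"
    proof -
      have "1 / x \<le> 1 / (1 / 2) ^ (m + k + 1)" using xI x(1) by (intro divide_left_mono) (auto simp: I_def)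
      then show ?thesis by (simp add: power_one_over)
    qed
    then have "y (1 / x) \<le> y (2 ^ (m + k + 1))" using x(1) by (intro y_mono) auto
    moreover have "x \<le> (1 / 2) ^ (m + k)" using xI by (simp add: I_def)
    ultimately have "y (1 / x) * x \<le> T (m + k)"
      unfolding T_def using x(1) y_nonneg by (intro mult_mono) auto
    then have "conjugate \<phi> (1 / x) * ennreal x \<le> ennreal (T (m + k))"
      using x(1) y_nonneg by (simp add: ennreal_leI flip: ennreal_y ennreal_mult)
    also have "\<dots> = (\<Sum>j\<in>{k}. ennreal (T (m + j)) * indicator (I (m + j)) x)" using xI by simp
    also have "\<dots> \<le> (\<Sum>j. ennreal (T (m + j)) * indicator (I (m + j)) x)"
      by (intro sum_le_suminf summableI) auto
    finally show ?thesis using True by simp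
  qed simp
  have emI: "emeasure lborel (I j) = ennreal ((1 / 2) ^ (j + 1))" for j
  proof -
    have "(1 / 2 :: real) ^ (j + 1) \<le> (1 / 2) ^ j" by (rule power_decreasing) auto
    then show ?thesis unfolding I_def by simp
  qed
  have "(\<integral>\<^sup>+x. conjugate \<phi> (1 / x) * ennreal x * indicator {0<..<(1 / 2) ^ m} x \<partial>lborel)
      \<le> (\<integral>\<^sup>+x. (\<Sum>j. ennreal (T (m + j)) * indicator (I (m + j)) x) \<partial>lborel)"
    by (rule nn_integral_mono) (rule pt)
  also have "\<dots> = (\<Sum>j. \<integral>\<^sup>+x. ennreal (T (m + j)) * indicator (I (m + j)) x \<partial>lborel)"
    by (rule nn_integral_suminf) (simp add: I_def)
  also have "\<dots> = (\<Sum>j. ennreal (2 * (y (2 ^ (m + j + 1)) * (1 / 4) ^ (m + j + 1))))"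
  proof (rule suminf_cong)
    fix j
    have "(\<integral>\<^sup>+x. ennreal (T (m + j)) * indicator (I (m + j)) x \<partial>lborel) = ennreal (T (m + j)) * emeasure lborel (I (m + j))"
      by (rule nn_integral_cmult_indicator) (simp add: I_def)
    also have "\<dots> = ennreal (T (m + j) * (1 / 2) ^ (m + j + 1))"
      unfolding emI by (rule ennreal_mult[symmetric]) (simp_all add: T0)
    also have "T (m + j) * (1 / 2) ^ (m + j + 1) = 2 * (y (2 ^ (m + j + 1)) * (1 / 4) ^ (m + j + 1))"
    proof -
      have "(1 / 4 :: real) ^ k = (1 / 2) ^ k * (1 / 2) ^ k" for k by (simp flip: power_mult_distrib)
      then show ?thesis by (simp add: T_def)
    qed
    finally show "(\<integral>\<^sup>+x. ennreal (T (m + j)) * indicator (I (m + j)) x \<partial>lborel) = ennreal (2 * (y (2 ^ (m + j + 1)) * (1 / 4) ^ (m + j + 1)))" .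
  qed
  also have "\<dots> \<le> ennreal (2 * L)"
    unfolding suminf_eq_SUP
  proof (rule SUP_least)
    fix n
    have "(\<Sum>j<n. ennreal (2 * (y (2 ^ (m + j + 1)) * (1 / 4) ^ (m + j + 1)))) = ennreal (\<Sum>j<n. 2 * (y (2 ^ (m + j + 1)) * (1 / 4) ^ (m + j + 1)))"
      by (rule sum_ennreal) (simp add: y_nonneg)
    also have "(\<Sum>j<n. 2 * (y (2 ^ (m + j + 1)) * (1 / 4) ^ (m + j + 1))) = 2 * (\<Sum>j<n. y (2 ^ (m + j + 1)) * (1 / 4) ^ (m + j + 1))"
      by (simp add: sum_distrib_left)
    \<comment> \<open>The shift by one places the indices in \<open>{m + 1..m + n}\<close>, a subset
      of the range for which the bound \<open>L\<close> is assumed.\<close>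
    also have "(\<Sum>j<n. y (2 ^ (m + j + 1)) * (1 / 4) ^ (m + j + 1)) = (\<Sum>i\<in>(\<lambda>j. m + j + 1) ` {..<n}. y (2 ^ i) * (1 / 4) ^ i)"
      by (subst sum.reindex) (auto simp: inj_on_def)
    also have "\<dots> \<le> (\<Sum>j=m..m + n. y (2 ^ j) * (1 / 4) ^ j)"
      by (rule sum_mono2) (auto simp: y_nonneg)
    also have "\<dots> \<le> L" by (rule le)
    finally show "(\<Sum>j<n. ennreal (2 * (y (2 ^ (m + j + 1)) * (1 / 4) ^ (m + j + 1)))) \<le> ennreal (2 * L)"
      by (simp add: ennreal_leI)
  qed
  also have "\<dots> < \<infinity>" by simp
  finally have "(\<integral>\<^sup>+x\<in>{0<..<(1 / 2) ^ m}. conjugate \<phi> (1 / x) * ennreal x \<partial>lborel) < \<infinity>" by simp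
  moreover have "(\<integral>\<^sup>+x\<in>{0<..<(1 / 2) ^ m}. conjugate \<phi> (1 / x) * ennreal x \<partial>lborel) = \<infinity>"
    using div unfolding integral_diverges_at_0_def by simp
  ultimately show False by simp
qed

end

end

text \<open>A quotient of squared positive parts, hence \<open>C^1\<close>, equal to 1 up to
  \<open>1 / 4\<close> and to 0 from 1 on. The argument will be a squared norm, so the transition
  takes place between the radii \<open>1 / 2\<close> and 1.\<close>

definition step :: "real \<Rightarrow> real" where
  "step s = (max 0 (1 - s))\<^sup>2 / ((max 0 (1 - s))\<^sup>2 + (max 0 (s - 1 / 4))\<^sup>2)"

definition step' :: "real \<Rightarrow> real" where
  "step' s = (- (2 * max 0 (1 - s)) * (max 0 (s - 1 / 4))\<^sup>2 - (max 0 (1 - s))\<^sup>2 * (2 * max 0 (s - 1 / 4))) /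
     ((max 0 (1 - s))\<^sup>2 + (max 0 (s - 1 / 4))\<^sup>2)\<^sup>2"

lemma max_square_derivative: "((\<lambda>t. (max 0 t)\<^sup>2) has_real_derivative 2 * max 0 t) (at (t::real))"
proof -
  consider "t < 0" | "t > 0" | "t = 0" by linarith
  then show ?thesis
  proof cases
    case 1
    have "((\<lambda>_. 0) has_real_derivative 0) (at t)" by simp
    then have "((\<lambda>t. (max 0 t)\<^sup>2) has_real_derivative 0) (at t)"
      by (rule has_field_derivative_transform_within_open[of _ _ _ "{..<0}"]) (use 1 in auto)
    then show ?thesis using 1 by simp
  next
    case 2
    have "((\<lambda>t. t\<^sup>2) has_real_derivative 2 * t) (at t)"
      using DERIV_pow[of 2 t UNIV] by simp
    then have "((\<lambda>t. (max 0 t)\<^sup>2) has_real_derivative 2 * t) (at t)"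
      by (rule has_field_derivative_transform_within_open[of _ _ _ "{0<..}"]) (use 2 in auto)
    then show ?thesis using 2 by simp
  next
    case 3
    have "((\<lambda>h. (max 0 h)\<^sup>2 / h) \<longlongrightarrow> 0) (at (0::real))"
    proof (rule Lim_null_comparison)
      have "norm ((max 0 h)\<^sup>2 / h) \<le> \<bar>h\<bar>" for h :: real by (cases "h \<le> 0") (auto simp: power2_eq_square)
      then show "\<forall>\<^sub>F h in at (0::real). norm ((max 0 h)\<^sup>2 / h) \<le> \<bar>h\<bar>" by simp
      show "((\<lambda>h. \<bar>h\<bar>) \<longlongrightarrow> 0) (at (0::real))" using tendsto_rabs[OF tendsto_ident_at[of 0 UNIV]] by simp
    qed
    then show ?thesis using 3 by (simp add: DERIV_def)
  qed
qed

lemma step_denominator: "(max 0 (1 - s))\<^sup>2 + (max 0 (s - 1 / 4))\<^sup>2 > (0::real)"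
proof (cases "s < 1")
  case True
  then have "(max 0 (1 - s))\<^sup>2 > 0" by simp
  then show ?thesis by (simp add: add_pos_nonneg)
next
  case False
  then have "(max 0 (s - 1 / 4))\<^sup>2 > 0" by simp
  then show ?thesis by (simp add: add_nonneg_pos)
qed

lemma step_derivative: "(step has_real_derivative step' s) (at s)"
proof -
  define A B where "A s = (max 0 (1 - s))\<^sup>2" and "B s = (max 0 (s - 1 / 4))\<^sup>2" for s :: real
  have a: "(A has_real_derivative 2 * max 0 (1 - s) * (0 - 1)) (at s)"
    unfolding A_def by (rule DERIV_chain2[OF max_square_derivative DERIV_diff[OF DERIV_const DERIV_ident]])
  have b: "(B has_real_derivative 2 * max 0 (s - 1 / 4) * (1 - 0)) (at s)"
    unfolding B_def by (rule DERIV_chain2[OF max_square_derivative DERIV_diff[OF DERIV_ident DERIV_const]])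
  have d: "A s + B s \<noteq> 0" unfolding A_def B_def by (rule less_imp_neq[OF step_denominator, symmetric])
  have "((\<lambda>s. A s / (A s + B s)) has_real_derivative
      (2 * max 0 (1 - s) * (0 - 1) * (A s + B s) - A s * (2 * max 0 (1 - s) * (0 - 1) + 2 * max 0 (s - 1 / 4) * (1 - 0))) / ((A s + B s) * (A s + B s))) (at s)"
    by (rule DERIV_divide[OF a DERIV_add[OF a b] d])
  moreover have "2 * max 0 (1 - s) * (0 - 1) * (A s + B s) - A s * (2 * max 0 (1 - s) * (0 - 1) + 2 * max 0 (s - 1 / 4) * (1 - 0))
      = - (2 * max 0 (1 - s)) * B s - A s * (2 * max 0 (s - 1 / 4))" by (simp add: algebra_simps)
  ultimately show ?thesis
    by (simp add: step_def[abs_def] step'_def A_def[symmetric] B_def[symmetric] power2_eq_square[of "A s + B s"])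
qed

lemma step'_continuous: "continuous_on UNIV step'"
  unfolding step'_def
proof (intro continuous_on_divide ballI)
  show "((max 0 (1 - s))\<^sup>2 + (max 0 (s - 1 / 4))\<^sup>2)\<^sup>2 \<noteq> (0::real)" for s
    by (intro power_not_zero less_imp_neq[OF step_denominator, symmetric])
qed (intro continuous_intros)+

lemma step_bounds: "0 \<le> step s" "step s \<le> 1"
proof -
  show "0 \<le> step s" unfolding step_def by simp
  have "(max 0 (1 - s))\<^sup>2 \<le> (max 0 (1 - s))\<^sup>2 + (max 0 (s - 1 / 4))\<^sup>2" by simp
  then show "step s \<le> 1" unfolding step_def using step_denominator[of s] by (simp only: divide_le_eq_1_pos)
qed

lemma step_eq_1:
  assumes "s \<le> 1 / 4"
  shows "step s = 1"
proof -
  have "max 0 (s - 1 / 4) = 0" "max 0 (1 - s) = 1 - s" "1 - s \<noteq> 0" using assms by auto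
  then show ?thesis by (simp add: step_def)
qed

lemma step_eq_0: "1 \<le> s \<Longrightarrow> step s = 0"
  by (simp add: step_def)

lemma step'_eq_0: "s \<le> 1 / 4 \<or> 1 \<le> s \<Longrightarrow> step' s = 0"
  by (auto simp: step'_def)

lemma step'_bounded: "\<exists>B>0. \<forall>s. \<bar>step' s\<bar> \<le> B"
proof -
  have "\<exists>B>0. \<forall>s. norm (step' s) \<le> B"
    using compact_support_bounded[OF step'_continuous compact_Icc[of "1 / 4" 1]] step'_eq_0
    by (metis atLeastAtMost_iff linorder_le_cases)
  then show ?thesis by simp
qed

lemma step_compose_derivative:
  fixes x :: "'a::euclidean_space"
  shows "((\<lambda>x. step (c * (x \<bullet> x))) has_derivative (\<lambda>h. ((step' (c * (x \<bullet> x)) * (2 * c)) *\<^sub>R x) \<bullet> h)) (at x)"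
proof -
  have i: "((\<lambda>x. x \<bullet> x) has_derivative (\<lambda>h. x \<bullet> h + h \<bullet> x)) (at x)"
    by (rule has_derivative_inner[OF has_derivative_ident has_derivative_ident])
  have "((\<lambda>x. c * (x \<bullet> x)) has_derivative (\<lambda>h. c * (x \<bullet> h + h \<bullet> x))) (at x)"
    by (rule has_derivative_mult_right[OF i])
  then have "((\<lambda>x. step (c * (x \<bullet> x))) has_derivative (\<lambda>h. step' (c * (x \<bullet> x)) * (c * (x \<bullet> h + h \<bullet> x)))) (at x)"
    using has_derivative_compose[of "\<lambda>x. c * (x \<bullet> x)" "\<lambda>h. c * (x \<bullet> h + h \<bullet> x)" x UNIV step "\<lambda>t. step' (c * (x \<bullet> x)) * t"]
      step_derivative[of "c * (x \<bullet> x)"] by (simp add: has_field_derivative_def)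
  moreover have "step' (c * (x \<bullet> x)) * (c * (x \<bullet> h + h \<bullet> x)) = ((step' (c * (x \<bullet> x)) * (2 * c)) *\<^sub>R x) \<bullet> h" for h
    by (simp add: inner_commute[of h x])
  ultimately show ?thesis by simp
qed

lemma emeasure_ball_plane: "0 \<le> q \<Longrightarrow> emeasure lborel (ball (0::real^2) q) = ennreal (pi * q\<^sup>2)"
  by (simp add: emeasure_ball unit_ball_vol_2)

text \<open>The cutoff is the convex combination of the functions
  \<open>step (4 ^ j * (x \<bullet> x))\<close> with weights \<open>a j\<close>. The gradient of the
  j-th one lives where \<open>norm x\<close> is between \<open>(1 / 2) ^ (j + 1)\<close> and
  \<open>(1 / 2) ^ j\<close>. These annuli are disjoint, so at each point at most one summand
  contributes, with size at most a constant times \<open>a j * 2 ^ j\<close>.\<close>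

lemma radial_cutoff:
  assumes B0: "B0 > 0" "\<And>s. \<bar>step' s\<bar> \<le> B0" and a0: "\<And>j. a j \<ge> 0" and a1: "(\<Sum>j=m..m + n. a j) = 1"
  shows "\<exists>\<eta> \<eta>' \<rho> B. \<rho> > 0 \<and> (\<forall>x::real^2. (\<eta> has_derivative (\<lambda>h. \<eta>' x \<bullet> h)) (at x)) \<and> continuous_on UNIV \<eta>' \<and>
    (\<forall>x. norm (\<eta>' x) \<le> B) \<and> (\<forall>x. 0 \<le> \<eta> x \<and> \<eta> x \<le> 1) \<and> (\<forall>x. norm x < \<rho> \<longrightarrow> \<eta> x = 1 \<and> \<eta>' x = 0) \<and>
    (\<forall>x. (1 / 2) ^ m \<le> norm x \<longrightarrow> \<eta> x = 0 \<and> \<eta>' x = 0) \<and>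
    (\<forall>x. \<eta>' x = 0 \<or> (\<exists>j\<in>{m..m + n}. norm x < (1 / 2) ^ j \<and> norm (\<eta>' x) \<le> 2 * B0 * a j * 2 ^ j))"
proof -
  define J where "J = {m..m + n}"
  note a1 = a1[folded J_def]
  define \<eta> where "\<eta> x = (\<Sum>j\<in>J. a j * step (4 ^ j * (x \<bullet> x)))" for x :: "real^2"
  define \<eta>' where "\<eta>' x = (\<Sum>j\<in>J. (a j * (step' (4 ^ j * (x \<bullet> x)) * (2 * 4 ^ j))) *\<^sub>R x)" for x :: "real^2"
  have D: "(\<eta> has_derivative (\<lambda>h. \<eta>' x \<bullet> h)) (at x)" for x
  proof -
    have "((\<lambda>x. \<Sum>j\<in>J. a j * step (4 ^ j * (x \<bullet> x))) has_derivative
        (\<lambda>h. \<Sum>j\<in>J. a j * (((step' (4 ^ j * (x \<bullet> x)) * (2 * 4 ^ j)) *\<^sub>R x) \<bullet> h))) (at x)"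
      by (rule has_derivative_sum) (rule has_derivative_mult_right[OF step_compose_derivative])
    then show ?thesis
      by (simp add: \<eta>_def[abs_def] \<eta>'_def inner_sum_left mult.assoc)
  qed
  have four: "(4::real) ^ j = 2 ^ j * 2 ^ j" for j by (simp flip: power_mult_distrib)
  have sq: "4 ^ j * (x \<bullet> x) = (2 ^ j * norm x)\<^sup>2" for j and x :: "real^2"
    unfolding dot_square_norm power_mult_distrib four by (simp only: power2_eq_square)
  have act: "step' (4 ^ j * (x \<bullet> x)) = 0" if "\<not> (1 / 4 < (2 ^ j * norm x)\<^sup>2 \<and> (2 ^ j * norm x)\<^sup>2 < 1)" for j and x :: "real^2"
    by (rule step'_eq_0) (use that in \<open>auto simp: sq\<close>)
  have act1: "2 ^ j * norm x < 1" "1 < 2 ^ Suc j * norm x" if "1 / 4 < (2 ^ j * norm x)\<^sup>2 \<and> (2 ^ j * norm x)\<^sup>2 < 1" for j and x :: "real^2"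
  proof -
    have nn: "0 \<le> 2 ^ j * norm x" by simp
    show "2 ^ j * norm x < 1" using that power_less_imp_less_base[of "2 ^ j * norm x" 2 1] by simp
    have "(1 / 2)\<^sup>2 < (2 ^ j * norm x)\<^sup>2" using that by (simp add: power2_eq_square)
    then have "1 / 2 < 2 ^ j * norm x" using power_less_imp_less_base[OF _ nn] by blast
    then show "1 < 2 ^ Suc j * norm x" by simp
  qed
  have bnd: "norm ((a j * (step' (4 ^ j * (x \<bullet> x)) * (2 * 4 ^ j))) *\<^sub>R x) \<le> 2 * B0 * a j * 2 ^ j" for j and x :: "real^2"
  proof (cases "1 / 4 < (2 ^ j * norm x)\<^sup>2 \<and> (2 ^ j * norm x)\<^sup>2 < 1")
    case True
    have "norm ((a j * (step' (4 ^ j * (x \<bullet> x)) * (2 * 4 ^ j))) *\<^sub>R x) = (2 * a j * 2 ^ j) * (\<bar>step' (4 ^ j * (x \<bullet> x))\<bar> * (2 ^ j * norm x))"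
      using a0[of j] by (simp add: abs_mult four)
    also have "\<dots> \<le> (2 * a j * 2 ^ j) * (B0 * 1)"
      using a0[of j] B0 act1(1)[OF True] by (intro mult_left_mono mult_mono) auto
    finally show ?thesis by (simp add: mult_ac)
  next
    case False
    then show ?thesis using act[OF False] a0[of j] B0(1) by simp
  qed
  have uniq: "i = j" if "1 / 4 < (2 ^ i * norm x)\<^sup>2 \<and> (2 ^ i * norm x)\<^sup>2 < 1" "1 / 4 < (2 ^ j * norm x)\<^sup>2 \<and> (2 ^ j * norm x)\<^sup>2 < 1"
    for i j and x :: "real^2"
  proof -
    have *: False if "1 < 2 ^ Suc i * norm x" "2 ^ j * norm x < 1" "i < j" for i j
    proof -
      have "(2::real) ^ Suc i * norm x \<le> 2 ^ j * norm x" using that(3) by (intro mult_right_mono power_increasing) auto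
      then show False using that by linarith
    qed
    show ?thesis using *[of i j] *[of j i] act1[OF that(1)] act1[OF that(2)] by (meson linorder_neqE_nat)
  qed
  have alt: "\<eta>' x = 0 \<or> (\<exists>j\<in>{m..m + n}. norm x < (1 / 2) ^ j \<and> norm (\<eta>' x) \<le> 2 * B0 * a j * 2 ^ j)" for x
  proof (cases "\<exists>j\<in>J. 1 / 4 < (2 ^ j * norm x)\<^sup>2 \<and> (2 ^ j * norm x)\<^sup>2 < 1")
    case True
    then obtain j where j: "j \<in> J" "1 / 4 < (2 ^ j * norm x)\<^sup>2 \<and> (2 ^ j * norm x)\<^sup>2 < 1" by blast
    have "step' (4 ^ i * (x \<bullet> x)) = 0" if "i \<in> J - {j}" for i
      using act uniq[OF _ j(2)] that by blast
    then have "\<eta>' x = (\<Sum>i\<in>{j}. (a i * (step' (4 ^ i * (x \<bullet> x)) * (2 * 4 ^ i))) *\<^sub>R x)"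
      unfolding \<eta>'_def using j(1) by (intro sum.mono_neutral_right) (auto simp: J_def)
    then have "norm (\<eta>' x) \<le> 2 * B0 * a j * 2 ^ j" using bnd[of j x] by simp
    moreover have "norm x < (1 / 2) ^ j" using act1(1)[OF j(2)] by (simp add: power_one_over field_simps)
    ultimately show ?thesis using j(1) by (auto simp: J_def)
  next
    case False
    then have "step' (4 ^ j * (x \<bullet> x)) = 0" if "j \<in> J" for j using act that by blast
    then show ?thesis unfolding \<eta>'_def by simp
  qed
  have near: "\<eta> x = 1" "\<eta>' x = 0" if x: "norm x < (1 / 2) ^ (m + n + 1)" for x
  proof -
    have s: "4 ^ j * (x \<bullet> x) \<le> 1 / 4" if "j \<in> J" for j
    proof -
      have "(1 / 2 :: real) ^ (m + n + 1) \<le> (1 / 2) ^ (j + 1)"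
        by (rule power_decreasing) (use that in \<open>auto simp: J_def\<close>)
      then have "norm x \<le> (1 / 2) ^ (j + 1)" using x by linarith
      then have "2 ^ j * norm x \<le> 2 ^ j * (1 / 2) ^ (j + 1)" by (intro mult_left_mono) auto
      then have "2 ^ j * norm x \<le> 1 / 2" by (simp add: power_one_over)
      then have "(2 ^ j * norm x)\<^sup>2 \<le> (1 / 2)\<^sup>2" by (intro power_mono) auto
      moreover have "(1 / 2 :: real)\<^sup>2 = 1 / 4" by (simp add: power2_eq_square)
      ultimately show ?thesis unfolding sq by linarith
    qed
    show "\<eta> x = 1" using a1 by (simp add: \<eta>_def step_eq_1[OF s])
    show "\<eta>' x = 0" by (simp add: \<eta>'_def step'_eq_0[OF disjI1[OF s]])
  qed
  have far: "\<eta> x = 0" "\<eta>' x = 0" if x: "(1 / 2) ^ m \<le> norm x" for x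
  proof -
    have s: "1 \<le> 4 ^ j * (x \<bullet> x)" if "j \<in> J" for j
    proof -
      have "(1 / 2 :: real) ^ j \<le> (1 / 2) ^ m"
        by (rule power_decreasing) (use that in \<open>auto simp: J_def\<close>)
      then have "(1 / 2) ^ j \<le> norm x" using x by linarith
      then have "2 ^ j * (1 / 2) ^ j \<le> 2 ^ j * norm x" by (intro mult_left_mono) auto
      then have "1 \<le> 2 ^ j * norm x" by (simp add: power_one_over)
      then have "1\<^sup>2 \<le> (2 ^ j * norm x)\<^sup>2" by (intro power_mono) auto
      then show ?thesis by (simp add: sq)
    qed
    show "\<eta> x = 0" by (simp add: \<eta>_def step_eq_0[OF s])
    show "\<eta>' x = 0" by (simp add: \<eta>'_def step'_eq_0[OF disjI2[OF s]])
  qed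
  have cont: "continuous_on UNIV \<eta>'"
    unfolding \<eta>'_def
  proof (intro continuous_on_sum continuous_on_scaleR continuous_on_mult continuous_on_const continuous_on_id)
    show "continuous_on UNIV (\<lambda>x::real^2. step' (4 ^ j * (x \<bullet> x)))" for j
      by (rule continuous_on_compose2[OF step'_continuous])
        (intro continuous_on_mult continuous_on_const continuous_on_inner continuous_on_id, simp)
  qed
  have bound: "norm (\<eta>' x) \<le> (\<Sum>j\<in>J. 2 * B0 * a j * 2 ^ j)" for x
    unfolding \<eta>'_def by (rule sum_norm_le) (rule bnd)
  have range: "0 \<le> \<eta> x" "\<eta> x \<le> 1" for x
  proof -
    show "0 \<le> \<eta> x" unfolding \<eta>_def by (intro sum_nonneg mult_nonneg_nonneg a0 step_bounds)
    have "\<eta> x \<le> (\<Sum>j\<in>J. a j * 1)" unfolding \<eta>_def by (intro sum_mono mult_left_mono a0 step_bounds)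
    then show "\<eta> x \<le> 1" using a1 by simp
  qed
  show ?thesis
    by (intro exI[of _ \<eta>] exI[of _ \<eta>'] exI[of _ "(1 / 2) ^ (m + n + 1)"] exI[of _ "\<Sum>j\<in>J. 2 * B0 * a j * 2 ^ j"]
        conjI allI D cont bound range alt impI near far) simp_all
qed

text \<open>The weights are proportional to \<open>t j * (1 / 2) ^ j\<close>, with
  \<open>t j\<close> a near maximiser for the slope \<open>2 ^ j\<close>, so the gradient on the
  j-th annulus is of order \<open>t j / \<Lambda>\<close>. Convexity gains a factor
  \<open>1 / \<Lambda>\<close>, but the sum of the energies, itself of order at most
  \<open>\<Lambda>\<close>, uses it up. The additional factor \<open>\<kappa>\<close> from the
  superlinear decay, available because divergence makes \<open>\<Lambda>\<close> large, renders the
  total small.\<close>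

lemma (in finite_orlicz) capacity_cutoff:
  assumes conj_finite: "\<And>s. s \<ge> 0 \<Longrightarrow> conjugate \<phi> s < \<infinity>" and nabla2: "Nabla2 \<phi>"
    and div: "integral_diverges_at_0 (\<lambda>r. conjugate \<phi> (1 / r) * ennreal r)"
    and M: "M \<ge> 0" and \<epsilon>: "\<epsilon> > 0"
  shows "\<exists>\<eta> \<eta>' \<rho> B. \<rho> > 0 \<and> (\<forall>x::real^2. (\<eta> has_derivative (\<lambda>h. \<eta>' x \<bullet> h)) (at x)) \<and> continuous_on UNIV \<eta>' \<and>
    (\<forall>x. norm (\<eta>' x) \<le> B) \<and> (\<forall>x. 0 \<le> \<eta> x \<and> \<eta> x \<le> 1) \<and> (\<forall>x. norm x < \<rho> \<longrightarrow> \<eta> x = 1 \<and> \<eta>' x = 0) \<and>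
    (\<forall>x. (1 / 2) ^ m \<le> norm x \<longrightarrow> \<eta> x = 0 \<and> \<eta>' x = 0) \<and>
    (\<integral>\<^sup>+x. \<phi> (M * norm (\<eta>' x)) \<partial>lborel) \<le> ennreal \<epsilon>"
proof -
  note yn = y_nonneg[OF conj_finite]
  obtain B0 where B0: "B0 > 0" "\<And>s. \<bar>step' s\<bar> \<le> B0" using step'_bounded by blast
  obtain c where c: "c > 0" "\<forall>s\<ge>0. \<exists>t\<ge>0. y s / 2 \<le> s * t \<and> r t \<le> c * y s"
    using y_maximizer_bounds[OF conj_finite nabla2] by blast
  have "\<forall>j::nat. \<exists>t. t \<ge> 0 \<and> y (2 ^ j) / 2 \<le> 2 ^ j * t \<and> r t \<le> c * y (2 ^ j)"
    using c(2) by simp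
  from choice[OF this] obtain t where t: "\<forall>j. t j \<ge> 0 \<and> y (2 ^ j) / 2 \<le> 2 ^ j * t j \<and> r (t j) \<le> c * y (2 ^ j)" by blast
  define L where "L = 2 * M * B0"
  have L: "L \<ge> 0" using M B0 by (simp add: L_def)
  obtain CL where CL: "CL \<ge> 0" "\<And>t. t \<ge> 0 \<Longrightarrow> \<phi> (L * t) \<le> ennreal CL * \<phi> t" using scale_bound[OF L] by blast
  have CLr: "r (L * t) \<le> CL * r t" if "t \<ge> 0" for t
  proof -
    have "ennreal (r (L * t)) \<le> ennreal (CL * r t)"
      using CL that L r_nonneg by (simp add: ennreal_r ennreal_mult)
    then show ?thesis using CL(1) r_nonneg by (simp add: ennreal_le_iff)
  qed
  \<comment> \<open>The constant \<open>2 * pi * CL * c\<close> is what remains once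
    \<open>Y \<le> 2 * \<Lambda>\<close> has cancelled \<open>\<Lambda>\<close>; the summand 1 keeps
    the denominator positive.\<close>
  define \<kappa> where "\<kappa> = \<epsilon> / (2 * pi * CL * c + 1)"
  have den: "2 * pi * CL * c + 1 > 0" using CL(1) c(1) by (simp add: add_nonneg_pos)
  have \<kappa>: "\<kappa> > 0" using den \<epsilon> by (simp add: \<kappa>_def)
  have \<kappa>_le: "\<kappa> * (2 * pi * CL * c) \<le> \<epsilon>"
  proof -
    have "\<kappa> * (2 * pi * CL * c + 1) = \<epsilon>" using den by (simp add: \<kappa>_def)
    then show ?thesis using \<kappa> by (simp add: algebra_simps)
  qed
  obtain lam0 where l0: "lam0 > 0" "\<And>l t. 0 < l \<Longrightarrow> l \<le> lam0 \<Longrightarrow> t \<ge> 0 \<Longrightarrow> r (l * t) \<le> \<kappa> * l * r t"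
    using r_superlinear_decay[OF conj_finite nabla2 \<kappa>] by blast
  \<comment> \<open>Together with \<open>Y \<le> 2 * \<Lambda>\<close> this forces
    \<open>1 / \<Lambda> \<le> lam0\<close>, the range in which the decay estimate holds.\<close>
  obtain n where n: "2 / lam0 < (\<Sum>j=m..m + n. y (2 ^ j) * (1 / 4) ^ j)"
    using dyadic_sum_unbounded[OF conj_finite div] by blast
  define J where "J = {m..m + n}"
  define Y where "Y = (\<Sum>j\<in>J. y (2 ^ j) * (1 / 4) ^ j)"
  define \<Lambda> where "\<Lambda> = (\<Sum>j\<in>J. t j * (1 / 2) ^ j)"
  have YL: "Y \<le> 2 * \<Lambda>"
    unfolding Y_def \<Lambda>_def sum_distrib_left
  proof (rule sum_mono)
    fix j
    have "(1 / 4 :: real) ^ j = (1 / 2) ^ j * (1 / 2) ^ j" by (simp flip: power_mult_distrib)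
    moreover have "y (2 ^ j) \<le> 2 * (2 ^ j * t j)" using t by (simp add: field_simps)
    ultimately have "y (2 ^ j) * (1 / 4) ^ j \<le> 2 * (2 ^ j * t j) * ((1 / 2) ^ j * (1 / 2) ^ j)"
      by (simp add: mult_right_mono)
    also have "\<dots> = 2 * (t j * (1 / 2) ^ j)" by (simp add: power_one_over field_simps)
    finally show "y (2 ^ j) * (1 / 4) ^ j \<le> 2 * (t j * (1 / 2) ^ j)" .
  qed
  have Y: "2 / lam0 < Y" using n by (simp add: Y_def J_def)
  then have \<Lambda>: "\<Lambda> > 0" "1 / \<Lambda> \<le> lam0"
  proof -
    have "1 / lam0 < \<Lambda>" using Y YL by simp
    moreover have "0 < 1 / lam0" using l0(1) by simp
    ultimately show "\<Lambda> > 0" by linarith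
    then show "1 / \<Lambda> \<le> lam0" using \<open>1 / lam0 < \<Lambda>\<close> l0(1) by (simp add: field_simps)
  qed
  define a where "a j = t j * (1 / 2) ^ j / \<Lambda>" for j
  have a0: "a j \<ge> 0" for j using t \<Lambda>(1) by (simp add: a_def)
  have a1: "(\<Sum>j\<in>J. a j) = 1"
  proof -
    have "(\<Sum>j\<in>J. a j) = (\<Sum>j\<in>J. t j * (1 / 2) ^ j) / \<Lambda>" unfolding a_def by (rule sum_divide_distrib[symmetric])
    also have "\<dots> = \<Lambda> / \<Lambda>" by (simp only: \<Lambda>_def)
    finally show ?thesis using \<Lambda>(1) by simp
  qed
  obtain \<eta> \<eta>' \<rho> B where cut: "\<rho> > 0" "\<forall>x::real^2. (\<eta> has_derivative (\<lambda>h. \<eta>' x \<bullet> h)) (at x)" "continuous_on UNIV \<eta>'"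
      "\<forall>x. norm (\<eta>' x) \<le> B" "\<forall>x. 0 \<le> \<eta> x \<and> \<eta> x \<le> 1" "\<forall>x. norm x < \<rho> \<longrightarrow> \<eta> x = 1 \<and> \<eta>' x = 0"
      "\<forall>x. (1 / 2) ^ m \<le> norm x \<longrightarrow> \<eta> x = 0 \<and> \<eta>' x = 0"
    and alt: "\<forall>x. \<eta>' x = 0 \<or> (\<exists>j\<in>J. norm x < (1 / 2) ^ j \<and> norm (\<eta>' x) \<le> 2 * B0 * a j * 2 ^ j)"
    using radial_cutoff[OF B0 a0 a1[unfolded J_def], folded J_def] by blast
  have E: "\<phi> (M * norm (\<eta>' x)) \<le> (\<Sum>j\<in>J. ennreal (r (L * (1 / \<Lambda> * t j))) * indicator (ball 0 ((1 / 2) ^ j)) x)" for x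
  proof (cases "\<eta>' x = 0")
    case False
    then obtain j where j: "j \<in> J" "norm x < (1 / 2) ^ j" "norm (\<eta>' x) \<le> 2 * B0 * a j * 2 ^ j" using alt by blast
    have "M * norm (\<eta>' x) \<le> M * (2 * B0 * a j * 2 ^ j)" using M j(3) by (intro mult_left_mono)
    also have "\<dots> = L * (1 / \<Lambda> * t j)" by (simp add: L_def a_def power_one_over)
    finally have "\<phi> (M * norm (\<eta>' x)) \<le> \<phi> (L * (1 / \<Lambda> * t j))" using M by (intro mono) auto
    also have "\<dots> = ennreal (r (L * (1 / \<Lambda> * t j)))" using L \<Lambda>(1) t by (intro ennreal_r[symmetric]) simp
    also have "\<dots> = (\<Sum>j\<in>{j}. ennreal (r (L * (1 / \<Lambda> * t j))) * indicator (ball 0 ((1 / 2) ^ j)) x)"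
      using j(2) by simp
    also have "\<dots> \<le> (\<Sum>j\<in>J. ennreal (r (L * (1 / \<Lambda> * t j))) * indicator (ball 0 ((1 / 2) ^ j)) x)"
      by (rule sum_mono2) (use j(1) in \<open>auto simp: J_def\<close>)
    finally show ?thesis .
  qed (simp add: zero)
  have energy: "(\<integral>\<^sup>+x. \<phi> (M * norm (\<eta>' x)) \<partial>lborel) \<le> ennreal \<epsilon>"
  proof -
    have "(\<integral>\<^sup>+x. \<phi> (M * norm (\<eta>' x)) \<partial>lborel) \<le>
        (\<integral>\<^sup>+x. (\<Sum>j\<in>J. ennreal (r (L * (1 / \<Lambda> * t j))) * indicator (ball 0 ((1 / 2) ^ j)) x) \<partial>(lborel :: (real^2) measure))"
      by (rule nn_integral_mono) (rule E)
    also have "\<dots> = (\<Sum>j\<in>J. ennreal (r (L * (1 / \<Lambda> * t j))) * emeasure lborel (ball (0::real^2) ((1 / 2) ^ j)))"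
    proof -
      have "(\<integral>\<^sup>+x. (\<Sum>j\<in>J. ennreal (r (L * (1 / \<Lambda> * t j))) * indicator (ball 0 ((1 / 2) ^ j)) x) \<partial>(lborel :: (real^2) measure)) =
          (\<Sum>j\<in>J. \<integral>\<^sup>+x. ennreal (r (L * (1 / \<Lambda> * t j))) * indicator (ball 0 ((1 / 2) ^ j)) x \<partial>(lborel :: (real^2) measure))"
        by (rule nn_integral_sum) (intro borel_measurable_times_ennreal borel_measurable_const borel_measurable_indicator, simp)
      also have "\<dots> = (\<Sum>j\<in>J. ennreal (r (L * (1 / \<Lambda> * t j))) * emeasure lborel (ball (0::real^2) ((1 / 2) ^ j)))"
        by (intro sum.cong refl nn_integral_cmult_indicator) simp
      finally show ?thesis .
    qed
    also have "\<dots> \<le> (\<Sum>j\<in>J. ennreal ((CL * \<kappa> * (1 / \<Lambda>) * c * pi) * (y (2 ^ j) * (1 / 4) ^ j)))"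
    proof (rule sum_mono)
      fix j
      have "r (L * (1 / \<Lambda> * t j)) \<le> CL * r (1 / \<Lambda> * t j)" using \<Lambda>(1) t by (intro CLr) simp
      also have "\<dots> \<le> CL * (\<kappa> * (1 / \<Lambda>) * r (t j))" using \<Lambda> t CL(1) by (intro mult_left_mono l0(2)) auto
      also have "\<dots> \<le> CL * (\<kappa> * (1 / \<Lambda>) * (c * y (2 ^ j)))" using \<Lambda>(1) t CL(1) \<kappa> by (intro mult_left_mono) auto
      finally have "r (L * (1 / \<Lambda> * t j)) * (pi * (1 / 4) ^ j) \<le> CL * (\<kappa> * (1 / \<Lambda>) * (c * y (2 ^ j))) * (pi * (1 / 4) ^ j)"
        by (rule mult_right_mono) simp
      also have "\<dots> = (CL * \<kappa> * (1 / \<Lambda>) * c * pi) * (y (2 ^ j) * (1 / 4) ^ j)" by (simp only: mult_ac)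
      finally have le: "ennreal (r (L * (1 / \<Lambda> * t j)) * (pi * (1 / 4) ^ j)) \<le> ennreal ((CL * \<kappa> * (1 / \<Lambda>) * c * pi) * (y (2 ^ j) * (1 / 4) ^ j))"
        by (rule ennreal_leI)
      have "((1 / 2 :: real) ^ j)\<^sup>2 = (1 / 4) ^ j" by (simp add: power2_eq_square flip: power_mult_distrib)
      then have "emeasure lborel (ball (0::real^2) ((1 / 2) ^ j)) = ennreal (pi * (1 / 4) ^ j)"
        by (simp only: emeasure_ball_plane zero_le_power zero_le_divide_1_iff zero_le_numeral)
      then have "ennreal (r (L * (1 / \<Lambda> * t j))) * emeasure lborel (ball (0::real^2) ((1 / 2) ^ j)) =
          ennreal (r (L * (1 / \<Lambda> * t j)) * (pi * (1 / 4) ^ j))"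
        by (simp only:) (rule ennreal_mult[symmetric], simp_all add: r_nonneg)
      with le show "ennreal (r (L * (1 / \<Lambda> * t j))) * emeasure lborel (ball (0::real^2) ((1 / 2) ^ j)) \<le>
          ennreal ((CL * \<kappa> * (1 / \<Lambda>) * c * pi) * (y (2 ^ j) * (1 / 4) ^ j))" by (simp only:)
    qed
    also have "\<dots> = ennreal (\<Sum>j\<in>J. (CL * \<kappa> * (1 / \<Lambda>) * c * pi) * (y (2 ^ j) * (1 / 4) ^ j))"
      by (rule sum_ennreal) (use CL(1) \<kappa> \<Lambda>(1) c(1) yn in simp)
    also have "(\<Sum>j\<in>J. (CL * \<kappa> * (1 / \<Lambda>) * c * pi) * (y (2 ^ j) * (1 / 4) ^ j)) = (CL * \<kappa> * (1 / \<Lambda>) * c * pi) * Y"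
      unfolding Y_def by (rule sum_distrib_left[symmetric])
    also have "\<dots> \<le> (CL * \<kappa> * (1 / \<Lambda>) * c * pi) * (2 * \<Lambda>)"
      using YL CL(1) \<kappa> \<Lambda>(1) c(1) by (intro mult_left_mono) auto
    also have "\<dots> = \<kappa> * (2 * pi * CL * c)" using \<Lambda>(1) by simp
    finally show ?thesis using \<kappa>_le by (meson ennreal_leI order_trans)
  qed
  show ?thesis
    by (intro exI[of _ \<eta>] exI[of _ \<eta>'] exI[of _ \<rho>] exI[of _ B] conjI cut energy)
qed

text \<open>With \<open>H n\<close> the gradient of \<open>(1 - \<eta> n x) * u x\<close>, the error
  is \<open>\<eta> n x *\<^sub>R G x + u x *\<^sub>R \<eta>' n x\<close>. The first term has
  shrinking support; in the second the bound on \<open>u\<close> enters as the factor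
  \<open>M\<close> of the capacity estimate.\<close>

lemma (in double_phase_functions) approximable_case_1:
  assumes conj_finite: "\<And>s. s \<ge> 0 \<Longrightarrow> conjugate \<psi> s < \<infinity>" and nabla2: "Nabla2 \<psi>"
    and div: "integral_diverges_at_0 (\<lambda>r. conjugate \<psi> (1 / r) * ennreal r)"
    and dom: "\<And>t. t \<ge> 0 \<Longrightarrow> \<phi> t \<le> ennreal c\<^sub>3 * \<psi> t + ennreal c\<^sub>4"
    and s: "sob \<Omega> A u G" and bd: "\<And>x. \<bar>u x\<bar> \<le> M" and fin: "modular G < \<infinity>"
  shows "approximable G"
proof -
  note sob_measurable[OF s, measurable]
  have M: "M \<ge> 0" using bd[of 0] by linarith
  define Q where "Q n p \<longleftrightarrow> (case p of (\<eta>, \<eta>', \<rho>, B) \<Rightarrow> \<rho> > 0 \<and> (\<forall>x::real^2. (\<eta> has_derivative (\<lambda>h. \<eta>' x \<bullet> h)) (at x)) \<and> continuous_on UNIV \<eta>' \<and>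
    (\<forall>x. norm (\<eta>' x) \<le> B) \<and> (\<forall>x. 0 \<le> \<eta> x \<and> \<eta> x \<le> 1) \<and> (\<forall>x. norm x < \<rho> \<longrightarrow> \<eta> x = 1 \<and> \<eta>' x = 0) \<and>
    (\<forall>x. (1 / 2) ^ n \<le> norm x \<longrightarrow> \<eta> x = 0 \<and> \<eta>' x = 0) \<and>
    (\<integral>\<^sup>+x. \<psi> (M * norm (\<eta>' x)) \<partial>lborel) \<le> ennreal ((1 / 2) ^ n))" for n and p :: "(real^2 \<Rightarrow> real) \<times> (real^2 \<Rightarrow> real^2) \<times> real \<times> real"
  have "\<exists>p. Q n p" for n
  proof -
    obtain \<eta> \<eta>' \<rho> B where "Q n (\<eta>, \<eta>', \<rho>, B)"
      using psi.capacity_cutoff[OF conj_finite nabla2 div M, of "(1 / 2) ^ n" n] unfolding Q_def split by auto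
    then show ?thesis by blast
  qed
  then obtain P where P: "\<And>n. Q n (P n)" using choice[of Q] by blast
  define \<eta> \<eta>' \<rho> B where "\<eta> n = fst (P n)" and "\<eta>' n = fst (snd (P n))" and "\<rho> n = fst (snd (snd (P n)))" and "B n = snd (snd (snd (P n)))" for n
  have \<rho>: "\<rho> n > 0" and D: "(\<eta> n has_derivative (\<lambda>h. \<eta>' n x \<bullet> h)) (at x)" and cont: "continuous_on UNIV (\<eta>' n)"
    and bnd: "norm (\<eta>' n x) \<le> B n" and rng: "0 \<le> \<eta> n x" "\<eta> n x \<le> 1"
    and near: "norm x < \<rho> n \<Longrightarrow> \<eta> n x = 1" "norm x < \<rho> n \<Longrightarrow> \<eta>' n x = 0"
    and far: "(1 / 2) ^ n \<le> norm x \<Longrightarrow> \<eta> n x = 0" "(1 / 2) ^ n \<le> norm x \<Longrightarrow> \<eta>' n x = 0"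
    and en: "(\<integral>\<^sup>+x. \<psi> (M * norm (\<eta>' n x)) \<partial>lborel) \<le> ennreal ((1 / 2) ^ n)" for n x
    using P[of n] unfolding Q_def \<eta>_def \<eta>'_def \<rho>_def B_def split_beta by auto
  have contE: "continuous_on UNIV (\<eta> n)" for n by (rule has_derivative_continuous_on[OF has_derivative_at_withinI[OF D]])
  have [measurable]: "\<eta> n \<in> borel_measurable borel" "\<eta>' n \<in> borel_measurable borel" for n
    using contE cont by (auto intro: borel_measurable_continuous_onI)
  have mod1: "(\<lambda>n. modular (\<lambda>x. \<eta> n x *\<^sub>R G x)) \<longlonglongrightarrow> 0"
  proof (rule modular_multiplier_tendsto_0[OF _ fin])
    show "\<bar>\<eta> n x\<bar> \<le> 1" for n x using rng[of n x] by simp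
    have "AE x in lborel. x \<noteq> (0::real^2)" by (rule AE_lborel_singleton)
    then show "AE x in lborel. (\<lambda>n. norm (\<eta> n x *\<^sub>R G x)) \<longlonglongrightarrow> 0"
    proof eventually_elim
      case (elim x)
      have "(\<lambda>n. (1 / 2 :: real) ^ n) \<longlonglongrightarrow> 0" by (rule LIMSEQ_power_zero) simp
      then have "\<forall>\<^sub>F n in sequentially. (1 / 2) ^ n < norm x" by (rule order_tendstoD) (use elim in simp)
      then have "\<forall>\<^sub>F n in sequentially. norm (\<eta> n x *\<^sub>R G x) = 0" by eventually_elim (simp add: far)
      then show ?case by (rule tendsto_eventually)
    qed
  qed measurable
  have em: "emeasure lborel (ball (0::real^2) ((1 / 2) ^ n)) \<le> ennreal (pi * (1 / 2) ^ n)" for n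
  proof -
    have "((1 / 2 :: real) ^ n)\<^sup>2 \<le> (1 / 2) ^ n" by (simp add: power2_eq_square mult_left_le_one_le power_le_one)
    then show ?thesis by (simp add: emeasure_ball_plane ennreal_leI)
  qed
  have modle: "modular (\<lambda>x. u x *\<^sub>R \<eta>' n x) \<le> ennreal c\<^sub>3 * ennreal ((1 / 2) ^ n) + ennreal c\<^sub>4 * ennreal (pi * (1 / 2) ^ n) + ennreal ((1 / 2) ^ n)" for n
  proof -
    have "(\<lambda>x. M *\<^sub>R \<eta>' n x) \<in> borel_measurable borel" by measurable
    from psi.norm_measurable[OF this] have [measurable]: "(\<lambda>x. \<psi> (M * norm (\<eta>' n x))) \<in> borel_measurable borel" using M by simp
    have "modular (\<lambda>x. u x *\<^sub>R \<eta>' n x) \<le> (\<integral>\<^sup>+x. ennreal c\<^sub>3 * \<psi> (M * norm (\<eta>' n x)) + ennreal c\<^sub>4 * indicator (ball 0 ((1 / 2) ^ n)) x + \<psi> (M * norm (\<eta>' n x)) \<partial>lborel)"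
      unfolding modular_def
    proof (rule nn_integral_mono)
      fix x
      have "norm (u x *\<^sub>R \<eta>' n x) \<le> M * norm (\<eta>' n x)" using bd[of x] by (simp add: mult_right_mono)
      then have "\<Phi> x (norm (u x *\<^sub>R \<eta>' n x)) * indicator \<Omega> x \<le> \<Phi> x (M * norm (\<eta>' n x)) * 1"
        by (intro mult_mono Phi_mono) (auto simp: indicator_def)
      also have "\<dots> \<le> \<phi> (M * norm (\<eta>' n x)) + \<psi> (M * norm (\<eta>' n x))"
        using weight_cases[of x] by (auto simp: double_phase_def)
      \<comment> \<open>Since \<open>\<eta>' n\<close> vanishes outside the ball of radius
        \<open>(1 / 2) ^ n\<close>, the additive constant of the domination is integrated over a
        shrinking area only.\<close>
      also have "\<phi> (M * norm (\<eta>' n x)) \<le> ennreal c\<^sub>3 * \<psi> (M * norm (\<eta>' n x)) + ennreal c\<^sub>4 * indicator (ball 0 ((1 / 2) ^ n)) x"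
      proof (cases "norm x < (1 / 2) ^ n")
        case True
        then show ?thesis using dom[of "M * norm (\<eta>' n x)"] M by simp
      next
        case False
        then show ?thesis using far(2)[where x=x and n=n] by (simp add: phi.zero)
      qed
      finally show "\<Phi> x (norm (u x *\<^sub>R \<eta>' n x)) * indicator \<Omega> x \<le> ennreal c\<^sub>3 * \<psi> (M * norm (\<eta>' n x)) + ennreal c\<^sub>4 * indicator (ball 0 ((1 / 2) ^ n)) x + \<psi> (M * norm (\<eta>' n x))"
        by (simp add: add_right_mono)
    qed
    also have "\<dots> = ennreal c\<^sub>3 * (\<integral>\<^sup>+x. \<psi> (M * norm (\<eta>' n x)) \<partial>lborel) + ennreal c\<^sub>4 * emeasure lborel (ball (0::real^2) ((1 / 2) ^ n)) + (\<integral>\<^sup>+x. \<psi> (M * norm (\<eta>' n x)) \<partial>lborel)"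
    proof -
      let ?p = "\<lambda>x. \<psi> (M * norm (\<eta>' n x))" and ?i = "indicator (ball (0::real^2) ((1 / 2) ^ n)) :: real^2 \<Rightarrow> ennreal"
      have im: "(\<lambda>x. ennreal c\<^sub>4 * ?i x) \<in> borel_measurable lborel"
        by (intro borel_measurable_times_ennreal borel_measurable_const borel_measurable_indicator) simp
      have "(\<integral>\<^sup>+x. ennreal c\<^sub>3 * ?p x + ennreal c\<^sub>4 * ?i x + ?p x \<partial>lborel) =
          (\<integral>\<^sup>+x. ennreal c\<^sub>3 * ?p x \<partial>lborel) + (\<integral>\<^sup>+x. ennreal c\<^sub>4 * ?i x \<partial>lborel) + (\<integral>\<^sup>+x. ?p x \<partial>lborel)"
        using im by (subst nn_integral_add; simp add: nn_integral_add)
      then show ?thesis by (simp add: nn_integral_cmult nn_integral_cmult_indicator)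
    qed
    also have "\<dots> \<le> ennreal c\<^sub>3 * ennreal ((1 / 2) ^ n) + ennreal c\<^sub>4 * ennreal (pi * (1 / 2) ^ n) + ennreal ((1 / 2) ^ n)"
      by (intro add_mono mult_left_mono en em) simp_all
    finally show ?thesis .
  qed
  obtain C where C: "C \<ge> 0" and qa: "\<forall>F G H. F \<in> borel_measurable borel \<longrightarrow> G \<in> borel_measurable borel \<longrightarrow> H \<in> borel_measurable borel \<longrightarrow>
     (\<forall>x. norm (F x) \<le> norm (G x) + norm (H x)) \<longrightarrow> modular F \<le> ennreal C * (modular G + modular H)"
    using modular_quasi_add by blast
  define H where "H n x = (1 - \<eta> n x) *\<^sub>R G x + u x *\<^sub>R (- \<eta>' n x)" for n x
  have Hm [measurable]: "H n \<in> borel_measurable borel" for n unfolding H_def by measurable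
  have um [measurable]: "(\<lambda>x. u x *\<^sub>R \<eta>' n x) \<in> borel_measurable borel" "(\<lambda>x. \<eta> n x *\<^sub>R G x) \<in> borel_measurable borel" for n by measurable
  have GH: "G x - H n x = \<eta> n x *\<^sub>R G x + u x *\<^sub>R \<eta>' n x" for n x by (simp add: H_def algebra_simps)
  have appH: "approximable (H n)" for n
  proof (rule approximable_of_gradient_zero_near_origin[OF _ \<rho>[of n]])
    have D1: "((\<lambda>x. 1 - \<eta> n x) has_derivative (\<lambda>h. (- \<eta>' n x) \<bullet> h)) (at x)" for x
      using has_derivative_diff[OF has_derivative_const[of 1] D[of n x]] by simp
    have c1: "continuous_on UNIV (\<lambda>x. - \<eta>' n x)" by (intro continuous_on_minus cont)
    have "sob \<Omega> UNIV (\<lambda>x. (1 - \<eta> n x) * u x) (\<lambda>x. (1 - \<eta> n x) *\<^sub>R G x + u x *\<^sub>R (- \<eta>' n x))"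
      using sob_mult[OF s, of "\<lambda>x. 1 - \<eta> n x" "\<lambda>x. - \<eta>' n x" "B n"] D1 c1 rng[of n] bnd[of n] by simp
    then show "sob \<Omega> UNIV (\<lambda>x. (1 - \<eta> n x) * u x) (H n)" by (simp add: H_def[abs_def])
    show "H n x = 0" if "norm x < \<rho> n" for x using near[OF that] by (simp add: H_def)
    have nle: "norm (H n x) \<le> norm (G x) + norm (u x *\<^sub>R \<eta>' n x)" for x
    proof -
      have "norm (H n x) \<le> norm ((1 - \<eta> n x) *\<^sub>R G x) + norm (u x *\<^sub>R \<eta>' n x)"
        using norm_triangle_ineq[of "(1 - \<eta> n x) *\<^sub>R G x" "u x *\<^sub>R (- \<eta>' n x)"] by (simp add: H_def)
      moreover have "norm ((1 - \<eta> n x) *\<^sub>R G x) \<le> norm (G x)" using rng[of n x] by (simp add: mult_left_le_one_le)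
      ultimately show ?thesis by linarith
    qed
    have "modular (H n) \<le> ennreal C * (modular G + modular (\<lambda>x. u x *\<^sub>R \<eta>' n x))"
      using qa[rule_format, of "H n" G "\<lambda>x. u x *\<^sub>R \<eta>' n x"] nle by simp
    also have "\<dots> < \<infinity>"
    proof -
      have "modular (\<lambda>x. u x *\<^sub>R \<eta>' n x) < \<infinity>" by (rule order_le_less_trans[OF modle]) (simp add: ennreal_mult_less_top)
      then show ?thesis using fin by (simp add: ennreal_mult_less_top)
    qed
    finally show "modular (H n) < \<infinity>" .
  qed
  have lim2: "(\<lambda>n. modular (\<lambda>x. u x *\<^sub>R \<eta>' n x)) \<longlonglongrightarrow> 0"
  proof -
    define K where "K = max 0 c\<^sub>3 + max 0 c\<^sub>4 * pi + 1"
    have "(\<lambda>n. ennreal (K * (1 / 2) ^ n)) \<longlonglongrightarrow> ennreal (K * 0)"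
      by (intro tendsto_ennrealI tendsto_mult tendsto_const LIMSEQ_power_zero) simp
    then have l: "(\<lambda>n. ennreal (K * (1 / 2) ^ n)) \<longlonglongrightarrow> 0" by simp
    \<comment> \<open>The constants may have any sign, and \<open>ennreal\<close> sends negative
      numbers to 0.\<close>
    have pos: "ennreal c = ennreal (max 0 c)" for c by (cases "c \<ge> 0") (auto simp: max_def ennreal_neg)
    have "modular (\<lambda>x. u x *\<^sub>R \<eta>' n x) \<le> ennreal (K * (1 / 2) ^ n)" for n
    proof -
      have "ennreal c\<^sub>3 * ennreal ((1 / 2) ^ n) + ennreal c\<^sub>4 * ennreal (pi * (1 / 2) ^ n) + ennreal ((1 / 2) ^ n)
          = ennreal (max 0 c\<^sub>3 * (1 / 2) ^ n + max 0 c\<^sub>4 * (pi * (1 / 2) ^ n) + (1 / 2) ^ n)"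
        unfolding pos[of "c\<^sub>3"] pos[of "c\<^sub>4"] by (simp add: ennreal_mult)
      also have "max 0 c\<^sub>3 * (1 / 2) ^ n + max 0 c\<^sub>4 * (pi * (1 / 2) ^ n) + (1 / 2) ^ n = K * (1 / 2) ^ n"
        unfolding K_def by (simp add: distrib_right)
      finally show ?thesis using modle[of n] by simp
    qed
    then show ?thesis by (intro tendsto_sandwich[OF _ _ tendsto_const l]) simp_all
  qed
  have "(\<lambda>n. ennreal C * (modular (\<lambda>x. \<eta> n x *\<^sub>R G x) + modular (\<lambda>x. u x *\<^sub>R \<eta>' n x))) \<longlonglongrightarrow> ennreal C * (0 + 0)"
    by (intro ennreal_tendsto_cmult tendsto_add mod1 lim2) simp
  then have lim: "(\<lambda>n. ennreal C * (modular (\<lambda>x. \<eta> n x *\<^sub>R G x) + modular (\<lambda>x. u x *\<^sub>R \<eta>' n x))) \<longlonglongrightarrow> 0" by simp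
  show ?thesis
  proof (rule approximable_closed)
    show "G \<in> borel_measurable borel" by measurable
    fix \<epsilon> :: real assume "\<epsilon> > 0"
    then have "\<forall>\<^sub>F n in sequentially. ennreal C * (modular (\<lambda>x. \<eta> n x *\<^sub>R G x) + modular (\<lambda>x. u x *\<^sub>R \<eta>' n x)) < ennreal \<epsilon>"
      using order_tendstoD(2)[OF lim, of "ennreal \<epsilon>"] by simp
    then obtain n where n: "ennreal C * (modular (\<lambda>x. \<eta> n x *\<^sub>R G x) + modular (\<lambda>x. u x *\<^sub>R \<eta>' n x)) < ennreal \<epsilon>"
      by (meson eventually_sequentially order_refl)
    have "modular (\<lambda>x. G x - H n x) \<le> ennreal C * (modular (\<lambda>x. \<eta> n x *\<^sub>R G x) + modular (\<lambda>x. u x *\<^sub>R \<eta>' n x))"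
      unfolding GH using qa[rule_format, of "\<lambda>x. \<eta> n x *\<^sub>R G x + u x *\<^sub>R \<eta>' n x" "\<lambda>x. \<eta> n x *\<^sub>R G x" "\<lambda>x. u x *\<^sub>R \<eta>' n x"]
      by (simp add: norm_triangle_ineq del: norm_scaleR)
    then show "\<exists>H. approximable H \<and> modular (\<lambda>x. G x - H x) \<le> ennreal \<epsilon>"
      using n appH[of n] by (intro exI[of _ "H n"]) simp
  qed
qed

section \<open>The second case: small oscillation on squares\<close>

definition vec2 :: "real \<Rightarrow> real \<Rightarrow> real^2" where
  "vec2 a b = a *\<^sub>R axis 1 1 + b *\<^sub>R axis 2 1"

lemma vec2_nth [simp]: "vec2 a b $ 1 = a" "vec2 a b $ 2 = b"
  by (simp_all add: vec2_def axis_def)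

lemma vec2_eta: "vec2 (x $ 1) (x $ 2) = x"
proof (rule vec_eq_iff[THEN iffD2], rule allI)
  fix i :: 2
  show "vec2 (x $ 1) (x $ 2) $ i = x $ i" using exhaust_2[of i] by auto
qed

lemma vec2_measurable [measurable (raw)]:
  assumes [measurable]: "f \<in> borel_measurable M" "g \<in> borel_measurable M"
  shows "(\<lambda>x. vec2 (f x) (g x)) \<in> borel_measurable M"
  unfolding vec2_def by measurable

lemma Basis_plane: "(Basis :: (real^2) set) = {axis 1 1, axis 2 1}"
proof -
  have "(Basis :: (real^2) set) = (\<lambda>i. axis i 1) ` UNIV" by (auto simp: Basis_vec_def)
  then show ?thesis by (simp add: UNIV_2)
qed

lemma lborel_plane: "distr (lborel \<Otimes>\<^sub>M lborel) borel (\<lambda>(a, b). vec2 a b) = lborel"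
proof (rule lborel_eqI[symmetric])
  fix l u :: "real^2" assume le: "\<And>b. b \<in> Basis \<Longrightarrow> l \<bullet> b \<le> u \<bullet> b"
  have le12: "l $ 1 \<le> u $ 1" "l $ 2 \<le> u $ 2"
    using le[of "axis 1 1"] le[of "axis 2 1"] by (simp_all add: Basis_plane inner_axis)
  have "(\<lambda>(a, b). vec2 a b) -` box l u \<inter> space (lborel \<Otimes>\<^sub>M lborel) = {l $ 1<..<u $ 1} \<times> {l $ 2<..<u $ 2}"
    by (auto simp: mem_box_cart forall_2 space_pair_measure)
  then have "emeasure (distr (lborel \<Otimes>\<^sub>M lborel) borel (\<lambda>(a, b). vec2 a b)) (box l u) =
      emeasure (lborel \<Otimes>\<^sub>M lborel) ({l $ 1<..<u $ 1} \<times> {l $ 2<..<u $ 2})"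
    by (subst emeasure_distr) simp_all
  also have "\<dots> = ennreal (u $ 1 - l $ 1) * ennreal (u $ 2 - l $ 2)"
    using le12 by (subst lborel.emeasure_pair_measure_Times) auto
  also have "\<dots> = ennreal ((u $ 1 - l $ 1) * (u $ 2 - l $ 2))"
    using le12 by (intro ennreal_mult[symmetric]) auto
  also have "(u $ 1 - l $ 1) * (u $ 2 - l $ 2) = (\<Prod>b\<in>Basis. (u - l) \<bullet> b)"
    by (simp add: Basis_plane axis_eq_axis inner_axis)
  finally show "emeasure (distr (lborel \<Otimes>\<^sub>M lborel) borel (\<lambda>(a, b). vec2 a b)) (box l u) = ennreal (\<Prod>b\<in>Basis. (u - l) \<bullet> b)" .
qed simp

lemma nn_integral_plane:
  assumes [measurable]: "q \<in> borel_measurable borel"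
  shows "(\<integral>\<^sup>+x. q x \<partial>lborel) = (\<integral>\<^sup>+a. \<integral>\<^sup>+b. q (vec2 a b) \<partial>lborel \<partial>lborel)"
    "(\<integral>\<^sup>+x. q x \<partial>lborel) = (\<integral>\<^sup>+b. \<integral>\<^sup>+a. q (vec2 a b) \<partial>lborel \<partial>lborel)"
proof -
  have "(\<integral>\<^sup>+x. q x \<partial>lborel) = (\<integral>\<^sup>+x. q x \<partial>distr (lborel \<Otimes>\<^sub>M lborel) borel (\<lambda>(a, b). vec2 a b))"
    by (simp add: lborel_plane)
  also have "\<dots> = (\<integral>\<^sup>+p. q (vec2 (fst p) (snd p)) \<partial>(lborel \<Otimes>\<^sub>M lborel))"
    by (subst nn_integral_distr) (simp_all add: split_beta)
  also have "\<dots> = (\<integral>\<^sup>+a. \<integral>\<^sup>+b. q (vec2 a b) \<partial>lborel \<partial>lborel)"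
    by (subst lborel.nn_integral_fst[symmetric]) simp_all
  finally show 1: "(\<integral>\<^sup>+x. q x \<partial>lborel) = (\<integral>\<^sup>+a. \<integral>\<^sup>+b. q (vec2 a b) \<partial>lborel \<partial>lborel)" .
  show "(\<integral>\<^sup>+x. q x \<partial>lborel) = (\<integral>\<^sup>+b. \<integral>\<^sup>+a. q (vec2 a b) \<partial>lborel \<partial>lborel)"
    unfolding 1 by (rule lborel_pair.Fubini') measurable
qed

text \<open>The sides of the square with corners \<open>(\<plusminus> r, \<plusminus> r)\<close>: top, bottom, right, left.\<close>

definition side :: "nat \<Rightarrow> real \<Rightarrow> real \<Rightarrow> real^2" where
  "side k r t = (if k = 0 then vec2 t r else if k = 1 then vec2 t (- r) else if k = 2 then vec2 r t else vec2 (- r) t)"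

definition side_integral :: "(real^2 \<Rightarrow> ennreal) \<Rightarrow> nat \<Rightarrow> real \<Rightarrow> ennreal" where
  "side_integral q k r = (\<integral>\<^sup>+t. q (side k r t) * indicator {-r..r} t \<partial>lborel)"

text \<open>The integral over the boundary of the square with respect to arc length; for negative
  \<open>r\<close> the parameter intervals are empty and it is 0.\<close>

definition square_integral :: "(real^2 \<Rightarrow> ennreal) \<Rightarrow> real \<Rightarrow> ennreal" where
  "square_integral q r = (\<Sum>k<4. side_integral q k r)"

lemma side_measurable [measurable (raw)]:
  assumes [measurable]: "f \<in> borel_measurable M" "g \<in> borel_measurable M"
  shows "(\<lambda>x. side k (f x) (g x)) \<in> borel_measurable M"
proof -
  consider "k = 0" | "k = 1" | "k = 2" | "k \<noteq> 0 \<and> k \<noteq> 1 \<and> k \<noteq> 2" by blast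
  then show ?thesis by cases (simp_all add: side_def)
qed

lemma side_integral_measurable [measurable]:
  assumes [measurable]: "q \<in> borel_measurable borel"
  shows "side_integral q k \<in> borel_measurable borel"
proof -
  have "(\<lambda>r. \<integral>\<^sup>+t. q (side k r t) * indicator {-r..r} t \<partial>lborel) \<in> borel_measurable lborel"
  proof (rule lborel.borel_measurable_nn_integral)
    have "(\<lambda>p. q (side k (fst p) (snd p)) * indicator {p. - fst p \<le> snd p \<and> snd p \<le> fst p} p) \<in> borel_measurable (lborel \<Otimes>\<^sub>M lborel)"
      by measurable
    also have "(\<lambda>p. q (side k (fst p) (snd p)) * indicator {p. - fst p \<le> snd p \<and> snd p \<le> fst p} p) =
        (\<lambda>(r, t). q (side k r t) * indicator {-r..r} t)"
      by (auto simp: fun_eq_iff indicator_def)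
    finally show "(\<lambda>(r, t). q (side k r t) * indicator {-r..r} t) \<in> borel_measurable (lborel \<Otimes>\<^sub>M lborel)" .
  qed
  then show ?thesis by (simp add: side_integral_def[abs_def])
qed

lemma square_integral_measurable [measurable]:
  "q \<in> borel_measurable borel \<Longrightarrow> square_integral q \<in> borel_measurable borel"
  unfolding square_integral_def[abs_def] by measurable

text \<open>As \<open>r\<close> runs through the reals, the line that carries the k-th side sweeps
  the plane once, so the iterated integral over full lines is the plane integral.\<close>

lemma nn_integral_side_integral_le:
  assumes [measurable]: "q \<in> borel_measurable borel"
  shows "(\<integral>\<^sup>+r. side_integral q k r \<partial>lborel) \<le> (\<integral>\<^sup>+x. q x \<partial>lborel)"
proof -
  have "(\<integral>\<^sup>+r. side_integral q k r \<partial>lborel) \<le> (\<integral>\<^sup>+r. \<integral>\<^sup>+t. q (side k r t) \<partial>lborel \<partial>lborel)"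
    unfolding side_integral_def by (intro nn_integral_mono) (auto simp: indicator_def)
  also have "\<dots> = (\<integral>\<^sup>+x. q x \<partial>lborel)"
  proof -
    have refl1: "(\<integral>\<^sup>+r. \<integral>\<^sup>+t. q (vec2 t (- r)) \<partial>lborel \<partial>lborel) = (\<integral>\<^sup>+r. \<integral>\<^sup>+t. q (vec2 t r) \<partial>lborel \<partial>lborel)"
      using nn_integral_reflect[of "\<lambda>r. \<integral>\<^sup>+t. q (vec2 t r) \<partial>lborel" 0] by simp
    have refl2: "(\<integral>\<^sup>+r. \<integral>\<^sup>+t. q (vec2 (- r) t) \<partial>lborel \<partial>lborel) = (\<integral>\<^sup>+r. \<integral>\<^sup>+t. q (vec2 r t) \<partial>lborel \<partial>lborel)"
      using nn_integral_reflect[of "\<lambda>r. \<integral>\<^sup>+t. q (vec2 r t) \<partial>lborel" 0] by simp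
    consider "k = 0" | "k = 1" | "k = 2" | "k \<noteq> 0 \<and> k \<noteq> 1 \<and> k \<noteq> 2" by blast
    then show ?thesis
    proof cases
      case 1
      then show ?thesis using nn_integral_plane(2)[of q] by (simp add: side_def)
    next
      case 2
      then show ?thesis using nn_integral_plane(2)[of q] refl1 by (simp add: side_def)
    next
      case 3
      then show ?thesis using nn_integral_plane(1)[of q] by (simp add: side_def)
    next
      case 4
      then show ?thesis using nn_integral_plane(1)[of q] refl2 by (simp add: side_def)
    qed
  qed
  finally show ?thesis .
qed

lemma nn_integral_square_integral_le:
  assumes [measurable]: "q \<in> borel_measurable borel"
  shows "(\<integral>\<^sup>+r. square_integral q r \<partial>lborel) \<le> 4 * (\<integral>\<^sup>+x. q x \<partial>lborel)"
proof -
  have "(\<integral>\<^sup>+r. square_integral q r \<partial>lborel) = (\<Sum>k<4. \<integral>\<^sup>+r. side_integral q k r \<partial>lborel)"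
    unfolding square_integral_def by (rule nn_integral_sum) measurable
  also have "\<dots> \<le> (\<Sum>k<(4::nat). \<integral>\<^sup>+x. q x \<partial>lborel)" by (intro sum_mono nn_integral_side_integral_le) measurable
  finally show ?thesis by simp
qed

lemma square_integral_mono: "(\<And>x. p x \<le> q x) \<Longrightarrow> square_integral p r \<le> square_integral q r"
  unfolding square_integral_def side_integral_def by (intro sum_mono nn_integral_mono mult_right_mono) auto

lemma square_integral_add:
  assumes [measurable]: "p \<in> borel_measurable borel" "q \<in> borel_measurable borel"
  shows "square_integral (\<lambda>x. p x + q x) r = square_integral p r + square_integral q r"
proof -
  have "side_integral (\<lambda>x. p x + q x) k r = side_integral p k r + side_integral q k r" for k
    unfolding side_integral_def distrib_right by (rule nn_integral_add) measurable
  then show ?thesis by (simp add: square_integral_def sum.distrib)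
qed

lemma square_integral_cmult:
  assumes [measurable]: "q \<in> borel_measurable borel"
  shows "square_integral (\<lambda>x. c * q x) r = c * square_integral q r"
proof -
  have "side_integral (\<lambda>x. c * q x) k r = c * side_integral q k r" for k
    unfolding side_integral_def mult.assoc by (rule nn_integral_cmult) measurable
  then show ?thesis by (simp add: square_integral_def sum_distrib_left)
qed

lemma square_integral_const: "r \<ge> 0 \<Longrightarrow> square_integral (\<lambda>x. ennreal c) r = ennreal c * ennreal (8 * r)"
proof -
  assume r: "r \<ge> 0"
  have "side_integral (\<lambda>x. ennreal c) k r = ennreal c * ennreal (2 * r)" for k
    unfolding side_integral_def using r by (subst nn_integral_cmult_indicator) auto
  then have "square_integral (\<lambda>x. ennreal c) r = 4 * (ennreal c * ennreal (2 * r))" by (simp add: square_integral_def)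
  also have "\<dots> = ennreal c * (ennreal 4 * ennreal (2 * r))" by (simp add: mult_ac)
  also have "ennreal 4 * ennreal (2 * r) = ennreal (4 * (2 * r))" using r by (intro ennreal_mult[symmetric]) auto
  finally show ?thesis by simp
qed

lemma side_derivative:
  assumes C: "C1c S f g"
  shows "\<exists>e. norm e = 1 \<and> (\<forall>t. ((\<lambda>t. f (side k r t)) has_real_derivative g (side k r t) \<bullet> e) (at t)) \<and>
    continuous_on UNIV (\<lambda>t. g (side k r t) \<bullet> e)"
proof -
  define e :: "real^2" where "e = (if k = 0 \<or> k = 1 then axis 1 1 else axis 2 1)"
  define p where "p = side k r 0"
  have eq: "side k r t = p + t *\<^sub>R e" for t by (simp add: p_def e_def side_def vec2_def)
  have ne: "norm e = 1" by (simp add: e_def)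
  have D: "((\<lambda>t. f (p + t *\<^sub>R e)) has_real_derivative g (p + t *\<^sub>R e) \<bullet> e) (at t)" for t
  proof -
    have "((\<lambda>t. t *\<^sub>R e) has_derivative (\<lambda>h. h *\<^sub>R e)) (at t)"
      by (rule has_derivative_scaleR_left[OF has_derivative_ident])
    then have "((\<lambda>t. p + t *\<^sub>R e) has_derivative (\<lambda>h. h *\<^sub>R e)) (at t)"
      using has_derivative_add[OF has_derivative_const[of p "at t"]] by fastforce
    then have "((\<lambda>t. f (p + t *\<^sub>R e)) has_derivative (\<lambda>h. g (p + t *\<^sub>R e) \<bullet> (h *\<^sub>R e))) (at t)"
      using has_derivative_compose[of "\<lambda>t. p + t *\<^sub>R e" "\<lambda>h. h *\<^sub>R e" t UNIV f "\<lambda>h. g (p + t *\<^sub>R e) \<bullet> h"] C1cD(1)[OF C] by simp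
    then show ?thesis by (simp add: has_field_derivative_def mult_commute_abs)
  qed
  have "continuous_on UNIV (\<lambda>t. g (p + t *\<^sub>R e) \<bullet> e)"
    by (intro continuous_on_inner continuous_on_const continuous_on_compose2[OF C1cD(2)[OF C]]
        continuous_on_add continuous_on_scaleR continuous_on_id) simp
  with D ne show ?thesis unfolding eq by blast
qed

lemma side_oscillation:
  assumes C: "C1c S f g" and s: "s \<in> {-r..r}" and t: "t \<in> {-r..r}"
  shows "ennreal \<bar>f (side k r t) - f (side k r s)\<bar> \<le> side_integral (\<lambda>x. ennreal (norm (g x))) k r"
proof -
  obtain e where e: "norm e = 1" and D: "\<And>t. ((\<lambda>t. f (side k r t)) has_real_derivative g (side k r t) \<bullet> e) (at t)"
    and c: "continuous_on UNIV (\<lambda>t. g (side k r t) \<bullet> e)"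
    using side_derivative[OF C, of k r] by blast
  have main: "ennreal \<bar>f (side k r t) - f (side k r s)\<bar> \<le> side_integral (\<lambda>x. ennreal (norm (g x))) k r"
    if st: "s \<le> t" "-r \<le> s" "t \<le> r" for s t
  proof -
    have "has_bochner_integral lborel (\<lambda>x. (g (side k r x) \<bullet> e) * indicator {s..t} x) (f (side k r t) - f (side k r s))"
      by (rule has_bochner_integral_FTC_Icc_real[OF st(1) D]) (use c in \<open>auto simp: continuous_on_eq_continuous_at\<close>)
    then have "ennreal (norm (f (side k r t) - f (side k r s))) \<le> (\<integral>\<^sup>+x. ennreal (norm ((g (side k r x) \<bullet> e) * indicator {s..t} x)) \<partial>lborel)"
      by (rule has_bochner_integral_norm_bound)
    also have "\<dots> \<le> side_integral (\<lambda>x. ennreal (norm (g x))) k r"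
      unfolding side_integral_def
    proof (rule nn_integral_mono)
      fix x
      have "\<bar>g (side k r x) \<bullet> e\<bar> \<le> norm (g (side k r x))"
        using Cauchy_Schwarz_ineq2[of "g (side k r x)" e] e by simp
      then show "ennreal (norm ((g (side k r x) \<bullet> e) * indicator {s..t} x)) \<le> ennreal (norm (g (side k r x))) * indicator {-r..r} x"
        using st by (cases "x \<in> {s..t}") (auto intro: ennreal_leI)
    qed
    finally show ?thesis by simp
  qed
  show ?thesis
  proof (cases "s \<le> t")
    case True
    then show ?thesis using main[of s t] s t by simp
  next
    case False
    then show ?thesis using main[of t s] s t by (simp add: abs_minus_commute)
  qed
qed

text \<open>Every boundary point is joined to the corner \<open>vec2 r r\<close> along at most two
  sides: top and right contain the corner, the bottom reaches it through the right side and the left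
  side through the top. The fundamental theorem of calculus is applied on each side.\<close>

lemma square_oscillation:
  assumes C: "C1c S f g" and r: "r \<ge> 0" and k: "k < 4" and t: "t \<in> {-r..r}"
  shows "ennreal \<bar>f (side k r t) - f (vec2 r r)\<bar> \<le> square_integral (\<lambda>x. ennreal (norm (g x))) r"
proof -
  let ?I = "\<lambda>k. side_integral (\<lambda>x. ennreal (norm (g x))) k r"
  have S: "square_integral (\<lambda>x. ennreal (norm (g x))) r = ?I 0 + ?I 1 + ?I 2 + ?I 3"
    by (simp add: square_integral_def numeral_eq_Suc lessThan_Suc add_ac)
  have tri: "ennreal \<bar>a - c\<bar> \<le> ennreal \<bar>a - b\<bar> + ennreal \<bar>b - c\<bar>" for a b c :: real
    by (simp flip: ennreal_plus)
  have corner: "side 0 r r = vec2 r r" "side 2 r r = vec2 r r" "side 3 r r = side 0 r (- r)" "side 1 r r = side 2 r (- r)"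
    by (simp_all add: side_def)
  have rr: "r \<in> {-r..r}" "- r \<in> {-r..r}" using r by auto
  note o = side_oscillation[OF C]
  consider "k = 0" | "k = 1" | "k = 2" | "k = 3" using k by linarith
  then show ?thesis
  proof cases
    case 1
    then have "ennreal \<bar>f (side k r t) - f (vec2 r r)\<bar> \<le> ?I 0" using o[OF rr(1) t, of 0] corner by simp
    then show ?thesis unfolding S by (simp add: add_increasing2)
  next
    case 2
    have "ennreal \<bar>f (side k r t) - f (vec2 r r)\<bar> \<le> ennreal \<bar>f (side 1 r t) - f (side 1 r r)\<bar> + ennreal \<bar>f (side 2 r (- r)) - f (side 2 r r)\<bar>"
      using tri[of "f (side k r t)" "f (vec2 r r)" "f (side 1 r r)"] 2 corner by simp
    also have "\<dots> \<le> ?I 1 + ?I 2" by (intro add_mono o rr t)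
    also have "\<dots> \<le> ?I 0 + ?I 1 + ?I 2 + ?I 3" by (simp add: add_increasing2 add_increasing add.assoc)
    finally show ?thesis unfolding S .
  next
    case 3
    then have "ennreal \<bar>f (side k r t) - f (vec2 r r)\<bar> \<le> ?I 2" using o[OF rr(1) t, of 2] corner by simp
    then show ?thesis unfolding S by (simp add: add_increasing2 add_increasing)
  next
    case 4
    have "ennreal \<bar>f (side k r t) - f (vec2 r r)\<bar> \<le> ennreal \<bar>f (side 3 r t) - f (side 3 r r)\<bar> + ennreal \<bar>f (side 0 r (- r)) - f (side 0 r r)\<bar>"
      using tri[of "f (side k r t)" "f (vec2 r r)" "f (side 3 r r)"] 4 corner by simp
    also have "\<dots> \<le> ?I 3 + ?I 0" by (intro add_mono o rr t)
    also have "\<dots> = ?I 0 + ?I 3" by (rule add.commute)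
    also have "\<dots> \<le> ?I 0 + (?I 1 + ?I 2 + ?I 3)" by (intro add_left_mono) (simp add: add_increasing)
    finally show ?thesis unfolding S by (simp add: add.assoc)
  qed
qed

section \<open>Squares and their filling by a constant\<close>

definition square :: "real \<Rightarrow> (real^2) set" where
  "square r = cbox (vec2 (- r) (- r)) (vec2 r r)"

lemma mem_square: "x \<in> square r \<longleftrightarrow> \<bar>x $ 1\<bar> \<le> r \<and> \<bar>x $ 2\<bar> \<le> r"
  by (auto simp: square_def mem_box_cart forall_2 abs_le_iff)

lemma compact_square: "compact (square r)"
  by (simp add: square_def)

lemma square_subset_Omega: "r < 1 \<Longrightarrow> square r \<subseteq> \<Omega>"
proof
  fix x assume "r < 1" "x \<in> square r"
  then have "\<bar>x $ 1\<bar> < 1" "\<bar>x $ 2\<bar> < 1" by (auto simp: mem_square)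
  then show "x \<in> \<Omega>" by (simp add: \<Omega>_def forall_2 abs_less_iff)
qed

lemma frontier_square:
  assumes "x \<in> frontier (square r)"
  shows "\<exists>k<4. \<exists>t\<in>{-r..r}. x = side k r t"
proof -
  have f: "frontier (square r) = square r - box (vec2 (- r) (- r)) (vec2 r r)"
    unfolding square_def by (rule frontier_cbox)
  then have m: "\<bar>x $ 1\<bar> \<le> r" "\<bar>x $ 2\<bar> \<le> r" using assms by (auto simp: mem_square)
  have "\<not> (\<bar>x $ 1\<bar> < r \<and> \<bar>x $ 2\<bar> < r)"
    using assms unfolding f by (auto simp: mem_box_cart forall_2 abs_less_iff)
  then consider "x $ 2 = r" | "x $ 2 = - r" | "x $ 1 = r" | "x $ 1 = - r" using m by linarith
  then show ?thesis
  proof cases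
    case 1
    then have "x = side 0 r (x $ 1)" using vec2_eta[of x] by (simp add: side_def)
    then show ?thesis using m by (intro exI[of _ 0] conjI bexI[of _ "x $ 1"]) auto
  next
    case 2
    then have "x = side 1 r (x $ 1)" using vec2_eta[of x] by (simp add: side_def)
    then show ?thesis using m by (intro exI[of _ 1] conjI bexI[of _ "x $ 1"]) auto
  next
    case 3
    then have "x = side 2 r (x $ 2)" using vec2_eta[of x] by (simp add: side_def)
    then show ?thesis using m by (intro exI[of _ 2] conjI bexI[of _ "x $ 2"]) auto
  next
    case 4
    then have "x = side 3 r (x $ 2)" using vec2_eta[of x] by (simp add: side_def)
    then show ?thesis using m by (intro exI[of _ 3] conjI bexI[of _ "x $ 2"]) auto
  qed
qed

text \<open>Near the frontier of \<open>Q\<close> the composition of \<open>F\<close> with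
  \<open>f\<close> is already equal to \<open>k\<close>, because \<open>V\<close> is open. Hence
  \<open>W\<close>, the interior of \<open>Q\<close> together with the preimage of \<open>V\<close>,
  is an open set containing \<open>Q\<close> on which the filled function is constant, and the two
  pieces glue to a \<open>C^1\<close> function.\<close>

lemma C1c_fill:
  assumes C: "C1c S f g" and F: "\<And>t. (F has_real_derivative F' t) (at t)" "continuous_on UNIV F'" "F 0 = 0"
    and Q: "compact Q" "Q \<subseteq> S" and V: "open V" "\<And>t. t \<in> V \<Longrightarrow> F t = k \<and> F' t = 0"
    and fr: "\<And>x. x \<in> frontier Q \<Longrightarrow> f x \<in> V"
  shows "C1c S (\<lambda>x. if x \<in> Q then k else F (f x)) (\<lambda>x. if x \<in> Q then 0 else F' (f x) *\<^sub>R g x)"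
    (is "C1c S ?v ?h")
proof -
  note CF = C1c_compose[OF C F]
  have cl: "closed Q" using Q(1) by (rule compact_imp_closed)
  define W where "W = interior Q \<union> f -` V"
  have oW: "open W" unfolding W_def using C1cD(3)[OF C] V(1)
    by (intro open_Un open_interior) (simp add: continuous_on_open_vimage)
  have QW: "x \<in> W" if "x \<in> Q" for x
    using fr[of x] that closure_subset[of Q] unfolding W_def frontier_def by blast
  have vW: "?v x = k" "?h x = 0" if "x \<in> W" for x
  proof -
    have "x \<in> Q \<or> f x \<in> V" using that interior_subset[of Q] unfolding W_def by blast
    then show "?v x = k" "?h x = 0" using V(2)[of "f x"] by auto
  qed
  have D: "(?v has_derivative (\<lambda>h. ?h x \<bullet> h)) (at x)" for x
  proof (cases "x \<in> W")
    case True
    have "((\<lambda>_. k) has_derivative (\<lambda>h. 0)) (at x)" by simp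
    then have "(?v has_derivative (\<lambda>h. 0)) (at x)"
      by (rule has_derivative_transform_within_open[OF _ oW True]) (rule vW(1)[symmetric])
    then show ?thesis unfolding vW(2)[OF True] by simp
  next
    case False
    then have x: "x \<in> - Q" using QW by blast
    have "((\<lambda>x. F (f x)) has_derivative (\<lambda>h. (F' (f x) *\<^sub>R g x) \<bullet> h)) (at x)" by (rule C1cD(1)[OF CF])
    then have "(?v has_derivative (\<lambda>h. (F' (f x) *\<^sub>R g x) \<bullet> h)) (at x)"
      by (rule has_derivative_transform_within_open[OF _ open_Compl[OF cl] x]) simp
    then show ?thesis using x by simp
  qed
  have "continuous_on (W \<union> - Q) ?h"
  proof (rule continuous_on_open_Un[OF oW open_Compl[OF cl]])
    have "continuous_on W (\<lambda>x. 0 :: 'a)" by (rule continuous_on_const)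
    then show "continuous_on W ?h" by (rule continuous_on_eq) (rule vW(2)[symmetric])
    have "continuous_on (- Q) (\<lambda>x. F' (f x) *\<^sub>R g x)" using C1cD(2)[OF CF] by (rule continuous_on_subset) simp
    then show "continuous_on (- Q) ?h" by (rule continuous_on_eq) simp
  qed
  moreover have "W \<union> - Q = UNIV" using QW by blast
  ultimately have c: "continuous_on UNIV ?h" by simp
  obtain K where K: "compact K" "K \<subseteq> S" "\<And>x. x \<notin> K \<Longrightarrow> f x = 0 \<and> g x = 0" using C unfolding C1c_def by blast
  show ?thesis
    unfolding C1c_def
  proof (intro conjI allI exI[of _ "K \<union> Q"] impI)
    show "compact (K \<union> Q)" using K(1) Q(1) by (rule compact_Un)
    show "K \<union> Q \<subseteq> S" using K(2) Q(2) by simp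
    fix x assume "x \<notin> K \<union> Q"
    then show "?v x = 0" "?h x = 0" using K(3)[of x] F(3) by auto
  qed (rule D c)+
qed

section \<open>Choice of the squares and approximation in the second case\<close>

context double_phase_functions
begin

text \<open>Jensen's inequality on the boundary, whose total length is \<open>8 * r\<close>. The
  supporting line is taken at \<open>\<delta> / (8 * r)\<close>, a lower bound for the mean of
  \<open>norm (G x)\<close>, which suffices because its slope is nonnegative; the finite term
  \<open>k * \<delta>\<close> cancels at the end.\<close>

lemma square_integral_lower_bound:
  assumes G: "G \<in> borel_measurable borel" and r: "r > 0" and \<delta>: "\<delta> > 0"
    and ge: "ennreal \<delta> \<le> square_integral (\<lambda>x. ennreal (norm (G x :: real^2))) r"
  shows "ennreal (8 * r) * \<phi> (\<delta> / (8 * r)) \<le> square_integral (\<lambda>x. \<phi> (norm (G x))) r"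
proof -
  note G[measurable] phi.norm_measurable[OF G, measurable]
  define m where "m = \<delta> / (8 * r)"
  have m: "m > 0" "8 * r * m = \<delta>" using r \<delta> by (auto simp: m_def)
  obtain k where k: "k \<ge> 0" "\<And>t. t \<ge> 0 \<Longrightarrow> phi.r m + k * (t - m) \<le> phi.r t" using phi.support_line[OF m(1)] by blast
  have "ennreal (8 * r) * \<phi> m + ennreal (k * \<delta>) = ennreal (phi.r m) * ennreal (8 * r) + ennreal k * ennreal \<delta>"
    using m k(1) \<delta> by (simp add: phi.ennreal_r mult.commute ennreal_mult)
  also have "\<dots> \<le> ennreal (phi.r m) * ennreal (8 * r) + ennreal k * square_integral (\<lambda>x. ennreal (norm (G x))) r"
    by (intro add_left_mono mult_left_mono ge) simp
  also have "\<dots> = square_integral (\<lambda>x. ennreal (phi.r m) + ennreal k * ennreal (norm (G x))) r"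
    using r by (simp add: square_integral_add square_integral_cmult square_integral_const)
  also have "\<dots> \<le> square_integral (\<lambda>x. \<phi> (norm (G x)) + ennreal (k * m)) r"
  proof (rule square_integral_mono)
    fix x
    have "phi.r m + k * norm (G x) \<le> phi.r (norm (G x)) + k * m" using k(2)[of "norm (G x)"] by (simp add: algebra_simps)
    then have "ennreal (phi.r m + k * norm (G x)) \<le> ennreal (phi.r (norm (G x)) + k * m)" by (rule ennreal_leI)
    then show "ennreal (phi.r m) + ennreal k * ennreal (norm (G x)) \<le> \<phi> (norm (G x)) + ennreal (k * m)"
      using k(1) m(1) phi.r_nonneg by (simp add: ennreal_mult phi.ennreal_r)
  qed
  also have "\<dots> = square_integral (\<lambda>x. \<phi> (norm (G x))) r + ennreal (k * m) * ennreal (8 * r)"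
    using r by (simp add: square_integral_add square_integral_const)
  also have "ennreal (k * m) * ennreal (8 * r) = ennreal (k * \<delta>)"
  proof -
    have "ennreal (k * m) * ennreal (8 * r) = ennreal (k * m * (8 * r))"
      using k(1) m(1) r by (intro ennreal_mult[symmetric]) auto
    also have "k * m * (8 * r) = k * (8 * r * m)" by (simp only: mult_ac)
    finally show ?thesis by (simp only: m(2))
  qed
  finally show ?thesis
    by (simp add: ennreal_add_left_cancel_le add.commute[of _ "ennreal (k * \<delta>)"] m_def)
qed

text \<open>If no radius worked, \<open>\<phi> (1 / r) * ennreal r\<close> would be dominated, up to
  a doubling constant, by the boundary energy, whose integral over \<open>r\<close> is controlled by
  the plane energy; this contradicts divergence. The condition \<open>P\<close> lets the radius be
  chosen so that approximants also converge on the boundary.\<close>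

lemma exists_radius_with_small_square_integral:
  assumes div: "integral_diverges_at_0 (\<lambda>r. \<phi> (1 / r) * ennreal r)"
    and G: "G \<in> borel_measurable borel" "(\<integral>\<^sup>+x. \<phi> (norm (G x :: real^2)) \<partial>lborel) < \<infinity>"
    and P: "AE r in lborel. P r" and \<rho>: "\<rho> > 0" and \<delta>: "\<delta> > 0"
  shows "\<exists>r. 0 < r \<and> r < \<rho> \<and> P r \<and> square_integral (\<lambda>x. ennreal (norm (G x))) r < ennreal \<delta>"
proof (rule ccontr)
  assume no: "\<not> ?thesis"
  note phi.norm_measurable[OF G(1), measurable]
  obtain C where C: "C \<ge> 0" "\<And>t. t \<ge> 0 \<Longrightarrow> \<phi> (8 / \<delta> * t) \<le> ennreal C * \<phi> t" using phi.scale_bound[of "8 / \<delta>"] \<delta> by auto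
  have le: "\<phi> (1 / r) * ennreal r * indicator {0<..<\<rho>} r \<le> ennreal C * square_integral (\<lambda>x. \<phi> (norm (G x))) r" if "P r" for r
  proof (cases "r \<in> {0<..<\<rho>}")
    case True
    then have r: "r > 0" "r < \<rho>" by auto
    then have "ennreal \<delta> \<le> square_integral (\<lambda>x. ennreal (norm (G x))) r" using no that by (meson not_less)
    note lb = square_integral_lower_bound[OF G(1) r(1) \<delta> this]
    have "1 / r = 8 / \<delta> * (\<delta> / (8 * r))" using \<delta> by simp
    then have "\<phi> (1 / r) \<le> ennreal C * \<phi> (\<delta> / (8 * r))" using C(2)[of "\<delta> / (8 * r)"] \<delta> r(1) by simp
    then have "\<phi> (1 / r) * ennreal r \<le> ennreal C * \<phi> (\<delta> / (8 * r)) * ennreal (8 * r)"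
      using r(1) by (intro mult_mono ennreal_leI) auto
    also have "\<dots> = ennreal C * (ennreal (8 * r) * \<phi> (\<delta> / (8 * r)))" by (simp only: mult_ac)
    also have "\<dots> \<le> ennreal C * square_integral (\<lambda>x. \<phi> (norm (G x))) r" by (intro mult_left_mono lb) simp
    finally show ?thesis using True by simp
  qed simp
  have "(\<integral>\<^sup>+r\<in>{0<..<\<rho>}. \<phi> (1 / r) * ennreal r \<partial>lborel) \<le> (\<integral>\<^sup>+r. ennreal C * square_integral (\<lambda>x. \<phi> (norm (G x))) r \<partial>lborel)"
    by (rule nn_integral_mono_AE) (use P le in \<open>auto elim: eventually_mono\<close>)
  also have "\<dots> = ennreal C * (\<integral>\<^sup>+r. square_integral (\<lambda>x. \<phi> (norm (G x))) r \<partial>lborel)"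
    by (rule nn_integral_cmult) measurable
  also have "\<dots> \<le> ennreal C * (4 * (\<integral>\<^sup>+x. \<phi> (norm (G x)) \<partial>lborel))"
    by (intro mult_left_mono nn_integral_square_integral_le) auto
  also have "\<dots> < \<infinity>" using G(2) by (simp add: ennreal_mult_less_top)
  finally show False using div \<rho> unfolding integral_diverges_at_0_def by simp
qed

text \<open>The radius is selected for the limit field \<open>G\<close>, with the extra property
  that the boundary integrals of \<open>G x - g n x\<close> tend to zero. Small boundary oscillation
  is thereby inherited by the approximants, which are the functions that get filled.\<close>

lemma approximable_case_2:
  assumes div: "integral_diverges_at_0 (\<lambda>r. \<phi> (1 / r) * ennreal r)"
    and s: "sob \<Omega> {-M..M} u G" and fin: "modular G < \<infinity>"
  shows "approximable G"
proof -
  note sob_measurable[OF s, measurable]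
  have z: "u x = 0" "G x = 0" if "x \<notin> \<Omega>" for x using s that by (auto simp: sob_def)
  have phifin: "(\<integral>\<^sup>+x. \<phi> (norm (G x)) \<partial>lborel) < \<infinity>"
  proof (rule order_le_less_trans[OF _ fin])
    show "(\<integral>\<^sup>+x. \<phi> (norm (G x)) \<partial>lborel) \<le> modular G"
      unfolding modular_def
    proof (rule nn_integral_mono)
      fix x
      show "\<phi> (norm (G x)) \<le> \<Phi> x (norm (G x)) * indicator \<Omega> x"
        using z(2)[of x] by (cases "x \<in> \<Omega>") (auto simp: double_phase_def phi.zero)
    qed
  qed
  obtain f g where fg_all: "\<forall>n. C1c \<Omega> (f n) (g n) \<and> range (f n) \<subseteq> {-M..M} \<and>
      (\<integral>\<^sup>+x. ennreal (norm (u x - f n x)) \<partial>lborel) \<le> ennreal ((1 / 2) ^ n) \<and>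
      (\<integral>\<^sup>+x. ennreal (norm (G x - g n x)) \<partial>lborel) \<le> ennreal ((1 / 2) ^ n)"
    and ae: "AE x in lborel. (\<lambda>n. f n x) \<longlonglongrightarrow> u x"
    using sob_sequence[OF s] by blast
  have C: "C1c \<Omega> (f n) (g n)" and rng: "range (f n) \<subseteq> {-M..M}"
    and e1: "(\<integral>\<^sup>+x. ennreal (norm (u x - f n x)) \<partial>lborel) \<le> ennreal ((1 / 2) ^ n)"
    and e2: "(\<integral>\<^sup>+x. ennreal (norm (G x - g n x)) \<partial>lborel) \<le> ennreal ((1 / 2) ^ n)" for n
    using fg_all by blast+
  have [measurable]: "f n \<in> borel_measurable borel" "g n \<in> borel_measurable borel" for n using C1cD(6,7)[OF C] by auto
  define d where "d n x = ennreal (norm (G x - g n x))" for n x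
  have dm [measurable]: "d n \<in> borel_measurable borel" for n unfolding d_def by measurable
  \<comment> \<open>The factor \<open>1 / 4\<close> cancels the 4 in the bound for integrated
    boundary integrals, so that the geometric criterion applies.\<close>
  have aeS: "AE r in lborel. (\<lambda>n. ennreal (1 / 4) * square_integral (d n) r) \<longlonglongrightarrow> 0"
  proof (rule AE_tendsto_0_of_nn_integral_geometric)
    show "(\<lambda>r. ennreal (1 / 4) * square_integral (d n) r) \<in> borel_measurable lborel" for n by measurable
    fix n
    have "(\<integral>\<^sup>+r. ennreal (1 / 4) * square_integral (d n) r \<partial>lborel) = ennreal (1 / 4) * (\<integral>\<^sup>+r. square_integral (d n) r \<partial>lborel)"
      by (rule nn_integral_cmult) measurable
    also have "\<dots> \<le> ennreal (1 / 4) * (4 * ennreal ((1 / 2) ^ n))"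
      by (intro mult_left_mono order_trans[OF nn_integral_square_integral_le[OF dm]]) (use e2 in \<open>simp_all add: d_def\<close>)
    also have "\<dots> = ennreal (1 / 4) * (ennreal 4 * ennreal ((1 / 2) ^ n))" by simp
    also have "\<dots> = ennreal (1 / 4 * (4 * (1 / 2) ^ n))"
      by (simp only: ennreal_mult' divide_nonneg_nonneg zero_le_one zero_le_numeral)
    finally show "(\<integral>\<^sup>+r. ennreal (1 / 4) * square_integral (d n) r \<partial>lborel) \<le> ennreal ((1 / 2) ^ n)" by simp
  qed
  text \<open>On suitable small squares infinitely many approximants are nearly constant, with the same value.\<close>
  have small: "\<exists>p. 0 < fst p \<and> fst p < inverse (real (Suc k)) \<and> snd p \<in> {-M..M} \<and>
      (\<forall>n0. \<exists>n\<ge>n0. \<forall>x\<in>frontier (square (fst p)). \<bar>f n x - snd p\<bar> \<le> 2 * inverse (real (Suc k)))" for k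
  proof -
    define \<delta> where "\<delta> = inverse (real (Suc k))"
    have \<delta>: "\<delta> > 0" by (simp add: \<delta>_def)
    obtain r where r: "0 < r" "r < \<delta>" and lim: "(\<lambda>n. ennreal (1 / 4) * square_integral (d n) r) \<longlonglongrightarrow> 0"
      and Gr: "square_integral (\<lambda>x. ennreal (norm (G x))) r < ennreal (\<delta> / 2)"
      using exists_radius_with_small_square_integral[OF div _ phifin aeS \<delta>, of "\<delta> / 2"] \<delta> by auto
    have "\<forall>\<^sub>F n in sequentially. ennreal (1 / 4) * square_integral (d n) r < ennreal (\<delta> / 8)"
      using order_tendstoD(2)[OF lim, of "ennreal (\<delta> / 8)"] \<delta> by simp
    then obtain N where N: "\<And>n. n \<ge> N \<Longrightarrow> ennreal (1 / 4) * square_integral (d n) r < ennreal (\<delta> / 8)"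
      by (auto simp: eventually_sequentially)
    have osc: "\<bar>f n x - f n (vec2 r r)\<bar> \<le> \<delta>" if n: "n \<ge> N" and x: "x \<in> frontier (square r)" for n x
    proof -
      have d2: "square_integral (d n) r \<le> ennreal (\<delta> / 2)"
      proof -
        have "ennreal 4 * (ennreal (1 / 4) * square_integral (d n) r) \<le> ennreal 4 * ennreal (\<delta> / 8)"
          by (intro mult_left_mono less_imp_le[OF N[OF n]]) simp
        moreover have "ennreal 4 * (ennreal (1 / 4) * square_integral (d n) r) = square_integral (d n) r"
        proof -
          have "ennreal 4 * ennreal (1 / 4) = ennreal (4 * (1 / 4))" by (rule ennreal_mult[symmetric]) auto
          then have "ennreal 4 * ennreal (1 / 4) = 1" by simp
          then show ?thesis by (simp only: mult.assoc[symmetric] mult_1_left)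
        qed
        moreover have "ennreal 4 * ennreal (\<delta> / 8) = ennreal (4 * (\<delta> / 8))" using \<delta> by (intro ennreal_mult[symmetric]) auto
        ultimately show ?thesis by simp
      qed
      obtain k t where kt: "k < 4" "t \<in> {-r..r}" "x = side k r t" using frontier_square[OF x] by blast
      have "ennreal \<bar>f n x - f n (vec2 r r)\<bar> \<le> square_integral (\<lambda>x. ennreal (norm (g n x))) r"
        unfolding kt(3) by (rule square_oscillation[OF C _ kt(1,2)]) (use r in simp)
      also have "\<dots> \<le> square_integral (\<lambda>x. ennreal (norm (G x)) + d n x) r"
      proof (rule square_integral_mono)
        fix x
        have "norm (g n x) \<le> norm (G x) + norm (G x - g n x)" using norm_triangle_ineq4[of "G x" "G x - g n x"] by simp
        then show "ennreal (norm (g n x)) \<le> ennreal (norm (G x)) + d n x" by (simp add: d_def flip: ennreal_plus)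
      qed
      also have "\<dots> = square_integral (\<lambda>x. ennreal (norm (G x))) r + square_integral (d n) r"
        by (rule square_integral_add) measurable
      also have "\<dots> \<le> ennreal (\<delta> / 2) + ennreal (\<delta> / 2)" using Gr d2 by (intro add_mono) auto
      also have "\<dots> = ennreal \<delta>" using \<delta> by (simp flip: ennreal_plus)
      finally show ?thesis using \<delta> by simp
    qed
    \<comment> \<open>The corner values stay in a compact interval, which is what truncation was
      for; a limit of them along a subsequence is the constant of this square.\<close>
    have "\<forall>n. f n (vec2 r r) \<in> {-M..M}" using rng by blast
    with compact_imp_seq_compact[OF compact_Icc[of "-M" M]]
    obtain c h where c: "c \<in> {-M..M}" and h: "strict_mono h" and hc: "((\<lambda>n. f n (vec2 r r)) \<circ> h) \<longlonglongrightarrow> c"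
      by (rule seq_compactE)
    have "\<exists>n\<ge>n0. \<forall>x\<in>frontier (square r). \<bar>f n x - c\<bar> \<le> 2 * \<delta>" for n0
    proof -
      have "(\<lambda>n. \<bar>f (h n) (vec2 r r) - c\<bar>) \<longlonglongrightarrow> 0"
        using hc by (simp add: o_def tendsto_rabs_zero_iff LIM_zero_iff)
      then have "\<forall>\<^sub>F n in sequentially. \<bar>f (h n) (vec2 r r) - c\<bar> < \<delta>" by (rule order_tendstoD) (rule \<delta>)
      then obtain N1 where N1: "\<And>n. n \<ge> N1 \<Longrightarrow> \<bar>f (h n) (vec2 r r) - c\<bar> < \<delta>" by (auto simp: eventually_sequentially)
      define n where "n = max N1 (max n0 N)"
      have hn: "h n \<ge> n" by (rule seq_suble[OF h])
      have "\<bar>f (h n) x - c\<bar> \<le> 2 * \<delta>" if "x \<in> frontier (square r)" for x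
      proof -
        have "\<bar>f (h n) x - f (h n) (vec2 r r)\<bar> \<le> \<delta>" using hn by (intro osc[OF _ that]) (simp add: n_def)
        moreover have "\<bar>f (h n) (vec2 r r) - c\<bar> < \<delta>" by (rule N1) (simp add: n_def)
        ultimately show ?thesis by linarith
      qed
      then show ?thesis using hn by (intro exI[of _ "h n"]) (auto simp: n_def)
    qed
    then show ?thesis using r c by (intro exI[of _ "(r, c)"]) (simp add: \<delta>_def)
  qed
  define Q where "Q k p \<longleftrightarrow> 0 < fst p \<and> fst p < inverse (real (Suc k)) \<and> snd p \<in> {-M..M} \<and>
      (\<forall>n0. \<exists>n\<ge>n0. \<forall>x\<in>frontier (square (fst p)). \<bar>f n x - snd p\<bar> \<le> 2 * inverse (real (Suc k)))" for k and p :: "real \<times> real"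
  have "\<forall>k. \<exists>p. Q k p" using small unfolding Q_def by blast
  from choice[OF this] obtain P where P: "\<forall>k. Q k (P k)" by blast
  \<comment> \<open>The constant still depends on the square. A further subsequence makes the
    constants converge to a single \<open>c\<close>, so that only one level set of \<open>u\<close>
    has to be given up.\<close>
  have "\<forall>k. snd (P k) \<in> {-M..M}" using P unfolding Q_def by blast
  with compact_imp_seq_compact[OF compact_Icc[of "-M" M]]
  obtain c h where h: "strict_mono h" and hc: "((\<lambda>k. snd (P k)) \<circ> h) \<longlonglongrightarrow> c"
    by (rule seq_compactE)
  \<comment> \<open>One parameter in three roles: bound on the size of the square, tolerance for the
    boundary values and width of the flattening. Matching the last two makes the flattened boundary
    values constant.\<close>
  define a where "a i = inverse (real (Suc i))" for i
  have a: "a i > 0" for i by (simp add: a_def)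
  have ex: "\<exists>r. 0 < r \<and> r < a i \<and> r < 1 \<and> (\<forall>n0. \<exists>n\<ge>n0. \<forall>x\<in>frontier (square r). \<bar>f n x - c\<bar> < a i)" for i
  proof -
    have "(\<lambda>k. \<bar>snd (P (h k)) - c\<bar>) \<longlonglongrightarrow> 0"
      using hc by (simp add: o_def tendsto_rabs_zero_iff LIM_zero_iff)
    moreover have "(\<lambda>k. 2 * inverse (real (Suc k))) \<longlonglongrightarrow> 2 * 0"
      by (intro tendsto_mult tendsto_const LIMSEQ_inverse_real_of_nat)
    ultimately have "(\<lambda>k. \<bar>snd (P (h k)) - c\<bar> + 2 * inverse (real (Suc k))) \<longlonglongrightarrow> 0 + 2 * 0" by (rule tendsto_add)
    then have "\<forall>\<^sub>F k in sequentially. \<bar>snd (P (h k)) - c\<bar> + 2 * inverse (real (Suc k)) < a i"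
      by (rule order_tendstoD) (use a in simp)
    then obtain K0 where K0: "\<And>k. k \<ge> K0 \<Longrightarrow> \<bar>snd (P (h k)) - c\<bar> + 2 * inverse (real (Suc k)) < a i" by (auto simp: eventually_sequentially)
    define k where "k = max K0 (Suc i)"
    have hk: "h k \<ge> k" by (rule seq_suble[OF h])
    have Qk: "Q (h k) (P (h k))" using P by blast
    have le: "inverse (real (Suc (h k))) \<le> inverse (real (Suc k))" using hk by (intro le_imp_inverse_le) auto
    have "inverse (real (Suc k)) \<le> a i" unfolding a_def by (intro le_imp_inverse_le) (auto simp: k_def)
    then have r1: "fst (P (h k)) < a i" using Qk le unfolding Q_def by linarith
    have "inverse (real (Suc (h k))) \<le> 1" by (simp add: inverse_le_1_iff)
    then have r2: "fst (P (h k)) < 1" using Qk unfolding Q_def by linarith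
    have "\<exists>n\<ge>n0. \<forall>x\<in>frontier (square (fst (P (h k)))). \<bar>f n x - c\<bar> < a i" for n0
    proof -
      obtain n where n: "n \<ge> n0" "\<forall>x\<in>frontier (square (fst (P (h k)))). \<bar>f n x - snd (P (h k))\<bar> \<le> 2 * inverse (real (Suc (h k)))"
        using Qk unfolding Q_def by blast
      have "\<bar>f n x - c\<bar> < a i" if "x \<in> frontier (square (fst (P (h k))))" for x
      proof -
        have "\<bar>f n x - snd (P (h k))\<bar> \<le> 2 * inverse (real (Suc (h k)))" using n(2) that by blast
        moreover have "\<bar>snd (P (h k)) - c\<bar> + 2 * inverse (real (Suc k)) < a i" using K0[of k] by (simp add: k_def)
        ultimately show ?thesis using le by linarith
      qed
      then show ?thesis using n(1) by blast
    qed
    then show ?thesis using r1 r2 Qk unfolding Q_def by blast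
  qed
  have "\<forall>i. \<exists>r. 0 < r \<and> r < a i \<and> r < 1 \<and> (\<forall>n0. \<exists>n\<ge>n0. \<forall>x\<in>frontier (square r). \<bar>f n x - c\<bar> < a i)" using ex by blast
  from choice[OF this] obtain \<rho> where \<rho>_all: "\<forall>i. 0 < \<rho> i \<and> \<rho> i < a i \<and> \<rho> i < 1 \<and> (\<forall>n0. \<exists>n\<ge>n0. \<forall>x\<in>frontier (square (\<rho> i)). \<bar>f n x - c\<bar> < a i)"
    by blast
  have \<rho>: "0 < \<rho> i" "\<rho> i < a i" "\<rho> i < 1" and \<rho>f: "\<exists>n\<ge>n0. \<forall>x\<in>frontier (square (\<rho> i)). \<bar>f n x - c\<bar> < a i" for i n0
    using \<rho>_all by blast+
  define q where "q i x = (if x \<in> square (\<rho> i) then 0 else flatten' (a i) (u x - c))" for i x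
  define H where "H i x = q i x *\<^sub>R G x" for i x
  have sqm [measurable]: "square (\<rho> i) \<in> sets borel" for i using compact_square by (rule borel_compact)
  have flm [measurable]: "flatten' (a i) \<in> borel_measurable borel" for i
    by (rule borel_measurable_continuous_onI[OF flatten'_continuous[OF a]])
  have qm [measurable]: "q i \<in> borel_measurable borel" for i unfolding q_def by measurable
  have Hm [measurable]: "H i \<in> borel_measurable borel" for i unfolding H_def by measurable
  have q01: "0 \<le> q i x" "q i x \<le> 1" for i x using flatten'_bounds[OF a[of i], of "u x - c"] by (auto simp: q_def)
  have appH: "approximable (H i)" for i
  proof -
    define F where "F t = flatten (a i) (t - c) - flatten (a i) (- c)" for t
    define F' where "F' t = flatten' (a i) (t - c)" for t
    \<comment> \<open>The value that \<open>F\<close> takes on all of \<open>V\<close>; it may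
      differ from 0 because \<open>F\<close> is normalised to vanish at 0 rather than at
      \<open>c\<close>.\<close>
    define \<kappa> where "\<kappa> = - flatten (a i) (- c)"
    have Fd: "(F has_real_derivative F' t) (at t)" for t
    proof -
      have "((\<lambda>t. flatten (a i) (t - c)) has_real_derivative flatten' (a i) (t - c) * 1) (at t)"
        by (rule DERIV_chain2[OF flatten_derivative[OF a]])
          (use DERIV_diff[OF DERIV_ident DERIV_const[of c]] in simp)
      from DERIV_diff[OF this DERIV_const[of "flatten (a i) (- c)"]]
      show ?thesis by (simp add: F_def[abs_def] F'_def)
    qed
    have Fc: "continuous_on UNIV F'" unfolding F'_def
      by (rule continuous_on_compose2[OF flatten'_continuous[OF a]])
        (intro continuous_on_diff continuous_on_id continuous_on_const, simp)
    have F1: "\<bar>F' t\<bar> \<le> 1" for t using flatten'_bounds[OF a[of i], of "t - c"] by (simp add: F'_def)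
    have F0: "F 0 = 0" by (simp add: F_def)
    have Fm [measurable]: "F \<in> borel_measurable borel"
    proof -
      have "continuous_on UNIV F" using DERIV_isCont[OF Fd] by (intro continuous_at_imp_continuous_on) simp
      then show ?thesis by (rule borel_measurable_continuous_onI)
    qed
    note lip = lipschitz_of_derivative_le_1[OF Fd F1]
    define V where "V = {t. \<bar>t - c\<bar> < a i}"
    have V: "open V"
    proof -
      have "V = ball c (a i)" by (auto simp: V_def dist_real_def)
      then show ?thesis by simp
    qed
    have VF: "F t = \<kappa> \<and> F' t = 0" if "t \<in> V" for t
      using that a[of i] flatten_eq_0[of "t - c" "a i"] flatten'_eq_0[of "a i" "t - c"] by (auto simp: V_def F_def F'_def \<kappa>_def)
    define v where "v x = (if x \<in> square (\<rho> i) then \<kappa> else F (u x))" for x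
    have H_eq: "H i x = (if x \<in> square (\<rho> i) then 0 else F' (u x) *\<^sub>R G x)" for x by (simp add: H_def q_def F'_def)
    have sub: "square (\<rho> i) \<subseteq> \<Omega>" by (rule square_subset_Omega[OF \<rho>(3)])
    have l1: "(\<lambda>n. ennreal ((1 / 2) ^ n)) \<longlonglongrightarrow> 0"
    proof -
      have "(\<lambda>n. ennreal ((1 / 2) ^ n)) \<longlonglongrightarrow> ennreal 0" by (intro tendsto_ennrealI LIMSEQ_power_zero) simp
      then show ?thesis by simp
    qed
    note l2 = sob_compose_gradient_tendsto[OF s fg_all ae Fc F1]
    have "sob \<Omega> UNIV v (H i)"
      unfolding sob_def
    proof (intro conjI allI impI)
      show "v \<in> borel_measurable borel" unfolding v_def by measurable
      show "H i \<in> borel_measurable borel" by measurable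
      show "v x = 0" "H i x = 0" if "x \<notin> \<Omega>" for x using that sub z[OF that] F0 by (auto simp: v_def H_def)
      fix \<epsilon> :: real assume "\<epsilon> > 0"
      then have "\<forall>\<^sub>F n in sequentially. ennreal ((1 / 2) ^ n) < ennreal \<epsilon>"
        "\<forall>\<^sub>F n in sequentially. (\<integral>\<^sup>+x. ennreal (norm (F' (u x) *\<^sub>R G x - F' (f n x) *\<^sub>R g n x)) \<partial>lborel) < ennreal \<epsilon>"
        using order_tendstoD(2)[OF l1, of "ennreal \<epsilon>"] order_tendstoD(2)[OF l2, of "ennreal \<epsilon>"] by simp_all
      then have "\<forall>\<^sub>F n in sequentially. ennreal ((1 / 2) ^ n) < ennreal \<epsilon> \<and>
          (\<integral>\<^sup>+x. ennreal (norm (F' (u x) *\<^sub>R G x - F' (f n x) *\<^sub>R g n x)) \<partial>lborel) < ennreal \<epsilon>"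
        by (rule eventually_conj)
      then obtain n0 where n0: "\<forall>n\<ge>n0. ennreal ((1 / 2) ^ n) < ennreal \<epsilon> \<and>
          (\<integral>\<^sup>+x. ennreal (norm (F' (u x) *\<^sub>R G x - F' (f n x) *\<^sub>R g n x)) \<partial>lborel) < ennreal \<epsilon>"
        unfolding eventually_sequentially by blast
      \<comment> \<open>All large indices give closeness in L1, and infinitely many give boundary
        values near \<open>c\<close>; hence some index has both properties.\<close>
      obtain n where n: "n \<ge> n0" and fr: "\<forall>x\<in>frontier (square (\<rho> i)). \<bar>f n x - c\<bar> < a i" using \<rho>f[of n0 i] by blast
      define w where "w x = (if x \<in> square (\<rho> i) then \<kappa> else F (f n x))" for x
      define k where "k x = (if x \<in> square (\<rho> i) then 0 else F' (f n x) *\<^sub>R g n x)" for x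
      have Cw: "C1c \<Omega> w k"
        unfolding w_def k_def
        by (rule C1c_fill[OF C Fd Fc F0 compact_square sub V VF]) (use fr in \<open>auto simp: V_def\<close>)
      have "(\<integral>\<^sup>+x. ennreal (norm (v x - w x)) \<partial>lborel) \<le> (\<integral>\<^sup>+x. ennreal (norm (u x - f n x)) \<partial>lborel)"
        using lip by (intro nn_integral_mono ennreal_leI) (simp add: v_def w_def)
      also have "\<dots> \<le> ennreal ((1 / 2) ^ n)" by (rule e1)
      finally have A1: "(\<integral>\<^sup>+x. ennreal (norm (v x - w x)) \<partial>lborel) \<le> ennreal \<epsilon>" using n0 n by (meson less_imp_le order_trans)
      have "(\<integral>\<^sup>+x. ennreal (norm (H i x - k x)) \<partial>lborel) \<le> (\<integral>\<^sup>+x. ennreal (norm (F' (u x) *\<^sub>R G x - F' (f n x) *\<^sub>R g n x)) \<partial>lborel)"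
        by (intro nn_integral_mono ennreal_leI) (simp add: H_eq k_def)
      then have A2: "(\<integral>\<^sup>+x. ennreal (norm (H i x - k x)) \<partial>lborel) \<le> ennreal \<epsilon>" using n0 n by (meson less_imp_le order_trans)
      show "\<exists>f g. C1c \<Omega> f g \<and> range f \<subseteq> UNIV \<and>
          (\<integral>\<^sup>+x. ennreal (norm (v x - f x)) \<partial>lborel) \<le> ennreal \<epsilon> \<and>
          (\<integral>\<^sup>+x. ennreal (norm (H i x - g x)) \<partial>lborel) \<le> ennreal \<epsilon>"
        by (intro exI[of _ w] exI[of _ k] conjI Cw A1 A2) simp
    qed
    then show ?thesis
    proof (rule approximable_of_gradient_zero_near_origin[OF _ \<rho>(1)[of i]])
      show "H i x = 0" if x: "norm x < \<rho> i" for x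
      proof -
        have "\<bar>x $ 1\<bar> \<le> \<rho> i" "\<bar>x $ 2\<bar> \<le> \<rho> i"
          using component_le_norm_cart[of x 1] component_le_norm_cart[of x 2] x by linarith+
        then have "x \<in> square (\<rho> i)" by (simp add: mem_square)
        then show ?thesis by (simp add: H_def q_def)
      qed
      have "modular (H i) \<le> modular G" unfolding modular_def H_def
        using q01 by (intro nn_integral_mono mult_right_mono Phi_mono) (auto simp: mult_left_le_one_le)
      then show "modular (H i) < \<infinity>" using fin by (rule order_le_less_trans)
    qed
  qed
  have lim: "(\<lambda>i. modular (\<lambda>x. (1 - q i x) *\<^sub>R G x)) \<longlonglongrightarrow> 0"
  proof (rule modular_multiplier_tendsto_0[OF _ fin])
    show "\<bar>1 - q i x\<bar> \<le> 1" for i x using q01[of i x] by simp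
    have "AE x in lborel. x \<noteq> (0::real^2)" by (rule AE_lborel_singleton)
    then show "AE x in lborel. (\<lambda>i. norm ((1 - q i x) *\<^sub>R G x)) \<longlonglongrightarrow> 0"
      using sob_gradient_eq_0_on_level_set[OF s, of c]
    proof eventually_elim
      case (elim x)
      show ?case
      proof (cases "u x = c")
        \<comment> \<open>Here the multiplier stays 0 and does not recover the gradient, but
          \<open>G\<close> itself vanishes almost everywhere on this level set.\<close>
        case True
        then show ?thesis using elim(2) by simp
      next
        case False
        have out: "\<forall>\<^sub>F i in sequentially. x \<notin> square (\<rho> i)"
        proof -
          have "norm x > 0" using elim(1) by simp
          then have "\<forall>\<^sub>F i in sequentially. a i < norm x / 2"
            unfolding a_def by (intro order_tendstoD(2)[OF LIMSEQ_inverse_real_of_nat]) simp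
          then show ?thesis
          proof eventually_elim
            case (elim i)
            have "norm x \<le> \<bar>x $ 1\<bar> + \<bar>x $ 2\<bar>" using norm_le_l1_cart[of x] by (simp add: sum_2)
            then show ?case using elim \<rho>(2)[of i] unfolding mem_square by linarith
          qed
        qed
        have "(\<lambda>i. flatten' (a i) (u x - c)) \<longlonglongrightarrow> 1" using flatten'_tendsto[of "u x - c"] False by (simp add: a_def)
        moreover have "\<forall>\<^sub>F i in sequentially. flatten' (a i) (u x - c) = q i x"
          using out by eventually_elim (simp add: q_def)
        ultimately have "(\<lambda>i. q i x) \<longlonglongrightarrow> 1" by (rule Lim_transform_eventually)
        then have "(\<lambda>i. norm ((1 - q i x) *\<^sub>R G x)) \<longlonglongrightarrow> norm ((1 - 1) *\<^sub>R G x)"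
          by (intro tendsto_norm tendsto_scaleR tendsto_diff tendsto_const)
        then show ?thesis by simp
      qed
    qed
  qed measurable
  show ?thesis
  proof (rule approximable_closed)
    show "G \<in> borel_measurable borel" by measurable
    fix \<epsilon> :: real assume "\<epsilon> > 0"
    then have "\<forall>\<^sub>F i in sequentially. modular (\<lambda>x. (1 - q i x) *\<^sub>R G x) < ennreal \<epsilon>"
      using order_tendstoD(2)[OF lim, of "ennreal \<epsilon>"] by simp
    then obtain i where i: "modular (\<lambda>x. (1 - q i x) *\<^sub>R G x) < ennreal \<epsilon>"
      by (meson eventually_sequentially order_refl)
    have "(\<lambda>x. G x - H i x) = (\<lambda>x. (1 - q i x) *\<^sub>R G x)" by (simp add: H_def scaleR_diff_left)
    then show "\<exists>H. approximable H \<and> modular (\<lambda>x. G x - H x) \<le> ennreal \<epsilon>"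
      using i appH[of i] by (intro exI[of _ "H i"]) simp
  qed
qed

end

text \<open>For \<open>t\<close> beyond \<open>q = s powr (1 / (p - 1))\<close> the growth of
  \<open>\<phi>\<close> gives \<open>s * t \<le> t powr p\<close> and hence a vanishing truncated
  difference, so the supremum is governed by \<open>t \<le> q\<close>.\<close>

lemma conjugate_finite:
  assumes p: "1 < p" and lower: "\<And>t. t \<ge> 0 \<Longrightarrow> ennreal (t powr p) \<le> \<phi> t" and s: "s \<ge> 0"
  shows "conjugate \<phi> s < \<infinity>"
proof -
  define q where "q = s powr (1 / (p - 1))"
  have q: "q \<ge> 0" by (simp add: q_def)
  have "ennreal (s * t) - \<phi> t \<le> ennreal (s * q)" if t: "t \<ge> 0" for t
  proof (cases "t \<le> q")
    case True
    have "ennreal (s * t) - \<phi> t \<le> ennreal (s * t)" by simp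
    also have "\<dots> \<le> ennreal (s * q)" using True s by (intro ennreal_leI mult_left_mono) auto
    finally show ?thesis .
  next
    case False
    then have tq: "t > q" "t > 0" using q by auto
    have "s = q powr (p - 1)" using s p by (simp add: q_def powr_powr)
    also have "\<dots> \<le> t powr (p - 1)" using tq p q by (intro powr_mono2) auto
    finally have "s * t \<le> t powr (p - 1) * t powr 1" using tq by (simp add: mult_right_mono)
    also have "\<dots> = t powr p" by (simp only: powr_add[symmetric]) simp
    finally have "ennreal (s * t) \<le> \<phi> t" using lower[OF t] by (meson ennreal_leI order_trans)
    then show ?thesis by (simp add: diff_eq_0_ennreal)
  qed
  then have "conjugate \<phi> s \<le> ennreal (s * q)" unfolding conjugate_def by (intro SUP_least) auto
  then show ?thesis by (rule order_le_less_trans) simp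
qed

theorem theorem18:
  fixes \<phi> \<psi> :: "real \<Rightarrow> ennreal"
    and p\<^sub>m p\<^sub>p c\<^sub>1 c\<^sub>2 c\<^sub>3 c\<^sub>4 :: real
  assumes "orlicz_function \<phi>" and "orlicz_function \<psi>"
    and "Delta2 \<phi>" and "Nabla2 \<phi>"
    and "Delta2 \<psi>" and "Nabla2 \<psi>"
    and "1 < p\<^sub>m" and "p\<^sub>m < p\<^sub>p" and "0 < c\<^sub>1"
    and "\<And>t. t \<ge> 0 \<Longrightarrow>
      ennreal (t powr p\<^sub>m) \<le> \<phi> t \<and> \<phi> t \<le> ennreal (c\<^sub>1 * t powr p\<^sub>p + c\<^sub>2)"
    and "\<And>t. t \<ge> 0 \<Longrightarrow>
      ennreal (t powr p\<^sub>m) \<le> \<psi> t \<and> \<psi> t \<le> ennreal (c\<^sub>1 * t powr p\<^sub>p + c\<^sub>2)"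
    and "\<And>t. t \<ge> 0 \<Longrightarrow> \<phi> t \<le> ennreal c\<^sub>3 * \<psi> t + ennreal c\<^sub>4"
    and "((\<lambda>t. \<phi> t / \<psi> t) \<longlongrightarrow> 0) at_top"
  shows "(integral_diverges_at_0 (\<lambda>r. conjugate \<psi> (1 / r) * ennreal r)
            \<longrightarrow> H_0 (double_phase \<phi> \<psi>) \<Omega> = W_0 (double_phase \<phi> \<psi>) \<Omega>)
       \<and> (integral_diverges_at_0 (\<lambda>r. \<phi> (1 / r) * ennreal r)
            \<longrightarrow> H_0 (double_phase \<phi> \<psi>) \<Omega> = W_0 (double_phase \<phi> \<psi>) \<Omega>)"
proof -
  have "\<phi> t < \<infinity>" "\<psi> t < \<infinity>" if "t \<ge> 0" for t
    using assms(10,11)[OF that] by (auto intro: order_le_less_trans)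
  then interpret double_phase_functions \<phi> \<psi>
    using assms(1-6) by unfold_locales auto
  have conj_finite: "conjugate \<psi> s < \<infinity>" if "s \<ge> 0" for s
    using conjugate_finite[OF assms(7) _ that] assms(11) by blast
  show ?thesis
  proof (intro conjI impI)
    assume div: "integral_diverges_at_0 (\<lambda>r. conjugate \<psi> (1 / r) * ennreal r)"
    show "H_0 \<Phi> \<Omega> = W_0 \<Phi> \<Omega>"
    proof (rule H_0_eq_W_0)
      fix v G assume "sob \<Omega> UNIV v G" "modular G < \<infinity>"
      then show "approximable G"
        by (rule approximable_of_bounded) (rule approximable_case_1[OF conj_finite assms(6) div assms(12)])
    qed
  next
    assume div: "integral_diverges_at_0 (\<lambda>r. \<phi> (1 / r) * ennreal r)"
    show "H_0 \<Phi> \<Omega> = W_0 \<Phi> \<Omega>"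
    proof (rule H_0_eq_W_0)
      fix v G assume "sob \<Omega> UNIV v G" "modular G < \<infinity>"
      then show "approximable G"
        by (rule approximable_of_bounded) (rule approximable_case_2[OF div])
    qed
  qed
qed

end
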